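(* Let $1\le p_0<\infty$ and let $\mathcal F$ be a collection of pairs $(f,g)$ of nonnegative measurable functions on $\mathbb{R}^n$. Assume that for every $(f,g)\in \mathcal F$ and every $u\in A_{p_0}$ we have $$\|g\|_{L^{p_0}(u)}\le C \|f\|_{L^{p_0}(u)},\qquad ( * )$$ where $C$ does not depend on the pair $(f,g)$ and it depends on $u$ only in terms of $[u]_{A_{p_0}}$. Let $1<p<\infty$, $w\in A_p$, $0\le\lambda_2\le n$, $0<\lambda_1 {\sigma_w'}+ \lambda_2 <n$, and $\lambda=(\lambda_1,\lambda_2)$. Let $\theta\ge0$ be such that $\lambda_1+\lambda_2\theta>0$ and, for some constant $c$, $\frac{w(B(0, r))}{ w(B(0, R)) }\le c \left(\frac rR\right)^{n\theta}$ for all $0<r<R$; and let $\alpha$ satisfy $0\le\alpha<\frac{n}{n-\lambda_2 }\left(\lambda_1+ \lambda_2 \theta\right)$ if $\lambda_2<n$, and $0\le\alpha<\infty$ if $\lambda_2= n$. Then for all $(f,g)\in\mathcal F$ $$\|g\|_{\mathcal L^{p,\lambda}(|x|^\alpha w)}\le C \|f\|_{\mathcal L^{p,\lambda}(|x|^\alpha w)},\qquad ( ** )$$ with $C$ independent of the pair $(f,g)$. If $( * )$ holds for $p_0=1$, then the conclusion $( ** )$ is also satisfied for $p=1$ (with $w\in A_1$ and the same conditions on $\lambda_1,\lambda_2,\theta,\alpha$).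
   Context: For a weight (locally integrable, a.e. positive function) $v$ on $\mathbb{R}^n$, $v(E)=\int_E v$; $|E|$ is Lebesgue measure and $B(x,r)$ the Euclidean ball; $\|f\|_{L^p(v)}=(\int|f|^pv)^{1/p}$. For $0<p<\infty$ and $\lambda=(\lambda_1,\lambda_2)\in\mathbb{R}^2$, $$\|f\|_{\mathcal L^{p,\lambda}(v)} := \sup_{x\in \mathbb{R}^n,\, r>0}\left(\frac 1{r^{\lambda_1}\, v(B(x,r))^{\lambda_2/n}}\int_{B(x,r)}|f|^p v\right)^{1/p}.$$ $|x|^\alpha w$ denotes the weight $x\mapsto|x|^\alpha w(x)$. $w\in A_p$ ($1<p<\infty$) means $[w]_{A_p}:=\sup_B \frac{w(B)}{|B|}\left(\frac{w^{1-p'}(B)}{|B|}\right)^{p-1}<\infty$ over all balls; $w\in A_1$ means $w(B)/|B|\le c\,w(x)$ for a.e. $x\in B$, for all balls $B$, and $[w]_{A_1}$ is the smallest such $c$. For $1<\sigma<\infty$, $w\in RH_\sigma$ means $\left(\frac{1}{|B|}\int_{B} w^\sigma \right)^{1/\sigma}\le \frac{C}{|B|} \int_{B} w$ with $C$ independent of the ball $B$. Every $A_p$ weight is in some $RH_\sigma$. Define $\sigma_w=\sup\{\sigma: w\in RH_\sigma\}\in(1,\infty]$; $\sigma'=\sigma/(\sigma-1)$ is the conjugate exponent, with $\sigma_w'=1$ if $\sigma_w=\infty$. *)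

theory Defs
  imports "HOL-Analysis.Analysis"
begin

text \<open>
  Real powers on \<open>[0, \<infinity>]\<close>, with the usual conventions at the end points: the exponent \<open>0\<close> gives
  \<open>1\<close>, and negative exponents exchange \<open>0\<close> and \<open>\<infinity>\<close>.  (The library's powr on the reals has
  \<open>0 powr 0 = 0\<close>.)
\<close>

definition epowr :: "ennreal \<Rightarrow> real \<Rightarrow> ennreal" where
  "epowr t a =
     (if a = 0 then 1
      else if t = \<infinity> then (if 0 < a then \<infinity> else 0)
      else if t = 0 then (if 0 < a then 0 else \<infinity>)
      else ennreal (enn2real t powr a))"

text \<open>
  Weights are real valued, and only almost everywhere positive; all integrals below are taken of
  \<open>ennreal (w x)\<close>, so the values of a weight on an exceptional null set are irrelevant.
\<close>

definition is_weight :: "(real ^ 'n \<Rightarrow> real) \<Rightarrow> bool" where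
  "is_weight w \<longleftrightarrow>
     (\<forall>K. compact K \<longrightarrow> w absolutely_integrable_on K) \<and> (AE x in lebesgue. 0 < w x)"

definition wmeasure :: "(real ^ 'n \<Rightarrow> real) \<Rightarrow> (real ^ 'n) set \<Rightarrow> ennreal" where
  "wmeasure w E = (\<integral>\<^sup>+x\<in>E. ennreal (w x) \<partial>lebesgue)"

definition wavg :: "(real ^ 'n \<Rightarrow> real) \<Rightarrow> (real ^ 'n) set \<Rightarrow> ennreal" where
  "wavg w B = wmeasure w B / emeasure lebesgue B"

definition Lp_norm :: "real \<Rightarrow> (real ^ 'n \<Rightarrow> real) \<Rightarrow> (real ^ 'n \<Rightarrow> ennreal) \<Rightarrow> ennreal" where
  "Lp_norm p v f = epowr (\<integral>\<^sup>+x. epowr (f x) p * ennreal (v x) \<partial>lebesgue) (1 / p)"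

definition morrey_norm ::
    "real \<Rightarrow> real \<times> real \<Rightarrow> (real ^ 'n \<Rightarrow> real) \<Rightarrow> (real ^ 'n \<Rightarrow> ennreal) \<Rightarrow> ennreal" where
  "morrey_norm p l v f =
     (SUP x. SUP r\<in>{0<..}.
        epowr ((\<integral>\<^sup>+y\<in>ball x r. epowr (f y) p * ennreal (v y) \<partial>lebesgue)
               / (ennreal (r powr fst l) * epowr (wmeasure v (ball x r)) (snd l / real CARD('n))))
          (1 / p))"

definition A1_bound :: "(real ^ 'n \<Rightarrow> real) \<Rightarrow> ennreal \<Rightarrow> bool" where
  "A1_bound w c \<longleftrightarrow>
     (\<forall>x. \<forall>r>0. AE y\<in>ball x r in lebesgue. wavg w (ball x r) \<le> c * ennreal (w y))"

text \<open>
  The constant \<open>[w]\<close> of the class \<open>A\<^sub>p\<close>, for \<open>1 \<le> p < \<infinity>\<close>.  For \<open>p = 1\<close> the infimum is attained,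
  and it is \<open>\<infinity>\<close> if no finite \<open>c\<close> is admissible.  For \<open>p > 1\<close> the conjugate exponent of \<open>p\<close> is
  \<open>p / (p - 1)\<close>.
\<close>

definition Ap_const :: "real \<Rightarrow> (real ^ 'n \<Rightarrow> real) \<Rightarrow> ennreal" where
  "Ap_const p w =
     (if p = 1 then Inf {c. A1_bound w c}
      else (SUP x. SUP r\<in>{0<..}.
              wavg w (ball x r) *
              epowr (wavg (\<lambda>y. w y powr (1 - p / (p - 1))) (ball x r)) (p - 1)))"

definition Ap_class :: "real \<Rightarrow> (real ^ 'n \<Rightarrow> real) set" where
  "Ap_class p = {w. is_weight w \<and> Ap_const p w < \<infinity>}"

definition RH_class :: "real \<Rightarrow> (real ^ 'n \<Rightarrow> real) set" where
  "RH_class \<sigma> =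
     {w. is_weight w \<and>
         (\<exists>C::real. \<forall>x. \<forall>r>0.
            epowr (wavg (\<lambda>y. w y powr \<sigma>) (ball x r)) (1 / \<sigma>) \<le> ennreal C * wavg w (ball x r))}"

definition sigma_exp :: "(real ^ 'n \<Rightarrow> real) \<Rightarrow> ereal" where
  "sigma_exp w = Sup {ereal \<sigma> |\<sigma>. 1 < \<sigma> \<and> w \<in> RH_class \<sigma>}"

definition conj_exp :: "ereal \<Rightarrow> real" where
  "conj_exp s = (if s = \<infinity> then 1 else real_of_ereal s / (real_of_ereal s - 1))"

end

theory Submission
  imports Defs
begin

text \<open>
  The hypothesis extrapolates to \<open>L\<^sup>p(u)\<close> for all \<open>u \<in> A\<^sub>p\<close> (Rubio de Francia), with a constant that is
  uniform over bounded \<open>A\<^sub>p\<close> constants.  To estimate \<open>g\<close> on a ball \<open>B(x, r)\<close> in the Morrey norm, this is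
  applied to the weight \<open>u(z) = w(z) / m(max (dist x z) r)\<close>, where
  \<open>m(\<rho>) = \<rho>\<^sup>\<gamma> w(B(x, \<rho>))\<^sup>\<kappa>\<close> and \<open>\<kappa> = \<lambda>\<^sub>2 / n\<close>.  If \<open>m\<close> is quasi-increasing and \<open>w(B(x, \<rho>)) / m(\<rho>)\<close> grows at
  least like a positive power of \<open>\<rho>\<close>, then \<open>u \<in> A\<^sub>p\<close> uniformly in \<open>x\<close> and \<open>r\<close>.  Both conditions follow from the
  bound \<open>w(B(x, \<rho>)) \<le> C (\<rho> / R)\<^bsup>n / \<sigma>'\<^esup> w(B(x, R))\<close>, a consequence of the reverse Hoelder inequality, for
  the centre \<open>x\<close> and \<open>\<gamma> = \<lambda>\<^sub>1 + \<epsilon>\<close>; and for the centre \<open>0\<close> and \<open>\<gamma> = \<lambda>\<^sub>1 - \<alpha> (1 - \<kappa>) + \<epsilon>\<close> they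
  follow from this and the growth condition with exponent \<open>\<theta>\<close>.  The first choice is made when
  \<open>2 r \<le> norm x\<close>, the second one otherwise.  The small excess \<open>\<epsilon>\<close> makes the sum over dyadic annuli around the
  centre converge, and the condition on \<open>\<alpha>\<close> does the same for the annuli shrinking to \<open>0\<close>, on which
  \<open>norm z powr \<alpha>\<close> degenerates.
\<close>

section \<open>Extended real powers, Hoelder's inequality and the layer cake formula\<close>

text \<open>The weight \<open>u\<close> is built so that, on the annulus at distance \<rho> from the
  centre, the integral of \<open>f^p w\<close> is at most a multiple of \<rho>^(-\<epsilon>)
  m(\<rho>). Dividing by \<open>m\<close> leaves a geometric series of size r^(-\<epsilon>), and on
  B(x, r) the weight \<open>w\<close> is just m(r) \<open>u\<close>, so nothing is lost on the way
  back to \<open>g\<close>. The exponent \<alpha> (1 - \<kappa>) is the net cost of replacing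
  |z|^\<alpha> \<open>w\<close> by \<open>w\<close>: the integrand loses |z|^\<alpha>, the
  denominator of the Morrey norm returns |z|^(\<alpha> \<kappa>). For a ball far from 0 this cost is
  a fixed power of \<open>norm x\<close>, which also dominates on the larger annuli, so \<alpha>
  stays out of \<gamma>. Around 0 it is a power of \<rho> and has to enter \<gamma>. With b = 1 /
  \<sigma>' the hypothesis 0 < \<lambda>1 \<sigma>' + \<lambda>2 < n reads 0 < \<lambda>1 +
  \<lambda>2 b < n b. The left inequality makes \<open>m\<close> quasi-increasing, the right one
  makes w(B) / m grow. Both are strict, so they survive when the supremum that defines the critical
  exponent is replaced by an admissible exponent close to it.\<close>

lemma ennreal_three_cases:
  obtains "t = 0" | "t = top" | r where "0 < r" "t = ennreal r"
  by (cases t) (auto simp: less_le)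

lemma epowr_0_right [simp]: "epowr t 0 = 1"
  by (simp add: epowr_def)

lemma epowr_zero_left: "0 < a \<Longrightarrow> epowr 0 a = 0"
  by (simp add: epowr_def)

lemma epowr_top_left: "0 < a \<Longrightarrow> epowr top a = top"
  by (simp add: epowr_def)

lemma epowr_ennreal: "0 < t \<Longrightarrow> epowr (ennreal t) a = ennreal (t powr a)"
  by (auto simp: epowr_def)

lemma epowr_one_left [simp]: "epowr 1 a = 1"
  using epowr_ennreal[of 1 a] by simp

lemma epowr_1_right [simp]: "epowr t 1 = t"
  by (cases t rule: ennreal_three_cases) (auto simp: epowr_ennreal epowr_zero_left epowr_top_left)

lemma epowr_minus: "epowr t (- a) = inverse (epowr t a)"
proof (cases t rule: ennreal_three_cases)
  case (3 r) then show ?thesis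
    by (simp add: epowr_ennreal inverse_ennreal powr_minus)
qed (auto simp: epowr_def)

lemma epowr_pos: "0 < t \<Longrightarrow> t < top \<Longrightarrow> 0 < epowr t a"
  by (cases t rule: ennreal_three_cases) (auto simp: epowr_ennreal)

lemma epowr_eq_0_iff: "0 < a \<Longrightarrow> epowr t a = 0 \<longleftrightarrow> t = 0"
  by (cases t rule: ennreal_three_cases) (auto simp: epowr_ennreal epowr_def)

lemma epowr_less_top: "0 < t \<Longrightarrow> t < top \<Longrightarrow> epowr t a < top"
  by (cases t rule: ennreal_three_cases) (auto simp: epowr_ennreal)

lemma epowr_less_top': "0 \<le> a \<Longrightarrow> t < top \<Longrightarrow> epowr t a < top"
  by (cases t rule: ennreal_three_cases) (auto simp: epowr_ennreal epowr_def)

lemma epowr_mult: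
  assumes "0 \<le> a" shows "epowr (s * t) a = epowr s a * epowr t a"
proof (cases "a = 0")
  case False
  with assms have a: "0 < a" by simp
  have *: "0 < r \<Longrightarrow> top * ennreal r = top" "0 < r \<Longrightarrow> ennreal r * top = top" for r
    by (auto simp: ennreal_mult_top ennreal_top_mult)
  show ?thesis using a
    by (cases s rule: ennreal_three_cases; cases t rule: ennreal_three_cases)
       (auto simp: epowr_ennreal epowr_zero_left epowr_top_left ennreal_mult[symmetric] powr_mult * )
qed auto

lemma epowr_mult':
  assumes "0 < s" "s < top" "0 < t" "t < top" shows "epowr (s * t) a = epowr s a * epowr t a"
  using assms by (cases s rule: ennreal_three_cases; cases t rule: ennreal_three_cases)
       (auto simp: epowr_ennreal ennreal_mult[symmetric] powr_mult)

lemma epowr_epowr: "epowr (epowr t a) b = epowr t (a * b)"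
proof (cases t rule: ennreal_three_cases)
  case (3 r) then show ?thesis by (simp add: epowr_ennreal powr_powr)
next
  case 1 then show ?thesis
    by (auto simp: epowr_def mult_less_0_iff zero_less_mult_iff)
next
  case 2 then show ?thesis
    by (auto simp: epowr_def mult_less_0_iff zero_less_mult_iff)
qed

lemma epowr_mono: "0 \<le> a \<Longrightarrow> s \<le> t \<Longrightarrow> epowr s a \<le> epowr t a"
  by (cases s rule: ennreal_three_cases; cases t rule: ennreal_three_cases)
     (auto simp: epowr_ennreal powr_mono2 epowr_def top_unique)

lemma epowr_antimono: "a \<le> 0 \<Longrightarrow> s \<le> t \<Longrightarrow> epowr t a \<le> epowr s a"
  by (cases s rule: ennreal_three_cases; cases t rule: ennreal_three_cases)
     (auto simp: epowr_ennreal powr_mono2' epowr_def top_unique)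

lemma epowr_add: "0 < t \<Longrightarrow> t < top \<Longrightarrow> epowr t (a + b) = epowr t a * epowr t b"
  by (cases t rule: ennreal_three_cases) (auto simp: epowr_ennreal powr_add ennreal_mult)

lemma epowr_add': "0 \<le> a \<Longrightarrow> 0 \<le> b \<Longrightarrow> epowr t (a + b) = epowr t a * epowr t b"
  by (cases t rule: ennreal_three_cases)
     (auto simp: epowr_ennreal powr_add ennreal_mult epowr_def ennreal_top_mult)

lemma epowr_cancel: "0 < a \<Longrightarrow> epowr (epowr t a) (1 / a) = t"
  by (simp add: epowr_epowr)

lemma epowr_cancel': "0 < a \<Longrightarrow> epowr (epowr t (1 / a)) a = t"
  by (simp add: epowr_epowr)

lemma borel_measurable_epowr [measurable]:
  assumes [measurable]: "f \<in> borel_measurable M" shows "(\<lambda>x. epowr (f x) a) \<in> borel_measurable M"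
  unfolding epowr_def by measurable

lemma epowr_amgm:
  assumes "0 < \<theta>" "\<theta> < 1"
  shows "epowr a \<theta> * epowr b (1 - \<theta>) \<le> ennreal \<theta> * a + ennreal (1 - \<theta>) * b"
proof -
  have *: "0 < r \<Longrightarrow> top * ennreal r = top" "0 < r \<Longrightarrow> ennreal r * top = top" for r
    by (auto simp: ennreal_mult_top ennreal_top_mult)
  show ?thesis using assms
    using Youngs_inequality_0[of \<theta> "1 - \<theta>"]
    by (cases a rule: ennreal_three_cases; cases b rule: ennreal_three_cases)
       (auto simp: epowr_ennreal epowr_zero_left epowr_top_left ennreal_mult[symmetric] 
           ennreal_plus[symmetric] * simp del: ennreal_plus)
qed

text \<open>Both sides are homogeneous, so \<open>f\<close> and \<open>g\<close> may be divided by
  their integrals; the pointwise weighted AM-GM inequality then integrates to \<theta> + (1 -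
  \<theta>) = 1. The division needs finite nonzero integrals: a vanishing one kills the left side
  almost everywhere, an infinite one next to a nonzero one makes the right side infinite.\<close>

lemma nn_integral_Holder:
  assumes \<theta>: "0 < \<theta>" "\<theta> < 1"
    and [measurable]: "f \<in> borel_measurable M" "g \<in> borel_measurable M"
  shows "(\<integral>\<^sup>+x. epowr (f x) \<theta> * epowr (g x) (1 - \<theta>) \<partial>M)
           \<le> epowr (\<integral>\<^sup>+x. f x \<partial>M) \<theta> * epowr (\<integral>\<^sup>+x. g x \<partial>M) (1 - \<theta>)"
    (is "?L \<le> epowr ?A \<theta> * epowr ?B _")
proof -
  consider "?A = 0 \<or> ?B = 0" | "?A \<noteq> 0" "?B \<noteq> 0" "?A = top \<or> ?B = top"
    | "0 < ?A" "?A < top" "0 < ?B" "?B < top"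
    unfolding zero_less_iff_neq_zero less_top[symmetric] by blast
  then show ?thesis
  proof cases
    case 1
    have "AE x in M. epowr (f x) \<theta> * epowr (g x) (1 - \<theta>) = 0"
      using 1
    proof
      assume "?A = 0"
      then have "AE x in M. f x = 0" by (simp add: nn_integral_0_iff_AE)
      then show ?thesis by eventually_elim (use \<theta> in \<open>simp add: epowr_zero_left\<close>)
    next
      assume "?B = 0"
      then have "AE x in M. g x = 0" by (simp add: nn_integral_0_iff_AE)
      then show ?thesis by eventually_elim (use \<theta> in \<open>simp add: epowr_zero_left\<close>)
    qed
    then have "?L = 0" by (simp add: nn_integral_0_iff_AE)
    then show ?thesis by simp
  next
    case 2
    have "epowr ?A \<theta> \<noteq> 0" "epowr ?B (1 - \<theta>) \<noteq> 0"
      using 2 \<theta> by (auto simp: epowr_eq_0_iff)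
    moreover have "epowr ?A \<theta> = top \<or> epowr ?B (1 - \<theta>) = top"
      using 2 \<theta> by (auto simp: epowr_top_left)
    ultimately have "epowr ?A \<theta> * epowr ?B (1 - \<theta>) = top"
      by (auto simp: ennreal_mult_eq_top_iff)
    then show ?thesis by simp
  next
    case 3
    let ?c = "epowr ?A \<theta> * epowr ?B (1 - \<theta>)"
    have "epowr (f x) \<theta> * epowr (g x) (1 - \<theta>)
        \<le> ?c * (ennreal \<theta> * (f x / ?A) + ennreal (1 - \<theta>) * (g x / ?B))" for x
    proof -
      have A: "f x = ?A * (f x / ?A)" 
        using 3 by (simp add: ennreal_times_divide ennreal_mult_divide_eq mult.commute)
      have B: "g x = ?B * (g x / ?B)"
        using 3 by (simp add: ennreal_times_divide ennreal_mult_divide_eq mult.commute)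
      have "epowr (f x) \<theta> * epowr (g x) (1 - \<theta>)
        = epowr (?A * (f x / ?A)) \<theta> * epowr (?B * (g x / ?B)) (1 - \<theta>)"
        using A B by simp
      also have "\<dots> = ?c * (epowr (f x / ?A) \<theta> * epowr (g x / ?B) (1 - \<theta>))"
        using \<theta> by (simp add: epowr_mult mult_ac)
      also have "\<dots> \<le> ?c * (ennreal \<theta> * (f x / ?A) + ennreal (1 - \<theta>) * (g x / ?B))"
        using \<theta> by (intro mult_left_mono epowr_amgm) auto
      finally show ?thesis .
    qed
    then have "?L \<le> (\<integral>\<^sup>+x. ?c * (ennreal \<theta> * (f x / ?A) + ennreal (1 - \<theta>) * (g x / ?B)) \<partial>M)"
      by (intro nn_integral_mono)
    also have "\<dots> = ?c * (ennreal \<theta> * (?A / ?A) + ennreal (1 - \<theta>) * (?B / ?B))"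
      by (simp add: nn_integral_cmult nn_integral_add nn_integral_divide)
    also have "\<dots> = ?c"
      using 3 \<theta> by (simp add: ennreal_divide_self ennreal_plus[symmetric] del: ennreal_plus)
    finally show ?thesis .
  qed
qed

text \<open>This is the integral of q s^(q-1) over 0 < s < t, with t = \<infinity> included. The
  strict inequality makes strict superlevel sets appear in the layer cake formula; those of a
  maximal function are open.\<close>

lemma epowr_eq_nn_integral:
  assumes q: "0 < q"
  shows "epowr t q = (\<integral>\<^sup>+s. (if 0 < s \<and> ennreal s < t then ennreal (q * s powr (q - 1)) else 0) \<partial>lborel)"
proof -
  have fin: "(\<integral>\<^sup>+s. (if 0 < s \<and> s < r then ennreal (q * s powr (q - 1)) else 0) \<partial>lborel)
      = ennreal (r powr q)" if "0 < r" for r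
  proof -
    have "((\<lambda>s. q * s powr (q - 1)) has_integral q * (r powr (q - 1 + 1) / (q - 1 + 1))) {0..r}"
      using q that by (intro has_integral_mult_right has_integral_powr_from_0) auto
    then have "((\<lambda>s. q * s powr (q - 1)) has_integral r powr q) {0..r}"
      using q by simp
    from nn_integral_has_integral_lebesgue[OF _ this] q
    have "ennreal (r powr q) = (\<integral>\<^sup>+s. ennreal (indicator {0..r} s * (q * s powr (q - 1))) \<partial>lborel)"
      by simp
    also have "\<dots> = (\<integral>\<^sup>+s. indicator {0..r} s * ennreal (q * s powr (q - 1)) \<partial>lborel)"
      by (intro nn_integral_cong) (auto simp: indicator_def)
    also have "\<dots> = (\<integral>\<^sup>+s. (if 0 < s \<and> s < r then ennreal (q * s powr (q - 1)) else 0) \<partial>lborel)"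
    proof (rule nn_integral_cong_AE)
      have "AE s in lborel. s \<noteq> (0::real)" "AE s in lborel. s \<noteq> r"
        by (rule AE_lborel_singleton)+
      then show "AE s in lborel. indicator {0..r} s * ennreal (q * s powr (q - 1)) =
         (if 0 < s \<and> s < r then ennreal (q * s powr (q - 1)) else 0)"
        by eventually_elim (auto simp: indicator_def)
    qed
    finally show ?thesis by simp
  qed
  show ?thesis
  proof (cases t rule: ennreal_three_cases)
    case 1 then show ?thesis using q by (simp add: epowr_zero_left)
  next
    case (3 r) then show ?thesis using fin[of r]
      by (simp add: epowr_ennreal ennreal_less_iff cong: conj_cong)
  next
    case 2
    have "ennreal x \<le> (\<integral>\<^sup>+s. (if 0 < s \<and> ennreal s < t then ennreal (q * s powr (q - 1)) else 0) \<partial>lborel)"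
      if "0 < x" for x
    proof -
      have "ennreal x = ennreal ((x powr (1 / q)) powr q)"
        using q that by (simp add: powr_powr)
      also have "\<dots> = (\<integral>\<^sup>+s. (if 0 < s \<and> s < x powr (1/q) then ennreal (q * s powr (q - 1)) else 0) \<partial>lborel)"
        using that by (subst fin) auto
      also have "\<dots> \<le> (\<integral>\<^sup>+s. (if 0 < s \<and> ennreal s < t then ennreal (q * s powr (q - 1)) else 0) \<partial>lborel)"
        using 2 by (intro nn_integral_mono) auto
      finally show ?thesis .
    qed
    note * = this
    have "(\<integral>\<^sup>+s. (if 0 < s \<and> ennreal s < t then ennreal (q * s powr (q - 1)) else 0) \<partial>lborel) = top"
      (is "?I = top")
    proof (rule ccontr)
      assume "?I \<noteq> top"
      then obtain y where "0 \<le> y" "?I = ennreal y" by (cases ?I) auto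
      with *[of "y + 1"] show False by simp
    qed
    then show ?thesis using 2 q by (simp add: epowr_top_left)
  qed
qed

text \<open>Tonelli's theorem applied to \<open>epowr_eq_nn_integral\<close> at t = h(x). The
  separate factor \<open>k\<close> carries the weight, and later also one power of the function
  itself.\<close>

lemma layer_cake:
  assumes "sigma_finite_measure M" and q: "0 < q"
    and [measurable]: "h \<in> borel_measurable M" "k \<in> borel_measurable M"
  shows "(\<integral>\<^sup>+x. epowr (h x) q * k x \<partial>M) =
    (\<integral>\<^sup>+s. (if 0 < s then ennreal (q * s powr (q - 1)) *
        (\<integral>\<^sup>+x. k x * indicator {x. ennreal s < h x} x \<partial>M) else 0) \<partial>lborel)"
proof -
  interpret sigma_finite_measure M by fact
  interpret pair_sigma_finite M lborel ..
  let ?F = "\<lambda>x s. (if 0 < s \<and> ennreal s < h x then ennreal (q * s powr (q - 1)) else 0) * k x"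
  have "(\<integral>\<^sup>+x. epowr (h x) q * k x \<partial>M) = (\<integral>\<^sup>+x. \<integral>\<^sup>+s. ?F x s \<partial>lborel \<partial>M)"
    by (simp add: epowr_eq_nn_integral[OF q] nn_integral_multc)
  also have "\<dots> = (\<integral>\<^sup>+s. \<integral>\<^sup>+x. ?F x s \<partial>M \<partial>lborel)"
    by (intro Fubini'[symmetric]) measurable
  also have "\<dots> = (\<integral>\<^sup>+s. (if 0 < s then ennreal (q * s powr (q - 1)) *
        (\<integral>\<^sup>+x. k x * indicator {x. ennreal s < h x} x \<partial>M) else 0) \<partial>lborel)"
  proof (intro nn_integral_cong)
    fix s :: real
    show "(\<integral>\<^sup>+x. ?F x s \<partial>M) = (if 0 < s then ennreal (q * s powr (q - 1)) *
        (\<integral>\<^sup>+x. k x * indicator {x. ennreal s < h x} x \<partial>M) else 0)"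
    proof (cases "0 < s")
      case True
      have "(\<integral>\<^sup>+x. ?F x s \<partial>M) = (\<integral>\<^sup>+x. ennreal (q * s powr (q - 1)) * (k x * indicator {x. ennreal s < h x} x) \<partial>M)"
        using True by (intro nn_integral_cong) (auto simp: indicator_def)
      also have "\<dots> = ennreal (q * s powr (q - 1)) * (\<integral>\<^sup>+x. k x * indicator {x. ennreal s < h x} x \<partial>M)"
        by (intro nn_integral_cmult) measurable
      finally show ?thesis using True by simp
    qed auto
  qed
  finally show ?thesis .
qed

section \<open>Doubling weights and weighted maximal functions\<close>

lemma ennreal_divide_le_iff: "b \<noteq> 0 \<Longrightarrow> b < top \<Longrightarrow> a / b \<le> c \<longleftrightarrow> a \<le> (c * b :: ennreal)"
proof
  assume b: "b \<noteq> 0" "b < top"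
  { assume "a / b \<le> c"
    then have "a / b * b \<le> c * b" by (rule mult_right_mono) simp
    also have "a / b * b = a" using b by (metis ennreal_divide_times ennreal_mult_divide_eq ennreal_times_divide less_top)
    finally show "a \<le> c * b" . }
  { assume "a \<le> c * b"
    then have "a / b \<le> c * b / b" by (rule divide_right_mono_ennreal)
    also have "c * b / b = c" using b by (intro ennreal_mult_divide_eq) auto
    finally show "a / b \<le> c" . }
qed

lemma ennreal_less_divide_iff: "b \<noteq> 0 \<Longrightarrow> b < top \<Longrightarrow> c < a / b \<longleftrightarrow> c * b < (a :: ennreal)"
  using ennreal_divide_le_iff[of b a c] by (simp flip: not_le)

lemma sigma_finite_lebesgue: "sigma_finite_measure (lebesgue :: 'a::euclidean_space measure)"
proof
  obtain A :: "'a set set" where "countable A" "A \<subseteq> sets lborel" "\<Union>A = space lborel"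
    "\<forall>a\<in>A. emeasure lborel a \<noteq> \<infinity>"
    using lborel.sigma_finite_countable by blast
  then show "\<exists>A::'a set set. countable A \<and> A \<subseteq> sets lebesgue \<and> \<Union>A = space lebesgue \<and>
     (\<forall>a\<in>A. emeasure lebesgue a \<noteq> \<infinity>)"
    by (intro exI[of _ A]) (auto dest: subsetD)
qed

lemma emeasure_lebesgue_ball:
  fixes c :: "'a::euclidean_space"
  assumes "0 \<le> r"
  shows "emeasure lebesgue (ball c r) = ennreal (unit_ball_vol (real DIM('a)) * r ^ DIM('a))"
  using emeasure_ball[of r c] assms by simp

lemma emeasure_lebesgue_ball_pos:
  "0 < r \<Longrightarrow> 0 < emeasure lebesgue (ball (c :: 'a::euclidean_space) r)"
  by (subst emeasure_lebesgue_ball) auto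

lemma emeasure_lebesgue_ball_finite:
  "emeasure lebesgue (ball (c :: 'a::euclidean_space) r) < top"
proof (cases "0 \<le> r")
  case True then show ?thesis by (subst emeasure_lebesgue_ball) auto
next
  case False then have *: "ball c r = {}" by auto
  show ?thesis unfolding * by simp
qed

lemma emeasure_lebesgue_ball_scale:
  fixes c d :: "'a::euclidean_space"
  assumes "0 \<le> r" "0 \<le> k"
  shows "emeasure lebesgue (ball c (k * r)) = ennreal (k ^ DIM('a)) * emeasure lebesgue (ball d r)"
proof -
  have "0 \<le> k * r" using assms by simp
  then show ?thesis
    unfolding emeasure_lebesgue_ball[OF \<open>0 \<le> r\<close>] emeasure_lebesgue_ball[OF \<open>0 \<le> k * r\<close>]
    using assms by (simp add: power_mult_distrib ennreal_mult[symmetric] mult_ac)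
qed

lemma open_imp_lebesgue: "open S \<Longrightarrow> S \<in> sets lebesgue"
  by (simp add: sets_completionI_sets)

section \<open>Integrals of weights over sets, and Vitali's covering lemma\<close>

definition mass :: "('a::euclidean_space \<Rightarrow> ennreal) \<Rightarrow> 'a set \<Rightarrow> ennreal" where
  "mass W E = (\<integral>\<^sup>+x\<in>E. W x \<partial>lebesgue)"

text \<open>Weights are taken positive and finite at every point, so that negative powers never meet
  the end points of \<open>epowr\<close>. Weights that are only almost everywhere positive are
  altered on a null set by \<open>pos_version\<close>.\<close>

definition pos_weight :: "('a::euclidean_space \<Rightarrow> ennreal) \<Rightarrow> bool" where
  "pos_weight W \<longleftrightarrow> W \<in> borel_measurable lebesgue \<and> (\<forall>x. 0 < W x \<and> W x < top)"

lemma pos_weight_measurable: "pos_weight W \<Longrightarrow> W \<in> borel_measurable lebesgue"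
  by (simp add: pos_weight_def)

lemma pos_weight_pos: "pos_weight W \<Longrightarrow> 0 < W x"
  and pos_weight_finite: "pos_weight W \<Longrightarrow> W x < top"
  and pos_weight_ne: "pos_weight W \<Longrightarrow> W x \<noteq> 0" "pos_weight W \<Longrightarrow> W x \<noteq> top"
  by (auto simp: pos_weight_def less_top zero_less_iff_neq_zero)

lemma mass_mono: "E \<subseteq> F \<Longrightarrow> mass W E \<le> mass W F"
  unfolding mass_def by (intro nn_integral_mono) (auto simp: indicator_def)

lemma mass_mono_AE: "AE x in lebesgue. x \<in> E \<longrightarrow> V x \<le> W x \<Longrightarrow> mass V E \<le> mass W E"
  unfolding mass_def by (intro nn_integral_mono_AE, erule eventually_mono) (auto simp: indicator_def)

lemma mass_mono_weight: "(\<And>x. x \<in> E \<Longrightarrow> V x \<le> W x) \<Longrightarrow> mass V E \<le> mass W E"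
  by (rule mass_mono_AE) auto

lemma mass_cong: "(\<And>x. x \<in> E \<Longrightarrow> V x = W x) \<Longrightarrow> mass V E = mass W E"
  unfolding mass_def by (intro nn_integral_cong) (auto simp: indicator_def)

lemma mass_cmult:
  assumes [measurable]: "W \<in> borel_measurable lebesgue" "E \<in> sets lebesgue"
  shows "mass (\<lambda>x. c * W x) E = c * mass W E"
  unfolding mass_def by (simp add: nn_integral_cmult mult.assoc)

lemma mass_add:
  assumes [measurable]: "V \<in> borel_measurable lebesgue" "W \<in> borel_measurable lebesgue" "E \<in> sets lebesgue"
  shows "mass (\<lambda>x. V x + W x) E = mass V E + mass W E"
  unfolding mass_def by (simp add: nn_integral_add distrib_right)

lemma mass_const: "E \<in> sets lebesgue \<Longrightarrow> mass (\<lambda>x. c) E = c * emeasure lebesgue E"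
  unfolding mass_def by (simp add: nn_integral_cmult_indicator)

lemma mass_eq_density:
  assumes "W \<in> borel_measurable lebesgue" "E \<in> sets lebesgue"
  shows "mass W E = emeasure (density lebesgue W) E"
  using assms by (simp add: mass_def emeasure_density)

lemma mass_UNIV: "mass W UNIV = (\<integral>\<^sup>+x. W x \<partial>lebesgue)"
  by (simp add: mass_def)

lemma mass_Un_le:
  assumes [measurable]: "W \<in> borel_measurable lebesgue" "E \<in> sets lebesgue" "F \<in> sets lebesgue"
  shows "mass W (E \<union> F) \<le> mass W E + mass W F"
  unfolding mass_def
  by (subst nn_integral_add[symmetric]) (auto intro!: nn_integral_mono simp: indicator_def)

lemma mass_indicator: "mass (\<lambda>x. W x * indicator F x) E = mass W (E \<inter> F)"
  unfolding mass_def by (intro nn_integral_cong) (auto simp: indicator_def)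

lemma mass_pos:
  assumes W: "pos_weight W" and E [measurable]: "E \<in> sets lebesgue" and "0 < emeasure lebesgue E"
  shows "0 < mass W E"
proof (rule ccontr)
  note [measurable] = pos_weight_measurable[OF W]
  assume "\<not> 0 < mass W E"
  then have "(\<integral>\<^sup>+x\<in>E. W x \<partial>lebesgue) = 0" by (simp add: mass_def not_less)
  then have "AE x in lebesgue. W x * indicator E x = 0"
    by (subst (asm) nn_integral_0_iff_AE) auto
  then have "AE x in lebesgue. x \<notin> E"
    by eventually_elim (use pos_weight_ne[OF W] in \<open>auto simp: indicator_def split: if_splits\<close>)
  then have "emeasure lebesgue E = 0"
    by (simp add: AE_iff_null_sets[symmetric] null_setsD1)
  with assms show False by simp
qed

lemma mass_ball_pos: "pos_weight W \<Longrightarrow> 0 < r \<Longrightarrow> 0 < mass W (ball c r)"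
  by (intro mass_pos emeasure_lebesgue_ball_pos) auto

lemma mass_UN_le:
  assumes "countable C" and [measurable]: "W \<in> borel_measurable lebesgue"
    and X: "\<And>i. i \<in> C \<Longrightarrow> X i \<in> sets lebesgue"
  shows "mass W (\<Union>i\<in>C. X i) \<le> (\<integral>\<^sup>+i. mass W (X i) \<partial>count_space C)"
proof -
  have "mass W (\<Union>i\<in>C. X i) \<le> (\<integral>\<^sup>+x. \<integral>\<^sup>+i. W x * indicator (X i) x \<partial>count_space C \<partial>lebesgue)"
    unfolding mass_def
  proof (intro nn_integral_mono)
    fix x
    show "W x * indicator (\<Union>i\<in>C. X i) x \<le> (\<integral>\<^sup>+i. W x * indicator (X i) x \<partial>count_space C)"
    proof (cases "x \<in> (\<Union>i\<in>C. X i)")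
      case True
      then obtain i where i: "i \<in> C" "x \<in> X i" by auto
      have "W x = (\<integral>\<^sup>+j. W x * indicator {i} j \<partial>count_space C)"
        using i by (subst nn_integral_count_space'[of "{i}"]) auto
      also have "\<dots> \<le> (\<integral>\<^sup>+i. W x * indicator (X i) x \<partial>count_space C)"
        using i by (intro nn_integral_mono) (auto simp: indicator_def)
      finally show ?thesis using True by simp
    qed auto
  qed
  also have "\<dots> = (\<integral>\<^sup>+i. mass W (X i) \<partial>count_space C)"
    unfolding mass_def
    by (subst nn_integral_count_space_nn_integral) (use assms in \<open>auto intro!: borel_measurable_times_ennreal borel_measurable_indicator\<close>)
  finally show ?thesis .
qed

lemma mass_UN_disjoint:
  assumes "countable C" and [measurable]: "W \<in> borel_measurable lebesgue"
    and X: "\<And>i. i \<in> C \<Longrightarrow> X i \<in> sets lebesgue" and "disjoint_family_on X C"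
  shows "(\<integral>\<^sup>+i. mass W (X i) \<partial>count_space C) = mass W (\<Union>i\<in>C. X i)"
proof -
  have *: "(\<Union>i\<in>C. X i) \<in> sets lebesgue"
    using assms by (intro sets.countable_UN'') auto
  have "emeasure (density lebesgue W) (\<Union>i\<in>C. X i)
      = (\<integral>\<^sup>+i. emeasure (density lebesgue W) (X i) \<partial>count_space C)"
    using assms by (intro emeasure_UN_countable) auto
  then show ?thesis using X *
    by (simp add: mass_eq_density cong: nn_integral_cong_simp)
qed

text \<open>Disjoint balls are selected whose fivefold enlargements cover \<open>S\<close>; the
  inequality assumed for each ball is then summed, by subadditivity for \<open>U\<close> and by
  disjointness for \<open>V\<close>. With two densities, doubling and the selection criterion of the
  balls can be combined in a single hypothesis.\<close>

lemma Vitali_mass: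
  fixes K :: "('a::euclidean_space \<times> real) set"
  assumes S: "S \<subseteq> (\<Union>(c, r)\<in>K. ball c r)"
    and K: "\<And>c r. (c, r) \<in> K \<Longrightarrow> 0 < r \<and> r \<le> R \<and> ball c r \<subseteq> T
               \<and> mass U (ball c (5 * r)) \<le> mass V (ball c r)"
    and [measurable]: "U \<in> borel_measurable lebesgue" "V \<in> borel_measurable lebesgue"
  shows "mass U S \<le> mass V T"
proof -
  obtain C where C: "countable C" "C \<subseteq> K"
     and dis: "pairwise (\<lambda>i j. disjnt (ball (fst i) (snd i)) (ball (fst j) (snd j))) C"
     and cov: "S \<subseteq> (\<Union>i\<in>C. ball (fst i) (5 * snd i))"
    by (rule Vitali_covering_lemma_balls[where S=S and K=K and a=fst and r=snd and B=R]) (use S K in \<open>auto simp: case_prod_beta\<close>)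
  have "mass U S \<le> mass U (\<Union>i\<in>C. ball (fst i) (5 * snd i))"
    by (rule mass_mono[OF cov])
  also have "\<dots> \<le> (\<integral>\<^sup>+i. mass U (ball (fst i) (5 * snd i)) \<partial>count_space C)"
    by (intro mass_UN_le C) auto
  also have "\<dots> \<le> (\<integral>\<^sup>+i. mass V (ball (fst i) (snd i)) \<partial>count_space C)"
    using C K by (intro nn_integral_mono) auto
  also have "\<dots> = mass V (\<Union>i\<in>C. ball (fst i) (snd i))"
    using dis by (intro mass_UN_disjoint C) (auto simp: disjoint_family_on_def pairwise_def disjnt_def)
  also have "\<dots> \<le> mass V T"
    using C K by (intro mass_mono UN_least) (metis prod.collapse subsetD)
  finally show ?thesis .
qed

section \<open>Maximal functions relative to a doubling weight\<close>

definition maxf :: "('a::euclidean_space \<Rightarrow> ennreal) \<Rightarrow> ('a \<Rightarrow> ennreal) \<Rightarrow> 'a \<Rightarrow> ennreal" where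
  "maxf W f x = (SUP (c, r)\<in>{(c, r). 0 < r \<and> x \<in> ball c r}.
      mass (\<lambda>y. f y * W y) (ball c r) / mass W (ball c r))"

definition doubling :: "ennreal \<Rightarrow> ('a::euclidean_space \<Rightarrow> ennreal) \<Rightarrow> bool" where
  "doubling D W \<longleftrightarrow> (\<forall>c r. 0 < r \<longrightarrow> mass W (ball c r) < top \<and> mass W (ball c (5 * r)) \<le> D * mass W (ball c r))"

lemma maxf_ge: "x \<in> ball c r \<Longrightarrow> mass (\<lambda>y. f y * W y) (ball c r) / mass W (ball c r) \<le> maxf W f x"
  unfolding maxf_def
  by (rule SUP_upper2[of "(c, r)"]) (auto intro: order_le_less_trans[OF zero_le_dist])

lemma less_maxf_iff:
  "t < maxf W f x \<longleftrightarrow> (\<exists>c r. 0 < r \<and> x \<in> ball c r \<and>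
      t < mass (\<lambda>y. f y * W y) (ball c r) / mass W (ball c r))"
  unfolding maxf_def by (auto simp: less_SUP_iff)

text \<open>The maximal function is uncentred, so a superlevel set is a union of balls. This also
  settles measurability, for an arbitrary \<open>f\<close>.\<close>

lemma open_maxf_greater: "open {x. t < maxf W f x}"
proof -
  have "{x. t < maxf W f x} = (\<Union>(c, r)\<in>{(c, r). 0 < r \<and>
      t < mass (\<lambda>y. f y * W y) (ball c r) / mass W (ball c r)}. ball c r)"
    by (auto simp: less_maxf_iff; blast)
  also have "open \<dots>" by (intro open_UN) auto
  finally show ?thesis .
qed

lemma borel_measurable_maxf [measurable]: "maxf W f \<in> borel_measurable lebesgue"
  by (rule borel_measurableI_greater) (simp add: open_imp_lebesgue[OF open_maxf_greater])

text \<open>The part of \<open>f\<close> below t / 2 contributes at most half of an average that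
  exceeds t. Hence the part above t / 2 alone has integral at least t / 2 times the mass of the
  ball, and keeping only this part on the right is what makes the strong type estimate
  possible.\<close>

lemma maxf_weak_type:
  assumes W: "pos_weight W" and D: "doubling D W" and [measurable]: "f \<in> borel_measurable lebesgue"
    and t: "0 < t"
  shows "mass W {x. ennreal t < maxf W f x}
    \<le> ennreal (2 / t) * D * (\<integral>\<^sup>+x. f x * W x * indicator {x. ennreal t < 2 * f x} x \<partial>lebesgue)"
proof -
  note [measurable] = pos_weight_measurable[OF W]
  let ?f1 = "\<lambda>x. f x * W x * indicator {x. ennreal t < 2 * f x} x"
  let ?V = "\<lambda>x. ennreal (2 / t) * D * ?f1 x"
  \<comment> \<open>The covering lemma asks for bounded radii; the superlevel set is exhausted by
    the sets \<open>T R\<close> as \<open>R\<close> grows.\<close>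
  define K where "K R = {(c::'a, r). 0 < r \<and> r \<le> R \<and>
     ennreal t < mass (\<lambda>y. f y * W y) (ball c r) / mass W (ball c r)}" for R
  define T where "T R = (\<Union>(c, r)\<in>K R. ball c r)" for R
  have K: "mass W (ball c (5 * r)) \<le> mass ?V (ball c r)" if "(c, r) \<in> K R" for c r R
  proof -
    from that have r: "0 < r" and gt: "ennreal t < mass (\<lambda>y. f y * W y) (ball c r) / mass W (ball c r)"
      by (auto simp: K_def)
    let ?m = "mass W (ball c r)"
    have m: "0 < ?m" "?m < top" using mass_ball_pos[OF W r, of c] D r by (auto simp: doubling_def)
    have gt: "ennreal t * ?m < mass (\<lambda>y. f y * W y) (ball c r)"
      using gt m by (subst (asm) ennreal_less_divide_iff) auto
    have "mass (\<lambda>y. f y * W y) (ball c r) \<le> mass (\<lambda>y. ?f1 y + ennreal (t / 2) * W y) (ball c r)"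
    proof (rule mass_mono_weight)
      fix x
      show "f x * W x \<le> ?f1 x + ennreal (t / 2) * W x"
      proof (cases "ennreal t < 2 * f x")
        case False
        then have "f x \<le> ennreal (t / 2)"
          using t by (cases "f x") (auto simp: ennreal_mult_less_top ennreal_less_iff ennreal_mult[of 2, simplified, symmetric] ennreal_le_iff not_less)
        then show ?thesis using False by (auto intro: mult_right_mono)
      qed auto
    qed
    also have "\<dots> = mass ?f1 (ball c r) + ennreal (t / 2) * ?m"
      by (simp add: mass_add mass_cmult)
    finally have le: "mass (\<lambda>y. f y * W y) (ball c r) \<le> mass ?f1 (ball c r) + ennreal (t / 2) * ?m" .
    have "ennreal (t / 2) * ?m \<le> mass ?f1 (ball c r)"
    proof (rule ccontr)
      assume "\<not> ennreal (t / 2) * ?m \<le> mass ?f1 (ball c r)"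
      then have "mass ?f1 (ball c r) + ennreal (t / 2) * ?m \<le> ennreal (t / 2) * ?m + ennreal (t / 2) * ?m"
        by (intro add_right_mono) auto
      also have "\<dots> = ennreal t * ?m"
        using t by (simp add: distrib_right[symmetric] ennreal_plus[symmetric] del: ennreal_plus)
      finally show False using le gt by simp
    qed
    then have "ennreal (2 / t) * (ennreal (t / 2) * ?m) \<le> ennreal (2 / t) * mass ?f1 (ball c r)"
      by (rule mult_left_mono) simp
    then have "?m \<le> ennreal (2 / t) * mass ?f1 (ball c r)"
      using t by (simp add: mult.assoc[symmetric] ennreal_mult[symmetric])
    then have "D * ?m \<le> D * (ennreal (2 / t) * mass ?f1 (ball c r))"
      by (rule mult_left_mono) simp
    moreover have "mass W (ball c (5 * r)) \<le> D * ?m" using D r by (auto simp: doubling_def)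
    moreover have "mass ?V (ball c r) = D * (ennreal (2 / t) * mass ?f1 (ball c r))"
      by (subst mass_cmult) (auto simp: mult_ac)
    ultimately show ?thesis by simp
  qed
  have T: "mass W (T R) \<le> mass ?V UNIV" for R
    by (rule Vitali_mass[where K="K R" and R=R]) (use K in \<open>auto simp: T_def K_def\<close>)
  have Tsets: "T R \<in> sets lebesgue" for R
    unfolding T_def by (intro open_imp_lebesgue) auto
  have "{x. ennreal t < maxf W f x} = (\<Union>n. T (real n))"
  proof (intro equalityI subsetI)
    fix x assume "x \<in> {x. ennreal t < maxf W f x}"
    then obtain c r where "0 < r" "x \<in> ball c r"
      "ennreal t < mass (\<lambda>y. f y * W y) (ball c r) / mass W (ball c r)"
      by (auto simp: less_maxf_iff)
    moreover obtain n where "r \<le> real n" using real_arch_simple by blast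
    ultimately show "x \<in> (\<Union>n. T (real n))" by (auto simp: T_def K_def)
  qed (auto simp: less_maxf_iff T_def K_def; blast)
  then have "mass W {x. ennreal t < maxf W f x} = emeasure (density lebesgue W) (\<Union>n. T (real n))"
    using Tsets by (subst mass_eq_density) auto
  also have "\<dots> = (SUP n. emeasure (density lebesgue W) (T (real n)))"
  proof (rule SUP_emeasure_incseq[symmetric])
    show "incseq (\<lambda>n. T (real n))"
      unfolding incseq_def T_def K_def by fastforce
  qed (use Tsets in auto)
  also have "\<dots> \<le> mass ?V UNIV"
    using T Tsets by (intro SUP_least) (auto simp flip: mass_eq_density)
  also have "\<dots> = ennreal (2 / t) * D * (\<integral>\<^sup>+x. ?f1 x \<partial>lebesgue)"
    unfolding mass_UNIV by (intro nn_integral_cmult) measurable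
  finally show ?thesis .
qed

text \<open>Marcinkiewicz interpolation between the weak type bound and boundedness. The layer cake
  formula is used twice: with exponent \<open>q\<close> on the left, and backwards with exponent
  \<open>q - 1\<close>, where the factor f W in the weak type bound supplies the missing power of
  \<open>f\<close>.\<close>

lemma maxf_strong_type:
  assumes W: "pos_weight W" and D: "doubling D W" and [measurable]: "f \<in> borel_measurable lebesgue"
    and q: "1 < q"
  shows "(\<integral>\<^sup>+x. epowr (maxf W f x) q * W x \<partial>lebesgue)
    \<le> ennreal (2 * q / (q - 1) * 2 powr (q - 1)) * D * (\<integral>\<^sup>+x. epowr (f x) q * W x \<partial>lebesgue)"
proof -
  note [measurable] = pos_weight_measurable[OF W]
  let ?J = "\<lambda>s. \<integral>\<^sup>+x. f x * W x * indicator {x. ennreal s < 2 * f x} x \<partial>lebesgue"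
  have "(\<integral>\<^sup>+x. epowr (maxf W f x) q * W x \<partial>lebesgue) =
    (\<integral>\<^sup>+s. (if 0 < s then ennreal (q * s powr (q - 1)) *
        (\<integral>\<^sup>+x. W x * indicator {x. ennreal s < maxf W f x} x \<partial>lebesgue) else 0) \<partial>lborel)"
    using q by (intro layer_cake sigma_finite_lebesgue) auto
  also have "\<dots> \<le> (\<integral>\<^sup>+s. ennreal (2 * q / (q - 1)) * D * (if 0 < s then ennreal ((q - 1) * s powr (q - 1 - 1)) *
        ?J s else 0) \<partial>lborel)"
  proof (intro nn_integral_mono)
    fix s :: real
    show "(if 0 < s then ennreal (q * s powr (q - 1)) *
        (\<integral>\<^sup>+x. W x * indicator {x. ennreal s < maxf W f x} x \<partial>lebesgue) else 0)
       \<le> ennreal (2 * q / (q - 1)) * D * (if 0 < s then ennreal ((q - 1) * s powr (q - 1 - 1)) * ?J s else 0)"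
    proof (cases "0 < s")
      case s: True
      have "ennreal (q * s powr (q - 1)) * mass W {x. ennreal s < maxf W f x}
         \<le> ennreal (q * s powr (q - 1)) * (ennreal (2 / s) * D * ?J s)"
        by (intro mult_left_mono maxf_weak_type W D s) auto
      also have "\<dots> = (ennreal (q * s powr (q - 1)) * ennreal (2 / s)) * (D * ?J s)"
        by (simp only: mult_ac)
      also have "ennreal (q * s powr (q - 1)) * ennreal (2 / s)
         = ennreal (2 * q / (q - 1)) * ennreal ((q - 1) * s powr (q - 1 - 1))"
      proof -
        have "q * s powr (q - 1) * (2 / s) = 2 * q / (q - 1) * ((q - 1) * s powr (q - 1 - 1))"
          using s q unfolding powr_diff[of s "q - 1" 1] by simp
        then show ?thesis using s q by (simp add: ennreal_mult[symmetric])
      qed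
      finally show ?thesis using s by (simp add: mass_def mult_ac)
    qed auto
  qed
  also have "\<dots> = ennreal (2 * q / (q - 1)) * D * (\<integral>\<^sup>+s. (if 0 < s then ennreal ((q - 1) * s powr (q - 1 - 1)) *
        ?J s else 0) \<partial>lborel)"
  proof (rule nn_integral_cmult)
    interpret sigma_finite_measure "lebesgue :: 'a measure" by (rule sigma_finite_lebesgue)
    show "(\<lambda>s. if 0 < s then ennreal ((q - 1) * s powr (q - 1 - 1)) * ?J s else 0) \<in> borel_measurable lborel"
      by measurable
  qed
  also have "(\<integral>\<^sup>+s. (if 0 < s then ennreal ((q - 1) * s powr (q - 1 - 1)) * ?J s else 0) \<partial>lborel)
     = (\<integral>\<^sup>+x. epowr (2 * f x) (q - 1) * (f x * W x) \<partial>lebesgue)"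
    using q by (intro layer_cake[symmetric] sigma_finite_lebesgue) auto
  also have "\<dots> = (\<integral>\<^sup>+x. ennreal (2 powr (q - 1)) * (epowr (f x) q * W x) \<partial>lebesgue)"
  proof (intro nn_integral_cong)
    fix x
    have "epowr (f x) q = epowr (f x) (q - 1) * f x"
      using epowr_add'[of "q - 1" 1 "f x"] q by simp
    moreover have "epowr 2 (q - 1) = ennreal (2 powr (q - 1))"
      using epowr_ennreal[of 2 "q - 1"] by simp
    ultimately show "epowr (2 * f x) (q - 1) * (f x * W x) = ennreal (2 powr (q - 1)) * (epowr (f x) q * W x)"
      using q by (simp add: epowr_mult mult_ac)
  qed
  also have "\<dots> = ennreal (2 powr (q - 1)) * (\<integral>\<^sup>+x. epowr (f x) q * W x \<partial>lebesgue)"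
    by (simp add: nn_integral_cmult)
  finally have "(\<integral>\<^sup>+x. epowr (maxf W f x) q * W x \<partial>lebesgue)
    \<le> (ennreal (2 * q / (q - 1)) * ennreal (2 powr (q - 1))) * D * (\<integral>\<^sup>+x. epowr (f x) q * W x \<partial>lebesgue)"
    by (simp only: mult_ac)
  moreover have "ennreal (2 * q / (q - 1)) * ennreal (2 powr (q - 1)) = ennreal (2 * q / (q - 1) * 2 powr (q - 1))"
    using q by (intro ennreal_mult[symmetric]) auto
  ultimately show ?thesis by simp
qed

section \<open>Muckenhoupt weights and the maximal theorem\<close>

(* Otherwise simp replaces the Lebesgue measure of a ball by its Borel measure. *)
declare emeasure_completion [simp del]

definition avg :: "('a::euclidean_space \<Rightarrow> ennreal) \<Rightarrow> 'a set \<Rightarrow> ennreal" where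
  "avg W E = mass W E / emeasure lebesgue E"

definition dual_weight :: "real \<Rightarrow> ('a::euclidean_space \<Rightarrow> ennreal) \<Rightarrow> 'a \<Rightarrow> ennreal" where
  "dual_weight p W = (\<lambda>x. epowr (W x) (- 1 / (p - 1)))"

text \<open>The condition on one ball is isolated because in \<open>Ap_U\<close> the constants that
  compare two weights change from ball to ball, and only their product is uniform.\<close>

definition Ap_ball :: "real \<Rightarrow> ennreal \<Rightarrow> ('a::euclidean_space \<Rightarrow> ennreal) \<Rightarrow> 'a \<Rightarrow> real \<Rightarrow> bool" where
  "Ap_ball p K W c r \<longleftrightarrow>
     (if p = 1 then AE y in lebesgue. y \<in> ball c r \<longrightarrow> avg W (ball c r) \<le> K * W y
      else avg W (ball c r) * epowr (avg (dual_weight p W) (ball c r)) (p - 1) \<le> K)"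

definition Ap :: "real \<Rightarrow> ennreal \<Rightarrow> ('a::euclidean_space \<Rightarrow> ennreal) \<Rightarrow> bool" where
  "Ap p K W \<longleftrightarrow> (\<forall>c r. 0 < r \<longrightarrow> Ap_ball p K W c r)"

lemma ball_volume_ne [simp]:
  assumes "0 < r"
  shows "emeasure lebesgue (ball (c :: 'a::euclidean_space) r) \<noteq> 0"
    and "emeasure lebesgue (ball (c :: 'a::euclidean_space) r) \<noteq> top"
    and "emeasure lebesgue (ball (c :: 'a::euclidean_space) r) < top"
  using emeasure_lebesgue_ball_pos[OF assms, of c] emeasure_lebesgue_ball_finite[of c r] by auto

lemma AE_not_in_ballD:
  assumes "AE y in lebesgue. y \<notin> ball (c :: 'a::euclidean_space) r" "0 < r" shows False
proof -
  have "ball c r \<in> null_sets lebesgue"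
    by (rule AE_iff_null_sets[THEN iffD2, rotated]) (use assms in auto)
  then show False using ball_volume_ne(1)[OF \<open>0 < r\<close>, of c] by (auto dest: null_setsD1)
qed

lemma inverse_mult_ennreal: "x \<noteq> 0 \<Longrightarrow> x \<noteq> top \<Longrightarrow> inverse x * x = (1 :: ennreal)"
  by (cases x rule: ennreal_three_cases) (auto simp: inverse_ennreal ennreal_mult[symmetric])

lemma conj_exponent_eq: "1 < p \<Longrightarrow> p / (p - 1) = 1 + 1 / (p - 1 :: real)"
  by (simp add: divide_simps)

lemma pos_weight_dual:
  assumes "pos_weight W" shows "pos_weight (dual_weight p W)"
  using assms unfolding pos_weight_def dual_weight_def by (auto intro: epowr_pos epowr_less_top)

lemma dual_weight_dual:
  assumes "pos_weight W" "1 < p"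
  shows "dual_weight (p / (p - 1)) (dual_weight p W) = W"
proof
  fix x
  have "- 1 / (p - 1) * (- 1 / (p / (p - 1) - 1)) = 1"
    using assms(2) by (simp add: field_simps)
  then show "dual_weight (p / (p - 1)) (dual_weight p W) x = W x"
    by (simp add: dual_weight_def epowr_epowr)
qed

lemma avg_times_volume: "0 < r \<Longrightarrow> avg W (ball c r) * emeasure lebesgue (ball c r) = mass W (ball c r)"
  unfolding avg_def by (simp add: ennreal_divide_times ennreal_divide_self)

lemma mass_eq_avg: "0 < r \<Longrightarrow> mass W (ball c r) = emeasure lebesgue (ball c r) * avg W (ball c r)"
  using avg_times_volume[of r W c] by (simp add: mult.commute)

lemma avg_le_iff: "0 < r \<Longrightarrow> avg W (ball c r) \<le> t \<longleftrightarrow> mass W (ball c r) \<le> t * emeasure lebesgue (ball c r)"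
  unfolding avg_def by (intro ennreal_divide_le_iff) auto

lemma avg_pos:
  assumes "pos_weight W" "0 < r" shows "0 < avg W (ball c r)"
  using mass_ball_pos[OF assms, of c] assms(2)
  by (simp add: avg_def ennreal_zero_less_divide)

lemma Ap_mono:
  assumes "Ap p K W" "K \<le> L" shows "Ap p L W"
  unfolding Ap_def
proof (intro allI impI)
  fix c :: 'a and r :: real assume "0 < r"
  with assms(1) have "Ap_ball p K W c r" by (simp add: Ap_def)
  then show "Ap_ball p L W c r"
    unfolding Ap_ball_def using assms(2)
    by (auto split: if_splits elim!: eventually_mono intro: order_trans[OF _ mult_right_mono])
qed

lemma Ap_mass_bound:
  assumes "Ap p K W" "1 < p" "0 < r"
  shows "mass W (ball c r) * epowr (mass (dual_weight p W) (ball c r)) (p - 1)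
      \<le> K * epowr (emeasure lebesgue (ball c r)) p"
proof -
  let ?v = "emeasure lebesgue (ball c r)"
  let ?A = "avg W (ball c r)" and ?B = "avg (dual_weight p W) (ball c r)"
  have v: "0 < ?v" "?v < top"
    using assms(3) by (auto simp: emeasure_lebesgue_ball_pos emeasure_lebesgue_ball_finite)
  have "mass W (ball c r) * epowr (mass (dual_weight p W) (ball c r)) (p - 1)
     = (?v * ?A) * (epowr ?v (p - 1) * epowr ?B (p - 1))"
    using assms by (simp only: mass_eq_avg) (simp add: epowr_mult)
  also have "\<dots> = (?A * epowr ?B (p - 1)) * (epowr ?v (p - 1) * epowr ?v 1)"
    by (simp add: mult_ac)
  also have "epowr ?v (p - 1) * epowr ?v 1 = epowr ?v p"
    using epowr_add[OF v, of "p - 1" 1] by simp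
  also have "(?A * epowr ?B (p - 1)) * epowr ?v p \<le> K * epowr ?v p"
    using assms by (intro mult_right_mono) (auto simp: Ap_def Ap_ball_def)
  finally show ?thesis .
qed

text \<open>\<open>pos_weight\<close> does not include local integrability. It comes from the finite
  constant: the factor with the dual weight cannot vanish, and for p = 1 the average is bounded by
  the finite value of \<open>K * W\<close> at some point of the ball.\<close>

lemma Ap_mass_finite:
  assumes W: "pos_weight W" and "Ap p K W" "1 \<le> p" "K < top" "0 < r"
  shows "mass W (ball c r) < top"
proof (cases "p = 1")
  case True
  have "AE y in lebesgue. y \<in> ball c r \<longrightarrow> avg W (ball c r) \<le> K * W y"
    using assms True by (auto simp: Ap_def Ap_ball_def)
  have "\<exists>y. avg W (ball c r) \<le> K * W y"
  proof (rule ccontr)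
    assume "\<nexists>y. avg W (ball c r) \<le> K * W y"
    then have "AE y in lebesgue. y \<notin> ball c r"
      using \<open>AE y in lebesgue. _\<close> by (auto elim!: eventually_mono)
    then show False using \<open>0 < r\<close> by (rule AE_not_in_ballD)
  qed
  then obtain y where "avg W (ball c r) \<le> K * W y" by blast
  also have "\<dots> < top" using \<open>K < top\<close> pos_weight_finite[OF W, of y] by (simp add: ennreal_mult_less_top)
  finally show ?thesis
    using \<open>0 < r\<close> by (simp add: mass_eq_avg ennreal_mult_less_top)
next
  case False
  then have p: "1 < p" using assms by simp
  have "mass W (ball c r) * epowr (mass (dual_weight p W) (ball c r)) (p - 1)
      \<le> K * epowr (emeasure lebesgue (ball c r)) p"
    by (rule Ap_mass_bound) (use assms p in auto)
  also have "\<dots> < top"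
    using assms p by (auto simp: ennreal_mult_less_top intro!: epowr_less_top')
  finally have "mass W (ball c r) * epowr (mass (dual_weight p W) (ball c r)) (p - 1) < top" .
  moreover have "epowr (mass (dual_weight p W) (ball c r)) (p - 1) \<noteq> 0"
    using mass_ball_pos[OF pos_weight_dual[OF W, of p] \<open>0 < r\<close>, of c] p by (simp add: epowr_eq_0_iff)
  ultimately show ?thesis by (auto simp: ennreal_mult_less_top)
qed

text \<open>Hoelder's inequality for the factorization 1 = W^(1/p) \<sigma>^(1 - 1/p), where
  \<sigma> is the dual weight.\<close>

lemma Holder_dual_weight:
  assumes W: "pos_weight W" and p: "1 < p" and E [measurable]: "E \<in> sets lebesgue"
  shows "epowr (emeasure lebesgue E) p \<le> mass W E * epowr (mass (dual_weight p W) E) (p - 1)"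
proof -
  note [measurable] = pos_weight_measurable[OF W] pos_weight_measurable[OF pos_weight_dual[OF W]]
  let ?s = "dual_weight p W"
  have "emeasure lebesgue E = (\<integral>\<^sup>+x. epowr (W x * indicator E x) (1 / p) * epowr (?s x * indicator E x) (1 - 1 / p) \<partial>lebesgue)"
  proof -
    have "epowr (W x * indicator E x) (1 / p) * epowr (?s x * indicator E x) (1 - 1 / p) = indicator E x" for x
    proof -
      have "- 1 / (p - 1) * (1 - 1 / p) = - (1 / p)" using p by (simp add: field_simps)
      then have "epowr (W x) (1 / p) * epowr (?s x) (1 - 1 / p) = epowr (W x) (1 / p + - (1 / p))"
        using pos_weight_pos[OF W] pos_weight_finite[OF W]
        by (subst epowr_add) (auto simp: dual_weight_def epowr_epowr)
      then have "epowr (W x) (1 / p) * epowr (?s x) (1 - 1 / p) = 1" by simp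
      then show ?thesis using p
        by (cases "x \<in> E") (auto simp: epowr_zero_left)
    qed
    then show ?thesis by simp
  qed
  also have "\<dots> \<le> epowr (mass W E) (1 / p) * epowr (mass ?s E) (1 - 1 / p)"
    unfolding mass_def using p by (intro nn_integral_Holder) auto
  finally have "epowr (emeasure lebesgue E) p \<le> epowr (epowr (mass W E) (1 / p) * epowr (mass ?s E) (1 - 1 / p)) p"
    using p by (intro epowr_mono) auto
  also have "\<dots> = mass W E * epowr (mass ?s E) (p - 1)"
    using p by (simp add: epowr_mult epowr_epowr left_diff_distrib)
  finally show ?thesis .
qed

text \<open>The comparison W(B) / W(E) \<le> K (|B| / |E|)^p, multiplied out so that null sets
  \<open>E\<close> are allowed. It is the source of doubling and of the superlevel
  estimates.\<close>

lemma Ap_subset: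
  assumes W: "pos_weight W" and A: "Ap p K W" "1 < p" "0 < r"
    and E [measurable]: "E \<in> sets lebesgue" and sub: "E \<subseteq> ball c r"
  shows "epowr (emeasure lebesgue E) p * mass W (ball c r)
     \<le> K * epowr (emeasure lebesgue (ball c r)) p * mass W E"
proof -
  let ?s = "dual_weight p W"
  have "epowr (emeasure lebesgue E) p \<le> mass W E * epowr (mass ?s E) (p - 1)"
    by (rule Holder_dual_weight[OF W A(2) E])
  also have "\<dots> \<le> mass W E * epowr (mass ?s (ball c r)) (p - 1)"
    using A sub by (intro mult_left_mono epowr_mono mass_mono) auto
  finally have "epowr (emeasure lebesgue E) p * mass W (ball c r)
     \<le> mass W E * epowr (mass ?s (ball c r)) (p - 1) * mass W (ball c r)"
    by (rule mult_right_mono) simp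
  also have "\<dots> = mass W E * (mass W (ball c r) * epowr (mass ?s (ball c r)) (p - 1))"
    by (simp only: mult_ac)
  also have "\<dots> \<le> mass W E * (K * epowr (emeasure lebesgue (ball c r)) p)"
    by (intro mult_left_mono Ap_mass_bound A) auto
  finally show ?thesis by (simp add: mult_ac)
qed

lemma Ap_ball_compare:
  fixes W :: "'a::euclidean_space \<Rightarrow> ennreal"
  assumes W: "pos_weight W" and A: "Ap p K W" "1 < p" and r: "0 < r" "1 \<le> k"
    and sub: "ball d r \<subseteq> ball c (k * r)"
  shows "mass W (ball c (k * r)) \<le> K * ennreal (k powr (real DIM('a) * p)) * mass W (ball d r)"
proof -
  let ?v = "emeasure lebesgue (ball d r)"
  have v: "0 < ?v" "?v < top" using r by (auto simp: zero_less_iff_neq_zero)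
  then have v': "0 < epowr ?v p" "epowr ?v p < top" by (auto intro: epowr_pos epowr_less_top)
  have kr: "0 < k * r" using r by simp
  have "epowr ?v p * mass W (ball c (k * r)) \<le> K * epowr (emeasure lebesgue (ball c (k * r))) p * mass W (ball d r)"
    using A r sub by (intro Ap_subset W) auto
  also have "emeasure lebesgue (ball c (k * r)) = ennreal (k ^ DIM('a)) * ?v"
    using r by (intro emeasure_lebesgue_ball_scale) auto
  also have "epowr (ennreal (k ^ DIM('a)) * ?v) p = ennreal (k powr (real DIM('a) * p)) * epowr ?v p"
  proof -
    have "epowr (ennreal (k ^ DIM('a))) p = ennreal (k powr (real DIM('a) * p))"
      using r by (subst epowr_ennreal) (auto simp flip: powr_realpow simp: powr_powr)
    then show ?thesis using A by (simp add: epowr_mult)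
  qed
  finally have "mass W (ball c (k * r)) * epowr ?v p \<le> (K * ennreal (k powr (real DIM('a) * p)) * mass W (ball d r)) * epowr ?v p"
    by (simp only: mult_ac)
  then show ?thesis using v' by (simp add: ennreal_mult_le_mult_iff mult.commute[of _ "epowr ?v p"])
qed

lemma Ap_doubling:
  fixes W :: "'a::euclidean_space \<Rightarrow> ennreal"
  assumes W: "pos_weight W" and A: "Ap p K W" "1 < p" "K < top"
  shows "doubling (K * ennreal (5 powr (real DIM('a) * p))) W"
  unfolding doubling_def
proof (intro allI impI conjI)
  fix c :: 'a and r :: real assume r: "0 < r"
  show "mass W (ball c r) < top" by (rule Ap_mass_finite) (use assms r in auto)
  show "mass W (ball c (5 * r)) \<le> K * ennreal (5 powr (real DIM('a) * p)) * mass W (ball c r)"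
    by (rule Ap_ball_compare) (use assms r in auto)
qed

lemma Ap_dual:
  assumes W: "pos_weight W" and A: "Ap p K W" "1 < p"
  shows "Ap (p / (p - 1)) (epowr K (1 / (p - 1))) (dual_weight p W)"
  unfolding Ap_def
proof (intro allI impI)
  fix c :: 'a and r :: real assume "0 < r"
  let ?s = "dual_weight p W"
  have *: "p / (p - 1) \<noteq> 1" "p / (p - 1) - 1 = 1 / (p - 1)" using A by (auto simp: field_simps)
  have "avg W (ball c r) * epowr (avg ?s (ball c r)) (p - 1) \<le> K"
    using A \<open>0 < r\<close> by (auto simp: Ap_def Ap_ball_def)
  then have "epowr (avg W (ball c r) * epowr (avg ?s (ball c r)) (p - 1)) (1 / (p - 1)) \<le> epowr K (1 / (p - 1))"
    using A by (intro epowr_mono) auto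
  then show "Ap_ball (p / (p - 1)) (epowr K (1 / (p - 1))) ?s c r"
    using A * by (simp add: Ap_ball_def dual_weight_dual[OF W] epowr_mult epowr_epowr mult.commute)
qed

text \<open>On a ball \<open>W\<close> is almost everywhere at least its average divided by
  \<open>K\<close>, so the dual weight is bounded pointwise there and its average needs no further
  estimate. The constant \<open>K\<close> is preserved.\<close>

lemma Ap_1_imp_Ap:
  assumes W: "pos_weight W" and A: "Ap 1 K W" "K < top" and q: "1 < q"
  shows "Ap q K W"
  unfolding Ap_def
proof (intro allI impI)
  fix c :: 'a and r :: real assume r: "0 < r"
  let ?A = "avg W (ball c r)"
  have Apos: "0 < ?A" by (rule avg_pos[OF W r])
  have "mass W (ball c r) < top" by (rule Ap_mass_finite[OF W A(1)]) (use A r in auto)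
  then have Afin: "?A < top" using r by (simp add: avg_def ennreal_divide_eq_top_iff less_top[symmetric])
  have AE: "AE y in lebesgue. y \<in> ball c r \<longrightarrow> ?A \<le> K * W y"
    using A r by (auto simp: Ap_def Ap_ball_def)
  have Kpos: "0 < K"
  proof (rule ccontr)
    assume "\<not> 0 < K"
    then have "K = 0" by simp
    from AE have "AE y in lebesgue. y \<notin> ball c r"
      by eventually_elim (use Apos \<open>K = 0\<close> in auto)
    then show False using r by (rule AE_not_in_ballD)
  qed
  let ?a = "- 1 / (q - 1)"
  let ?X = "epowr ?A ?a * epowr K (1 / (q - 1))"
  have "AE y in lebesgue. y \<in> ball c r \<longrightarrow> dual_weight q W y \<le> ?X"
    using AE
  proof eventually_elim
    fix y assume le: "y \<in> ball c r \<longrightarrow> ?A \<le> K * W y"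
    show "y \<in> ball c r \<longrightarrow> dual_weight q W y \<le> ?X"
    proof
      assume y: "y \<in> ball c r"
      have "epowr (W y) ?a = epowr (W y) ?a * (epowr K ?a * epowr K (1 / (q - 1)))"
        using epowr_add[OF Kpos A(2), of ?a "1 / (q - 1)"] by simp
      also have "\<dots> = epowr (K * W y) ?a * epowr K (1 / (q - 1))"
        using Kpos A pos_weight_pos[OF W] pos_weight_finite[OF W] by (simp add: epowr_mult' mult_ac)
      also have "\<dots> \<le> ?X"
        using le y q by (intro mult_right_mono epowr_antimono) auto
      finally show "dual_weight q W y \<le> ?X" by (simp add: dual_weight_def)
    qed
  qed
  then have "mass (dual_weight q W) (ball c r) \<le> mass (\<lambda>_. ?X) (ball c r)"
    by (rule mass_mono_AE)
  then have "avg (dual_weight q W) (ball c r) \<le> ?X"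
    using r by (simp add: avg_le_iff mass_const)
  then have "?A * epowr (avg (dual_weight q W) (ball c r)) (q - 1) \<le> ?A * epowr ?X (q - 1)"
    using q by (intro mult_left_mono epowr_mono) auto
  also have "epowr ?X (q - 1) = epowr ?A (- 1) * K"
    using q by (simp add: epowr_mult epowr_epowr)
  also have "?A * (epowr ?A (- 1) * K) = (epowr ?A 1 * epowr ?A (- 1)) * K" by (simp add: mult.assoc)
  also have "\<dots> = K" by (subst epowr_add[OF Apos Afin, symmetric]) simp
  finally show "Ap_ball q K W c r" using q by (simp add: Ap_ball_def)
qed

section \<open>The Hardy-Littlewood maximal function on weighted spaces\<close>

abbreviation HL :: "('a::euclidean_space \<Rightarrow> ennreal) \<Rightarrow> 'a \<Rightarrow> ennreal" where
  "HL f \<equiv> maxf (\<lambda>_. 1) f"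

lemma less_HL_iff:
  "t < HL f x \<longleftrightarrow> (\<exists>c r. 0 < r \<and> x \<in> ball c r \<and> t < avg f (ball c r))"
  by (simp add: less_maxf_iff avg_def mass_const)

lemma avg_le_HL: "x \<in> ball c r \<Longrightarrow> avg f (ball c r) \<le> HL f x"
  using maxf_ge[of x c r f "\<lambda>_. 1"] by (simp add: avg_def mass_const)

lemma HL_le: "(\<And>c r. 0 < r \<Longrightarrow> x \<in> ball c r \<Longrightarrow> avg f (ball c r) \<le> t) \<Longrightarrow> HL f x \<le> t"
  unfolding not_less[symmetric] less_HL_iff by blast

(* Lerner's pointwise domination of the maximal function by two weighted ones, whose bounds need doubling only. *)
lemma HL_le_weighted:
  assumes W: "pos_weight W" and A: "Ap p K W" "1 < p" "K < top"
    and [measurable]: "f \<in> borel_measurable lebesgue"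
  shows "HL f x \<le> epowr (K * maxf W (\<lambda>y. epowr (maxf (dual_weight p W)
       (\<lambda>y. f y * epowr (W y) (1 / (p - 1))) y) (p - 1) * inverse (W y)) x) (1 / (p - 1))"
proof (rule HL_le)
  fix c :: 'a and r :: real assume r: "0 < r" and x: "x \<in> ball c r"
  note [measurable] = pos_weight_measurable[OF W] pos_weight_measurable[OF pos_weight_dual[OF W]]
  let ?s = "dual_weight p W"
  let ?g = "\<lambda>y. f y * epowr (W y) (1 / (p - 1))"
  let ?Ms = "maxf ?s ?g"
  let ?h = "\<lambda>y. epowr (?Ms y) (p - 1) * inverse (W y)"
  let ?M = "maxf W ?h x"
  let ?v = "emeasure lebesgue (ball c r)"
  let ?F = "mass f (ball c r)" and ?S = "mass ?s (ball c r)" and ?Wb = "mass W (ball c r)"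
  have v: "0 < ?v" "?v < top" using r by (auto simp: zero_less_iff_neq_zero)
  have Wb: "0 < ?Wb" "?Wb < top" using mass_ball_pos[OF W r] Ap_mass_finite[OF W A(1) _ A(3) r] A by auto
  have "epowr K (1 / (p - 1)) < top" using A by (intro epowr_less_top') auto
  then have S: "0 < ?S" "?S < top"
    using mass_ball_pos[OF pos_weight_dual[OF W] r] Ap_mass_finite[OF pos_weight_dual[OF W] Ap_dual[OF W A(1,2)] _ _ r] A
    by auto
  have gs: "?g y * ?s y = f y" for y
  proof -
    have "epowr (W y) (1 / (p - 1)) * epowr (W y) (- 1 / (p - 1)) = epowr (W y) (1 / (p - 1) + - 1 / (p - 1))"
      using pos_weight_pos[OF W] pos_weight_finite[OF W] by (intro epowr_add[symmetric]) auto
    then show ?thesis by (simp add: dual_weight_def mult.assoc)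
  qed
  have hW: "?h y * W y = epowr (?Ms y) (p - 1)" for y
    using pos_weight_ne[OF W, of y] by (simp add: mult.assoc inverse_mult_ennreal)
  \<comment> \<open>The quotient \<open>?F / ?S\<close> is the average of \<open>?g\<close> with
    respect to the dual weight, hence at most \<open>?Ms\<close> at every point of the ball. Since
    \<open>?h * W\<close> is the power p - 1 of \<open>?Ms\<close>, averaging over the ball brings
    in the outer maximal function.\<close>
  have "epowr (?F / ?S) (p - 1) * ?v = mass (\<lambda>y. epowr (?F / ?S) (p - 1)) (ball c r)"
    by (simp add: mass_const)
  also have "\<dots> \<le> mass (\<lambda>y. ?h y * W y) (ball c r)"
  proof (rule mass_mono_weight)
    fix y assume "y \<in> ball c r"
    then have "?F / ?S \<le> ?Ms y" using maxf_ge[of y c r ?g ?s] by (simp only: gs)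
    then show "epowr (?F / ?S) (p - 1) \<le> ?h y * W y"
      unfolding hW using A by (intro epowr_mono) auto
  qed
  also have "\<dots> \<le> ?M * ?Wb"
    using maxf_ge[OF x, of ?h W] Wb by (subst (asm) ennreal_divide_le_iff) auto
  finally have *: "epowr (?F / ?S) (p - 1) * ?v \<le> ?M * ?Wb" .
  have FS: "?F = ?F / ?S * ?S" using S by (simp add: ennreal_divide_times)
  have "epowr ?F (p - 1) * ?v = epowr (?F / ?S) (p - 1) * ?v * epowr ?S (p - 1)"
    using A by (subst FS) (simp add: epowr_mult mult_ac)
  also have "\<dots> \<le> ?M * ?Wb * epowr ?S (p - 1)"
    by (intro mult_right_mono *) auto
  also have "\<dots> \<le> ?M * (K * epowr ?v p)"
    unfolding mult.assoc by (intro mult_left_mono Ap_mass_bound A r) auto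
  also have "epowr ?v p = epowr ?v (p - 1) * ?v"
    using epowr_add[OF v, of "p - 1" 1] by simp
  finally have "?v * epowr ?F (p - 1) \<le> ?v * (?M * K * epowr ?v (p - 1))"
    by (simp only: mult_ac)
  then have "epowr ?F (p - 1) \<le> ?M * K * epowr ?v (p - 1)"
    using v by (simp add: ennreal_mult_le_mult_iff)
  then have "epowr (epowr ?F (p - 1)) (1 / (p - 1)) \<le> epowr (?M * K * epowr ?v (p - 1)) (1 / (p - 1))"
    using A by (intro epowr_mono) auto
  also have "\<dots> = epowr (K * ?M) (1 / (p - 1)) * ?v"
    using A by (simp add: epowr_mult epowr_epowr mult_ac)
  finally show "avg f (ball c r) \<le> epowr (K * ?M) (1 / (p - 1))"
    using A r by (simp add: avg_le_iff epowr_epowr)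
qed

text \<open>In the pointwise bound the outer maximal function is estimated on L^q(W), q the
  conjugate exponent, and the inner one on L^p of the dual weight; the identities \<open>hq\<close>
  and \<open>gp\<close> make the three norms fit together. Only the doubling constants enter, so
  \<open>N\<close> depends on \<open>K\<close>, \<open>p\<close> and the dimension alone. The
  normalization 1 \<le> N is for the series in \<open>Rubio_de_Francia\<close>.\<close>

theorem Muckenhoupt:
  assumes p: "1 < p" and K: "K < top"
  obtains N where "1 \<le> N"
    "\<And>(W :: 'a::euclidean_space \<Rightarrow> ennreal) f. pos_weight W \<Longrightarrow> Ap p K W \<Longrightarrow> f \<in> borel_measurable lebesgue \<Longrightarrow>
       (\<integral>\<^sup>+x. epowr (HL f x) p * W x \<partial>lebesgue) \<le> ennreal N * (\<integral>\<^sup>+x. epowr (f x) p * W x \<partial>lebesgue)"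
proof -
  define q where "q = p / (p - 1)"
  have q: "1 < q" using p by (simp add: q_def field_simps)
  define C where "C s = ennreal (2 * s / (s - 1) * 2 powr (s - 1))" for s :: real
  define D1 where "D1 = K * ennreal (5 powr (real DIM('a) * p))"
  define D2 where "D2 = epowr K (1 / (p - 1)) * ennreal (5 powr (real DIM('a) * q))"
  define N where "N = epowr K q * (C q * D1 * (C p * D2))"
  have eK: "epowr K (1 / (p - 1)) < top" "epowr K q < top"
    using K p q by (auto intro!: epowr_less_top')
  have N: "N < top"
    using K eK by (simp add: N_def D1_def D2_def C_def ennreal_mult_less_top)
  have bound: "(\<integral>\<^sup>+x. epowr (HL f x) p * W x \<partial>lebesgue) \<le> N * (\<integral>\<^sup>+x. epowr (f x) p * W x \<partial>lebesgue)"
    if W: "pos_weight W" and A: "Ap p K W" and [measurable]: "f \<in> borel_measurable lebesgue"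
    for W f :: "'a \<Rightarrow> ennreal"
  proof -
    note [measurable] = pos_weight_measurable[OF W] pos_weight_measurable[OF pos_weight_dual[OF W]]
    let ?s = "dual_weight p W"
    let ?g = "\<lambda>y. f y * epowr (W y) (1 / (p - 1))"
    let ?Ms = "maxf ?s ?g"
    let ?h = "\<lambda>y. epowr (?Ms y) (p - 1) * inverse (W y)"
    let ?M = "maxf W ?h"
    have [measurable]: "?h \<in> borel_measurable lebesgue" by measurable
    have hq: "epowr (?h y) q * W y = epowr (?Ms y) p * ?s y" for y
    proof -
      have "epowr (?h y) q * W y = epowr (?Ms y) p * (epowr (W y) (- q) * epowr (W y) 1)"
      proof -
        have "epowr (inverse (W y)) q = epowr (W y) (- q)"
          using epowr_epowr[of "W y" "- 1" q] epowr_minus[of "W y" 1] by simp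
        moreover have "(p - 1) * q = p" using p by (simp add: q_def)
        ultimately show ?thesis using q by (simp add: epowr_mult epowr_epowr mult_ac)
      qed
      also have "epowr (W y) (- q) * epowr (W y) 1 = epowr (W y) (- q + 1)"
        using pos_weight_pos[OF W] pos_weight_finite[OF W] by (intro epowr_add[symmetric]) auto
      also have "- q + 1 = - 1 / (p - 1)" using p by (simp add: q_def conj_exponent_eq)
      finally show ?thesis by (simp add: dual_weight_def)
    qed
    have gp: "epowr (?g y) p * ?s y = epowr (f y) p * W y" for y
    proof -
      have "epowr (?g y) p * ?s y = epowr (f y) p * (epowr (W y) (p / (p - 1)) * epowr (W y) (- 1 / (p - 1)))"
        using p by (simp add: epowr_mult epowr_epowr dual_weight_def mult_ac)
      also have "epowr (W y) (p / (p - 1)) * epowr (W y) (- 1 / (p - 1)) = epowr (W y) (p / (p - 1) + - 1 / (p - 1))"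
        using pos_weight_pos[OF W] pos_weight_finite[OF W] by (intro epowr_add[symmetric]) auto
      also have "p / (p - 1) + - 1 / (p - 1) = 1" using p by (simp add: conj_exponent_eq)
      finally show ?thesis by simp
    qed
    have "(\<integral>\<^sup>+x. epowr (HL f x) p * W x \<partial>lebesgue)
       \<le> (\<integral>\<^sup>+x. epowr (epowr (K * ?M x) (1 / (p - 1))) p * W x \<partial>lebesgue)"
      using p by (intro nn_integral_mono mult_right_mono epowr_mono HL_le_weighted W A K) auto
    also have "\<dots> = (\<integral>\<^sup>+x. epowr K q * (epowr (?M x) q * W x) \<partial>lebesgue)"
      using q by (intro nn_integral_cong) (simp add: epowr_epowr q_def[symmetric] epowr_mult mult_ac)
    also have "\<dots> = epowr K q * (\<integral>\<^sup>+x. epowr (?M x) q * W x \<partial>lebesgue)"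
      by (intro nn_integral_cmult) measurable
    finally have 1: "(\<integral>\<^sup>+x. epowr (HL f x) p * W x \<partial>lebesgue)
       \<le> epowr K q * (\<integral>\<^sup>+x. epowr (?M x) q * W x \<partial>lebesgue)" .
    have 2: "(\<integral>\<^sup>+x. epowr (?M x) q * W x \<partial>lebesgue) \<le> C q * D1 * (\<integral>\<^sup>+x. epowr (?h x) q * W x \<partial>lebesgue)"
      unfolding C_def D1_def by (intro maxf_strong_type W Ap_doubling A p K q) auto
    have "(\<integral>\<^sup>+x. epowr (?h x) q * W x \<partial>lebesgue) = (\<integral>\<^sup>+x. epowr (?Ms x) p * ?s x \<partial>lebesgue)"
      unfolding hq ..
    also have "\<dots> \<le> C p * D2 * (\<integral>\<^sup>+x. epowr (?g x) p * ?s x \<partial>lebesgue)"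
      unfolding C_def D2_def using Ap_dual[OF W A p] q eK
      by (intro maxf_strong_type pos_weight_dual W Ap_doubling p) (auto simp: q_def)
    also have "(\<integral>\<^sup>+x. epowr (?g x) p * ?s x \<partial>lebesgue) = (\<integral>\<^sup>+x. epowr (f x) p * W x \<partial>lebesgue)"
      unfolding gp ..
    finally have 3: "(\<integral>\<^sup>+x. epowr (?h x) q * W x \<partial>lebesgue) \<le> C p * D2 * (\<integral>\<^sup>+x. epowr (f x) p * W x \<partial>lebesgue)" .
    show ?thesis
      unfolding N_def mult.assoc
      by (intro order_trans[OF 1] mult_left_mono order_trans[OF 2[unfolded mult.assoc]]
          order_trans[OF 3[unfolded mult.assoc]] order_refl zero_le)
  qed
  define N' where "N' = max 1 (enn2real N)"
  have "N \<le> ennreal N'" using N by (cases N) (auto simp: N'_def ennreal_leI)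
  show ?thesis
  proof (rule that[of N'])
    show "1 \<le> N'" by (simp add: N'_def)
  next
    fix W f :: "'a \<Rightarrow> ennreal" assume *: "pos_weight W" "Ap p K W" "f \<in> borel_measurable lebesgue"
    have "(\<integral>\<^sup>+x. epowr (HL f x) p * W x \<partial>lebesgue) \<le> N * (\<integral>\<^sup>+x. epowr (f x) p * W x \<partial>lebesgue)"
      by (rule bound) fact+
    also have "\<dots> \<le> ennreal N' * (\<integral>\<^sup>+x. epowr (f x) p * W x \<partial>lebesgue)"
      by (intro mult_right_mono) (use \<open>N \<le> ennreal N'\<close> in auto)
    finally show "(\<integral>\<^sup>+x. epowr (HL f x) p * W x \<partial>lebesgue) \<le> ennreal N' * (\<integral>\<^sup>+x. epowr (f x) p * W x \<partial>lebesgue)" .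
  qed
qed

section \<open>Rubio de Francia's algorithm\<close>

lemma sets_lebesgue_ball [measurable, simp]: "ball c r \<in> sets lebesgue"
  by (simp add: open_imp_lebesgue)

lemma pos_weight_mult:
  assumes "pos_weight V" "pos_weight W" shows "pos_weight (\<lambda>x. V x * W x)"
  using assms by (auto simp: pos_weight_def ennreal_mult_less_top ennreal_zero_less_mult_iff)

lemma pos_weight_epowr: "pos_weight W \<Longrightarrow> pos_weight (\<lambda>x. epowr (W x) a)"
  by (auto simp: pos_weight_def intro: epowr_pos epowr_less_top)

lemma epowr_add_le:
  assumes "0 \<le> p" shows "epowr (a + b) p \<le> ennreal (2 powr p) * (epowr a p + epowr b p)"
proof -
  have "a + b \<le> 2 * max a b"
    using add_mono[of a "max a b" b "max a b"] by (simp add: mult_2)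
  then have "epowr (a + b) p \<le> epowr (2 * max a b) p"
    using assms by (rule epowr_mono[rotated])
  also have "\<dots> = ennreal (2 powr p) * epowr (max a b) p"
    using assms epowr_ennreal[of 2 p] by (simp add: epowr_mult)
  also have "\<dots> \<le> ennreal (2 powr p) * (epowr a p + epowr b p)"
    by (intro mult_left_mono) (auto simp: max_def)
  finally show ?thesis .
qed

lemma avg_Holder:
  assumes \<theta>: "0 < \<theta>" "\<theta> < 1" and r: "0 < r"
    and [measurable]: "f \<in> borel_measurable lebesgue" "g \<in> borel_measurable lebesgue"
  shows "avg (\<lambda>x. epowr (f x) \<theta> * epowr (g x) (1 - \<theta>)) (ball c r)
      \<le> epowr (avg f (ball c r)) \<theta> * epowr (avg g (ball c r)) (1 - \<theta>)"
proof -
  let ?v = "emeasure lebesgue (ball c r)"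
  have v: "0 < ?v" "?v < top" using r by (auto simp: zero_less_iff_neq_zero)
  have "mass (\<lambda>x. epowr (f x) \<theta> * epowr (g x) (1 - \<theta>)) (ball c r)
     = (\<integral>\<^sup>+x. epowr (f x * indicator (ball c r) x) \<theta> * epowr (g x * indicator (ball c r) x) (1 - \<theta>) \<partial>lebesgue)"
    unfolding mass_def using \<theta> by (intro nn_integral_cong) (auto simp: indicator_def epowr_zero_left)
  also have "\<dots> \<le> epowr (mass f (ball c r)) \<theta> * epowr (mass g (ball c r)) (1 - \<theta>)"
    unfolding mass_def using \<theta> by (intro nn_integral_Holder) auto
  also have "\<dots> = (epowr (avg f (ball c r)) \<theta> * epowr (avg g (ball c r)) (1 - \<theta>)) * (epowr ?v \<theta> * epowr ?v (1 - \<theta>))"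
    using \<theta> r by (simp only: mass_eq_avg) (simp add: epowr_mult mult_ac)
  also have "epowr ?v \<theta> * epowr ?v (1 - \<theta>) = ?v"
    using epowr_add[OF v, of \<theta> "1 - \<theta>"] by simp
  finally show ?thesis using r by (simp add: avg_le_iff)
qed

lemma avg_le_cmult_AE:
  assumes AE: "AE y in lebesgue. y \<in> ball c r \<longrightarrow> f y \<le> t * g y" and r: "0 < r"
    and [measurable]: "g \<in> borel_measurable lebesgue"
  shows "avg f (ball c r) \<le> t * avg g (ball c r)"
proof -
  have "mass f (ball c r) \<le> mass (\<lambda>y. t * g y) (ball c r)"
    by (rule mass_mono_AE) (rule AE)
  also have "\<dots> = t * avg g (ball c r) * emeasure lebesgue (ball c r)"
    using r by (simp add: mass_cmult avg_times_volume mult.assoc)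
  finally show ?thesis using r by (simp add: avg_le_iff)
qed

lemma avg_finite:
  assumes "pos_weight W" "Ap p K W" "1 \<le> p" "K < top" "0 < r"
  shows "avg W (ball c r) < top"
  using Ap_mass_finite[OF assms, of c] assms(5)
  by (simp add: avg_def ennreal_divide_eq_top_iff less_top[symmetric])

text \<open>A negative power turns the lower bound of the \<open>A1\<close> condition into a
  pointwise upper bound by a power of the average. On each ball this power can therefore be pulled
  out of an integral.\<close>

lemma A1_negative_power:
  assumes u: "pos_weight u" "Ap 1 L u" "0 < L" "L < top" and d: "0 \<le> d" and r: "0 < r"
  shows "AE y in lebesgue. y \<in> ball c r \<longrightarrow>
     epowr (u y) (- d) \<le> epowr L d * epowr (avg u (ball c r)) (- d)"
proof -
  have A: "0 < avg u (ball c r)" "avg u (ball c r) < top"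
    using avg_pos[OF u(1) r] avg_finite[OF u(1,2) _ u(4) r] by auto
  have "AE y in lebesgue. y \<in> ball c r \<longrightarrow> avg u (ball c r) \<le> L * u y"
    using u r by (auto simp: Ap_def Ap_ball_def)
  then show ?thesis
  proof eventually_elim
    fix y assume *: "y \<in> ball c r \<longrightarrow> avg u (ball c r) \<le> L * u y"
    show "y \<in> ball c r \<longrightarrow> epowr (u y) (- d) \<le> epowr L d * epowr (avg u (ball c r)) (- d)"
    proof
      assume "y \<in> ball c r"
      with * have "epowr (L * u y) (- d) \<le> epowr (avg u (ball c r)) (- d)"
        using d by (intro epowr_antimono) auto
      then have "epowr L d * (epowr L (- d) * epowr (u y) (- d)) \<le> epowr L d * epowr (avg u (ball c r)) (- d)"
        using u pos_weight_pos[OF u(1)] pos_weight_finite[OF u(1)]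
        by (intro mult_left_mono) (auto simp: epowr_mult')
      moreover have "epowr L d * epowr L (- d) = 1"
        using epowr_add[OF u(3,4), of d "- d"] by simp
      ultimately show "epowr (u y) (- d) \<le> epowr L d * epowr (avg u (ball c r)) (- d)"
        by (simp add: mult.assoc[symmetric])
    qed
  qed
qed

text \<open>The easy direction of the factorization of Muckenhoupt weights. In the average of the
  weight the negative power of \<open>u\<close> is pulled out; the dual weight is a geometric mean
  of the dual of \<open>W\<close> and of \<open>u\<close>, to which Hoelder applies with \<theta> =
  (p - 1) / (p0 - 1). The powers of the average of \<open>u\<close> cancel.\<close>

lemma Ap_mult_A1_negative_power:
  assumes W: "pos_weight W" "Ap p K W" and u: "pos_weight u" "Ap 1 L u" "0 < L" "L < top"
    and p: "1 < p" "p < p0"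
  shows "Ap p0 (K * epowr L (p0 - p)) (\<lambda>x. W x * epowr (u x) (- (p0 - p)))"
  unfolding Ap_def
proof (intro allI impI)
  fix c :: 'a and r :: real assume r: "0 < r"
  note [measurable] = pos_weight_measurable[OF W(1)] pos_weight_measurable[OF u(1)] pos_weight_measurable[OF pos_weight_dual[OF W(1)]]
  let ?d = "p0 - p" and ?B = "ball c r"
  let ?X = "\<lambda>x. W x * epowr (u x) (- ?d)"
  let ?A = "avg W ?B" and ?U = "avg u ?B" and ?S = "avg (dual_weight p W) ?B"
  define \<theta> where "\<theta> = (p - 1) / (p0 - 1)"
  have \<theta>: "0 < \<theta>" "\<theta> < 1" "\<theta> * (p0 - 1) = p - 1" "(1 - \<theta>) * (p0 - 1) = ?d" "1 - \<theta> = ?d / (p0 - 1)"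
    using p by (auto simp: \<theta>_def field_simps)
  have U: "0 < ?U" "?U < top"
    using avg_pos[OF u(1) r] avg_finite[OF u(1,2) _ u(4) r] by auto
  have X: "avg ?X ?B \<le> epowr L ?d * epowr ?U (- ?d) * ?A"
  proof (rule avg_le_cmult_AE[OF _ r])
    have "AE y in lebesgue. y \<in> ?B \<longrightarrow> epowr (u y) (- ?d) \<le> epowr L ?d * epowr ?U (- ?d)"
      using p by (intro A1_negative_power u r) auto
    then show "AE y in lebesgue. y \<in> ?B \<longrightarrow> ?X y \<le> epowr L ?d * epowr ?U (- ?d) * W y"
      by eventually_elim (auto simp: mult.commute[of "W _"] intro: mult_right_mono)
  qed auto
  have dual: "dual_weight p0 ?X = (\<lambda>x. epowr (dual_weight p W x) \<theta> * epowr (u x) (1 - \<theta>))"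
  proof
    fix x
    have "- ?d * (- 1 / (p0 - 1)) = 1 - \<theta>"
      unfolding \<theta>(5) minus_divide_left[symmetric] by (simp only: minus_mult_minus times_divide_eq_right mult_1_right)
    then have "epowr (epowr (u x) (- ?d)) (- 1 / (p0 - 1)) = epowr (u x) (1 - \<theta>)"
      by (simp only: epowr_epowr)
    moreover have "epowr (W x) (- 1 / (p0 - 1)) = epowr (dual_weight p W x) \<theta>"
      using p by (simp add: dual_weight_def epowr_epowr \<theta>_def)
    ultimately show "dual_weight p0 ?X x = epowr (dual_weight p W x) \<theta> * epowr (u x) (1 - \<theta>)"
      unfolding dual_weight_def[of p0]
      using pos_weight_pos[OF W(1), of x] pos_weight_finite[OF W(1), of x]
        pos_weight_pos[OF pos_weight_epowr[OF u(1)], of x] pos_weight_finite[OF pos_weight_epowr[OF u(1)], of x]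
      by (simp add: epowr_mult')
  qed
  have "avg (dual_weight p0 ?X) ?B \<le> epowr ?S \<theta> * epowr ?U (1 - \<theta>)"
    unfolding dual by (intro avg_Holder \<theta> r) auto
  then have "epowr (avg (dual_weight p0 ?X) ?B) (p0 - 1) \<le> epowr (epowr ?S \<theta> * epowr ?U (1 - \<theta>)) (p0 - 1)"
    using p by (intro epowr_mono) auto
  also have "\<dots> = epowr ?S (p - 1) * epowr ?U ?d"
    using p \<theta> by (simp add: epowr_mult epowr_epowr)
  finally have "avg ?X ?B * epowr (avg (dual_weight p0 ?X) ?B) (p0 - 1)
     \<le> (epowr L ?d * epowr ?U (- ?d) * ?A) * (epowr ?S (p - 1) * epowr ?U ?d)"
    by (intro mult_mono X) auto
  also have "\<dots> = (?A * epowr ?S (p - 1)) * epowr L ?d * (epowr ?U (- ?d) * epowr ?U ?d)"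
    by (simp only: mult_ac)
  also have "epowr ?U (- ?d) * epowr ?U ?d = 1"
    using epowr_add[OF U, of "- ?d" ?d] by simp
  also have "?A * epowr ?S (p - 1) * epowr L ?d * 1 \<le> K * epowr L ?d"
    using W p r by (auto simp: Ap_def Ap_ball_def intro: mult_right_mono)
  finally show "Ap_ball p0 (K * epowr L ?d) ?X c r"
    using p by (simp add: Ap_ball_def)
qed

text \<open>The mirror image of \<open>Ap_mult_A1_negative_power\<close>: Hoelder is now applied to
  the weight itself, and the negative power of \<open>v\<close> sits in the dual weight. The value
  of \<open>s\<close> is fixed by (1 - s) (p - 1) = p0 - 1; for p0 = 1 the new weight is
  \<open>v\<close>.\<close>

lemma Ap_interpolate_A1:
  assumes W: "pos_weight W" "Ap p K W" and v: "pos_weight v" "Ap 1 L v" "0 < L" "L < top"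
    and p: "1 \<le> p0" "p0 < p" and s: "s = (p - p0) / (p - 1)"
  shows "Ap p0 (epowr K (1 - s) * epowr L s) (\<lambda>x. epowr (v x) s * epowr (W x) (1 - s))"
proof (cases "p0 = 1")
  case True
  then have "s = 1" using p s by simp
  then show ?thesis using v(2) True by simp
next
  case False
  then have p: "1 < p0" "p0 < p" using p by auto
  have s01: "0 < s" "s < 1" "(1 - s) * (p - 1) = p0 - 1" "(1 - s) / (p0 - 1) = 1 / (p - 1)"
  proof -
    have *: "1 - s = (p0 - 1) / (p - 1)" using p by (simp add: s divide_simps)
    show "0 < s" "s < 1" using p by (auto simp: s)
    show "(1 - s) * (p - 1) = p0 - 1" "(1 - s) / (p0 - 1) = 1 / (p - 1)" using p by (auto simp: * )
  qed
  show ?thesis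
    unfolding Ap_def
  proof (intro allI impI)
    fix c :: 'a and r :: real assume r: "0 < r"
    note [measurable] = pos_weight_measurable[OF W(1)] pos_weight_measurable[OF v(1)] pos_weight_measurable[OF pos_weight_dual[OF W(1)]]
    let ?B = "ball c r"
    let ?X = "\<lambda>x. epowr (v x) s * epowr (W x) (1 - s)"
    let ?A = "avg W ?B" and ?V = "avg v ?B" and ?S = "avg (dual_weight p W) ?B"
    let ?e = "s / (p0 - 1)"
    have V: "0 < ?V" "?V < top"
      using avg_pos[OF v(1) r] avg_finite[OF v(1,2) _ v(4) r] by auto
    have X: "avg ?X ?B \<le> epowr ?V s * epowr ?A (1 - s)"
      by (intro avg_Holder s01 r) auto
    have dual: "dual_weight p0 ?X = (\<lambda>x. epowr (v x) (- ?e) * dual_weight p W x)"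
    proof
      fix x
      have "(1 - s) * (- 1 / (p0 - 1)) = - 1 / (p - 1)" using s01(4) by simp
      then have "epowr (epowr (W x) (1 - s)) (- 1 / (p0 - 1)) = dual_weight p W x"
        by (simp add: dual_weight_def epowr_epowr)
      then show "dual_weight p0 ?X x = epowr (v x) (- ?e) * dual_weight p W x"
        unfolding dual_weight_def[of p0]
        using pos_weight_pos[OF pos_weight_epowr[OF v(1)], of x] pos_weight_finite[OF pos_weight_epowr[OF v(1)], of x]
          pos_weight_pos[OF pos_weight_epowr[OF W(1)], of x] pos_weight_finite[OF pos_weight_epowr[OF W(1)], of x]
        by (simp add: epowr_mult' epowr_epowr)
    qed
    have "avg (dual_weight p0 ?X) ?B \<le> epowr L ?e * epowr ?V (- ?e) * ?S"
    proof (rule avg_le_cmult_AE[OF _ r])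
      have "AE y in lebesgue. y \<in> ?B \<longrightarrow> epowr (v y) (- ?e) \<le> epowr L ?e * epowr ?V (- ?e)"
        using p s01 by (intro A1_negative_power v r) auto
      then show "AE y in lebesgue. y \<in> ?B \<longrightarrow> dual_weight p0 ?X y \<le> epowr L ?e * epowr ?V (- ?e) * dual_weight p W y"
        unfolding dual by eventually_elim (auto intro: mult_right_mono)
    qed auto
    then have "epowr (avg (dual_weight p0 ?X) ?B) (p0 - 1) \<le> epowr (epowr L ?e * epowr ?V (- ?e) * ?S) (p0 - 1)"
      using p by (intro epowr_mono) auto
    also have "\<dots> = epowr L s * epowr ?V (- s) * epowr ?S (p0 - 1)"
      using p by (simp add: epowr_mult epowr_epowr)
    finally have "avg ?X ?B * epowr (avg (dual_weight p0 ?X) ?B) (p0 - 1)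
       \<le> (epowr ?V s * epowr ?A (1 - s)) * (epowr L s * epowr ?V (- s) * epowr ?S (p0 - 1))"
      by (intro mult_mono X) auto
    also have "\<dots> = (epowr ?A (1 - s) * epowr ?S (p0 - 1)) * epowr L s * (epowr ?V s * epowr ?V (- s))"
      by (simp only: mult_ac)
    also have "epowr ?V s * epowr ?V (- s) = 1"
      using epowr_add[OF V, of s "- s"] by simp
    also have "epowr ?A (1 - s) * epowr ?S (p0 - 1) = epowr (?A * epowr ?S (p - 1)) (1 - s)"
      using s01 by (simp add: epowr_mult epowr_epowr mult.commute)
    also have "epowr (?A * epowr ?S (p - 1)) (1 - s) * epowr L s * 1 \<le> epowr K (1 - s) * epowr L s"
      using W p r s01 by (auto simp: Ap_def Ap_ball_def intro!: mult_right_mono epowr_mono)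
    finally show "Ap_ball p0 (epowr K (1 - s) * epowr L s) ?X c r"
      using p by (simp add: Ap_ball_def)
  qed
qed

lemma Ap_1_iff:
  "Ap 1 K W \<longleftrightarrow> (\<forall>c r. 0 < r \<longrightarrow> (AE y in lebesgue. y \<in> ball c r \<longrightarrow> avg W (ball c r) \<le> K * W y))"
  unfolding Ap_def Ap_ball_def by simp

lemma HL_suminf_le:
  assumes [measurable]: "\<And>k. F k \<in> borel_measurable lebesgue"
  shows "HL (\<lambda>x. \<Sum>k. a k * F k x) x \<le> (\<Sum>k. a k * HL (F k) x)"
proof (rule HL_le)
  fix c :: 'a and r :: real assume r: "0 < r" and x: "x \<in> ball c r"
  have "mass (\<lambda>x. \<Sum>k. a k * F k x) (ball c r) = (\<Sum>k. a k * mass (F k) (ball c r))"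
  proof -
    have "mass (\<lambda>x. \<Sum>k. a k * F k x) (ball c r) = (\<integral>\<^sup>+x. (\<Sum>k. a k * (F k x * indicator (ball c r) x)) \<partial>lebesgue)"
      unfolding mass_def by (intro nn_integral_cong) (simp add: indicator_def)
    also have "\<dots> = (\<Sum>k. \<integral>\<^sup>+x. a k * (F k x * indicator (ball c r) x) \<partial>lebesgue)"
      by (intro nn_integral_suminf) measurable
    also have "\<dots> = (\<Sum>k. a k * mass (F k) (ball c r))"
      unfolding mass_def by (intro suminf_cong nn_integral_cmult) measurable
    finally show ?thesis .
  qed
  then have "avg (\<lambda>x. \<Sum>k. a k * F k x) (ball c r) = (\<Sum>k. a k * avg (F k) (ball c r))"
    by (simp add: avg_def ennreal_times_divide flip: ennreal_suminf_divide)
  also have "\<dots> \<le> (\<Sum>k. a k * HL (F k) x)"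
    by (intro suminf_le mult_left_mono avg_le_HL x) auto
  finally show "avg (\<lambda>x. \<Sum>k. a k * F k x) (ball c r) \<le> (\<Sum>k. a k * HL (F k) x)" .
qed

text \<open>Jensen's inequality for the probability weights 2^(-k-1), proved by Hoelder for counting
  measure. In \<open>Rubio_de_Francia\<close> it bounds the norm of the series.\<close>

lemma epowr_suminf_half_le:
  assumes p: "1 < p"
  shows "epowr (\<Sum>k. ennreal ((1/2) ^ Suc k) * b k) p \<le> (\<Sum>k. ennreal ((1/2) ^ Suc k) * epowr (b k) p)"
proof -
  let ?a = "\<lambda>k. ennreal ((1/2) ^ Suc k)"
  have suma: "(\<Sum>k. ?a k) = 1"
    using power_half_series by (subst suminf_ennreal_eq[of _ 1]) (auto simp: ennreal_1)
  have "?a k * b k = epowr (?a k * epowr (b k) p) (1 / p) * epowr (?a k) (1 - 1 / p)" for k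
  proof -
    have "epowr (?a k * epowr (b k) p) (1 / p) * epowr (?a k) (1 - 1 / p)
      = (epowr (?a k) (1 / p) * epowr (?a k) (1 - 1 / p)) * b k"
      using p by (simp add: epowr_mult epowr_epowr mult_ac)
    also have "epowr (?a k) (1 / p) * epowr (?a k) (1 - 1 / p) = ?a k"
      using epowr_add'[of "1 / p" "1 - 1 / p" "?a k"] p by simp
    finally show ?thesis by simp
  qed
  then have "(\<Sum>k. ?a k * b k) = (\<integral>\<^sup>+k. epowr (?a k * epowr (b k) p) (1 / p) * epowr (?a k) (1 - 1 / p) \<partial>count_space UNIV)"
    by (simp add: nn_integral_count_space_nat)
  also have "\<dots> \<le> epowr (\<integral>\<^sup>+k. ?a k * epowr (b k) p \<partial>count_space UNIV) (1 / p)
       * epowr (\<integral>\<^sup>+k. ?a k \<partial>count_space UNIV) (1 - 1 / p)"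
    using p by (intro nn_integral_Holder) auto
  also have "\<dots> = epowr (\<Sum>k. ?a k * epowr (b k) p) (1 / p)"
    by (simp only: nn_integral_count_space_nat suma) simp
  finally have "epowr (\<Sum>k. ?a k * b k) p \<le> epowr (epowr (\<Sum>k. ?a k * epowr (b k) p) (1 / p)) p"
    using p by (intro epowr_mono) auto
  then show ?thesis using p by (simp add: epowr_epowr)
qed

text \<open>The majorant is the series of the iterated maximal functions M^k f / (2 N)^k. Applying M
  shifts the series by one term, which gives the factor \<open>2 * N\<close>. The number
  \<open>N\<close> bounds the p-th power of the operator norm, and hence the norm itself because 1
  \<le> N.\<close>

lemma Rubio_de_Francia:
  fixes W f :: "'a::euclidean_space \<Rightarrow> ennreal"
  assumes p: "1 < p" and N: "1 \<le> N" and [measurable]: "W \<in> borel_measurable lebesgue" "f \<in> borel_measurable lebesgue"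
    and HL: "\<And>f. f \<in> borel_measurable lebesgue \<Longrightarrow>
       (\<integral>\<^sup>+x. epowr (HL f x) p * W x \<partial>lebesgue) \<le> ennreal N * (\<integral>\<^sup>+x. epowr (f x) p * W x \<partial>lebesgue)"
  obtains u where "u \<in> borel_measurable lebesgue" "\<And>x. f x \<le> u x" "\<And>x. HL u x \<le> ennreal (2 * N) * u x"
    "(\<integral>\<^sup>+x. epowr (u x) p * W x \<partial>lebesgue) \<le> ennreal (2 powr p) * (\<integral>\<^sup>+x. epowr (f x) p * W x \<partial>lebesgue)"
proof -
  let ?I = "\<lambda>f. \<integral>\<^sup>+x. epowr (f x) p * W x \<partial>lebesgue"
  define F where "F k = (HL ^^ k) f" for k
  have [measurable]: "F k \<in> borel_measurable lebesgue" for k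
    by (induction k) (auto simp: F_def)
  have FSuc: "HL (F k) = F (Suc k)" for k by (simp add: F_def)
  have IF: "?I (F k) \<le> ennreal (N ^ k) * ?I f" for k
  proof (induction k)
    case (Suc k)
    have "?I (F (Suc k)) \<le> ennreal N * ?I (F k)"
      unfolding FSuc[symmetric] by (intro HL) auto
    also have "\<dots> \<le> ennreal N * (ennreal (N ^ k) * ?I f)" by (intro mult_left_mono Suc) auto
    finally show ?case using N by (simp add: ennreal_mult mult.assoc)
  qed (simp add: F_def)
  define a where "a k = ennreal (1 / (2 * N) ^ k)" for k
  define u where "u x = (\<Sum>k. a k * F k x)" for x
  have [measurable]: "u \<in> borel_measurable lebesgue" unfolding u_def by measurable
  show ?thesis
  proof (rule that[of u])
    fix x
    have "a 0 * F 0 x \<le> u x"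
      unfolding u_def using sum_le_suminf[of "\<lambda>k. a k * F k x" "{0}"] by simp
    then show "f x \<le> u x" by (simp add: a_def F_def)
    have "HL u x \<le> (\<Sum>k. a k * HL (F k) x)"
      unfolding u_def by (intro HL_suminf_le) auto
    also have "\<dots> = (\<Sum>k. ennreal (2 * N) * (a (Suc k) * F (Suc k) x))"
    proof -
      have *: "a k = ennreal (2 * N) * a (Suc k)" for k
      proof -
        have "1 / (2 * N) ^ k = 2 * N * (1 / (2 * N) ^ Suc k)" using N by simp
        then show ?thesis using N unfolding a_def by (subst ennreal_mult[symmetric]) auto
      qed
      show ?thesis
      proof (intro suminf_cong)
        fix k show "a k * HL (F k) x = ennreal (2 * N) * (a (Suc k) * F (Suc k) x)"
          unfolding FSuc *[of k] by (simp only: mult.assoc)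
      qed
    qed
    also have "\<dots> = ennreal (2 * N) * (\<Sum>k. a (Suc k) * F (Suc k) x)"
      by simp
    also have "\<dots> \<le> ennreal (2 * N) * u x"
      unfolding u_def using suminf_offset[of "\<lambda>k. a k * F k x" 1]
      by (intro mult_left_mono) (auto simp: le_iff_add add.commute)
    finally show "HL u x \<le> ennreal (2 * N) * u x" .
  next
    \<comment> \<open>The factor 2^(-k-1) is split off as a probability weight; what remains, 2 /
      N^k, still compensates the growth of the norms because N^k \<le> N^(k p).\<close>
    have eq: "u x = (\<Sum>k. ennreal ((1/2) ^ Suc k) * (ennreal (2 / N ^ k) * F k x))" for x
      unfolding u_def
    proof (intro suminf_cong)
      fix k
      have "a k = ennreal ((1/2) ^ Suc k) * ennreal (2 / N ^ k)"
      proof -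
        have "1 / (2 * N) ^ k = (1/2) ^ Suc k * (2 / N ^ k)"
          by (simp add: power_mult_distrib power_divide)
        then show ?thesis using N unfolding a_def by (subst ennreal_mult[symmetric]) auto
      qed
      then show "a k * F k x = ennreal ((1/2) ^ Suc k) * (ennreal (2 / N ^ k) * F k x)"
        by (simp add: mult.assoc)
    qed
    have "?I u \<le> (\<integral>\<^sup>+x. (\<Sum>k. ennreal ((1/2) ^ Suc k) * epowr (ennreal (2 / N ^ k) * F k x) p) * W x \<partial>lebesgue)"
      unfolding eq by (intro nn_integral_mono mult_right_mono epowr_suminf_half_le p) auto
    also have "\<dots> = (\<integral>\<^sup>+x. (\<Sum>k. ennreal ((1/2) ^ Suc k) * ennreal ((2 / N ^ k) powr p) * (epowr (F k x) p * W x)) \<partial>lebesgue)"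
    proof (intro nn_integral_cong)
      fix x
      have "epowr (ennreal (2 / N ^ k) * F k x) p = ennreal ((2 / N ^ k) powr p) * epowr (F k x) p" for k
        using p N by (simp add: epowr_mult epowr_ennreal)
      then show "(\<Sum>k. ennreal ((1/2) ^ Suc k) * epowr (ennreal (2 / N ^ k) * F k x) p) * W x
         = (\<Sum>k. ennreal ((1/2) ^ Suc k) * ennreal ((2 / N ^ k) powr p) * (epowr (F k x) p * W x))"
        by (simp only: ennreal_suminf_multc[symmetric] mult.assoc)
    qed
    also have "\<dots> = (\<Sum>k. \<integral>\<^sup>+x. ennreal ((1/2) ^ Suc k) * ennreal ((2 / N ^ k) powr p) * (epowr (F k x) p * W x) \<partial>lebesgue)"
      by (intro nn_integral_suminf) measurable
    also have "\<dots> = (\<Sum>k. ennreal ((1/2) ^ Suc k) * ennreal ((2 / N ^ k) powr p) * ?I (F k))"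
      by (intro suminf_cong nn_integral_cmult) measurable
    also have "\<dots> \<le> (\<Sum>k. ennreal ((1/2) ^ Suc k) * (ennreal (2 powr p) * ?I f))"
    proof (intro suminf_le)
      fix k
      have Nk: "1 \<le> N ^ k" using N by simp
      have "ennreal ((2 / N ^ k) powr p) * ?I (F k) \<le> ennreal ((2 / N ^ k) powr p) * (ennreal (N ^ k) * ?I f)"
        by (intro mult_left_mono IF) auto
      also have "\<dots> = ennreal ((2 / N ^ k) powr p * N ^ k) * ?I f"
        using N by (simp add: ennreal_mult mult.assoc)
      also have "\<dots> \<le> ennreal (2 powr p) * ?I f"
      proof (intro mult_right_mono ennreal_leI)
        have "N ^ k = (N ^ k) powr 1" using Nk by simp
        also have "\<dots> \<le> (N ^ k) powr p" using Nk p by (intro powr_mono) auto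
        finally have "N ^ k \<le> (N ^ k) powr p" .
        then have "2 powr p / (N ^ k) powr p * N ^ k \<le> 2 powr p / (N ^ k) powr p * (N ^ k) powr p"
          by (intro mult_left_mono) auto
        then show "(2 / N ^ k) powr p * N ^ k \<le> 2 powr p"
          using Nk N by (simp add: powr_divide)
      qed auto
      finally show "ennreal ((1/2) ^ Suc k) * ennreal ((2 / N ^ k) powr p) * ?I (F k)
         \<le> ennreal ((1/2) ^ Suc k) * (ennreal (2 powr p) * ?I f)"
        unfolding mult.assoc by (rule mult_left_mono) simp
    qed auto
    also have "\<dots> = (\<Sum>k. ennreal ((1/2) ^ Suc k)) * (ennreal (2 powr p) * ?I f)"
      by (rule ennreal_suminf_multc)
    also have "(\<Sum>k. ennreal ((1/2) ^ Suc k)) = 1"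
      using power_half_series by (subst suminf_ennreal_eq[of _ 1]) (auto simp: ennreal_1)
    finally show "?I u \<le> ennreal (2 powr p) * ?I f" by simp
  qed measurable
qed

text \<open>The series of \<open>Rubio_de_Francia\<close> may be infinite on a null set. It is given
  the value 1 there to be a \<open>pos_weight\<close>, so \<open>f\<close> is dominated only almost
  everywhere.\<close>

lemma A1_majorant:
  fixes W f :: "'a::euclidean_space \<Rightarrow> ennreal"
  assumes p: "1 < p" and N: "1 \<le> N" and W: "pos_weight W" and [measurable]: "f \<in> borel_measurable lebesgue"
    and HL: "\<And>f. f \<in> borel_measurable lebesgue \<Longrightarrow>
       (\<integral>\<^sup>+x. epowr (HL f x) p * W x \<partial>lebesgue) \<le> ennreal N * (\<integral>\<^sup>+x. epowr (f x) p * W x \<partial>lebesgue)"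
    and f: "\<And>x. 0 < f x" "(\<integral>\<^sup>+x. epowr (f x) p * W x \<partial>lebesgue) < top"
  obtains u where "pos_weight u" "Ap 1 (ennreal (2 * N)) u" "AE x in lebesgue. f x \<le> u x"
    "(\<integral>\<^sup>+x. epowr (u x) p * W x \<partial>lebesgue) \<le> ennreal (2 powr p) * (\<integral>\<^sup>+x. epowr (f x) p * W x \<partial>lebesgue)"
proof -
  note [measurable] = pos_weight_measurable[OF W]
  obtain v where v [measurable]: "v \<in> borel_measurable lebesgue" and fv: "\<And>x. f x \<le> v x"
    and HLv: "\<And>x. HL v x \<le> ennreal (2 * N) * v x"
    and Iv: "(\<integral>\<^sup>+x. epowr (v x) p * W x \<partial>lebesgue) \<le> ennreal (2 powr p) * (\<integral>\<^sup>+x. epowr (f x) p * W x \<partial>lebesgue)"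
    by (rule Rubio_de_Francia[OF p N _ _ HL, of f]) auto
  define u where "u x = (if v x = top then 1 else v x)" for x
  have [measurable]: "u \<in> borel_measurable lebesgue" unfolding u_def by measurable
  have "(\<integral>\<^sup>+x. epowr (v x) p * W x \<partial>lebesgue) < top"
    using f(2) by (intro order_le_less_trans[OF Iv]) (simp add: ennreal_mult_less_top)
  then have "AE x in lebesgue. epowr (v x) p * W x \<noteq> top"
    using nn_integral_PInf_AE[of "\<lambda>x. epowr (v x) p * W x" lebesgue] by (simp add: top.not_eq_extremum)
  then have uv: "AE x in lebesgue. u x = v x"
    by eventually_elim (use pos_weight_ne[OF W] p in \<open>auto simp: u_def epowr_top_left ennreal_top_mult\<close>)
  have vpos: "0 < v x" for x using f(1)[of x] fv[of x] by simp
  show ?thesis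
  proof (rule that[of u])
    show "pos_weight u" using vpos by (auto simp: pos_weight_def u_def top.not_eq_extremum)
    show "Ap 1 (ennreal (2 * N)) u"
      unfolding Ap_1_iff
    proof (intro allI impI)
      fix c :: 'a and r :: real
      have "mass u (ball c r) = mass v (ball c r)"
        unfolding mass_def using uv by (intro nn_integral_cong_AE) (auto elim!: eventually_mono)
      then have "avg u (ball c r) = avg v (ball c r)" by (simp add: avg_def)
      then have le: "y \<in> ball c r \<Longrightarrow> avg u (ball c r) \<le> ennreal (2 * N) * v y" for y
        using order_trans[OF avg_le_HL[of y c r v] HLv] by simp
      from uv show "AE y in lebesgue. y \<in> ball c r \<longrightarrow> avg u (ball c r) \<le> ennreal (2 * N) * u y"
        by eventually_elim (use le in auto)
    qed
    show "AE x in lebesgue. f x \<le> u x" using uv fv by (auto elim!: eventually_mono)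
    have "(\<integral>\<^sup>+x. epowr (u x) p * W x \<partial>lebesgue) = (\<integral>\<^sup>+x. epowr (v x) p * W x \<partial>lebesgue)"
      using uv by (intro nn_integral_cong_AE) (auto elim!: eventually_mono)
    then show "(\<integral>\<^sup>+x. epowr (u x) p * W x \<partial>lebesgue) \<le> ennreal (2 powr p) * (\<integral>\<^sup>+x. epowr (f x) p * W x \<partial>lebesgue)"
      using Iv by simp
  qed
qed

section \<open>Extrapolation\<close>

text \<open>Strict positivity of the function that is majorized is what makes the majorant a weight.
  A function that may vanish is perturbed by such a \<phi>, obtained from a positive integrable
  function divided by \<open>W\<close>.\<close>

lemma ex_small_positive:
  assumes W: "pos_weight (W :: 'a::euclidean_space \<Rightarrow> ennreal)" and p: "0 < p" and e: "0 < e"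
  obtains \<phi> where "\<phi> \<in> borel_measurable lebesgue" "\<And>x. 0 < \<phi> x"
    "(\<integral>\<^sup>+x. epowr (\<phi> x) p * W x \<partial>lebesgue) \<le> ennreal e"
proof -
  note [measurable] = pos_weight_measurable[OF W]
  interpret sigma_finite_measure "lebesgue :: 'a measure" by (rule sigma_finite_lebesgue)
  obtain h where h [measurable]: "h \<in> borel_measurable lebesgue" and hI: "(\<integral>\<^sup>+x. h x \<partial>lebesgue) \<noteq> \<infinity>"
    and hpos: "\<And>x::'a. 0 < h x"
    using Ex_finite_integrable_function by auto
  define t where "t = enn2real (\<integral>\<^sup>+x. h x \<partial>lebesgue)"
  have t: "0 \<le> t" "(\<integral>\<^sup>+x. h x \<partial>lebesgue) = ennreal t" using hI by (auto simp: t_def ennreal_enn2real_if)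
  define \<phi> where "\<phi> x = epowr (ennreal (e / (1 + t)) * h x * inverse (W x)) (1 / p)" for x
  show ?thesis
  proof (rule that[of \<phi>])
    show "\<phi> \<in> borel_measurable lebesgue" unfolding \<phi>_def by measurable
    fix x
    have "ennreal (e / (1 + t)) * h x * inverse (W x) \<noteq> 0"
      using hpos[of x] pos_weight_ne[OF W, of x] e t by (auto simp: ennreal_eq_0_iff divide_le_0_iff)
    then show "0 < \<phi> x" using p by (simp add: \<phi>_def zero_less_iff_neq_zero epowr_eq_0_iff)
  next
    have "epowr (\<phi> x) p * W x = ennreal (e / (1 + t)) * h x" for x
      using p pos_weight_ne[OF W, of x] by (simp add: \<phi>_def epowr_epowr mult.assoc inverse_mult_ennreal)
    then have "(\<integral>\<^sup>+x. epowr (\<phi> x) p * W x \<partial>lebesgue) = ennreal (e / (1 + t)) * ennreal t"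
      by (simp add: nn_integral_cmult t(2))
    also have "\<dots> = ennreal (e / (1 + t) * t)" using e t by (simp add: ennreal_mult[symmetric])
    also have "\<dots> \<le> ennreal e"
      using e t by (intro ennreal_leI) (simp add: field_simps)
    finally show "(\<integral>\<^sup>+x. epowr (\<phi> x) p * W x \<partial>lebesgue) \<le> ennreal e" .
  qed
qed

lemma SUP_min_of_nat:
  assumes "0 < h" shows "(SUP n. min y (of_nat n * h)) = (y :: ennreal)"
proof (rule antisym)
  show "(SUP n. min y (of_nat n * h)) \<le> y" by (intro SUP_least) auto
  show "y \<le> (SUP n. min y (of_nat n * h))"
  proof (rule dense_le)
    fix z assume z: "z < y"
    then have "z < top" by (simp add: order_less_le_trans)
    have "\<exists>n. z \<le> of_nat n * h"
    proof (cases h rule: ennreal_three_cases)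
      case 2
      have "z \<le> of_nat 1 * h" using 2 by simp
      then show ?thesis by blast
    next
      case (3 r)
      obtain s where s: "0 \<le> s" "z = ennreal s" using \<open>z < top\<close> by (cases z) auto
      obtain n where "s / r \<le> real n" using real_arch_simple by blast
      then have "s \<le> real n * r" using 3 by (simp add: field_simps)
      then have "z \<le> of_nat n * h"
        using s 3 by (simp add: ennreal_of_nat_eq_real_of_nat ennreal_mult[symmetric] ennreal_leI)
      then show ?thesis by blast
    qed (use assms in simp)
    then obtain n where "z \<le> of_nat n * h" by blast
    then have "z \<le> min y (of_nat n * h)" using z by simp
    also have "\<dots> \<le> (SUP n. min y (of_nat n * h))" by (rule SUP_upper) simp
    finally show "z \<le> (SUP n. min y (of_nat n * h))" .
  qed
qed

definition wint :: "real \<Rightarrow> ('a::euclidean_space \<Rightarrow> ennreal) \<Rightarrow> ('a \<Rightarrow> ennreal) \<Rightarrow> ennreal" where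
  "wint p W f = (\<integral>\<^sup>+x. epowr (f x) p * W x \<partial>lebesgue)"

lemma wint_add_le:
  assumes "0 \<le> p" and [measurable]: "f \<in> borel_measurable lebesgue" "g \<in> borel_measurable lebesgue" "W \<in> borel_measurable lebesgue"
  shows "wint p W (\<lambda>x. f x + g x) \<le> ennreal (2 powr p) * (wint p W f + wint p W g)"
proof -
  have "wint p W (\<lambda>x. f x + g x) \<le> (\<integral>\<^sup>+x. ennreal (2 powr p) * (epowr (f x) p * W x + epowr (g x) p * W x) \<partial>lebesgue)"
    unfolding wint_def
  proof (intro nn_integral_mono)
    fix x
    show "epowr (f x + g x) p * W x \<le> ennreal (2 powr p) * (epowr (f x) p * W x + epowr (g x) p * W x)"
      using mult_right_mono[OF epowr_add_le[OF assms(1)], of "W x" "f x" "g x"]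
      by (simp add: distrib_right mult.assoc)
  qed
  also have "\<dots> = ennreal (2 powr p) * (wint p W f + wint p W g)"
    unfolding wint_def by (simp add: nn_integral_cmult nn_integral_add)
  finally show ?thesis .
qed

lemma ennreal_le_of_small_perturbation:
  assumes "\<And>e. 0 < e \<Longrightarrow> x \<le> ennreal C * (y + ennreal e)" and C: "0 < C"
  shows "x \<le> ennreal C * y"
proof (rule ennreal_le_epsilon)
  fix e :: real assume e: "0 < e"
  have "x \<le> ennreal C * (y + ennreal (e / C))" by (rule assms) (use e C in simp)
  also have "\<dots> = ennreal C * y + ennreal e"
    using C e by (simp add: distrib_left ennreal_mult[symmetric])
  finally show "x \<le> ennreal C * y + ennreal e" .
qed

(* When p < p0, the Rubio de Francia majorant u of f turns W into the A_{p0} weight W u^{p-p0}, and both Hoelder factors are controlled by f. *)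
lemma extrapolation_down:
  fixes W f g :: "'a::euclidean_space \<Rightarrow> ennreal"
  assumes p: "1 < p" "p < p0" and N: "1 \<le> N" and W: "pos_weight W" "Ap p K W"
    and HL: "\<And>f. f \<in> borel_measurable lebesgue \<Longrightarrow> wint p W (HL f) \<le> ennreal N * wint p W f"
    and [measurable]: "f \<in> borel_measurable lebesgue" "g \<in> borel_measurable lebesgue"
    and C: "1 \<le> C"
    and hyp: "\<And>X. pos_weight X \<Longrightarrow> Ap p0 (K * epowr (ennreal (2 * N)) (p0 - p)) X \<Longrightarrow> wint p0 X g \<le> ennreal C * wint p0 X f"
  shows "wint p W g \<le> ennreal (C * 2 powr (2 * p)) * wint p W f"
proof (cases "wint p W f = top")
  case True
  then show ?thesis using C by (simp add: ennreal_mult_top)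
next
  case False
  note [measurable] = pos_weight_measurable[OF W(1)]
  define \<theta> where "\<theta> = p / p0"
  have \<theta>: "0 < \<theta>" "\<theta> < 1" using p by (auto simp: \<theta>_def)
  have step: "wint p W g \<le> ennreal (C * 2 powr (2 * p)) * (wint p W f + ennreal e)" if e: "0 < e" for e
  proof -
    obtain \<phi> where \<phi> [measurable]: "\<phi> \<in> borel_measurable lebesgue" and pos: "\<And>x. 0 < \<phi> x"
      and \<phi>I: "wint p W \<phi> \<le> ennreal e"
      unfolding wint_def using ex_small_positive[OF W(1) _ e, of p] p by auto
    define f1 where "f1 x = f x + \<phi> x" for x
    have [measurable]: "f1 \<in> borel_measurable lebesgue" unfolding f1_def by measurable
    have f1I: "wint p W f1 \<le> ennreal (2 powr p) * (wint p W f + ennreal e)"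
    proof -
      have "wint p W f1 \<le> ennreal (2 powr p) * (wint p W f + wint p W \<phi>)"
        unfolding f1_def using p by (intro wint_add_le) auto
      also have "\<dots> \<le> ennreal (2 powr p) * (wint p W f + ennreal e)"
        by (intro mult_left_mono add_left_mono \<phi>I) auto
      finally show ?thesis .
    qed
    also have "\<dots> < top" using False by (simp add: ennreal_mult_less_top top.not_eq_extremum)
    finally have f1fin: "wint p W f1 < top" .
    obtain u where u: "pos_weight u" "Ap 1 (ennreal (2 * N)) u" and f1u: "AE x in lebesgue. f1 x \<le> u x"
      and uI: "wint p W u \<le> ennreal (2 powr p) * wint p W f1"
      unfolding wint_def
    proof (rule A1_majorant[OF p(1) N W(1) \<open>f1 \<in> _\<close>])
      show "0 < f1 x" for x using pos[of x] by (simp add: f1_def zero_less_iff_neq_zero)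
    qed (use HL f1fin in \<open>auto simp: wint_def\<close>)
    note [measurable] = pos_weight_measurable[OF u(1)]
    let ?X = "\<lambda>x. W x * epowr (u x) (- (p0 - p))"
    have X: "pos_weight ?X" "Ap p0 (K * epowr (ennreal (2 * N)) (p0 - p)) ?X"
      by (intro pos_weight_mult pos_weight_epowr W u)
        (rule Ap_mult_A1_negative_power[OF W u _ _ p], use N in auto)
    have "epowr (g x) p * W x = epowr (epowr (g x) p0 * ?X x) \<theta> * epowr (epowr (u x) p * W x) (1 - \<theta>)" for x
    proof -
      have "epowr (epowr (g x) p0 * ?X x) \<theta> * epowr (epowr (u x) p * W x) (1 - \<theta>)
         = epowr (g x) (p0 * \<theta>) * (epowr (u x) (- (p0 - p) * \<theta>) * epowr (u x) (p * (1 - \<theta>)))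
             * (epowr (W x) \<theta> * epowr (W x) (1 - \<theta>))"
        using \<theta> by (simp add: epowr_mult epowr_epowr mult_ac)
      also have "epowr (u x) (- (p0 - p) * \<theta>) * epowr (u x) (p * (1 - \<theta>)) = epowr (u x) (- (p0 - p) * \<theta> + p * (1 - \<theta>))"
        using pos_weight_pos[OF u(1)] pos_weight_finite[OF u(1)] by (intro epowr_add[symmetric]) auto
      also have "epowr (W x) \<theta> * epowr (W x) (1 - \<theta>) = W x"
        using epowr_add'[of \<theta> "1 - \<theta>" "W x"] \<theta> by simp
      also have "- (p0 - p) * \<theta> + p * (1 - \<theta>) = 0" using p by (simp add: \<theta>_def field_simps)
      also have "p0 * \<theta> = p" using p by (simp add: \<theta>_def)
      finally show ?thesis by simp
    qed
    then have "wint p W g = (\<integral>\<^sup>+x. epowr (epowr (g x) p0 * ?X x) \<theta> * epowr (epowr (u x) p * W x) (1 - \<theta>) \<partial>lebesgue)"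
      by (simp add: wint_def)
    also have "\<dots> \<le> epowr (wint p0 ?X g) \<theta> * epowr (wint p W u) (1 - \<theta>)"
      unfolding wint_def by (intro nn_integral_Holder \<theta>) measurable
    also have "\<dots> \<le> epowr (ennreal C * wint p W f1) \<theta> * epowr (ennreal (2 powr p) * wint p W f1) (1 - \<theta>)"
    proof (intro mult_mono epowr_mono uI)
      have "wint p0 ?X g \<le> ennreal C * wint p0 ?X f" by (rule hyp[OF X])
      also have "wint p0 ?X f \<le> wint p W f1"
        unfolding wint_def
      proof (intro nn_integral_mono_AE)
        show "AE x in lebesgue. epowr (f x) p0 * ?X x \<le> epowr (f1 x) p * W x"
          using f1u
        proof eventually_elim
          fix x assume fu: "f1 x \<le> u x"
          have ff1: "f x \<le> f1 x" by (simp add: f1_def)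
          have "epowr (f x) p0 * ?X x = epowr (f x) p * (epowr (f x) (p0 - p) * epowr (u x) (- (p0 - p))) * W x"
            using epowr_add'[of p "p0 - p" "f x"] p by (simp add: mult_ac)
          also have "\<dots> \<le> epowr (f1 x) p * (epowr (u x) (p0 - p) * epowr (u x) (- (p0 - p))) * W x"
            using p fu ff1 by (intro mult_right_mono mult_mono epowr_mono) auto
          also have "epowr (u x) (p0 - p) * epowr (u x) (- (p0 - p)) = 1"
            using epowr_add[of "u x" "p0 - p" "- (p0 - p)"] pos_weight_pos[OF u(1)] pos_weight_finite[OF u(1)] by simp
          finally show "epowr (f x) p0 * ?X x \<le> epowr (f1 x) p * W x" by simp
        qed
      qed
      finally show "wint p0 ?X g \<le> ennreal C * wint p W f1" by (simp add: mult_left_mono)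
    qed (use \<theta> in auto)
    also have "\<dots> \<le> epowr (ennreal (C * 2 powr p) * wint p W f1) \<theta> * epowr (ennreal (C * 2 powr p) * wint p W f1) (1 - \<theta>)"
    proof -
      have "1 \<le> 2 powr p" using p by (simp add: ge_one_powr_ge_zero)
      then have "C \<le> C * 2 powr p" "2 powr p \<le> C * 2 powr p" using C by auto
      then show ?thesis using \<theta> by (intro mult_mono epowr_mono mult_right_mono ennreal_leI) auto
    qed
    also have "\<dots> = ennreal (C * 2 powr p) * wint p W f1"
      using epowr_add'[of \<theta> "1 - \<theta>" "ennreal (C * 2 powr p) * wint p W f1"] \<theta> by simp
    also have "\<dots> \<le> ennreal (C * 2 powr p) * (ennreal (2 powr p) * (wint p W f + ennreal e))"
      by (intro mult_left_mono f1I) auto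
    also have "\<dots> = (ennreal (C * 2 powr p) * ennreal (2 powr p)) * (wint p W f + ennreal e)"
      by (simp only: mult.assoc)
    also have "ennreal (C * 2 powr p) * ennreal (2 powr p) = ennreal (C * 2 powr (2 * p))"
      using C powr_add[of 2 p p] by (simp add: ennreal_mult[symmetric] mult.assoc)
    finally show ?thesis .
  qed
  show ?thesis
    by (rule ennreal_le_of_small_perturbation[OF step]) (use C in auto)
qed

(* When p > p0, g^{p-p0} plays the role of the dual function, so that no duality is needed; truncating g makes the final division legitimate. *)
lemma extrapolation_up:
  fixes W f g :: "'a::euclidean_space \<Rightarrow> ennreal"
  assumes p: "1 \<le> p0" "p0 < p" and N: "1 \<le> N" and W: "pos_weight W" "Ap p K W"
    and HL: "\<And>f. f \<in> borel_measurable lebesgue \<Longrightarrow>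
      wint (p / (p - 1)) (dual_weight p W) (HL f) \<le> ennreal N * wint (p / (p - 1)) (dual_weight p W) f"
    and [measurable]: "f \<in> borel_measurable lebesgue" "g \<in> borel_measurable lebesgue"
    and C: "1 \<le> C" and s: "s = (p - p0) / (p - 1)"
    and hyp: "\<And>X. pos_weight X \<Longrightarrow> Ap p0 (epowr K (1 - s) * epowr (ennreal (2 * N)) s) X \<Longrightarrow> wint p0 X g \<le> ennreal C * wint p0 X f"
    and C': "C' = (C * (2 powr (p / (p - 1)) * 2 powr p * 2) powr (1 - p0 / p)) powr (p / p0)"
  shows "wint p W g \<le> ennreal C' * wint p W f"
proof -
  note [measurable] = pos_weight_measurable[OF W(1)] pos_weight_measurable[OF pos_weight_dual[OF W(1)]]
  interpret sigma_finite_measure "lebesgue :: 'a measure" by (rule sigma_finite_lebesgue)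
  obtain h0 where h0 [measurable]: "h0 \<in> borel_measurable lebesgue" and h0I: "(\<integral>\<^sup>+x. h0 x \<partial>lebesgue) \<noteq> \<infinity>"
    and h0pos: "\<And>x::'a. 0 < h0 x"
    using Ex_finite_integrable_function by auto
  let ?q = "p / (p - 1)" and ?\<sigma> = "dual_weight p W"
  have p1: "1 < p" using p by simp
  have q: "1 < ?q" using p1 by (simp add: field_simps)
  define \<theta> where "\<theta> = p0 / p"
  have \<theta>: "0 < \<theta>" "\<theta> < 1" using p by (auto simp: \<theta>_def)
  have s0: "0 < s" "s \<le> 1" using p by (auto simp: s)
  have bound: "wint p W (\<lambda>x. epowr (min (epowr (g x) p * W x) (of_nat n * h0 x) * inverse (W x)) (1 / p)) \<le> ennreal C' * wint p W f"
    (is "wint p W ?gn \<le> _") for n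
  proof -
    have gn_pow: "epowr (?gn x) p * W x = min (epowr (g x) p * W x) (of_nat n * h0 x)" for x
      using p1 pos_weight_ne[OF W(1), of x] by (simp add: epowr_epowr mult.assoc inverse_mult_ennreal)
    have gn_le: "?gn x \<le> g x" for x
    proof -
      have "?gn x \<le> epowr (epowr (g x) p * W x * inverse (W x)) (1 / p)"
        using p1 by (intro epowr_mono mult_right_mono) auto
      also have "\<dots> = g x"
        using p1 pos_weight_ne[OF W(1), of x]
        by (simp add: epowr_epowr mult.assoc mult.commute[of "W x"] inverse_mult_ennreal)
      finally show ?thesis .
    qed
    let ?J = "wint p W ?gn"
    have "?J \<le> (\<integral>\<^sup>+x. of_nat n * h0 x \<partial>lebesgue)"
      unfolding wint_def gn_pow by (intro nn_integral_mono) auto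
    also have "\<dots> < top"
      using h0I by (simp add: nn_integral_cmult ennreal_mult_less_top top.not_eq_extremum of_nat_less_top)
    finally have Jfin: "?J < top" .
    show ?thesis
    proof (cases "?J = 0")
      case False
      then have J: "0 < ?J" "0 < enn2real ?J" "ennreal (enn2real ?J) = ?J"
        using Jfin by (auto simp: zero_less_iff_neq_zero enn2real_positive_iff)
      \<comment> \<open>The perturbation is as large as \<open>?J\<close> itself, so
        \<open>G\<close> stays comparable with \<open>?gn\<close> in norm and no limit has to be
        taken.\<close>
      obtain \<phi> where \<phi> [measurable]: "\<phi> \<in> borel_measurable lebesgue" and pos: "\<And>x. 0 < \<phi> x"
        and \<phi>I: "wint p W \<phi> \<le> ?J"
        unfolding wint_def using ex_small_positive[OF W(1) _ J(2), of p] p1 J(3) by (auto simp: wint_def)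
      define G where "G x = ?gn x + \<phi> x" for x
      have [measurable]: "G \<in> borel_measurable lebesgue" unfolding G_def by measurable
      have Gpos: "0 < G x" for x using pos[of x] by (simp add: G_def zero_less_iff_neq_zero)
      have GI: "wint p W G \<le> ennreal (2 powr p * 2) * ?J"
      proof -
        have "wint p W G \<le> ennreal (2 powr p) * (?J + wint p W \<phi>)"
          unfolding G_def using p1 by (intro wint_add_le) measurable
        also have "\<dots> \<le> ennreal (2 powr p) * (?J + ?J)"
          by (intro mult_left_mono add_left_mono \<phi>I) auto
        also have "\<dots> = ennreal (2 powr p * 2) * ?J"
          by (simp add: ennreal_mult mult.assoc mult_2)
        finally show ?thesis .
      qed
      \<comment> \<open>The extremal function of duality for \<open>G\<close>: its power
        \<open>?q\<close> integrates against the dual weight to the same value as \<open>G^p\<close>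
        against \<open>W\<close>. Its \<open>A1\<close> majorant \<open>v\<close> therefore has norm
        controlled by \<open>?J\<close>.\<close>
      define H where "H x = epowr (G x) (p - 1) * W x" for x
      have [measurable]: "H \<in> borel_measurable lebesgue" unfolding H_def by measurable
      have Hpos: "0 < H x" for x
        using Gpos[of x] pos_weight_ne[OF W(1), of x] p1
        by (auto simp: H_def zero_less_iff_neq_zero epowr_eq_0_iff)
      have "epowr (H x) ?q * ?\<sigma> x = epowr (G x) p * W x" for x
      proof -
        have "epowr (H x) ?q * ?\<sigma> x = epowr (G x) p * (epowr (W x) ?q * epowr (W x) (- 1 / (p - 1)))"
          using p1 by (simp add: H_def dual_weight_def epowr_mult epowr_epowr mult.assoc)
        also have "epowr (W x) ?q * epowr (W x) (- 1 / (p - 1)) = epowr (W x) (?q + - 1 / (p - 1))"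
          using pos_weight_pos[OF W(1)] pos_weight_finite[OF W(1)] by (intro epowr_add[symmetric]) auto
        also have "?q + - 1 / (p - 1) = 1" using p1 by (simp add: conj_exponent_eq)
        finally show ?thesis by simp
      qed
      then have HI: "wint ?q ?\<sigma> H = wint p W G" by (simp add: wint_def)
      obtain v where v: "pos_weight v" "Ap 1 (ennreal (2 * N)) v" and Hv: "AE x in lebesgue. H x \<le> v x"
        and vI: "wint ?q ?\<sigma> v \<le> ennreal (2 powr ?q) * wint ?q ?\<sigma> H"
        unfolding wint_def
      proof (rule A1_majorant[OF q N pos_weight_dual[OF W(1)] \<open>H \<in> _\<close>])
        have "wint ?q ?\<sigma> H < top"
          unfolding HI using Jfin by (intro order_le_less_trans[OF GI]) (simp add: ennreal_mult_less_top)
        then show "(\<integral>\<^sup>+x. epowr (H x) ?q * ?\<sigma> x \<partial>lebesgue) < top" by (simp add: wint_def)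
      qed (use HL Hpos in \<open>auto simp: wint_def\<close>)
      note [measurable] = pos_weight_measurable[OF v(1)]
      let ?X = "\<lambda>x. epowr (v x) s * epowr (W x) (1 - s)"
      have X: "pos_weight ?X" "Ap p0 (epowr K (1 - s) * epowr (ennreal (2 * N)) s) ?X"
        by (intro pos_weight_mult pos_weight_epowr W v)
          (rule Ap_interpolate_A1[OF W v _ _ p s], use N in auto)
      have "?J \<le> wint p0 ?X g"
        unfolding wint_def
      proof (intro nn_integral_mono_AE)
        show "AE x in lebesgue. epowr (?gn x) p * W x \<le> epowr (g x) p0 * ?X x"
          using Hv
        proof eventually_elim
          fix x assume "H x \<le> v x"
          have gG: "?gn x \<le> G x" by (simp add: G_def)
          have "epowr (?gn x) p * W x = epowr (?gn x) p0 * epowr (?gn x) (p - p0) * W x"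
            using epowr_add'[of p0 "p - p0" "?gn x"] p by simp
          also have "\<dots> \<le> epowr (g x) p0 * epowr (G x) (p - p0) * W x"
            using p by (intro mult_right_mono mult_mono epowr_mono gG gn_le) auto
          also have "\<dots> = epowr (g x) p0 * (epowr (G x) (p - p0) * (epowr (W x) s * epowr (W x) (1 - s)))"
            using epowr_add'[of s "1 - s" "W x"] s0 by (simp add: mult_ac)
          also have "\<dots> = epowr (g x) p0 * (epowr (H x) s * epowr (W x) (1 - s))"
          proof -
            have "epowr (H x) s = epowr (G x) (p - p0) * epowr (W x) s"
              using s0 p by (simp add: H_def epowr_mult epowr_epowr s)
            then show ?thesis by (simp add: mult.assoc)
          qed
          also have "\<dots> \<le> epowr (g x) p0 * (epowr (v x) s * epowr (W x) (1 - s))"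
            using s0 \<open>H x \<le> v x\<close> by (intro mult_left_mono mult_right_mono epowr_mono) auto
          finally show "epowr (?gn x) p * W x \<le> epowr (g x) p0 * ?X x" .
        qed
      qed
      also have "\<dots> \<le> ennreal C * wint p0 ?X f" by (rule hyp[OF X])
      also have "wint p0 ?X f = (\<integral>\<^sup>+x. epowr (epowr (f x) p * W x) \<theta> * epowr (epowr (v x) ?q * ?\<sigma> x) (1 - \<theta>) \<partial>lebesgue)"
        unfolding wint_def
      proof (intro nn_integral_cong)
        fix x
        have "epowr (epowr (f x) p * W x) \<theta> * epowr (epowr (v x) ?q * ?\<sigma> x) (1 - \<theta>)
          = epowr (f x) (p * \<theta>) * (epowr (v x) (?q * (1 - \<theta>)) * (epowr (W x) \<theta> * epowr (W x) (- 1 / (p - 1) * (1 - \<theta>))))"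
          using \<theta> by (simp add: dual_weight_def epowr_mult epowr_epowr mult_ac)
        also have "epowr (W x) \<theta> * epowr (W x) (- 1 / (p - 1) * (1 - \<theta>)) = epowr (W x) (\<theta> + - 1 / (p - 1) * (1 - \<theta>))"
          using pos_weight_pos[OF W(1)] pos_weight_finite[OF W(1)] by (intro epowr_add[symmetric]) auto
        also have "\<theta> + - 1 / (p - 1) * (1 - \<theta>) = 1 - s"
        proof -
          have "\<theta> * p = p0" "s * (p - 1) = p - p0" using p by (auto simp: \<theta>_def s)
          then have "\<theta> * (p - 1) - (1 - \<theta>) = (1 - s) * (p - 1)" by (simp add: algebra_simps)
          moreover have "\<theta> + - 1 / (p - 1) * (1 - \<theta>) = (\<theta> * (p - 1) - (1 - \<theta>)) / (p - 1)"
            using p by (simp add: diff_divide_distrib)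
          ultimately show ?thesis using p by simp
        qed
        also have "?q * (1 - \<theta>) = s" using p by (simp add: \<theta>_def s divide_simps)
        also have "p * \<theta> = p0" using p by (simp add: \<theta>_def)
        finally show "epowr (f x) p0 * ?X x = epowr (epowr (f x) p * W x) \<theta> * epowr (epowr (v x) ?q * ?\<sigma> x) (1 - \<theta>)"
          by simp
      qed
      also have "\<dots> \<le> epowr (wint p W f) \<theta> * epowr (wint ?q ?\<sigma> v) (1 - \<theta>)"
        unfolding wint_def by (intro nn_integral_Holder \<theta>) measurable
      also have "\<dots> \<le> epowr (wint p W f) \<theta> * epowr (ennreal (2 powr ?q * 2 powr p * 2) * ?J) (1 - \<theta>)"
      proof (intro mult_left_mono epowr_mono)
        have "wint ?q ?\<sigma> v \<le> ennreal (2 powr ?q) * wint p W G" using vI HI by simp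
        also have "\<dots> \<le> ennreal (2 powr ?q) * (ennreal (2 powr p * 2) * ?J)"
          by (intro mult_left_mono GI) auto
        also have "\<dots> = ennreal (2 powr ?q * 2 powr p * 2) * ?J"
          by (simp add: ennreal_mult mult.assoc)
        finally show "wint ?q ?\<sigma> v \<le> ennreal (2 powr ?q * 2 powr p * 2) * ?J" .
      qed (use \<theta> in auto)
      also have "ennreal C * \<dots> = ennreal (C * (2 powr ?q * 2 powr p * 2) powr (1 - \<theta>)) * epowr (wint p W f) \<theta> * epowr ?J (1 - \<theta>)"
        (is "_ = ennreal ?c * _ * _")
      proof -
        have *: "epowr (ennreal t * y) (1 - \<theta>) = ennreal (t powr (1 - \<theta>)) * epowr y (1 - \<theta>)" if "0 < t" for t y
          using \<theta> that by (simp add: epowr_mult epowr_ennreal)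
        have "ennreal ?c = ennreal C * ennreal ((2 powr ?q * 2 powr p * 2) powr (1 - \<theta>))"
          using C by (intro ennreal_mult) auto
        then show ?thesis
          by (subst * ) (simp, simp only: mult_ac)
      qed
      finally have "?J \<le> ennreal ?c * epowr (wint p W f) \<theta> * epowr ?J (1 - \<theta>)"
        by (simp add: mult_left_mono)
      moreover have "?J = epowr ?J \<theta> * epowr ?J (1 - \<theta>)"
        using epowr_add'[of \<theta> "1 - \<theta>" ?J] \<theta> by simp
      ultimately have "epowr ?J (1 - \<theta>) * epowr ?J \<theta> \<le> epowr ?J (1 - \<theta>) * (ennreal ?c * epowr (wint p W f) \<theta>)"
        by (simp add: mult_ac)
      then have "epowr ?J \<theta> \<le> ennreal ?c * epowr (wint p W f) \<theta>"
        using epowr_pos[OF J(1) Jfin, of "1 - \<theta>"] epowr_less_top[OF J(1) Jfin, of "1 - \<theta>"]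
        by (simp add: ennreal_mult_le_mult_iff)
      then have "epowr (epowr ?J \<theta>) (1 / \<theta>) \<le> epowr (ennreal ?c * epowr (wint p W f) \<theta>) (1 / \<theta>)"
        using \<theta> by (intro epowr_mono) auto
      also have "\<dots> = ennreal (?c powr (1 / \<theta>)) * wint p W f"
        using \<theta> C by (simp add: epowr_mult epowr_epowr epowr_ennreal)
      also have "?c powr (1 / \<theta>) = C'" by (simp add: C' \<theta>_def)
      finally show ?thesis unfolding epowr_cancel[OF \<theta>(1)] .
    qed simp
  qed
  have "wint p W g = (\<integral>\<^sup>+x. (SUP n. min (epowr (g x) p * W x) (of_nat n * h0 x)) \<partial>lebesgue)"
    unfolding wint_def using h0pos by (simp add: SUP_min_of_nat)
  also have "\<dots> = (SUP n. \<integral>\<^sup>+x. min (epowr (g x) p * W x) (of_nat n * h0 x) \<partial>lebesgue)"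
  proof (intro nn_integral_monotone_convergence_SUP)
    show "incseq (\<lambda>n x. min (epowr (g x) p * W x) (of_nat n * h0 x))"
      by (intro monoI le_funI min.mono mult_right_mono) (auto simp: ennreal_of_nat_eq_real_of_nat intro: ennreal_leI)
  qed measurable
  also have "\<dots> \<le> ennreal C' * wint p W f"
  proof (intro SUP_least)
    fix n
    have "epowr (epowr (min (epowr (g x) p * W x) (of_nat n * h0 x) * inverse (W x)) (1 / p)) p * W x
        = min (epowr (g x) p * W x) (of_nat n * h0 x)" for x
      using p1 pos_weight_ne[OF W(1), of x] by (simp add: epowr_epowr mult.assoc inverse_mult_ennreal)
    then show "(\<integral>\<^sup>+x. min (epowr (g x) p * W x) (of_nat n * h0 x) \<partial>lebesgue) \<le> ennreal C' * wint p W f"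
      using bound[of n] by (simp add: wint_def)
  qed
  finally show ?thesis .
qed

text \<open>The order of quantifiers is the point: the maximal theorem gives one \<open>N\<close>
  for all weights with constant at most \<open>K\<close>, so the auxiliary weights have uniformly
  bounded constants of exponent \<open>p0\<close> and one \<open>C\<close> serves all weights and
  all pairs.\<close>

theorem extrapolation:
  fixes F :: "(('a::euclidean_space \<Rightarrow> ennreal) \<times> ('a \<Rightarrow> ennreal)) set"
  assumes p0: "1 \<le> p0" and p: "1 < p"
    and meas: "\<And>f g. (f, g) \<in> F \<Longrightarrow> f \<in> borel_measurable lebesgue \<and> g \<in> borel_measurable lebesgue"
    and hyp: "\<And>K. K < top \<Longrightarrow> \<exists>C. \<forall>X. pos_weight X \<longrightarrow> Ap p0 K X \<longrightarrow> (\<forall>(f, g)\<in>F. wint p0 X g \<le> ennreal C * wint p0 X f)"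
    and K: "K < top"
  shows "\<exists>C. \<forall>W. pos_weight W \<longrightarrow> Ap p K W \<longrightarrow> (\<forall>(f, g)\<in>F. wint p W g \<le> ennreal C * wint p W f)"
proof -
  have hyp': "\<exists>C\<ge>1. \<forall>X f g. pos_weight X \<longrightarrow> Ap p0 L X \<longrightarrow> (f, g) \<in> F \<longrightarrow> wint p0 X g \<le> ennreal C * wint p0 X f"
    if L: "L < top" for L
  proof -
    obtain C where C: "\<And>X f g. pos_weight X \<Longrightarrow> Ap p0 L X \<Longrightarrow> (f, g) \<in> F \<Longrightarrow> wint p0 X g \<le> ennreal C * wint p0 X f"
      using hyp[OF L] by fast
    have "wint p0 X g \<le> ennreal (max 1 C) * wint p0 X f" if "pos_weight X" "Ap p0 L X" "(f, g) \<in> F" for X f g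
      using C[OF that] by (rule order_trans) (auto intro!: mult_right_mono ennreal_leI)
    then show ?thesis by (intro exI[of _ "max 1 C"]) auto
  qed
  consider "p < p0" | "p = p0" | "p0 < p" by linarith
  then show ?thesis
  proof cases
    case 1
    obtain N where N: "1 \<le> N" "\<And>(W :: 'a \<Rightarrow> ennreal) f. pos_weight W \<Longrightarrow> Ap p K W \<Longrightarrow> f \<in> borel_measurable lebesgue \<Longrightarrow>
        wint p W (HL f) \<le> ennreal N * wint p W f"
      by (rule Muckenhoupt[OF p K, folded wint_def]) blast
    have "K * epowr (ennreal (2 * N)) (p0 - p) < top"
      using K 1 by (auto simp: ennreal_mult_less_top intro: epowr_less_top')
    from hyp'[OF this] obtain C where C: "1 \<le> C" "\<And>X f g. pos_weight X \<Longrightarrow> Ap p0 (K * epowr (ennreal (2 * N)) (p0 - p)) X \<Longrightarrow> (f, g) \<in> F \<Longrightarrow>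
        wint p0 X g \<le> ennreal C * wint p0 X f"
      by auto
    have "wint p W g \<le> ennreal (C * 2 powr (2 * p)) * wint p W f"
      if "pos_weight W" "Ap p K W" "(f, g) \<in> F" for W f g
      by (rule extrapolation_down[OF p 1 N(1)]) (use that N(2) C meas in auto)
    then show ?thesis by (intro exI[of _ "C * 2 powr (2 * p)"]) auto
  next
    case 2
    then show ?thesis using hyp[OF K] by simp
  next
    case 3
    define s where "s = (p - p0) / (p - 1)"
    have q: "1 < p / (p - 1)" using p by (simp add: field_simps)
    have K': "epowr K (1 / (p - 1)) < top" using K p by (intro epowr_less_top') auto
    obtain N where N: "1 \<le> N" "\<And>(W :: 'a \<Rightarrow> ennreal) f. pos_weight W \<Longrightarrow> Ap (p / (p - 1)) (epowr K (1 / (p - 1))) W \<Longrightarrow>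
        f \<in> borel_measurable lebesgue \<Longrightarrow> wint (p / (p - 1)) W (HL f) \<le> ennreal N * wint (p / (p - 1)) W f"
      by (rule Muckenhoupt[OF q K', folded wint_def]) blast
    have "0 \<le> s" "s \<le> 1" using 3 p p0 by (auto simp: s_def)
    then have "epowr K (1 - s) * epowr (ennreal (2 * N)) s < top"
      using K by (auto simp: ennreal_mult_less_top intro: epowr_less_top')
    from hyp'[OF this] obtain C where C: "1 \<le> C" "\<And>X f g. pos_weight X \<Longrightarrow> Ap p0 (epowr K (1 - s) * epowr (ennreal (2 * N)) s) X \<Longrightarrow> (f, g) \<in> F \<Longrightarrow>
        wint p0 X g \<le> ennreal C * wint p0 X f"
      by auto
    define C' where "C' = (C * (2 powr (p / (p - 1)) * 2 powr p * 2) powr (1 - p0 / p)) powr (p / p0)"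
    have "wint p W g \<le> ennreal C' * wint p W f"
      if *: "pos_weight W" "Ap p K W" "(f, g) \<in> F" for W f g
    proof (rule extrapolation_up[OF p0 3 N(1) *(1,2)])
      show "wint (p / (p - 1)) (dual_weight p W) (HL f) \<le> ennreal N * wint (p / (p - 1)) (dual_weight p W) f"
        if "f \<in> borel_measurable lebesgue" for f
        using N(2)[OF pos_weight_dual[OF *(1)] Ap_dual[OF *(1,2) p] that] .
    qed (use * C meas s_def C'_def in auto)
    then show ?thesis by (intro exI[of _ C']) auto
  qed
qed

section \<open>Uniformity in the weight constant\<close>

text \<open>The two comparisons differ because the condition is monotone in different ways: the
  first factor needs only a bound for the average of \<open>Z\<close>, while the dual weight
  decreases in \<open>Z\<close> and needs a pointwise lower bound for it. Near the centre of the
  adapted weight, \<open>Ap_U\<close> has just these two.\<close>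

lemma Ap_ball_perturb:
  assumes Y: "pos_weight Y" and A: "Ap_ball p L Y c r" and p: "1 \<le> p" and r: "0 < r"
    and avg: "avg Z (ball c r) \<le> \<beta> * avg Y (ball c r)"
    and le: "AE y in lebesgue. y \<in> ball c r \<longrightarrow> Y y \<le> \<alpha> * Z y"
    and Z: "pos_weight Z" and \<alpha>: "0 < \<alpha>" "\<alpha> < top"
  shows "Ap_ball p (\<alpha> * \<beta> * L) Z c r"
proof (cases "p = 1")
  case True
  have "AE y in lebesgue. y \<in> ball c r \<longrightarrow> avg Y (ball c r) \<le> L * Y y"
    using A True by (simp add: Ap_ball_def)
  then have "AE y in lebesgue. y \<in> ball c r \<longrightarrow> avg Z (ball c r) \<le> \<alpha> * \<beta> * L * Z y"
    using le
  proof eventually_elim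
    fix y assume 1: "y \<in> ball c r \<longrightarrow> avg Y (ball c r) \<le> L * Y y" and 2: "y \<in> ball c r \<longrightarrow> Y y \<le> \<alpha> * Z y"
    show "y \<in> ball c r \<longrightarrow> avg Z (ball c r) \<le> \<alpha> * \<beta> * L * Z y"
    proof
      assume y: "y \<in> ball c r"
      have "avg Y (ball c r) \<le> L * Y y" using 1 y by blast
      also have "\<dots> \<le> L * (\<alpha> * Z y)" using 2 y by (intro mult_left_mono) auto
      finally have "\<beta> * avg Y (ball c r) \<le> \<beta> * (L * (\<alpha> * Z y))" by (rule mult_left_mono) simp
      with avg have "avg Z (ball c r) \<le> \<beta> * (L * (\<alpha> * Z y))" by (rule order_trans)
      then show "avg Z (ball c r) \<le> \<alpha> * \<beta> * L * Z y" by (simp add: mult_ac)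
    qed
  qed
  then show ?thesis using True by (simp add: Ap_ball_def)
next
  case False
  with p have p: "1 < p" by simp
  note [measurable] = pos_weight_measurable[OF pos_weight_dual[OF Y]]
  let ?a = "- 1 / (p - 1)"
  have "AE y in lebesgue. y \<in> ball c r \<longrightarrow> dual_weight p Z y \<le> epowr \<alpha> (1 / (p - 1)) * dual_weight p Y y"
    using le
  proof eventually_elim
    fix y assume le: "y \<in> ball c r \<longrightarrow> Y y \<le> \<alpha> * Z y"
    show "y \<in> ball c r \<longrightarrow> dual_weight p Z y \<le> epowr \<alpha> (1 / (p - 1)) * dual_weight p Y y"
    proof
      assume "y \<in> ball c r"
      with le p have "epowr (\<alpha> * Z y) ?a \<le> epowr (Y y) ?a" by (intro epowr_antimono) auto
      moreover have "epowr (Z y) ?a = epowr \<alpha> (1 / (p - 1)) * epowr (\<alpha> * Z y) ?a"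
        using epowr_add[OF \<alpha>, of "1 / (p - 1)" ?a] epowr_mult'[OF \<alpha>, of "Z y" ?a] pos_weight_pos[OF Z] pos_weight_finite[OF Z]
        by (simp add: mult.assoc[symmetric])
      ultimately show "dual_weight p Z y \<le> epowr \<alpha> (1 / (p - 1)) * dual_weight p Y y"
        by (simp add: dual_weight_def mult_left_mono)
    qed
  qed
  then have "avg (dual_weight p Z) (ball c r) \<le> epowr \<alpha> (1 / (p - 1)) * avg (dual_weight p Y) (ball c r)"
    by (rule avg_le_cmult_AE[OF _ r]) measurable
  then have "epowr (avg (dual_weight p Z) (ball c r)) (p - 1) \<le> epowr (epowr \<alpha> (1 / (p - 1)) * avg (dual_weight p Y) (ball c r)) (p - 1)"
    using p by (intro epowr_mono) auto
  also have "\<dots> = \<alpha> * epowr (avg (dual_weight p Y) (ball c r)) (p - 1)"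
    using p by (simp add: epowr_mult epowr_epowr)
  finally have "avg Z (ball c r) * epowr (avg (dual_weight p Z) (ball c r)) (p - 1)
     \<le> (\<beta> * avg Y (ball c r)) * (\<alpha> * epowr (avg (dual_weight p Y) (ball c r)) (p - 1))"
    by (intro mult_mono avg) auto
  also have "\<dots> = \<alpha> * \<beta> * (avg Y (ball c r) * epowr (avg (dual_weight p Y) (ball c r)) (p - 1))"
    by (simp only: mult_ac)
  also have "\<dots> \<le> \<alpha> * \<beta> * L"
    using A p by (intro mult_left_mono) (auto simp: Ap_ball_def)
  finally show ?thesis using p by (simp add: Ap_ball_def)
qed

lemma avg_mono: "(\<And>x. x \<in> ball c r \<Longrightarrow> V x \<le> W x) \<Longrightarrow> avg V (ball c r) \<le> avg W (ball c r)"
  unfolding avg_def by (intro divide_right_mono_ennreal mass_mono_weight)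

lemma avg_cmult: "W \<in> borel_measurable lebesgue \<Longrightarrow> avg (\<lambda>x. t * W x) (ball c r) = t * avg W (ball c r)"
  unfolding avg_def by (simp add: mass_cmult ennreal_times_divide)

lemma Ap_perturb:
  assumes Y: "pos_weight Y" and Z: "pos_weight Z" and A: "Ap p L Y" "1 \<le> p"
    and "\<And>x. Z x \<le> \<beta> * Y x" "\<And>x. Y x \<le> \<alpha> * Z x" "0 < \<alpha>" "\<alpha> < top"
  shows "Ap p (\<alpha> * \<beta> * L) Z"
  unfolding Ap_def
proof (intro allI impI)
  fix c :: 'a and r :: real assume r: "0 < r"
  have "avg Z (ball c r) \<le> avg (\<lambda>x. \<beta> * Y x) (ball c r)" by (intro avg_mono assms)
  also have "\<dots> = \<beta> * avg Y (ball c r)" by (intro avg_cmult pos_weight_measurable Y)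
  finally show "Ap_ball p (\<alpha> * \<beta> * L) Z c r"
    using A r assms by (intro Ap_ball_perturb[OF Y _ _ r _ _ Z]) (auto simp: Ap_def)
qed

lemma Ap_top: "pos_weight W \<Longrightarrow> Ap p top W"
  unfolding Ap_def Ap_ball_def using pos_weight_ne[of W] by (auto simp: ennreal_top_mult)

section \<open>Weights with a prescribed constant\<close>

definition Ap_cst :: "real \<Rightarrow> ('a::euclidean_space \<Rightarrow> ennreal) \<Rightarrow> ennreal" where
  "Ap_cst p W = Inf {L. Ap p L W}"

text \<open>The infimum is attained. For p = 1 the exceptional null set depends on the constant, so
  only countably many constants tending to the infimum are used.\<close>

lemma Ap_Ap_cst:
  assumes W: "pos_weight W" shows "Ap p (Ap_cst p W) W"
proof (cases "Ap_cst p W = top")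
  case True then show ?thesis using Ap_top[OF W] by simp
next
  case False
  have e: "Ap p (Ap_cst p W + ennreal e) W" if "0 < e" for e
  proof -
    have "Ap_cst p W < Ap_cst p W + ennreal e"
      using False that by (simp add: ennreal_add_left_cancel_less top.not_eq_extremum)
    then obtain L where "Ap p L W" "L < Ap_cst p W + ennreal e"
      unfolding Ap_cst_def by (auto simp: Inf_less_iff)
    then show ?thesis by (auto intro: Ap_mono)
  qed
  show ?thesis
    unfolding Ap_def
  proof (intro allI impI)
    fix c :: 'a and r :: real assume r: "0 < r"
    show "Ap_ball p (Ap_cst p W) W c r"
    proof (cases "p = 1")
      case True
      have "AE y in lebesgue. \<forall>n. y \<in> ball c r \<longrightarrow> avg W (ball c r) \<le> (Ap_cst p W + ennreal (1 / real (Suc n))) * W y"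
        using e r True by (subst AE_all_countable) (auto simp: Ap_def Ap_ball_def)
      then have "AE y in lebesgue. y \<in> ball c r \<longrightarrow> avg W (ball c r) \<le> Ap_cst p W * W y"
      proof eventually_elim
        fix y assume *: "\<forall>n. y \<in> ball c r \<longrightarrow> avg W (ball c r) \<le> (Ap_cst p W + ennreal (1 / real (Suc n))) * W y"
        show "y \<in> ball c r \<longrightarrow> avg W (ball c r) \<le> Ap_cst p W * W y"
        proof
          assume y: "y \<in> ball c r"
          obtain b where b: "0 < b" "W y = ennreal b"
            using pos_weight_ne[OF W, of y] by (cases "W y" rule: ennreal_three_cases) auto
          show "avg W (ball c r) \<le> Ap_cst p W * W y"
          proof (rule ennreal_le_epsilon)
            fix d :: real assume d: "0 < d"
            obtain n where n: "b / d < real (Suc n)" using reals_Archimedean2[of "b / d"] by (metis less_Suc_eq of_nat_less_iff order_less_trans)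
            have "avg W (ball c r) \<le> (Ap_cst p W + ennreal (1 / real (Suc n))) * W y" using * y by blast
            also have "\<dots> = Ap_cst p W * W y + ennreal (b / real (Suc n))"
              using b by (simp add: distrib_right ennreal_mult[symmetric])
            also have "\<dots> \<le> Ap_cst p W * W y + ennreal d"
              using n d b by (intro add_left_mono ennreal_leI) (simp add: field_simps)
            finally show "avg W (ball c r) \<le> Ap_cst p W * W y + ennreal d" .
          qed
        qed
      qed
      then show ?thesis using True by (simp add: Ap_ball_def)
    next
      case False
      have "avg W (ball c r) * epowr (avg (dual_weight p W) (ball c r)) (p - 1) \<le> Ap_cst p W"
      proof (rule ennreal_le_epsilon)
        fix d :: real assume "0 < d"
        from e[OF this] show "avg W (ball c r) * epowr (avg (dual_weight p W) (ball c r)) (p - 1) \<le> Ap_cst p W + ennreal d"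
          using r False by (simp add: Ap_def Ap_ball_def)
      qed
      then show ?thesis using False by (simp add: Ap_ball_def)
    qed
  qed
qed

lemma Ap_iff_cst: "pos_weight W \<Longrightarrow> Ap p L W \<longleftrightarrow> Ap_cst p W \<le> L"
  using Ap_Ap_cst[of W p] Ap_mono[of p "Ap_cst p W" W L]
  by (auto simp: Ap_cst_def intro: Inf_lower)

lemma one_le_avg_dual:
  assumes W: "pos_weight W" and p: "1 < p" and r: "0 < r"
  shows "1 \<le> avg W (ball c r) * epowr (avg (dual_weight p W) (ball c r)) (p - 1)"
proof -
  let ?v = "emeasure lebesgue (ball c r)"
  have v: "0 < ?v" "?v < top" using r by (auto simp: zero_less_iff_neq_zero)
  have v': "0 < epowr ?v p" "epowr ?v p < top" using epowr_pos[OF v] epowr_less_top[OF v] by auto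
  have "epowr ?v p \<le> mass W (ball c r) * epowr (mass (dual_weight p W) (ball c r)) (p - 1)"
    by (rule Holder_dual_weight[OF W p]) simp
  also have "\<dots> = (?v * avg W (ball c r)) * (epowr ?v (p - 1) * epowr (avg (dual_weight p W) (ball c r)) (p - 1))"
    using p r by (simp only: mass_eq_avg) (simp add: epowr_mult)
  also have "\<dots> = (epowr ?v (p - 1) * epowr ?v 1) * (avg W (ball c r) * epowr (avg (dual_weight p W) (ball c r)) (p - 1))"
    by (simp add: mult_ac)
  also have "epowr ?v (p - 1) * epowr ?v 1 = epowr ?v p"
    using epowr_add[OF v, of "p - 1" 1] by simp
  finally have "epowr ?v p * 1 \<le> epowr ?v p * (avg W (ball c r) * epowr (avg (dual_weight p W) (ball c r)) (p - 1))"
    by simp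
  then show ?thesis using v' by (simp only: ennreal_mult_le_mult_iff)
qed

lemma avg_subball_le:
  fixes c d :: "'a::euclidean_space"
  assumes "ball d r \<subseteq> ball c (k * r)" "0 < r" "1 \<le> k"
  shows "avg V (ball d r) \<le> ennreal (k ^ DIM('a)) * avg V (ball c (k * r))"
proof -
  have "mass V (ball d r) \<le> mass V (ball c (k * r))" by (rule mass_mono[OF assms(1)])
  also have "\<dots> = emeasure lebesgue (ball c (k * r)) * avg V (ball c (k * r))"
    using assms by (intro mass_eq_avg) auto
  also have "emeasure lebesgue (ball c (k * r)) = ennreal (k ^ DIM('a)) * emeasure lebesgue (ball d r)"
    using assms by (intro emeasure_lebesgue_ball_scale) auto
  finally show ?thesis using assms by (simp add: avg_le_iff mult_ac)
qed

text \<open>A jump of relative height \<open>t\<close> across a hyperplane through 0, normal to an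
  arbitrary coordinate vector. Multiplication by it changes the constant of a weight continuously in
  \<open>t\<close> and pushes it beyond any bound.\<close>

definition half_step :: "real \<Rightarrow> 'a::euclidean_space \<Rightarrow> ennreal" where
  "half_step t x = (if 0 < x \<bullet> (SOME b. b \<in> Basis) then ennreal (1 + t) else 1)"

lemma borel_measurable_half_step [measurable]: "half_step t \<in> borel_measurable lebesgue"
proof -
  have "(half_step t :: 'a \<Rightarrow> ennreal) \<in> borel_measurable borel" unfolding half_step_def by measurable
  then show ?thesis by (simp add: measurable_completion)
qed

lemma pos_weight_half_step: "0 \<le> t \<Longrightarrow> pos_weight X \<Longrightarrow> pos_weight (\<lambda>x. half_step t x * X x)"
  by (intro pos_weight_mult)
    (auto simp: pos_weight_def borel_measurable_half_step, auto simp: half_step_def simp del: ennreal_plus)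

(* On the unit ball the oscillation of the step function across the hyperplane is seen by the A_p constant. *)
lemma Ap_half_step_lower:
  fixes X :: "'a::euclidean_space \<Rightarrow> ennreal"
  assumes X: "pos_weight X" "Ap p K X" and p: "1 \<le> p" and K: "1 \<le> K" "K < top" and t: "0 \<le> t"
    and L: "Ap p L (\<lambda>x. half_step t x * X x)"
  shows "ennreal (1 + t) \<le> K * ennreal (2 powr (real DIM('a) * (3 * p))) * L"
proof -
  note [measurable] = pos_weight_measurable[OF X(1)]
  let ?Y = "\<lambda>x. half_step t x * X x"
  have Y: "pos_weight ?Y" by (rule pos_weight_half_step[OF t X(1)])
  note [measurable] = pos_weight_measurable[OF Y] pos_weight_measurable[OF pos_weight_dual[OF Y]] pos_weight_measurable[OF pos_weight_dual[OF X(1)]]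
  define b :: 'a where "b = (SOME b. b \<in> Basis)"
  have b: "b \<in> Basis" unfolding b_def by (rule someI_ex) (use nonempty_Basis in blast)
  have nb: "norm b = 1" "b \<bullet> b = 1" using b by (auto simp: inner_Basis)
  define n where "n = real DIM('a)"
  \<comment> \<open>The unit ball, written as twice the radius 1/2 to match the factor 2 in
    \<open>Ap_ball_compare\<close> and \<open>avg_subball_le\<close>.\<close>
  let ?B = "ball (0 :: 'a) (2 * (1/2))" and ?P = "ball ((1/2) *\<^sub>R b) (1/2)" and ?M = "ball (- (1/2) *\<^sub>R b) (1/2)"
  have sub: "?P \<subseteq> ?B" "?M \<subseteq> ?B"
    using nb by (auto simp: ball_subset_ball_iff)
  have P: "half_step t x = ennreal (1 + t)" if "x \<in> ?P" for x
  proof -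
    have "((1/2) *\<^sub>R b - x) \<bullet> b \<le> norm ((1/2) *\<^sub>R b - x) * norm b" by (rule norm_cauchy_schwarz)
    also have "\<dots> < 1/2" using that nb by (simp add: dist_norm)
    finally show ?thesis using nb by (simp add: half_step_def b_def[symmetric] inner_diff_left)
  qed
  have M: "half_step t x = 1" if "x \<in> ?M" for x
  proof -
    have "(x - (- (1/2)) *\<^sub>R b) \<bullet> b \<le> norm (x - (- (1/2)) *\<^sub>R b) * norm b" by (rule norm_cauchy_schwarz)
    also have "\<dots> < 1/2" using that nb by (simp add: dist_norm norm_minus_commute)
    finally show ?thesis using nb by (simp add: half_step_def b_def[symmetric] inner_diff_left inner_add_left)
  qed
  \<comment> \<open>\<open>Ap_ball_compare\<close> asks for an exponent above 1; the exponent
    \<open>2 * p\<close> serves p = 1 and p > 1 alike.\<close>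
  have A: "Ap (2 * p) K X"
  proof (cases "p = 1")
    case True then show ?thesis using Ap_1_imp_Ap[of X K 2] X K by simp
  next
    case False
    then have p: "1 < p" using \<open>1 \<le> p\<close> by simp
    have dual: "dual_weight (2 * p) X = (\<lambda>x. epowr (dual_weight p X x) ((p - 1) / (2 * p - 1)) * epowr 1 (1 - (p - 1) / (2 * p - 1)))"
      using p by (auto simp: dual_weight_def epowr_epowr fun_eq_iff)
    show ?thesis
      unfolding Ap_def
    proof (intro allI impI)
      fix c :: 'a and r :: real assume r: "0 < r"
      have "avg (dual_weight (2 * p) X) (ball c r)
         \<le> epowr (avg (dual_weight p X) (ball c r)) ((p - 1) / (2 * p - 1)) * epowr (avg (\<lambda>_. 1) (ball c r)) (1 - (p - 1) / (2 * p - 1))"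
        unfolding dual using p by (intro avg_Holder r) (auto simp: field_simps)
      also have "avg (\<lambda>_. 1) (ball c r) = 1" using r by (simp add: avg_def mass_const)
      finally have "avg (dual_weight (2 * p) X) (ball c r) \<le> epowr (avg (dual_weight p X) (ball c r)) ((p - 1) / (2 * p - 1))" by simp
      then have "epowr (avg (dual_weight (2 * p) X) (ball c r)) (2 * p - 1) \<le> epowr (epowr (avg (dual_weight p X) (ball c r)) ((p - 1) / (2 * p - 1))) (2 * p - 1)"
        using p by (intro epowr_mono) auto
      also have "\<dots> = epowr (avg (dual_weight p X) (ball c r)) (p - 1)" using p by (simp add: epowr_epowr)
      finally have "avg X (ball c r) * epowr (avg (dual_weight (2 * p) X) (ball c r)) (2 * p - 1)
          \<le> avg X (ball c r) * epowr (avg (dual_weight p X) (ball c r)) (p - 1)" by (rule mult_left_mono) simp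
      also have "\<dots> \<le> K" using X p r by (auto simp: Ap_def Ap_ball_def)
      finally show "Ap_ball (2 * p) K X c r" using p by (simp add: Ap_ball_def)
    qed
  qed
  have MP: "avg X ?M \<le> K * ennreal (2 powr (n * (2 * p))) * avg X ?P"
  proof -
    have "mass X ?M \<le> mass X ?B" by (rule mass_mono[OF sub(2)])
    also have "\<dots> \<le> K * ennreal (2 powr (n * (2 * p))) * mass X ?P"
      unfolding n_def using A p sub by (intro Ap_ball_compare X) auto
    also have "\<dots> = K * ennreal (2 powr (n * (2 * p))) * avg X ?P * emeasure lebesgue ?P"
      by (simp add: avg_times_volume mult.assoc)
    also have "emeasure lebesgue ?P = emeasure lebesgue ?M"
      by (subst (1 2) emeasure_lebesgue_ball) auto
    finally show ?thesis by (simp add: avg_le_iff)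
  qed
  have n2: "(2::real) ^ DIM('a) = 2 powr n" by (simp add: n_def powr_realpow)
  have PY: "ennreal (1 + t) * avg X ?P \<le> ennreal (2 powr n) * avg ?Y ?B"
  proof -
    have "ennreal (1 + t) * avg X ?P = avg (\<lambda>x. ennreal (1 + t) * X x) ?P" by (intro avg_cmult[symmetric]) auto
    also have "\<dots> \<le> avg ?Y ?P" using P by (intro avg_mono) auto
    also have "\<dots> \<le> ennreal (2 powr n) * avg ?Y ?B"
      unfolding n2[symmetric] by (rule avg_subball_le) (use sub in auto)
    finally show ?thesis .
  qed
  show ?thesis
  proof (cases "p = 1")
    case True
    let ?y = "avg ?Y ?B"
    have "AE y in lebesgue. y \<in> ?B \<longrightarrow> ?y \<le> L * ?Y y"
      using spec[OF spec[OF L[unfolded True Ap_1_iff], of 0], of "2 * (1/2)"] by simp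
    then have "AE y in lebesgue. y \<in> ?M \<longrightarrow> ?y \<le> L * X y"
    proof eventually_elim
      fix y assume *: "y \<in> ?B \<longrightarrow> ?y \<le> L * ?Y y"
      show "y \<in> ?M \<longrightarrow> ?y \<le> L * X y"
      proof
        assume y: "y \<in> ?M"
        then have "y \<in> ?B" using sub(2) by blast
        with * have "?y \<le> L * ?Y y" by (rule mp)
        then show "?y \<le> L * X y" unfolding M[OF y] mult_1 .
      qed
    qed
    then have "avg (\<lambda>_. ?y) ?M \<le> L * avg X ?M" by (rule avg_le_cmult_AE) auto
    then have y: "?y \<le> L * avg X ?M" by (simp add: avg_def mass_const ennreal_mult_divide_eq)
    have Mfin: "0 < avg X ?M" "avg X ?M < top"
      using avg_pos[OF X(1)] avg_finite[OF X p K(2)] by auto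
    have "avg X ?M * ennreal (1 + t) \<le> (K * ennreal (2 powr (n * (2 * p))) * avg X ?P) * ennreal (1 + t)"
      by (intro mult_right_mono MP) auto
    also have "\<dots> = K * ennreal (2 powr (n * (2 * p))) * (ennreal (1 + t) * avg X ?P)" by (simp only: mult_ac)
    also have "\<dots> \<le> K * ennreal (2 powr (n * (2 * p))) * (ennreal (2 powr n) * (L * avg X ?M))"
      by (intro mult_left_mono order_trans[OF PY] y) auto
    also have "\<dots> = avg X ?M * (K * (ennreal (2 powr (n * (2 * p))) * ennreal (2 powr n)) * L)" by (simp only: mult_ac)
    also have "ennreal (2 powr (n * (2 * p))) * ennreal (2 powr n) = ennreal (2 powr (n * (3 * p)))"
      using True by (simp add: ennreal_mult[symmetric] powr_add[symmetric] algebra_simps)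
    finally show ?thesis using Mfin by (simp add: ennreal_mult_le_mult_iff n_def)
  next
    case False
    then have p: "1 < p" using p by simp
    let ?S = "epowr (avg (dual_weight p X) ?M) (p - 1)"
    have "avg (dual_weight p X) ?M \<le> avg (dual_weight p ?Y) ?M"
      using M by (intro avg_mono) (auto simp: dual_weight_def)
    also have "\<dots> \<le> ennreal (2 powr n) * avg (dual_weight p ?Y) ?B"
      unfolding n2[symmetric] by (rule avg_subball_le) (use sub in auto)
    finally have "?S \<le> epowr (ennreal (2 powr n) * avg (dual_weight p ?Y) ?B) (p - 1)"
      using p by (intro epowr_mono) auto
    also have "\<dots> = ennreal (2 powr (n * (p - 1))) * epowr (avg (dual_weight p ?Y) ?B) (p - 1)"
      using p by (simp add: epowr_mult epowr_ennreal powr_powr)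
    finally have S: "?S \<le> ennreal (2 powr (n * (p - 1))) * epowr (avg (dual_weight p ?Y) ?B) (p - 1)" .
    have "ennreal (1 + t) * 1 \<le> ennreal (1 + t) * (avg X ?M * ?S)"
      by (intro mult_left_mono one_le_avg_dual X p) auto
    also have "\<dots> \<le> ennreal (1 + t) * ((K * ennreal (2 powr (n * (2 * p))) * avg X ?P) * ?S)"
      by (intro mult_left_mono mult_right_mono MP) auto
    also have "\<dots> = K * ennreal (2 powr (n * (2 * p))) * ((ennreal (1 + t) * avg X ?P) * ?S)" by (simp only: mult_ac)
    also have "\<dots> \<le> K * ennreal (2 powr (n * (2 * p))) * ((ennreal (2 powr n) * avg ?Y ?B) * (ennreal (2 powr (n * (p - 1))) * epowr (avg (dual_weight p ?Y) ?B) (p - 1)))"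
      by (intro mult_left_mono mult_mono PY S) auto
    also have "\<dots> = K * (ennreal (2 powr (n * (2 * p))) * ennreal (2 powr n) * ennreal (2 powr (n * (p - 1)))) * (avg ?Y ?B * epowr (avg (dual_weight p ?Y) ?B) (p - 1))"
      by (simp only: mult_ac)
    also have "\<dots> \<le> K * (ennreal (2 powr (n * (2 * p))) * ennreal (2 powr n) * ennreal (2 powr (n * (p - 1)))) * L"
      using L p by (intro mult_left_mono) (auto simp: Ap_def Ap_ball_def)
    also have "ennreal (2 powr (n * (2 * p))) * ennreal (2 powr n) * ennreal (2 powr (n * (p - 1))) = ennreal (2 powr (n * (3 * p)))"
      by (simp add: ennreal_mult[symmetric] powr_add[symmetric] algebra_simps)
    finally show ?thesis by (simp add: n_def)
  qed
qed


lemma half_step_compare: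
  assumes "0 \<le> s" "s \<le> t"
  shows "half_step s x \<le> half_step t x" "half_step t x \<le> ennreal ((1 + t) / (1 + s)) * half_step s x"
proof -
  show "half_step s x \<le> half_step t x" using assms by (simp add: half_step_def del: ennreal_plus)
  have "1 \<le> (1 + t) / (1 + s)" "(1 + t) / (1 + s) * (1 + s) = 1 + t" using assms by auto
  then show "half_step t x \<le> ennreal ((1 + t) / (1 + s)) * half_step s x"
    using assms by (auto simp: half_step_def ennreal_mult[symmetric] simp del: ennreal_plus)
qed

lemma half_step_0 [simp]: "half_step 0 x = 1"
  by (simp add: half_step_def)

(* The constant in the hypothesis depends arbitrarily on [u], so a uniform bound for all weights with [u] <= k
   needs each of them to be comparable with a weight of constant exactly k. *)
lemma ex_weight_exact_Ap_cst:
  assumes p: "1 \<le> p" and k: "1 \<le> k"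
  obtains M where "1 \<le> M" "\<And>X :: 'a::euclidean_space \<Rightarrow> ennreal. pos_weight X \<Longrightarrow> Ap p (ennreal k) X \<Longrightarrow>
     \<exists>Y. pos_weight Y \<and> Ap_cst p Y = ennreal k \<and> (\<forall>x. X x \<le> Y x \<and> Y x \<le> ennreal M * X x)"
proof -
  \<comment> \<open>\<open>Ap_half_step_lower\<close> gives 1 + t \<le> C0 \<phi>(t), where
    \<phi>(t) is the constant at height \<open>t\<close>. The choice T = C0 k thus forces \<phi>(T)
    to be at least \<open>k\<close>, while \<phi>(0) is at most \<open>k\<close>.\<close>
  define C0 where "C0 = k * 2 powr (real DIM('a) * (3 * p))"
  define T where "T = C0 * k"
  have C0: "1 \<le> C0"
    using k p mult_mono[of 1 k 1 "2 powr (real DIM('a) * (3 * p))"] by (simp add: C0_def ge_one_powr_ge_zero)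
  then have T: "0 \<le> T" using k by (simp add: T_def)
  show ?thesis
  proof (rule that[of "1 + T"])
    show "1 \<le> 1 + T" using T by simp
    fix X :: "'a \<Rightarrow> ennreal" assume X: "pos_weight X" and A: "Ap p (ennreal k) X"
    define Y where "Y t x = half_step t x * X x" for t x
    have Y: "0 \<le> t \<Longrightarrow> pos_weight (Y t)" for t unfolding Y_def by (rule pos_weight_half_step[OF _ X])
    have YX: "X x \<le> Y t x" "Y t x \<le> ennreal (1 + t) * X x" if "0 \<le> t" for t x
      using half_step_compare[of 0 t x] that
      by (auto simp: Y_def intro!: mult_right_mono simp del: ennreal_plus dest: mult_right_mono[of 1 _ "X x"])
    have up: "Ap_cst p (Y t) \<le> ennreal ((1 + t) / (1 + s)) * Ap_cst p (Y s)" if "0 \<le> s" "s \<le> t" for s t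
    proof -
      have "Ap p (1 * ennreal ((1 + t) / (1 + s)) * Ap_cst p (Y s)) (Y t)"
      proof (rule Ap_perturb[OF Y Y Ap_Ap_cst[OF Y] p])
        show "Y t x \<le> ennreal ((1 + t) / (1 + s)) * Y s x" for x
          using mult_right_mono[OF half_step_compare(2)[OF that], of "X x" x] by (simp add: Y_def mult.assoc)
        show "Y s x \<le> 1 * Y t x" for x
          using mult_right_mono[OF half_step_compare(1)[OF that], of "X x" x] by (simp add: Y_def)
      qed (use that in auto)
      then show ?thesis using Y[of t] that by (simp add: Ap_iff_cst)
    qed
    have down: "Ap_cst p (Y s) \<le> ennreal ((1 + t) / (1 + s)) * Ap_cst p (Y t)" if "0 \<le> s" "s \<le> t" for s t
    proof -
      have "Ap p (ennreal ((1 + t) / (1 + s)) * 1 * Ap_cst p (Y t)) (Y s)"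
      proof (rule Ap_perturb[OF Y Y Ap_Ap_cst[OF Y] p])
        show "Y t x \<le> ennreal ((1 + t) / (1 + s)) * Y s x" for x
          using mult_right_mono[OF half_step_compare(2)[OF that], of "X x" x] by (simp add: Y_def mult.assoc)
        show "Y s x \<le> 1 * Y t x" for x
          using mult_right_mono[OF half_step_compare(1)[OF that], of "X x" x] by (simp add: Y_def)
      qed (use that in auto)
      then show ?thesis using Y[of s] that by (simp add: Ap_iff_cst)
    qed
    define \<phi> where "\<phi> t = enn2real (Ap_cst p (Y t))" for t
    have Y0: "Y 0 = X" by (simp add: Y_def fun_eq_iff)
    have cst0: "Ap_cst p (Y 0) \<le> ennreal k" using A X by (simp add: Y0 Ap_iff_cst)
    have fin: "Ap_cst p (Y t) \<le> ennreal ((1 + t) * k)" if "0 \<le> t" for t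
    proof -
      have "Ap_cst p (Y t) \<le> ennreal (1 + t) * Ap_cst p (Y 0)" using up[of 0 t] that by simp
      also have "\<dots> \<le> ennreal (1 + t) * ennreal k" by (intro mult_left_mono cst0) simp
      also have "\<dots> = ennreal ((1 + t) * k)" using that k by (intro ennreal_mult[symmetric]) auto
      finally show ?thesis .
    qed
    have \<phi>: "Ap_cst p (Y t) = ennreal (\<phi> t)" if "0 \<le> t" for t
      using order_le_less_trans[OF fin[OF that] ennreal_less_top] by (simp add: \<phi>_def)
    have \<phi>0: "0 \<le> \<phi> t" for t by (simp add: \<phi>_def)
    have \<phi>_le: "\<phi> t \<le> (1 + T) * k" if "0 \<le> t" "t \<le> T" for t
    proof -
      have "ennreal (\<phi> t) \<le> ennreal ((1 + t) * k)" using fin[OF that(1)] \<phi>[OF that(1)] by simp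
      then have "\<phi> t \<le> (1 + t) * k" using that k by (subst (asm) ennreal_le_iff) auto
      also have "\<dots> \<le> (1 + T) * k" using that k by (intro mult_right_mono) auto
      finally show ?thesis .
    qed
    \<comment> \<open>The weights at heights s \<le> t are comparable with ratio (1 + t) / (1 + s),
      so their constants differ at most by this factor in either direction. As \<phi> is bounded on
      [0, T] this is a Lipschitz estimate, and the intermediate value theorem finds a height with
      constant exactly \<open>k\<close>.\<close>
    have lip: "\<bar>\<phi> t - \<phi> s\<bar> \<le> (1 + T) * k * (t - s)" if "0 \<le> s" "s \<le> t" "t \<le> T" for s t
    proof -
            have le: "\<phi> t \<le> (1 + t) / (1 + s) * \<phi> s" "\<phi> s \<le> (1 + t) / (1 + s) * \<phi> t"
      proof -
        define a where "a = (1 + t) / (1 + s)"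
        have a: "0 \<le> a" using that by (simp add: a_def)
        have "ennreal (\<phi> t) \<le> ennreal (a * \<phi> s)" "ennreal (\<phi> s) \<le> ennreal (a * \<phi> t)"
          using up[OF that(1,2)] down[OF that(1,2)] that a \<phi>0 by (auto simp: \<phi> ennreal_mult a_def[symmetric])
        then show "\<phi> t \<le> (1 + t) / (1 + s) * \<phi> s" "\<phi> s \<le> (1 + t) / (1 + s) * \<phi> t"
          using a \<phi>0 by (auto simp: ennreal_le_iff a_def[symmetric])
      qed
      have r: "(1 + t) / (1 + s) = 1 + (t - s) / (1 + s)" using that by (simp add: field_simps)
      have *: "(t - s) / (1 + s) * \<phi> x \<le> (t - s) * ((1 + T) * k)" if "0 \<le> x" "x \<le> T" for x
      proof (rule mult_mono)
        have "(t - s) / (1 + s) \<le> (t - s) / 1" using \<open>0 \<le> s\<close> \<open>s \<le> t\<close> by (intro divide_left_mono) auto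
        then show "(t - s) / (1 + s) \<le> t - s" by simp
      qed (use \<open>0 \<le> s\<close> \<open>s \<le> t\<close> that \<phi>_le \<phi>0 in auto)
      show ?thesis using le *[of s] *[of t] that unfolding r by (simp add: algebra_simps abs_le_iff)
    qed
    have "((1 + T) * k)-lipschitz_on {0..T} \<phi>"
    proof (rule lipschitz_onI)
      fix s t assume "s \<in> {0..T}" "t \<in> {0..T}"
      then show "dist (\<phi> s) (\<phi> t) \<le> (1 + T) * k * dist s t"
        using lip[of s t] lip[of t s] by (cases "s \<le> t") (auto simp: dist_real_def abs_minus_commute)
    qed (use T k in auto)
    then have cont: "continuous_on {0..T} \<phi>" by (rule lipschitz_on_continuous_on)
    have "\<phi> 0 \<le> k" using cst0 \<phi>[of 0] k by simp
    moreover have "k \<le> \<phi> T"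
    proof -
      have "ennreal (1 + T) \<le> ennreal k * ennreal (2 powr (real DIM('a) * (3 * p))) * ennreal (\<phi> T)"
        by (rule Ap_half_step_lower[OF X A p _ _ T]) (use Ap_Ap_cst[OF Y[OF T], of p] \<phi>[OF T] k in \<open>auto simp: Y_def[abs_def]\<close>)
      also have "\<dots> = ennreal (C0 * \<phi> T)"
        using k \<phi>0 by (simp add: C0_def ennreal_mult)
      finally have "1 + T \<le> C0 * \<phi> T" using C0 \<phi>0 by (subst (asm) ennreal_le_iff) auto
      then have "C0 * k \<le> C0 * \<phi> T" by (simp add: T_def)
      then show ?thesis using C0 by simp
    qed
    ultimately obtain t where t: "0 \<le> t" "t \<le> T" "\<phi> t = k"
      using IVT'[of \<phi> 0 k T] cont T by auto
    show "\<exists>Y. pos_weight Y \<and> Ap_cst p Y = ennreal k \<and> (\<forall>x. X x \<le> Y x \<and> Y x \<le> ennreal (1 + T) * X x)"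
    proof (intro exI[of _ "Y t"] conjI allI)
      fix x
      have "Y t x \<le> ennreal (1 + t) * X x" using YX t by auto
      also have "\<dots> \<le> ennreal (1 + T) * X x" using t by (intro mult_right_mono ennreal_leI) auto
      finally show "Y t x \<le> ennreal (1 + T) * X x" .
    qed (use t Y \<phi> YX in auto)
  qed
qed

section \<open>Real valued weights and their everywhere positive versions\<close>

lemma wmeasure_eq_mass: "wmeasure w E = mass (\<lambda>x. ennreal (w x)) E"
  by (simp add: wmeasure_def mass_def)

lemma wavg_eq_avg: "wavg w E = avg (\<lambda>x. ennreal (w x)) E"
  by (simp add: wavg_def avg_def wmeasure_eq_mass)

lemma mass_cong_AE: "AE x in lebesgue. x \<in> E \<longrightarrow> V x = W x \<Longrightarrow> mass V E = mass W E"
  unfolding mass_def by (intro nn_integral_cong_AE, erule eventually_mono) (auto simp: indicator_def)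

lemma avg_cong_AE: "AE x in lebesgue. V x = W x \<Longrightarrow> avg V E = avg W E"
  unfolding avg_def by (subst mass_cong_AE[of E V W]) (auto elim: eventually_mono)

definition pos_version :: "(real ^ 'n \<Rightarrow> real) \<Rightarrow> real ^ 'n \<Rightarrow> ennreal" where
  "pos_version w x = (if 0 < w x then ennreal (w x) else 1)"

lemma is_weight_measurable:
  assumes "is_weight w" shows "w \<in> borel_measurable lebesgue"
proof (rule borel_measurable_LIMSEQ_real)
  fix n :: nat
  have "w absolutely_integrable_on (cball 0 (real n))" using assms by (auto simp: is_weight_def)
  then show "(\<lambda>x. indicator (cball 0 (real n)) x *\<^sub>R w x) \<in> borel_measurable lebesgue"
    unfolding set_integrable_def by (rule borel_measurable_integrable)
next
  fix x :: "real ^ 'a"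
  obtain N :: nat where N: "norm x \<le> real N" using real_arch_simple by blast
  show "(\<lambda>n. indicator (cball 0 (real n)) x *\<^sub>R w x) \<longlonglongrightarrow> w x"
  proof (rule tendsto_eventually, rule eventually_sequentiallyI[of N])
    fix n assume "N \<le> n"
    then have "norm x \<le> real n" using N by simp
    then show "indicator (cball 0 (real n)) x *\<^sub>R w x = w x" by simp
  qed
qed

lemma pos_weight_pos_version: "is_weight w \<Longrightarrow> pos_weight (pos_version w)"
  using is_weight_measurable[of w] unfolding pos_weight_def pos_version_def by auto

lemma AE_pos_version: "is_weight w \<Longrightarrow> AE x in lebesgue. ennreal (w x) = pos_version w x"
  unfolding is_weight_def by (auto simp: pos_version_def elim!: eventually_mono)

lemma A1_bound_iff:
  assumes w: "is_weight w" shows "A1_bound w c \<longleftrightarrow> Ap 1 c (pos_version w)"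
proof -
  have "wavg w (ball x r) = avg (pos_version w) (ball x r)" for x r
    unfolding wavg_eq_avg by (rule avg_cong_AE[OF AE_pos_version[OF w]])
  then have "A1_bound w c \<longleftrightarrow> (\<forall>x. \<forall>r>0. AE y in lebesgue. y \<in> ball x r \<longrightarrow> avg (pos_version w) (ball x r) \<le> c * ennreal (w y))"
    by (simp add: A1_bound_def)
  also have "\<dots> \<longleftrightarrow> (\<forall>x. \<forall>r>0. AE y in lebesgue. y \<in> ball x r \<longrightarrow> avg (pos_version w) (ball x r) \<le> c * pos_version w y)"
  proof (intro iff_allI imp_cong refl)
    fix x r
    show "(AE y in lebesgue. y \<in> ball x r \<longrightarrow> avg (pos_version w) (ball x r) \<le> c * ennreal (w y))
      \<longleftrightarrow> (AE y in lebesgue. y \<in> ball x r \<longrightarrow> avg (pos_version w) (ball x r) \<le> c * pos_version w y)"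
      by (rule eventually_subst) (use AE_pos_version[OF w] in \<open>auto elim!: eventually_mono\<close>)
  qed
  finally show ?thesis by (auto simp: Ap_1_iff)
qed

lemma Ap_const_eq:
  assumes w: "is_weight w" and p: "1 \<le> p"
  shows "Ap_const p w = Ap_cst p (pos_version w)"
proof (cases "p = 1")
  case True
  moreover have "A1_bound w = (\<lambda>c. Ap 1 c (pos_version w))" by (simp add: fun_eq_iff A1_bound_iff[OF w])
  ultimately show ?thesis by (simp add: Ap_const_def Ap_cst_def)
next
  case False
  with p have p: "1 < p" by simp
  let ?W = "pos_version w"
  have avgw: "wavg w (ball x r) = avg ?W (ball x r)" for x r
    unfolding wavg_eq_avg by (rule avg_cong_AE[OF AE_pos_version[OF w]])
  have avgd: "wavg (\<lambda>y. w y powr (1 - p / (p - 1))) (ball x r) = avg (dual_weight p ?W) (ball x r)" for x r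
    unfolding wavg_eq_avg
  proof (rule avg_cong_AE)
    have "1 - p / (p - 1) = - 1 / (p - 1)" using p by (simp add: conj_exponent_eq)
    moreover have "AE x in lebesgue. 0 < w x" using w by (simp add: is_weight_def)
    ultimately show "AE x in lebesgue. ennreal (w x powr (1 - p / (p - 1))) = dual_weight p ?W x"
      by (auto simp: dual_weight_def pos_version_def epowr_ennreal elim!: eventually_mono)
  qed
  have "Ap_const p w \<le> L \<longleftrightarrow> Ap p L ?W" for L
    using p by (simp add: Ap_const_def SUP_le_iff Ap_def Ap_ball_def avgw avgd Ball_def)
  then have "Ap_const p w \<le> L \<longleftrightarrow> Ap_cst p ?W \<le> L" for L
    by (simp add: Ap_iff_cst[OF pos_weight_pos_version[OF w]])
  then show ?thesis by (meson antisym order_refl)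
qed

lemma Ap_class_pos_version:
  assumes "w \<in> Ap_class p" "1 \<le> p"
  shows "pos_weight (pos_version w)" "Ap p (Ap_const p w) (pos_version w)" "Ap_const p w < top"
  using assms Ap_Ap_cst[OF pos_weight_pos_version[of w], of p]
  by (auto simp: Ap_class_def Ap_const_eq intro: pos_weight_pos_version)

text \<open>The way back: the local integrability demanded by \<open>is_weight\<close> follows from
  a finite constant through \<open>Ap_mass_finite\<close>.\<close>

lemma pos_weight_real_version:
  fixes Y :: "real ^ 'n \<Rightarrow> ennreal"
  assumes Y: "pos_weight Y" and A: "Ap p K Y" "1 \<le> p" "K < top"
  shows "is_weight (\<lambda>x. enn2real (Y x))" "pos_version (\<lambda>x. enn2real (Y x)) = Y" "ennreal (enn2real (Y x)) = Y x"
proof -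
  note [measurable] = pos_weight_measurable[OF Y]
  have eq: "ennreal (enn2real (Y x)) = Y x" for x using pos_weight_finite[OF Y] by simp
  then show "ennreal (enn2real (Y x)) = Y x" .
  have pos: "0 < enn2real (Y x)" for x
    using pos_weight_pos[OF Y, of x] pos_weight_finite[OF Y, of x] by (simp add: enn2real_positive_iff)
  show "pos_version (\<lambda>x. enn2real (Y x)) = Y"
    using pos eq by (simp add: pos_version_def fun_eq_iff)
  show "is_weight (\<lambda>x. enn2real (Y x))"
    unfolding is_weight_def
  proof (intro conjI allI impI)
    fix S :: "(real ^ 'n) set" assume "compact S"
    then have S: "S \<in> sets lebesgue" "bounded S" by (auto intro: compact_imp_bounded lmeasurable_compact fmeasurableD)
    obtain R where R: "0 < R" "S \<subseteq> ball 0 R"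
      using bounded_subset_ballD[OF S(2), of 0] by auto
    show "(\<lambda>x. enn2real (Y x)) absolutely_integrable_on S"
      unfolding set_integrable_def
    proof (rule integrableI_bounded)
      show "(\<lambda>x. indicator S x *\<^sub>R enn2real (Y x)) \<in> borel_measurable lebesgue" using S by measurable
      have "(\<integral>\<^sup>+x. ennreal (norm (indicator S x *\<^sub>R enn2real (Y x))) \<partial>lebesgue) = mass Y S"
        unfolding mass_def using eq by (intro nn_integral_cong) (auto simp: indicator_def)
      also have "\<dots> \<le> mass Y (ball 0 R)" by (rule mass_mono[OF R(2)])
      also have "\<dots> < top" using Ap_mass_finite[OF Y A R(1)] .
      finally show "(\<integral>\<^sup>+x. ennreal (norm (indicator S x *\<^sub>R enn2real (Y x))) \<partial>lebesgue) < \<infinity>" by simp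
    qed
  qed (use pos in auto)
qed

text \<open>The hypothesis is applied only to weights whose constant is exactly \<open>k\<close>, so
  the single value \<Phi>(k) enters. The two-sided comparison X \<le> Y \<le> M X carries the
  estimate over to \<open>X\<close> at the cost of a factor \<open>M\<close>.\<close>

lemma uniform_hypothesis:
  fixes F :: "((real ^ 'n \<Rightarrow> ennreal) \<times> (real ^ 'n \<Rightarrow> ennreal)) set"
  assumes p0: "1 \<le> p0"
    and star: "\<forall>u \<in> Ap_class p0. \<forall>(f, g) \<in> F. Lp_norm p0 u g \<le> ennreal (\<Phi> (Ap_const p0 u)) * Lp_norm p0 u f"
    and meas: "\<And>f g. (f, g) \<in> F \<Longrightarrow> f \<in> borel_measurable lebesgue \<and> g \<in> borel_measurable lebesgue"
    and K: "K < top"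
  shows "\<exists>C. \<forall>X. pos_weight X \<longrightarrow> Ap p0 K X \<longrightarrow> (\<forall>(f, g)\<in>F. wint p0 X g \<le> ennreal C * wint p0 X f)"
proof -
  define k where "k = max 1 (enn2real K)"
  have k: "1 \<le> k" "K \<le> ennreal k" using K by (cases K; auto simp: k_def ennreal_leI)+
  obtain M where M: "1 \<le> M" "\<And>X :: real ^ 'n \<Rightarrow> ennreal. pos_weight X \<Longrightarrow> Ap p0 (ennreal k) X \<Longrightarrow>
     \<exists>Y. pos_weight Y \<and> Ap_cst p0 Y = ennreal k \<and> (\<forall>x. X x \<le> Y x \<and> Y x \<le> ennreal M * X x)"
    by (rule ex_weight_exact_Ap_cst[OF p0 k(1)]) blast
  define P where "P = max 1 (\<Phi> (ennreal k))"
  have P: "1 \<le> P" "ennreal (\<Phi> (ennreal k)) \<le> ennreal P" by (auto simp: P_def ennreal_leI)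
  have "wint p0 X g \<le> ennreal (P powr p0 * M) * wint p0 X f"
    if X: "pos_weight X" "Ap p0 K X" and fg: "(f, g) \<in> F" for X f g
  proof -
    obtain Y where Y: "pos_weight Y" "Ap_cst p0 Y = ennreal k" and XY: "\<And>x. X x \<le> Y x" "\<And>x. Y x \<le> ennreal M * X x"
      using M(2)[OF X(1) Ap_mono[OF X(2) k(2)]] by blast
    have AY: "Ap p0 (ennreal k) Y" using Ap_Ap_cst[OF Y(1), of p0] Y(2) by simp
    define u where "u x = enn2real (Y x)" for x
    note real = pos_weight_real_version[OF Y(1) AY p0 ennreal_less_top, folded u_def]
    have cst: "Ap_const p0 u = ennreal k"
      using Ap_const_eq[OF real(1) p0] real(2) Y(2) by simp
    then have "u \<in> Ap_class p0" using real(1) by (simp add: Ap_class_def)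
    with star fg have "Lp_norm p0 u g \<le> ennreal (\<Phi> (Ap_const p0 u)) * Lp_norm p0 u f" by blast
    then have "Lp_norm p0 u g \<le> ennreal P * Lp_norm p0 u f"
      unfolding cst by (rule order_trans) (intro mult_right_mono P, simp)
    moreover have L: "Lp_norm p0 u h = epowr (wint p0 Y h) (1 / p0)" for h
      by (simp add: Lp_norm_def wint_def real(3))
    ultimately have "epowr (wint p0 Y g) (1 / p0) \<le> ennreal P * epowr (wint p0 Y f) (1 / p0)"
      by simp
    then have "epowr (epowr (wint p0 Y g) (1 / p0)) p0 \<le> epowr (ennreal P * epowr (wint p0 Y f) (1 / p0)) p0"
      using p0 by (intro epowr_mono) auto
    then have Yb: "wint p0 Y g \<le> ennreal (P powr p0) * wint p0 Y f"
      using p0 P by (simp add: epowr_mult epowr_cancel' epowr_ennreal)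
    have "wint p0 X g \<le> wint p0 Y g"
      unfolding wint_def by (intro nn_integral_mono mult_left_mono XY) auto
    also note Yb
    also have "wint p0 Y f \<le> ennreal M * wint p0 X f"
    proof -
      have [measurable]: "f \<in> borel_measurable lebesgue" "X \<in> borel_measurable lebesgue"
        using meas[OF fg] pos_weight_measurable[OF X(1)] by auto
      have "wint p0 Y f \<le> (\<integral>\<^sup>+x. ennreal M * (epowr (f x) p0 * X x) \<partial>lebesgue)"
        unfolding wint_def
        using mult_left_mono[OF XY(2), of "epowr (f _) p0"] by (intro nn_integral_mono) (simp add: mult_ac)
      also have "\<dots> = ennreal M * wint p0 X f"
        unfolding wint_def by (intro nn_integral_cmult) measurable
      finally show ?thesis .
    qed
    finally show ?thesis using M P by (simp add: ennreal_mult mult_left_mono mult.assoc)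
  qed
  then show ?thesis by (intro exI[of _ "P powr p0 * M"]) auto
qed

section \<open>Superlevel sets of a weight\<close>

lemma epowr_le_iff: "0 < a \<Longrightarrow> epowr s a \<le> epowr t a \<longleftrightarrow> s \<le> t"
  using epowr_mono[of a s t] epowr_mono[of "1 / a" "epowr s a" "epowr t a"] by (auto simp: epowr_epowr)

(* The balls B_j(x) = B(x + 2^-j (c - x), 2^-j r) shrink to x, are nested, and stay inside B(c, r). *)
definition shrink_centre :: "'a::euclidean_space \<Rightarrow> 'a \<Rightarrow> nat \<Rightarrow> 'a" where
  "shrink_centre c x j = x + ((1/2) ^ j) *\<^sub>R (c - x)"

abbreviation shrink_ball :: "'a::euclidean_space \<Rightarrow> real \<Rightarrow> 'a \<Rightarrow> nat \<Rightarrow> 'a set" where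
  "shrink_ball c r x j \<equiv> ball (shrink_centre c x j) ((1/2) ^ j * r)"

lemma shrink_centre_0 [simp]: "shrink_centre c x 0 = c"
  by (simp add: shrink_centre_def)

lemma mem_shrink_ball: "x \<in> ball c r \<Longrightarrow> x \<in> shrink_ball c r x j"
  by (simp add: shrink_centre_def dist_norm)

lemma shrink_ball_Suc_subset:
  assumes x: "x \<in> ball c r"
  shows "shrink_ball c r x (Suc j) \<subseteq> shrink_ball c r x j"
proof -
  have "shrink_centre c x j - shrink_centre c x (Suc j) = ((1/2) ^ Suc j) *\<^sub>R (c - x)"
    by (simp add: shrink_centre_def scaleR_left_diff_distrib[symmetric])
  then have "dist (shrink_centre c x (Suc j)) (shrink_centre c x j) = (1/2) ^ Suc j * norm (c - x)"
    by (subst dist_commute) (simp add: dist_norm)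
  moreover have "(1/2) ^ Suc j * norm (c - x) \<le> (1/2) ^ Suc j * r"
    using x by (intro mult_left_mono) (auto simp: dist_norm)
  ultimately have "dist (shrink_centre c x (Suc j)) (shrink_centre c x j) \<le> (1/2) ^ Suc j * r" by (simp only:)
  then show ?thesis by (simp add: ball_subset_ball_iff)
qed

lemma shrink_ball_subset: "x \<in> ball c r \<Longrightarrow> shrink_ball c r x j \<subseteq> ball c r"
proof (induction j)
  case (Suc j)
  then show ?case using shrink_ball_Suc_subset[of x c r j] by blast
qed simp

lemma measurable_lebesgue_ident: "(\<lambda>x. x) \<in> borel_measurable lebesgue"
  by (simp add: measurable_completion)

lemma borel_measurable_mass_shrink_ball:
  assumes [measurable]: "W \<in> borel_measurable (lebesgue :: 'a::euclidean_space measure)"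
  shows "(\<lambda>x. mass W (shrink_ball c r x j)) \<in> borel_measurable lebesgue"
proof -
  interpret sigma_finite_measure "lebesgue :: 'a measure" by (rule sigma_finite_lebesgue)
  note measurable_lebesgue_ident [measurable]
  have "(\<lambda>x. \<integral>\<^sup>+y. (if dist (shrink_centre c x j) y < (1/2) ^ j * r then W y else 0) \<partial>lebesgue) \<in> borel_measurable lebesgue"
    unfolding shrink_centre_def dist_norm by measurable
  moreover have "mass W (shrink_ball c r x j) = (\<integral>\<^sup>+y. (if dist (shrink_centre c x j) y < (1/2) ^ j * r then W y else 0) \<partial>lebesgue)" for x
    unfolding mass_def by (intro nn_integral_cong) (auto simp: indicator_def)
  ultimately show ?thesis by simp
qed

(* A weak form of the Lebesgue differentiation theorem, straight from the Vitali covering theorem. *)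
lemma AE_ex_shrink_ball_avg_greater:
  fixes W :: "'a::euclidean_space \<Rightarrow> ennreal"
  assumes [measurable]: "W \<in> borel_measurable lebesgue" and r: "0 < r" and l: "0 \<le> l"
  shows "AE x in lebesgue. x \<in> ball c r \<longrightarrow> ennreal l < W x \<longrightarrow> (\<exists>j. ennreal l < avg W (shrink_ball c r x j))"
proof -
  note [measurable] = borel_measurable_mass_shrink_ball
  \<comment> \<open>The bad set for a fixed excess \<open>d\<close>: the weight is at least l + d,
    yet no ball of the shrinking family has average above \<open>l\<close>.\<close>
  define N where "N d = {x \<in> ball c r. ennreal (l + d) \<le> W x \<and> (\<forall>j. mass W (shrink_ball c r x j) \<le> ennreal l * emeasure lebesgue (shrink_ball c r x j))}" for d
  have vol: "emeasure lebesgue (shrink_ball c r x j) = ennreal (((1/2) ^ j) ^ DIM('a)) * emeasure lebesgue (ball c r)" for x j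
    using r by (intro emeasure_lebesgue_ball_scale) auto
  have Nm [measurable]: "N d \<in> sets lebesgue" for d
  proof -
    have "Measurable.pred lebesgue (\<lambda>x. x \<in> ball c r \<and> ennreal (l + d) \<le> W x \<and> (\<forall>j. mass W (shrink_ball c r x j) \<le> ennreal l * emeasure lebesgue (shrink_ball c r x j)))"
      unfolding vol by measurable
    then show ?thesis by (simp add: N_def pred_def)
  qed
  have null: "emeasure lebesgue (N d) = 0" if d: "0 < d" for d
  proof -
    have Nfin: "emeasure lebesgue (N d) < top"
      by (rule order_le_less_trans[OF emeasure_mono emeasure_lebesgue_ball_finite[of c r]]) (auto simp: N_def)
    \<comment> \<open>\<open>N d\<close> is covered up to a null set by disjoint shrinking balls
      inside an open set exceeding it in measure by less than \<open>e\<close>; each of them has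
      average at most \<open>l\<close>. For small \<open>e\<close> this is incompatible with W \<ge>
      l + d on a set of positive finite measure.\<close>
    have key: "ennreal (l + d) * emeasure lebesgue (N d) \<le> ennreal l * (emeasure lebesgue (N d) + ennreal e)"
      if e: "0 < e" for e
    proof -
      obtain O' where O': "open O'" "N d \<subseteq> O'" "O' - N d \<in> lmeasurable" "emeasure lebesgue (O' - N d) < ennreal e"
        by (rule sets_lebesgue_outer_open[OF Nm e])
      define K where "K = {(x, j). x \<in> N d \<and> shrink_ball c r x j \<subseteq> O'}"
      have cover: "\<exists>i. i \<in> K \<and> x \<in> ball (shrink_centre c (fst i) (snd i)) ((1/2) ^ (snd i) * r) \<and> (1/2) ^ (snd i) * r < s"
        if x: "x \<in> N d" and s: "0 < s" for x s
      proof -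
        obtain s' where s': "0 < s'" "ball x s' \<subseteq> O'" using O' x by (meson openE subsetD)
        define t where "t = min s (s' / 2)"
        have t: "0 < t" using s s' by (simp add: t_def)
        obtain j where j: "(1/2) ^ j < t / r"
          using real_arch_pow_inv[of "t / r" "1/2"] t r by auto
        then have jt: "(1/2) ^ j * r < t" using r by (simp add: pos_less_divide_eq)
        have xb: "x \<in> ball c r" using x by (simp add: N_def)
        have "shrink_ball c r x j \<subseteq> ball x s'"
        proof
          fix y assume y: "y \<in> shrink_ball c r x j"
          have "dist x y \<le> dist (shrink_centre c x j) x + dist (shrink_centre c x j) y"
            by (rule dist_triangle3)
          also have "\<dots> < (1/2) ^ j * r + (1/2) ^ j * r"
            using y mem_shrink_ball[OF xb, of j] by (intro add_strict_mono) auto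
          also have "\<dots> < s'"
          proof -
            have "(1/2) ^ j * r < s' / 2" using jt by (simp add: t_def)
            then show ?thesis by linarith
          qed
          finally show "y \<in> ball x s'" by simp
        qed
        then have "(x, j) \<in> K" using s' x by (auto simp: K_def)
        moreover have "(1/2) ^ j * r < s" using jt by (simp add: t_def)
        ultimately show ?thesis using mem_shrink_ball[OF xb, of j] by (intro exI[of _ "(x, j)"]) simp
      qed
      obtain C where C: "countable C" "C \<subseteq> K"
        and dis: "pairwise (\<lambda>i j. disjnt (shrink_ball c r (fst i) (snd i)) (shrink_ball c r (fst j) (snd j))) C"
        and neg: "negligible (N d - (\<Union>i\<in>C. shrink_ball c r (fst i) (snd i)))"
        by (rule Vitali_covering_theorem_balls[where S="N d" and K=K and a="\<lambda>i. shrink_centre c (fst i) (snd i)" and r="\<lambda>i. (1/2) ^ (snd i) * r", OF cover])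
      let ?U = "\<Union>i\<in>C. shrink_ball c r (fst i) (snd i)"
      have dis': "disjoint_family_on (\<lambda>i. shrink_ball c r (fst i) (snd i)) C"
        using dis by (auto simp: disjoint_family_on_def pairwise_def disjnt_def)
      have Um [measurable]: "?U \<in> sets lebesgue" by (intro open_imp_lebesgue) auto
      have "ennreal (l + d) * emeasure lebesgue (N d) = mass (\<lambda>_. ennreal (l + d)) (N d)" by (simp add: mass_const)
      also have "\<dots> \<le> mass W (N d)" by (rule mass_mono_weight) (auto simp: N_def)
      also have "\<dots> \<le> mass W ?U"
      proof -
        have "AE x in lebesgue. x \<notin> N d - ?U"
          using neg by (intro AE_not_in) (simp add: negligible_iff_null_sets)
        then show ?thesis
          unfolding mass_def by (intro nn_integral_mono_AE) (auto simp: indicator_def elim!: eventually_mono)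
      qed
      also have "\<dots> = (\<integral>\<^sup>+i. mass W (shrink_ball c r (fst i) (snd i)) \<partial>count_space C)"
        by (intro mass_UN_disjoint[symmetric] C dis') auto
      also have "\<dots> \<le> (\<integral>\<^sup>+i. mass (\<lambda>_. ennreal l) (shrink_ball c r (fst i) (snd i)) \<partial>count_space C)"
      proof (intro nn_integral_mono)
        fix i assume "i \<in> space (count_space C)"
        then have "fst i \<in> N d" using C(2) by (auto simp: K_def)
        then show "mass W (shrink_ball c r (fst i) (snd i)) \<le> mass (\<lambda>_. ennreal l) (shrink_ball c r (fst i) (snd i))"
          by (simp add: N_def mass_const)
      qed
      also have "\<dots> = mass (\<lambda>_. ennreal l) ?U"
        by (intro mass_UN_disjoint C dis') auto
      also have "\<dots> = ennreal l * emeasure lebesgue ?U" by (simp add: mass_const)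
      also have "\<dots> \<le> ennreal l * (emeasure lebesgue (N d) + ennreal e)"
      proof (intro mult_left_mono)
        have "?U \<subseteq> O'"
        proof (rule UN_least)
          fix i assume "i \<in> C"
          with C(2) have "i \<in> K" by blast
          then show "shrink_ball c r (fst i) (snd i) \<subseteq> O'" by (cases i) (simp add: K_def)
        qed
        then have "?U \<subseteq> N d \<union> (O' - N d)" by blast
        then have "emeasure lebesgue ?U \<le> emeasure lebesgue (N d \<union> (O' - N d))"
          using O' by (intro emeasure_mono) (auto simp: fmeasurableD)
        also have "\<dots> \<le> emeasure lebesgue (N d) + emeasure lebesgue (O' - N d)"
          using O' by (intro emeasure_subadditive) (auto simp: fmeasurableD)
        also have "\<dots> \<le> emeasure lebesgue (N d) + ennreal e"
          using O' by (intro add_left_mono) auto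
        finally show "emeasure lebesgue ?U \<le> emeasure lebesgue (N d) + ennreal e" .
      qed auto
      finally show ?thesis .
    qed
    obtain v where v: "0 \<le> v" "emeasure lebesgue (N d) = ennreal v"
      using Nfin by (cases "emeasure lebesgue (N d)") auto
    have "(l + d) * v \<le> l * v + \<epsilon>" if "0 < \<epsilon>" for \<epsilon>
    proof -
      have "ennreal ((l + d) * v) \<le> ennreal (l * (v + \<epsilon> / (l + 1)))"
        using key[of "\<epsilon> / (l + 1)"] that l v d by (simp add: v ennreal_mult ennreal_plus[symmetric] del: ennreal_plus)
      then have "(l + d) * v \<le> l * (v + \<epsilon> / (l + 1))"
        using that l v by (subst (asm) ennreal_le_iff) auto
      also have "\<dots> \<le> l * v + \<epsilon>" using that l by (simp add: field_simps)
      finally show ?thesis .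
    qed
    then have "(l + d) * v \<le> l * v" by (rule field_le_epsilon)
    then have "v \<le> 0" using d by (simp add: distrib_right mult_le_0_iff)
    then show ?thesis using v by simp
  qed
  have "AE x in lebesgue. \<forall>n. x \<notin> N (1 / real (Suc n))"
  proof (subst AE_all_countable, rule allI)
    fix n
    show "AE x in lebesgue. x \<notin> N (1 / real (Suc n))"
      using null[of "1 / real (Suc n)"] by (intro AE_not_in) (simp add: null_setsI)
  qed
  then show ?thesis
  proof eventually_elim
    fix x assume x: "\<forall>n. x \<notin> N (1 / real (Suc n))"
    show "x \<in> ball c r \<longrightarrow> ennreal l < W x \<longrightarrow> (\<exists>j. ennreal l < avg W (shrink_ball c r x j))"
    proof (intro impI, rule ccontr)
      assume xb: "x \<in> ball c r" and gt: "ennreal l < W x" and no: "\<nexists>j. ennreal l < avg W (shrink_ball c r x j)"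
      have "\<exists>n. ennreal (l + 1 / real (Suc n)) \<le> W x"
      proof (cases "W x = top")
        case False
        then obtain y where y: "0 \<le> y" "W x = ennreal y" by (cases "W x") auto
        then have "l < y" using gt l by (simp add: ennreal_less_iff)
        then obtain n where "1 / real (Suc n) < y - l"
          using reals_Archimedean[of "y - l"] by (auto simp: inverse_eq_divide)
        then show ?thesis using y by (intro exI[of _ n]) (auto intro: ennreal_leI)
      qed auto
      then obtain n where n: "ennreal (l + 1 / real (Suc n)) \<le> W x" by blast
      have "mass W (shrink_ball c r x j) \<le> ennreal l * emeasure lebesgue (shrink_ball c r x j)" for j
        using no r by (subst avg_le_iff[symmetric]) (auto simp: not_less)
      then have "x \<in> N (1 / real (Suc n))" using xb n by (simp add: N_def)
      with x show False by blast
    qed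
  qed
qed

text \<open>Let g = 2^(-p) / k and let E be the part of the ball where W \<le> g l. Then W(E) \<le>
  g W(B), and \<open>Ap_subset\<close> gives (|E| / |B|)^p \<le> k g = 2^(-p). So E fills at most
  half of the ball.\<close>

lemma Ap_large_superlevel:
  fixes W :: "'a::euclidean_space \<Rightarrow> ennreal"
  assumes W: "pos_weight W" "Ap p (ennreal k) W" and p: "1 < p" and k: "1 \<le> k" and r: "0 < r"
    and l: "0 \<le> l" "ennreal l \<le> avg W (ball c r)"
  shows "emeasure lebesgue (ball c r) \<le> 2 * emeasure lebesgue (ball c r \<inter> {x. ennreal (2 powr (- p) / k * l) < W x})"
proof -
  note [measurable] = pos_weight_measurable[OF W(1)]
  define g where "g = 2 powr (- p) / k"
  have g: "0 < g" using k by (simp add: g_def)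
  let ?B = "ball c r" and ?v = "emeasure lebesgue (ball c r)"
  let ?G = "?B \<inter> {x. ennreal (g * l) < W x}" and ?E = "?B \<inter> {x. W x \<le> ennreal (g * l)}"
  have Em [measurable]: "?E \<in> sets lebesgue" "?G \<in> sets lebesgue"
    by (auto intro!: sets.Int borel_measurable_le borel_measurable_less)
  have v: "0 < ?v" "?v < top" using r by (auto simp: zero_less_iff_neq_zero)
  have mB: "0 < mass W ?B" "mass W ?B < top" using mass_ball_pos[OF W(1) r] Ap_mass_finite[OF W _ _ r] p by auto
  have "mass W ?E \<le> mass (\<lambda>_. ennreal (g * l)) ?E" by (rule mass_mono_weight) auto
  also have "\<dots> = ennreal (g * l) * emeasure lebesgue ?E" by (simp add: mass_const)
  also have "\<dots> \<le> ennreal (g * l) * ?v" by (intro mult_left_mono emeasure_mono) auto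
  also have "\<dots> = ennreal g * (ennreal l * ?v)" using g l by (simp add: ennreal_mult mult.assoc)
  also have "\<dots> \<le> ennreal g * mass W ?B"
    unfolding avg_times_volume[OF r, symmetric] by (intro mult_left_mono mult_right_mono l(2)) auto
  finally have mE: "mass W ?E \<le> ennreal g * mass W ?B" .
  have "mass W ?B * epowr (emeasure lebesgue ?E) p \<le> ennreal k * epowr ?v p * mass W ?E"
    using Ap_subset[OF W p r, of ?E c] by (simp add: mult.commute)
  also have "\<dots> \<le> ennreal k * epowr ?v p * (ennreal g * mass W ?B)"
    by (intro mult_left_mono mE) auto
  also have "\<dots> = mass W ?B * ((ennreal k * ennreal g) * epowr ?v p)" by (simp only: mult_ac)
  finally have "epowr (emeasure lebesgue ?E) p \<le> (ennreal k * ennreal g) * epowr ?v p"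
    using mB by (simp add: ennreal_mult_le_mult_iff)
  also have "ennreal k * ennreal g = ennreal (2 powr (- p))" using k g by (simp add: ennreal_mult[symmetric] g_def)
  also have "\<dots> * epowr ?v p = epowr (ennreal (1/2) * ?v) p"
  proof -
    have "epowr (ennreal (1/2)) p = ennreal (2 powr (- p))"
    proof -
      have "(1/2) powr p = 2 powr (- p)"
        using powr_divide[of 1 2 p] powr_minus_divide[of 2 p] by simp
      then show ?thesis using epowr_ennreal[of "1/2" p] by (simp only: zero_less_divide_1_iff zero_less_numeral simp_thms)
    qed
    then show ?thesis using epowr_mult[of p "ennreal (1/2)" ?v] p by simp
  qed
  finally have "epowr (emeasure lebesgue ?E) p \<le> epowr (ennreal (1/2) * ?v) p" .
  then have E: "emeasure lebesgue ?E \<le> ennreal (1/2) * ?v"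
    by (rule epowr_le_iff[THEN iffD1, rotated]) (use p in simp)
  have "?B = ?E \<union> ?G" by auto
  then have "?v \<le> emeasure lebesgue ?E + emeasure lebesgue ?G"
    using emeasure_subadditive[OF Em] by simp
  also have "\<dots> \<le> ennreal (1/2) * ?v + emeasure lebesgue ?G" by (intro add_right_mono E)
  finally have *: "?v \<le> ennreal (1/2) * ?v + emeasure lebesgue ?G" .
  obtain V where V: "0 < V" "?v = ennreal V" using v by (cases ?v) auto
  have "emeasure lebesgue ?G \<le> ?v" by (intro emeasure_mono) auto
  then obtain G where G: "0 \<le> G" "emeasure lebesgue ?G = ennreal G" using V by (cases "emeasure lebesgue ?G") (auto simp: top_unique)
  have "ennreal V \<le> ennreal (1/2 * V + G)"
  proof -
    have "ennreal (1/2) * ennreal V = ennreal (1/2 * V)" using V by (intro ennreal_mult[symmetric]) auto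
    moreover have "ennreal (1/2 * V) + ennreal G = ennreal (1/2 * V + G)" using V G by (intro ennreal_plus[symmetric]) auto
    ultimately show ?thesis using * unfolding V(2) G(2) by simp
  qed
  then have "V \<le> 1/2 * V + G" using V G by (subst (asm) ennreal_le_iff) auto
  then have "V \<le> 2 * G" by simp
  then have "ennreal V \<le> ennreal (2 * G)" by (rule ennreal_leI)
  then show ?thesis using V G by (simp add: g_def ennreal_mult)
qed

text \<open>A Calderon-Zygmund stopping argument along the shrinking balls. On a stopping ball the
  average lies between \<open>l\<close> and 2^n l; doubling absorbs the factor 5 of the covering
  lemma, the upper bound turns mass into volume, and \<open>Ap_large_superlevel\<close> bounds this
  volume by twice that of the superlevel set at the lower level.\<close>

lemma good_lambda:
  fixes W :: "'a::euclidean_space \<Rightarrow> ennreal"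
  assumes W: "pos_weight W" "Ap p (ennreal k) W" and p: "1 < p" and k: "1 \<le> k" and r: "0 < r"
    and l: "0 \<le> l" "avg W (ball c r) \<le> ennreal l"
  shows "mass W (ball c r \<inter> {x. ennreal l < W x})
     \<le> ennreal (2 * k * 5 powr (real DIM('a) * p) * 2 ^ DIM('a) * l) * emeasure lebesgue (ball c r \<inter> {x. ennreal (2 powr (- p) / k * l) < W x})"
proof -
  note [measurable] = pos_weight_measurable[OF W(1)]
  let ?B = "ball c r"
  define D where "D = k * 5 powr (real DIM('a) * p)"
  define C where "C = 2 * D * 2 ^ DIM('a) * l"
  have D: "0 \<le> D" using k by (simp add: D_def)
  let ?G = "{x. ennreal (2 powr (- p) / k * l) < W x}"
  let ?V = "\<lambda>x. ennreal C * indicator ?G x"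
  have Gm [measurable]: "?G \<in> sets lebesgue"
  proof -
    have "{x \<in> space lebesgue. ennreal (2 powr (- p) / k * l) < W x} \<in> sets lebesgue" by measurable
    then show ?thesis unfolding space_completion space_lborel space_borel by (simp only: UNIV_I simp_thms)
  qed
  define K where "K = {(c', r'). 0 < r' \<and> r' \<le> r \<and> ball c' r' \<subseteq> ?B \<and> ennreal l < avg W (ball c' r')
      \<and> avg W (ball c' r') \<le> ennreal (2 ^ DIM('a) * l)}"
  let ?S = "{x \<in> ?B. ennreal l < W x}"
  let ?S' = "{x \<in> ?S. \<exists>j. ennreal l < avg W (shrink_ball c r x j)}"
  have "mass W ?S \<le> mass W ?S'"
    unfolding mass_def
    by (intro nn_integral_mono_AE)
      (use AE_ex_shrink_ball_avg_greater[OF pos_weight_measurable[OF W(1)] r l(1), of c] in \<open>auto simp: indicator_def elim!: eventually_mono\<close>)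
  also have "mass W ?S' \<le> mass ?V ?B"
  proof (rule Vitali_mass[where K=K and R=r])
    show "?S' \<subseteq> (\<Union>(c', r')\<in>K. ball c' r')"
    proof
      fix x assume x: "x \<in> ?S'"
      then have xb: "x \<in> ?B" by simp
      \<comment> \<open>The stopping index. It is not 0, because the average over the whole ball is
        at most \<open>l\<close>; so there is a predecessor of twice the radius whose average is at
        most \<open>l\<close>.\<close>
      define j where "j = (LEAST j. ennreal l < avg W (shrink_ball c r x j))"
      have j: "ennreal l < avg W (shrink_ball c r x j)"
        unfolding j_def by (rule LeastI_ex) (use x in blast)
      have "j \<noteq> 0" using j l(2) by (intro notI) (simp add: not_less[symmetric])
      then obtain i where i: "j = Suc i" by (cases j) auto
      have "i < j" by (simp add: i)
      then have "\<not> ennreal l < avg W (shrink_ball c r x i)"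
        unfolding j_def by (rule not_less_Least)
      then have le: "avg W (shrink_ball c r x i) \<le> ennreal l" by simp
      have ri: "(1/2) ^ i * r = 2 * ((1/2) ^ j * r)" by (simp add: i)
      have "avg W (shrink_ball c r x j) \<le> ennreal (2 ^ DIM('a)) * avg W (ball (shrink_centre c x i) (2 * ((1/2) ^ j * r)))"
        by (rule avg_subball_le) (use shrink_ball_Suc_subset[OF xb, of i] r in \<open>auto simp: i\<close>)
      also have "\<dots> \<le> ennreal (2 ^ DIM('a)) * ennreal l"
        using le unfolding ri by (rule mult_left_mono) simp
      also have "\<dots> = ennreal (2 ^ DIM('a) * l)" using l by (simp add: ennreal_mult)
      finally have "avg W (shrink_ball c r x j) \<le> ennreal (2 ^ DIM('a) * l)" .
      moreover have "(1/2) ^ j * r \<le> 1 * r" using r by (intro mult_right_mono power_le_one) auto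
      ultimately have "(shrink_centre c x j, (1/2) ^ j * r) \<in> K"
        using j shrink_ball_subset[OF xb, of j] r by (simp add: K_def)
      then show "x \<in> (\<Union>(c', r')\<in>K. ball c' r')"
        using mem_shrink_ball[OF xb, of j] by blast
    qed
    fix c' r' assume "(c', r') \<in> K"
    then have K: "0 < r'" "r' \<le> r" "ball c' r' \<subseteq> ?B" "ennreal l < avg W (ball c' r')"
       "avg W (ball c' r') \<le> ennreal (2 ^ DIM('a) * l)" by (auto simp: K_def)
    have "mass W (ball c' (5 * r')) \<le> ennreal D * mass W (ball c' r')"
      using Ap_doubling[OF W(1,2) p] K(1) k by (auto simp: doubling_def D_def ennreal_mult)
    also have "\<dots> \<le> ennreal D * (ennreal (2 ^ DIM('a) * l) * emeasure lebesgue (ball c' r'))"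
      using K by (intro mult_left_mono) (auto simp: avg_le_iff)
    also have "\<dots> \<le> ennreal D * (ennreal (2 ^ DIM('a) * l) * (2 * emeasure lebesgue (ball c' r' \<inter> ?G)))"
      using K l by (intro mult_left_mono Ap_large_superlevel[OF W p k]) auto
    also have "\<dots> = (ennreal D * ennreal (2 ^ DIM('a) * l) * 2) * emeasure lebesgue (ball c' r' \<inter> ?G)" by (simp only: mult_ac)
    also have "ennreal D * ennreal (2 ^ DIM('a) * l) * 2 = ennreal D * ennreal (2 ^ DIM('a) * l) * ennreal 2" by simp
    also have "\<dots> = ennreal C"
      using D l by (simp add: C_def ennreal_mult[symmetric] mult_ac del: ennreal_numeral)
    also have "ennreal C * emeasure lebesgue (ball c' r' \<inter> ?G) = mass ?V (ball c' r')"
      unfolding mass_indicator by (rule mass_const[symmetric]) (rule sets.Int[OF sets_lebesgue_ball Gm])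
    finally show "0 < r' \<and> r' \<le> r \<and> ball c' r' \<subseteq> ?B \<and> mass W (ball c' (5 * r')) \<le> mass ?V (ball c' r')"
      using K by simp
  qed measurable
  also have "mass ?V ?B = ennreal C * emeasure lebesgue (?B \<inter> ?G)"
    unfolding mass_indicator by (rule mass_const) (rule sets.Int[OF sets_lebesgue_ball Gm])
  also have "?S = ?B \<inter> {x. ennreal l < W x}" by auto
  finally show ?thesis by (simp add: C_def D_def mult.assoc)
qed

section \<open>The reverse Hoelder inequality\<close>

text \<open>The estimate of \<open>good_lambda\<close> is integrated against \<delta>
  s^(\<delta>-1). Levels below the average \<open>a\<close> contribute a^\<delta> W(B), those above
  it a multiple of the left side with a factor of order \<delta>, which is absorbed once it is at
  most 1/2.\<close>

lemma reverse_Holder: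
  assumes p: "1 < p" and k: "1 \<le> k"
  obtains \<delta> where "0 < \<delta>"
    "\<And>(W :: 'a::euclidean_space \<Rightarrow> ennreal) c r. pos_weight W \<Longrightarrow> Ap p (ennreal k) W \<Longrightarrow> 0 < r \<Longrightarrow>
       avg (\<lambda>x. epowr (W x) (1 + \<delta>)) (ball c r) \<le> 2 * epowr (avg W (ball c r)) (1 + \<delta>)"
proof -
  define C1 where "C1 = 2 * k * 5 powr (real DIM('a) * p) * 2 ^ DIM('a)"
  define g where "g = 2 powr (- p) / k"
  \<comment> \<open>Chosen for \<open>small\<close>: g \<le> 1 and 1 + \<delta> \<le> 2 give (1 /
    g)^(1 + \<delta>) \<le> 1 / g^2, which a factor of at most g^2 / 2 brings down to 1/2.\<close>
  define \<delta> where "\<delta> = min 1 (g\<^sup>2 / (2 * C1))"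
  have C1: "0 < C1" using k by (simp add: C1_def)
  have g: "0 < g" using k by (simp add: g_def)
  have g1: "g \<le> 1"
  proof -
    have "2 powr (- p) \<le> (2::real) powr 0" using p by (intro powr_mono) auto
    then show ?thesis using k by (simp add: g_def)
  qed
  have \<delta>: "0 < \<delta>" "\<delta> \<le> 1" "\<delta> \<le> g\<^sup>2 / (2 * C1)" using g C1 by (auto simp: \<delta>_def)
  have small: "C1 * \<delta> / (1 + \<delta>) * (1 / g) powr (1 + \<delta>) \<le> 1 / 2"
  proof -
    have "(1 / g) powr (1 + \<delta>) \<le> (1 / g) powr 2" using g g1 \<delta> by (intro powr_mono) auto
    also have "\<dots> = 1 / g\<^sup>2" using g by (simp add: power_divide)
    finally have 1: "(1 / g) powr (1 + \<delta>) \<le> 1 / g\<^sup>2" .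
    have "C1 * \<delta> / (1 + \<delta>) \<le> C1 * \<delta> / 1" using C1 \<delta> by (intro divide_left_mono) auto
    also have "\<dots> \<le> C1 * (g\<^sup>2 / (2 * C1))" using C1 \<delta> by (simp del: times_divide_eq_right)
    also have "\<dots> = g\<^sup>2 / 2" using C1 by simp
    finally have 2: "C1 * \<delta> / (1 + \<delta>) \<le> g\<^sup>2 / 2" .
    have "C1 * \<delta> / (1 + \<delta>) * (1 / g) powr (1 + \<delta>) \<le> g\<^sup>2 / 2 * (1 / g\<^sup>2)"
      using 1 2 C1 \<delta> by (intro mult_mono) auto
    also have "\<dots> = 1 / 2" using g by simp
    finally show ?thesis .
  qed
  show ?thesis
  proof (rule that[OF \<delta>(1)])
    fix W :: "'a \<Rightarrow> ennreal" and c :: 'a and r :: real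
    assume W: "pos_weight W" "Ap p (ennreal k) W" and r: "0 < r"
    note [measurable] = pos_weight_measurable[OF W(1)]
    let ?B = "ball c r" and ?m = "mass W (ball c r)"
    have Afin: "0 < avg W ?B" "avg W ?B < top"
      using avg_pos[OF W(1) r] avg_finite[OF W _ _ r] p by auto
    then obtain a where a: "0 < a" "avg W ?B = ennreal a" by (cases "avg W ?B") auto
    have mfin: "?m < top" by (rule Ap_mass_finite[OF W _ _ r]) (use p in auto)
    \<comment> \<open>Only the power \<delta> of the weight is truncated, at height
      \<open>N\<close>. This makes \<open>?I\<close> finite, so that half of it can be subtracted;
      monotone convergence removes the truncation.\<close>
    have bound: "(\<integral>\<^sup>+x. epowr (min (W x) (ennreal N)) \<delta> * (W x * indicator ?B x) \<partial>lebesgue) \<le> ennreal (2 * a powr \<delta>) * ?m"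
      (is "?I \<le> _") if N: "0 \<le> N" for N
    proof -
      define h where "h x = min (W x) (ennreal N)" for x
      have [measurable]: "h \<in> borel_measurable lebesgue" unfolding h_def by measurable
      define kB :: "'a \<Rightarrow> ennreal" where "kB = indicator ?B"
      have [measurable]: "kB \<in> borel_measurable lebesgue" unfolding kB_def by (rule borel_measurable_indicator) simp
      let ?A = "\<lambda>s. (if 0 < s \<and> ennreal s < ennreal a then ennreal (\<delta> * s powr (\<delta> - 1)) else 0) * ?m"
      let ?c = "C1 * \<delta> / (1 + \<delta>)"
      let ?D = "\<lambda>s. if 0 < s then ennreal ((1 + \<delta>) * s powr (1 + \<delta> - 1)) * (\<integral>\<^sup>+x. kB x * indicator {x. ennreal s < ennreal (1 / g) * h x} x \<partial>lebesgue) else 0"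
      have meas: "(\<lambda>s. ?D s) \<in> borel_measurable lborel"
      proof -
        interpret sigma_finite_measure "lebesgue :: 'a measure" by (rule sigma_finite_lebesgue)
        show ?thesis by measurable
      qed
      have "?I = (\<integral>\<^sup>+s. (if 0 < s then ennreal (\<delta> * s powr (\<delta> - 1)) *
          (\<integral>\<^sup>+x. W x * indicator ?B x * indicator {x. ennreal s < h x} x \<partial>lebesgue) else 0) \<partial>lborel)"
        unfolding h_def[symmetric] by (rule layer_cake[OF sigma_finite_lebesgue \<delta>(1)]) measurable
      also have "\<dots> \<le> (\<integral>\<^sup>+s. ?A s + ennreal ?c * ?D s \<partial>lborel)"
      proof (intro nn_integral_mono)
        fix s :: real
        let ?J = "\<integral>\<^sup>+x. W x * indicator ?B x * indicator {x. ennreal s < h x} x \<partial>lebesgue"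
        show "(if 0 < s then ennreal (\<delta> * s powr (\<delta> - 1)) * ?J else 0) \<le> ?A s + ennreal ?c * ?D s"
        proof (cases "0 < s")
          case s: True
          show ?thesis
          proof (cases "s < a")
            case True
            have "?J \<le> ?m" unfolding mass_def by (intro nn_integral_mono) (auto simp: indicator_def)
            then have "ennreal (\<delta> * s powr (\<delta> - 1)) * ?J \<le> ennreal (\<delta> * s powr (\<delta> - 1)) * ?m"
              by (rule mult_left_mono) simp
            then show ?thesis using s True a by (simp add: ennreal_less_iff add_increasing2)
          next
            case False
            let ?V = "\<integral>\<^sup>+x. kB x * indicator {x. ennreal s < ennreal (1 / g) * h x} x \<partial>lebesgue"
            have J: "?J \<le> ennreal (C1 * s) * ?V"
            proof (cases "s < N")
              case False
              then have "\<not> ennreal s < h x" for x using N by (auto simp: h_def not_less intro: min.coboundedI2 ennreal_leI)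
              then show ?thesis by simp
            next
              case sN: True
              have "?J \<le> mass W (?B \<inter> {x. ennreal s < W x})"
                unfolding mass_def h_def by (intro nn_integral_mono) (auto simp: indicator_def)
              also have "\<dots> \<le> ennreal (2 * k * 5 powr (real DIM('a) * p) * 2 ^ DIM('a) * s) * emeasure lebesgue (?B \<inter> {x. ennreal (2 powr (- p) / k * s) < W x})"
                by (rule good_lambda[OF W p k r]) (use s False a in \<open>auto intro: ennreal_leI\<close>)
              also have "\<dots> = ennreal (C1 * s) * emeasure lebesgue (?B \<inter> {x. ennreal (g * s) < W x})"
                by (simp add: C1_def g_def)
              \<comment> \<open>The truncation does no harm: s < N and g \<le> 1 give g s < N, so W
                > g s implies the same for the truncated weight.\<close>
              also have "emeasure lebesgue (?B \<inter> {x. ennreal (g * s) < W x}) \<le> ?V"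
              proof -
                have G: "{x. ennreal (g * s) < W x} \<in> sets lebesgue"
                proof -
                  have "{x \<in> space lebesgue. ennreal (g * s) < W x} \<in> sets lebesgue" by measurable
                  then show ?thesis unfolding space_completion space_lborel space_borel by (simp only: UNIV_I simp_thms)
                qed
                have "emeasure lebesgue (?B \<inter> {x. ennreal (g * s) < W x}) = (\<integral>\<^sup>+x. indicator (?B \<inter> {x. ennreal (g * s) < W x}) x \<partial>lebesgue)"
                  by (rule nn_integral_indicator[symmetric]) (rule sets.Int[OF sets_lebesgue_ball G])
                also have "\<dots> \<le> ?V"
                proof (intro nn_integral_mono)
                  fix x
                  show "indicator (?B \<inter> {x. ennreal (g * s) < W x}) x \<le> kB x * indicator {x. ennreal s < ennreal (1 / g) * h x} x"
                  proof (cases "x \<in> ?B \<and> ennreal (g * s) < W x")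
                    case True
                    obtain y where y: "0 < y" "W x = ennreal y"
                      using pos_weight_ne[OF W(1), of x] by (cases "W x" rule: ennreal_three_cases) auto
                    have hx: "h x = ennreal (min y N)" using y N by (auto simp: h_def min_def ennreal_le_iff)
                    have "g * s \<le> s" by (rule mult_left_le_one_le) (use g1 g s in auto)
                    then have "g * s < N" using sN by (rule order_le_less_trans)
                    moreover have "g * s < y" using True y s g by (auto simp: ennreal_less_iff)
                    ultimately have "g * s < min y N" by simp
                    then have "s < 1 / g * min y N" using g by (simp add: field_simps)
                    then have "ennreal s < ennreal (1 / g) * h x"
                      unfolding hx using s g y N by (subst ennreal_mult[symmetric]) (auto simp: ennreal_less_iff)
                    then show ?thesis using True by (simp add: kB_def)
                  qed (auto simp: indicator_def)
                qed
                finally show ?thesis .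
              qed
              finally show ?thesis by (simp add: mult_left_mono)
            qed
            have "ennreal (\<delta> * s powr (\<delta> - 1)) * ?J \<le> ennreal (\<delta> * s powr (\<delta> - 1)) * (ennreal (C1 * s) * ?V)"
              by (intro mult_left_mono J) auto
            also have "\<dots> = (ennreal (\<delta> * s powr (\<delta> - 1)) * ennreal (C1 * s)) * ?V" by (simp only: mult.assoc)
            also have "ennreal (\<delta> * s powr (\<delta> - 1)) * ennreal (C1 * s) = ennreal ?c * ennreal ((1 + \<delta>) * s powr (1 + \<delta> - 1))"
            proof -
              have "s powr \<delta> = s powr (\<delta> - 1) * s" using powr_add[of s "\<delta> - 1" 1] s by simp
              then have eq: "\<delta> * s powr (\<delta> - 1) * (C1 * s) = ?c * ((1 + \<delta>) * s powr (1 + \<delta> - 1))"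
                using \<delta> by simp
              have "ennreal (\<delta> * s powr (\<delta> - 1)) * ennreal (C1 * s) = ennreal (\<delta> * s powr (\<delta> - 1) * (C1 * s))"
                using \<delta> C1 s by (intro ennreal_mult[symmetric]) auto
              also have "\<dots> = ennreal ?c * ennreal ((1 + \<delta>) * s powr (1 + \<delta> - 1))"
                unfolding eq using \<delta> C1 s by (intro ennreal_mult) auto
              finally show ?thesis .
            qed
            finally show ?thesis using s False a by (simp add: ennreal_less_iff mult.assoc)
          qed
        qed auto
      qed
      also have "\<dots> = (\<integral>\<^sup>+s. ?A s \<partial>lborel) + (\<integral>\<^sup>+s. ennreal ?c * ?D s \<partial>lborel)"
      proof (rule nn_integral_add)
        show "?A \<in> borel_measurable lborel" by measurable
        show "(\<lambda>s. ennreal ?c * ?D s) \<in> borel_measurable lborel"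
          by (rule borel_measurable_times_ennreal[OF _ meas]) (rule borel_measurable_const)
      qed
      also have "(\<integral>\<^sup>+s. ?A s \<partial>lborel) = epowr (ennreal a) \<delta> * ?m"
        unfolding epowr_eq_nn_integral[OF \<delta>(1)] by (intro nn_integral_multc) measurable
      also have "(\<integral>\<^sup>+s. ennreal ?c * ?D s \<partial>lborel) = ennreal ?c * (\<integral>\<^sup>+s. ?D s \<partial>lborel)"
        by (rule nn_integral_cmult[OF meas])
      also have "(\<integral>\<^sup>+s. ?D s \<partial>lborel) = (\<integral>\<^sup>+x. epowr (ennreal (1 / g) * h x) (1 + \<delta>) * kB x \<partial>lebesgue)"
        using \<delta> by (intro layer_cake[symmetric] sigma_finite_lebesgue) measurable
      also have "\<dots> \<le> (\<integral>\<^sup>+x. ennreal ((1 / g) powr (1 + \<delta>)) * (epowr (h x) \<delta> * (W x * indicator ?B x)) \<partial>lebesgue)"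
      proof (intro nn_integral_mono)
        fix x
        have "epowr (ennreal (1 / g) * h x) (1 + \<delta>) = ennreal ((1 / g) powr (1 + \<delta>)) * epowr (h x) (1 + \<delta>)"
          using \<delta> g epowr_ennreal[of "1 / g" "1 + \<delta>"] by (simp only: epowr_mult) simp
        also have "epowr (h x) (1 + \<delta>) = epowr (h x) \<delta> * h x"
          using epowr_add'[of \<delta> 1 "h x"] \<delta> by (simp add: add.commute)
        also have "ennreal ((1 / g) powr (1 + \<delta>)) * (epowr (h x) \<delta> * h x) \<le> ennreal ((1 / g) powr (1 + \<delta>)) * (epowr (h x) \<delta> * W x)"
          by (intro mult_left_mono) (auto simp: h_def)
        finally have "epowr (ennreal (1 / g) * h x) (1 + \<delta>) \<le> ennreal ((1 / g) powr (1 + \<delta>)) * (epowr (h x) \<delta> * W x)" .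
        then show "epowr (ennreal (1 / g) * h x) (1 + \<delta>) * kB x \<le> ennreal ((1 / g) powr (1 + \<delta>)) * (epowr (h x) \<delta> * (W x * indicator ?B x))"
          unfolding kB_def
          by (auto simp: indicator_def)
      qed
      also have "\<dots> = ennreal ((1 / g) powr (1 + \<delta>)) * ?I"
        unfolding h_def by (rule nn_integral_cmult) measurable
      also have "ennreal ?c * (ennreal ((1 / g) powr (1 + \<delta>)) * ?I) = (ennreal ?c * ennreal ((1 / g) powr (1 + \<delta>))) * ?I"
        by (simp only: mult.assoc)
      also have "ennreal ?c * ennreal ((1 / g) powr (1 + \<delta>)) = ennreal (?c * (1 / g) powr (1 + \<delta>))"
        using C1 \<delta> by (intro ennreal_mult[symmetric]) auto
      finally have "?I \<le> epowr (ennreal a) \<delta> * ?m + ennreal (?c * (1 / g) powr (1 + \<delta>)) * ?I"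
        by (simp add: add_left_mono mult_left_mono)
      also have "\<dots> \<le> epowr (ennreal a) \<delta> * ?m + ennreal (1/2) * ?I"
        using small by (intro add_left_mono mult_right_mono ennreal_leI) auto
      finally have I: "?I \<le> epowr (ennreal a) \<delta> * ?m + ennreal (1/2) * ?I" .
      have "?I \<le> (\<integral>\<^sup>+x. epowr (ennreal N) \<delta> * (W x * indicator ?B x) \<partial>lebesgue)"
        using \<delta> by (intro nn_integral_mono mult_right_mono epowr_mono) auto
      also have "\<dots> = epowr (ennreal N) \<delta> * ?m"
        unfolding mass_def by (rule nn_integral_cmult) measurable
      also have "\<dots> < top" using mfin \<delta> by (auto simp: ennreal_mult_less_top intro: epowr_less_top')
      finally obtain i where i: "0 \<le> i" "?I = ennreal i" by (cases ?I) auto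
      obtain b where b: "0 \<le> b" "?m = ennreal b" using mfin by (cases ?m) auto
      have "ennreal i \<le> ennreal (a powr \<delta> * b + 1/2 * i)"
      proof -
        have "epowr (ennreal a) \<delta> * ?m = ennreal (a powr \<delta> * b)" using a b by (simp add: epowr_ennreal ennreal_mult)
        moreover have "ennreal (1/2) * ?I = ennreal (1/2 * i)" unfolding i(2) using i by (intro ennreal_mult[symmetric]) auto
        moreover have "ennreal (a powr \<delta> * b) + ennreal (1/2 * i) = ennreal (a powr \<delta> * b + 1/2 * i)"
          using i b by (intro ennreal_plus[symmetric]) auto
        ultimately show ?thesis using I i by simp
      qed
      then have "i \<le> a powr \<delta> * b + 1/2 * i" using i b by (subst (asm) ennreal_le_iff) auto
      then have "i \<le> 2 * a powr \<delta> * b" by simp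
      then have "ennreal i \<le> ennreal (2 * a powr \<delta> * b)" by (rule ennreal_leI)
      then show ?thesis using i b by (simp add: ennreal_mult)
    qed
    have "mass (\<lambda>x. epowr (W x) (1 + \<delta>)) ?B = (\<integral>\<^sup>+x. (SUP n. epowr (min (W x) (ennreal (real n))) \<delta> * (W x * indicator ?B x)) \<partial>lebesgue)"
      unfolding mass_def
    proof (intro nn_integral_cong)
      fix x
      obtain y where y: "0 < y" "W x = ennreal y"
        using pos_weight_ne[OF W(1), of x] by (cases "W x" rule: ennreal_three_cases) auto
      obtain n0 :: nat where n0: "y \<le> real n0" using real_arch_simple by blast
      have "epowr (W x) (1 + \<delta>) = epowr (W x) \<delta> * W x"
        using epowr_add'[of \<delta> 1 "W x"] \<delta> by (simp add: add.commute)
      moreover have "(SUP n. epowr (min (W x) (ennreal (real n))) \<delta> * (W x * indicator ?B x)) = epowr (W x) \<delta> * (W x * indicator ?B x)"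
      proof (rule antisym)
        show "(SUP n. epowr (min (W x) (ennreal (real n))) \<delta> * (W x * indicator ?B x)) \<le> epowr (W x) \<delta> * (W x * indicator ?B x)"
          using \<delta> by (intro SUP_least mult_right_mono epowr_mono) auto
        have "min (W x) (ennreal (real n0)) = W x" using y n0 by (simp add: min_def ennreal_leI)
        then show "epowr (W x) \<delta> * (W x * indicator ?B x) \<le> (SUP n. epowr (min (W x) (ennreal (real n))) \<delta> * (W x * indicator ?B x))"
          by (intro SUP_upper2[of n0]) auto
      qed
      ultimately show "epowr (W x) (1 + \<delta>) * indicator ?B x = (SUP n. epowr (min (W x) (ennreal (real n))) \<delta> * (W x * indicator ?B x))"
        by (simp add: mult.assoc)
    qed
    also have "\<dots> = (SUP n. \<integral>\<^sup>+x. epowr (min (W x) (ennreal (real n))) \<delta> * (W x * indicator ?B x) \<partial>lebesgue)"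
    proof (rule nn_integral_monotone_convergence_SUP)
      show "incseq (\<lambda>n x. epowr (min (W x) (ennreal (real n))) \<delta> * (W x * indicator ?B x))"
        using \<delta> by (intro monoI le_funI mult_right_mono epowr_mono min.mono ennreal_leI) auto
    qed measurable
    also have "\<dots> \<le> ennreal (2 * a powr \<delta>) * ?m"
      by (intro SUP_least bound) simp
    also have "\<dots> = (2 * epowr (ennreal a) (1 + \<delta>)) * emeasure lebesgue ?B"
    proof -
      have "ennreal (2 * a powr \<delta>) * ennreal a = 2 * epowr (ennreal a) (1 + \<delta>)"
        using a by (simp add: epowr_ennreal powr_add ennreal_mult mult_ac)
      then show ?thesis using a r by (simp only: avg_times_volume[OF r, symmetric]) (simp add: mult.assoc[symmetric])
    qed
    finally show "avg (\<lambda>x. epowr (W x) (1 + \<delta>)) ?B \<le> 2 * epowr (avg W ?B) (1 + \<delta>)"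
      using r a by (simp add: avg_le_iff)
  qed
qed

section \<open>Growth of the measure of balls\<close>

lemma AE_powr_pos_version:
  assumes "is_weight w" shows "AE x in lebesgue. ennreal (w x powr s) = epowr (pos_version w x) s"
proof -
  have "AE x in lebesgue. 0 < w x" using assms by (simp add: is_weight_def)
  then show ?thesis by eventually_elim (simp add: pos_version_def epowr_ennreal)
qed

text \<open>Ensures that the supremum defining \<open>sigma_exp w\<close> is taken over a nonempty
  set and exceeds 1.\<close>

lemma ex_RH_class:
  assumes w: "w \<in> Ap_class p" and p: "1 < p"
  shows "\<exists>\<sigma>>1. w \<in> RH_class \<sigma>"
proof -
  let ?W = "pos_version w"
  have iw: "is_weight w" using w by (simp add: Ap_class_def)
  have W: "pos_weight ?W" "Ap p (Ap_const p w) ?W" "Ap_const p w < top"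
    using Ap_class_pos_version[OF w] p by auto
  define k where "k = max 1 (enn2real (Ap_const p w))"
  have k: "1 \<le> k" "Ap_const p w \<le> ennreal k" using W(3) by (cases "Ap_const p w", auto simp: k_def intro: ennreal_leI)+
  obtain \<delta> where \<delta>: "0 < \<delta>" "\<And>(W :: real ^ 'a \<Rightarrow> ennreal) c r. pos_weight W \<Longrightarrow> Ap p (ennreal k) W \<Longrightarrow> 0 < r \<Longrightarrow>
       avg (\<lambda>x. epowr (W x) (1 + \<delta>)) (ball c r) \<le> 2 * epowr (avg W (ball c r)) (1 + \<delta>)"
    by (rule reverse_Holder[OF p k(1)]) blast
  have "w \<in> RH_class (1 + \<delta>)"
    unfolding RH_class_def
  proof (intro CollectI conjI iw exI[of _ "2 powr (1 / (1 + \<delta>))"] allI impI)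
    fix x :: "real ^ 'a" and r :: real assume r: "0 < r"
    have 1: "wavg (\<lambda>y. w y powr (1 + \<delta>)) (ball x r) = avg (\<lambda>y. epowr (?W y) (1 + \<delta>)) (ball x r)"
      unfolding wavg_eq_avg by (rule avg_cong_AE[OF AE_powr_pos_version[OF iw]])
    have 2: "wavg w (ball x r) = avg ?W (ball x r)"
      unfolding wavg_eq_avg by (rule avg_cong_AE[OF AE_pos_version[OF iw]])
    have "epowr (wavg (\<lambda>y. w y powr (1 + \<delta>)) (ball x r)) (1 / (1 + \<delta>)) \<le> epowr (2 * epowr (avg ?W (ball x r)) (1 + \<delta>)) (1 / (1 + \<delta>))"
      unfolding 1 using \<delta> by (intro epowr_mono \<delta>(2) W(1) Ap_mono[OF W(2) k(2)] r) auto
    also have "\<dots> = epowr (ennreal 2) (1 / (1 + \<delta>)) * avg ?W (ball x r)"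
      using \<delta> by (simp add: epowr_mult epowr_cancel)
    also have "epowr (ennreal 2) (1 / (1 + \<delta>)) = ennreal (2 powr (1 / (1 + \<delta>)))" by (rule epowr_ennreal) simp
    finally show "epowr (wavg (\<lambda>y. w y powr (1 + \<delta>)) (ball x r)) (1 / (1 + \<delta>)) \<le> ennreal (2 powr (1 / (1 + \<delta>))) * wavg w (ball x r)"
      unfolding 2 .
  qed
  then show ?thesis using \<delta>(1) by (intro exI[of _ "1 + \<delta>"]) simp
qed

text \<open>The exponent is counted in units of the dimension, so that b = 1 - 1 / s is the
  reciprocal of the conjugate exponent in \<open>RH_class_ball_growth\<close>.\<close>

definition ball_growth :: "real \<Rightarrow> real \<Rightarrow> ('a::euclidean_space \<Rightarrow> ennreal) \<Rightarrow> bool" where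
  "ball_growth b C W \<longleftrightarrow> (\<forall>x \<rho> R. 0 < \<rho> \<longrightarrow> \<rho> \<le> R \<longrightarrow>
     mass W (ball x \<rho>) \<le> ennreal (C * (\<rho> / R) powr (real DIM('a) * b)) * mass W (ball x R))"

text \<open>Hoelder with exponents s and s' on the small ball bounds its mass by a power of its
  volume times the integral of w^s. The latter is enlarged to the big ball, where the reverse
  Hoelder inequality returns to the average of \<open>w\<close>.\<close>

lemma RH_class_ball_growth:
  fixes w :: "real ^ 'n \<Rightarrow> real"
  assumes w: "w \<in> RH_class s" and s: "1 < s"
  shows "\<exists>C\<ge>1. ball_growth (1 - 1 / s) C (pos_version w)"
proof -
  let ?W = "pos_version w"
  have iw: "is_weight w" using w by (simp add: RH_class_def)
  note [measurable] = pos_weight_measurable[OF pos_weight_pos_version[OF iw]]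
  obtain C0 where C0: "\<And>x r. 0 < r \<Longrightarrow> epowr (wavg (\<lambda>y. w y powr s) (ball x r)) (1 / s) \<le> ennreal C0 * wavg w (ball x r)"
    using w by (auto simp: RH_class_def)
  define C where "C = max 1 C0"
  have "mass ?W (ball x \<rho>) \<le> ennreal (C * (\<rho> / R) powr (real DIM(real ^ 'n) * (1 - 1 / s))) * mass ?W (ball x R)"
    if \<rho>: "0 < \<rho>" "\<rho> \<le> R" for x \<rho> R
  proof -
    have R: "0 < R" using \<rho> by simp
    let ?\<theta> = "1 / s" and ?v = "emeasure lebesgue (ball x \<rho>)" and ?V = "emeasure lebesgue (ball x R)"
    let ?Ws = "\<lambda>y. epowr (?W y) s"
    have 1: "wavg (\<lambda>y. w y powr s) (ball x R) = avg ?Ws (ball x R)"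
      unfolding wavg_eq_avg by (rule avg_cong_AE[OF AE_powr_pos_version[OF iw]])
    have 2: "wavg w (ball x R) = avg ?W (ball x R)"
      unfolding wavg_eq_avg by (rule avg_cong_AE[OF AE_pos_version[OF iw]])
    have rh: "epowr (avg ?Ws (ball x R)) (1 / s) \<le> ennreal C * avg ?W (ball x R)"
      using C0[OF R, of x] unfolding 1 2 by (rule order_trans) (intro mult_right_mono ennreal_leI, auto simp: C_def)
    have "mass ?W (ball x \<rho>) = (\<integral>\<^sup>+y. epowr (?Ws y * indicator (ball x \<rho>) y) ?\<theta> * epowr (indicator (ball x \<rho>) y) (1 - ?\<theta>) \<partial>lebesgue)"
      unfolding mass_def using s by (intro nn_integral_cong) (auto simp: indicator_def epowr_epowr epowr_zero_left)
    also have "\<dots> \<le> epowr (mass ?Ws (ball x \<rho>)) ?\<theta> * epowr (\<integral>\<^sup>+y. indicator (ball x \<rho>) y \<partial>lebesgue) (1 - ?\<theta>)"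
      unfolding mass_def using s by (intro nn_integral_Holder) auto
    also have "(\<integral>\<^sup>+y. indicator (ball x \<rho>) y \<partial>lebesgue) = ?v" by simp
    also have "epowr (mass ?Ws (ball x \<rho>)) ?\<theta> * epowr ?v (1 - ?\<theta>) \<le> epowr (mass ?Ws (ball x R)) ?\<theta> * epowr ?v (1 - ?\<theta>)"
      using s \<rho> by (intro mult_right_mono epowr_mono mass_mono) auto
    also have "\<dots> = epowr (?V * avg ?Ws (ball x R)) ?\<theta> * epowr ?v (1 - ?\<theta>)"
      by (simp only: mass_eq_avg[OF R])
    also have "\<dots> = epowr ?V ?\<theta> * epowr (avg ?Ws (ball x R)) ?\<theta> * epowr ?v (1 - ?\<theta>)"
      using s by (simp add: epowr_mult)
    also have "\<dots> \<le> epowr ?V ?\<theta> * (ennreal C * avg ?W (ball x R)) * epowr ?v (1 - ?\<theta>)"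
      by (intro mult_right_mono mult_left_mono rh) auto
    also have "?v = ennreal ((\<rho> / R) ^ DIM(real ^ 'n)) * ?V"
      using emeasure_lebesgue_ball_scale[of R "\<rho> / R" x x] \<rho> by simp
    also have "epowr (ennreal ((\<rho> / R) ^ DIM(real ^ 'n)) * ?V) (1 - ?\<theta>) = ennreal ((\<rho> / R) powr (real DIM(real ^ 'n) * (1 - 1 / s))) * epowr ?V (1 - ?\<theta>)"
    proof -
      have "epowr (ennreal ((\<rho> / R) ^ DIM(real ^ 'n))) (1 - ?\<theta>) = ennreal ((\<rho> / R) powr (real DIM(real ^ 'n) * (1 - 1 / s)))"
        using \<rho> R by (subst epowr_ennreal) (auto simp flip: powr_realpow simp: powr_powr)
      then show ?thesis using s by (simp add: epowr_mult)
    qed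
    also have "epowr ?V ?\<theta> * (ennreal C * avg ?W (ball x R)) * (ennreal ((\<rho> / R) powr (real DIM(real ^ 'n) * (1 - 1 / s))) * epowr ?V (1 - ?\<theta>))
      = (ennreal C * ennreal ((\<rho> / R) powr (real DIM(real ^ 'n) * (1 - 1 / s)))) * ((epowr ?V ?\<theta> * epowr ?V (1 - ?\<theta>)) * avg ?W (ball x R))"
      by (simp only: mult_ac)
    also have "epowr ?V ?\<theta> * epowr ?V (1 - ?\<theta>) = ?V"
      using epowr_add'[of ?\<theta> "1 - ?\<theta>" ?V] s by simp
    also have "?V * avg ?W (ball x R) = mass ?W (ball x R)" by (rule mass_eq_avg[OF R, symmetric])
    also have "ennreal C * ennreal ((\<rho> / R) powr (real DIM(real ^ 'n) * (1 - 1 / s))) = ennreal (C * (\<rho> / R) powr (real DIM(real ^ 'n) * (1 - 1 / s)))"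
      by (intro ennreal_mult[symmetric]) (auto simp: C_def)
    finally show ?thesis .
  qed
  then show ?thesis by (intro exI[of _ C]) (auto simp: ball_growth_def C_def)
qed

lemma ex_growth_exponent:
  fixes w :: "real ^ 'n \<Rightarrow> real"
  assumes w: "w \<in> Ap_class p" and p: "1 < p"
    and lam2: "0 \<le> lam2" "lam2 \<le> n"
    and lam1: "0 < lam1 * conj_exp (sigma_exp w) + lam2" "lam1 * conj_exp (sigma_exp w) + lam2 < n"
  shows "\<exists>b C. 0 < b \<and> b < 1 \<and> 1 \<le> C \<and> ball_growth b C (pos_version w) \<and> 0 < lam1 + lam2 * b \<and> lam1 + lam2 * b < n * b"
proof -
  define S where "S = {ereal \<sigma> |\<sigma>. 1 < \<sigma> \<and> w \<in> RH_class \<sigma>}"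
  have sup: "sigma_exp w = Sup S" by (simp add: sigma_exp_def S_def)
  obtain \<sigma>1 where \<sigma>1: "1 < \<sigma>1" "w \<in> RH_class \<sigma>1" using ex_RH_class[OF w p] by blast
  then have "ereal \<sigma>1 \<le> Sup S" by (intro Sup_upper) (auto simp: S_def)
  then have sup1: "1 < sigma_exp w" using \<sigma>1(1) unfolding sup by (metis ereal_less(3) order_less_le_trans one_ereal_def less_ereal.simps(1))
  \<comment> \<open>The critical growth exponent. Multiplying the hypotheses on \<open>lam1\<close>
    and \<open>lam2\<close> by it gives \<open>l1\<close>, but \<open>w\<close> need not satisfy the
    reverse Hoelder inequality with the critical exponent itself.\<close>
  define b0 where "b0 = 1 / conj_exp (sigma_exp w)"
  have b0: "0 < b0" "b0 \<le> 1" "conj_exp (sigma_exp w) = 1 / b0" "\<And>\<eta>. \<eta> < b0 \<Longrightarrow> ereal (1 / (1 - \<eta>)) < sigma_exp w"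
  proof -
    consider "sigma_exp w = \<infinity>" | s where "1 < s" "sigma_exp w = ereal s"
      using sup1 by (cases "sigma_exp w") auto
    then have "0 < b0 \<and> b0 \<le> 1 \<and> conj_exp (sigma_exp w) = 1 / b0 \<and> (\<forall>\<eta><b0. ereal (1 / (1 - \<eta>)) < sigma_exp w)"
    proof cases
      case 1 then show ?thesis by (simp add: b0_def conj_exp_def)
    next
      case 2
      then have b: "b0 = 1 - 1 / s" by (simp add: b0_def conj_exp_def diff_divide_distrib)
      have "1 / (1 - \<eta>) < s" if "\<eta> < b0" for \<eta>
      proof -
        have *: "1 / s < 1 - \<eta>" using that b by simp
        then have "1 < (1 - \<eta>) * s" using 2 by (simp add: pos_divide_less_eq)
        moreover have "0 < 1 / s" using 2 by simp
        then have "0 < 1 - \<eta>" using * by linarith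
        ultimately show ?thesis by (simp add: pos_divide_less_eq mult.commute)
      qed
      moreover have "conj_exp (sigma_exp w) = 1 / b0" by (simp add: b0_def)
      moreover have "0 < b0" "b0 \<le> 1" using 2 by (auto simp: b)
      ultimately show ?thesis using 2 by simp
    qed
    then show "0 < b0" "b0 \<le> 1" "conj_exp (sigma_exp w) = 1 / b0" "\<And>\<eta>. \<eta> < b0 \<Longrightarrow> ereal (1 / (1 - \<eta>)) < sigma_exp w" by auto
  qed
  have l1: "0 < lam1 + lam2 * b0" "lam1 + lam2 * b0 < n * b0"
    using lam1 b0(1) unfolding b0(3) by (auto simp: field_simps)
  \<comment> \<open>A margin for which both inequalities of \<open>l1\<close> stay strict with b0 -
    e in place of b0. The summand 1 keeps the denominators positive when lam2 = 0 or lam2 = n and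
    makes the resulting inequalities strict.\<close>
  define e where "e = min b0 (min ((lam1 + lam2 * b0) / (lam2 + 1)) ((n * b0 - lam1 - lam2 * b0) / (n - lam2 + 1)))"
  have e: "0 < e" using l1 b0(1) lam2 by (simp add: e_def)
  have e1: "lam2 * e < lam1 + lam2 * b0"
  proof -
    have "e * (lam2 + 1) \<le> lam1 + lam2 * b0" using lam2 by (simp add: e_def pos_le_divide_eq[symmetric])
    then show ?thesis using e by (simp add: algebra_simps)
  qed
  have e2: "(n - lam2) * e < n * b0 - lam1 - lam2 * b0"
  proof -
    have "e * (n - lam2 + 1) \<le> n * b0 - lam1 - lam2 * b0" using lam2 by (simp add: e_def pos_le_divide_eq[symmetric])
    then show ?thesis using e by (simp add: algebra_simps)
  qed
  have "ereal (1 / (1 - (b0 - e))) < Sup S" using b0(4)[of "b0 - e"] e sup by simp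
  then obtain \<sigma> where \<sigma>: "1 < \<sigma>" "w \<in> RH_class \<sigma>" "1 / (1 - (b0 - e)) < \<sigma>"
    unfolding less_Sup_iff by (auto simp: S_def)
  define b where "b = 1 - 1 / \<sigma>"
  have "0 < 1 - (b0 - e)" using b0 e by linarith
  then have b: "b0 - e < b" using \<sigma> by (simp add: b_def field_simps)
  have b01: "0 < b" "b < 1" using \<sigma>(1) by (auto simp: b_def)
  have "0 < lam1 + lam2 * (b0 - e)" using e1 by (simp add: algebra_simps)
  also have "\<dots> \<le> lam1 + lam2 * b" using b lam2 by (intro add_left_mono mult_left_mono) auto
  finally have f1: "0 < lam1 + lam2 * b" .
  have "lam1 < (n - lam2) * (b0 - e)" using e2 by (simp add: algebra_simps)
  also have "\<dots> \<le> (n - lam2) * b" using b lam2 by (intro mult_left_mono) auto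
  finally have f2: "lam1 + lam2 * b < n * b" by (simp add: algebra_simps)
  obtain C where "1 \<le> C" "ball_growth b C (pos_version w)"
    using RH_class_ball_growth[OF \<sigma>(2,1)] by (auto simp: b_def)
  then show ?thesis using b01 f1 f2 by blast
qed

section \<open>Weights adapted to a ball\<close>

lemma suminf_geometric_ennreal:
  assumes "0 < \<delta>"
  shows "(\<Sum>j. ennreal ((2 powr (- \<delta>)) ^ j)) = ennreal (1 / (1 - 2 powr (- \<delta>)))"
proof -
  have "2 powr (- \<delta>) < (2::real) powr 0" using assms by (intro powr_less_mono) auto
  then have "norm (2 powr (- \<delta>) :: real) < 1" by simp
  from geometric_sums[OF this] show ?thesis
    by (intro suminf_ennreal_eq) auto
qed

text \<open>The ratio 2^(-\<delta>) arises from dyadic radii and a bound proportional to the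
  \<delta>-th power of the radius, or of its inverse. The covering is only almost everywhere since
  the centre of shrinking annuli is missed.\<close>

lemma mass_Un_annuli_le:
  assumes h: "h \<in> borel_measurable lebesgue" and \<delta>: "0 < \<delta>"
    and X: "\<And>j. X j \<in> sets lebesgue"
    and S: "AE z in lebesgue. z \<in> S \<longrightarrow> z \<in> (\<Union>j. X j)"
    and bound: "\<And>j. mass h (X j) \<le> E * ennreal ((2 powr (- \<delta>)) ^ j)"
  shows "mass h S \<le> E * ennreal (1 / (1 - 2 powr (- \<delta>)))"
proof -
  have "mass h S \<le> mass h (\<Union>j. X j)"
    unfolding mass_def using S by (intro nn_integral_mono_AE) (auto simp: indicator_def elim!: eventually_mono)
  also have "\<dots> \<le> (\<integral>\<^sup>+j. mass h (X j) \<partial>count_space UNIV)"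
    by (intro mass_UN_le h X) auto
  also have "\<dots> = (\<Sum>j. mass h (X j))" by (rule nn_integral_count_space_nat)
  also have "\<dots> \<le> (\<Sum>j. E * ennreal ((2 powr (- \<delta>)) ^ j))" by (intro suminf_le bound) auto
  also have "\<dots> = E * ennreal (1 / (1 - 2 powr (- \<delta>)))"
    using suminf_geometric_ennreal[OF \<delta>] by simp
  finally show ?thesis .
qed

lemma mass_ball_annuli:
  fixes x :: "'a::euclidean_space"
  assumes h: "h \<in> borel_measurable lebesgue" and \<delta>: "0 < \<delta>" and R: "0 < R"
    and bound: "\<And>\<rho>. 0 < \<rho> \<Longrightarrow> \<rho> \<le> R \<Longrightarrow> mass h (ball x \<rho> - ball x (\<rho> / 2)) \<le> E * ennreal ((\<rho> / R) powr \<delta>)"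
  shows "mass h (ball x R) \<le> E * ennreal (1 / (1 - 2 powr (- \<delta>)))"
proof (rule mass_Un_annuli_le[OF h \<delta>])
  let ?X = "\<lambda>j. ball x (R * (1/2) ^ j) - ball x (R * (1/2) ^ j / 2)"
  show "?X j \<in> sets lebesgue" for j by (intro sets.Diff) auto
  have "z \<in> (\<Union>j. ?X j)" if "z \<in> ball x R" "z \<noteq> x" for z
  proof -
    have d: "0 < dist x z" using that by simp
    obtain i where "(1/2) ^ i < dist x z / R"
      using real_arch_pow_inv[of "dist x z / R" "1/2"] d R by auto
    then have ex: "R * (1/2) ^ i \<le> dist x z" using R by (simp add: pos_less_divide_eq mult.commute)
    define k where "k = (LEAST i. R * (1/2) ^ i \<le> dist x z)"
    have k: "R * (1/2) ^ k \<le> dist x z" unfolding k_def by (rule LeastI[of _ i]) (rule ex)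
    have "k \<noteq> 0" using k that by (intro notI) simp
    then obtain j where j: "k = Suc j" by (cases k) auto
    then have "j < k" by simp
    then have "\<not> R * (1/2) ^ j \<le> dist x z" unfolding k_def by (rule not_less_Least)
    then have "z \<in> ?X j" using k by (simp add: j)
    then show ?thesis by blast
  qed
  moreover have "AE z in lebesgue. z \<noteq> x"
    by (intro AE_completion AE_lborel_singleton)
  ultimately show "AE z in lebesgue. z \<in> ball x R \<longrightarrow> z \<in> (\<Union>j. ?X j)"
    by (auto elim!: eventually_mono)
  fix j
  have "(R * (1/2) ^ j / R) powr \<delta> = (2 powr (- \<delta>)) ^ j"
    using R by (simp add: power_one_over powr_divide powr_minus_divide powr_power power_divide flip: powr_realpow)
      (simp add: powr_powr mult.commute)
  moreover have "R * (1/2) ^ j \<le> R" using R by (simp add: mult_left_le power_le_one)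
  ultimately show "mass h (?X j) \<le> E * ennreal ((2 powr (- \<delta>)) ^ j)"
    using bound[of "R * (1/2) ^ j"] R by simp
qed

lemma mass_outside_ball_annuli:
  fixes x :: "'a::euclidean_space"
  assumes h: "h \<in> borel_measurable lebesgue" and \<delta>: "0 < \<delta>" and r: "0 < r"
    and bound: "\<And>\<rho>. r \<le> \<rho> \<Longrightarrow> mass h (ball x (2 * \<rho>) - ball x \<rho>) \<le> E * ennreal ((r / \<rho>) powr \<delta>)"
  shows "mass h (- ball x r) \<le> E * ennreal (1 / (1 - 2 powr (- \<delta>)))"
proof (rule mass_Un_annuli_le[OF h \<delta>])
  let ?X = "\<lambda>j. ball x (2 * (r * 2 ^ j)) - ball x (r * 2 ^ j)"
  show "?X j \<in> sets lebesgue" for j by (intro sets.Diff) auto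
  have "z \<in> (\<Union>j. ?X j)" if "z \<in> - ball x r" for z
  proof -
    obtain i where "dist x z / r < 2 ^ i" using real_arch_pow[of 2 "dist x z / r"] by auto
    then have ex: "dist x z < r * 2 ^ i" using r by (simp add: pos_divide_less_eq mult.commute)
    define k where "k = (LEAST i. dist x z < r * 2 ^ i)"
    have k: "dist x z < r * 2 ^ k" unfolding k_def by (rule LeastI[of _ i]) (rule ex)
    have "k \<noteq> 0" using k that by (intro notI) simp
    then obtain j where j: "k = Suc j" by (cases k) auto
    then have "j < k" by simp
    then have "\<not> dist x z < r * 2 ^ j" unfolding k_def by (rule not_less_Least)
    then have "z \<in> ?X j" using k by (simp add: j)
    then show ?thesis by blast
  qed
  then show "AE z in lebesgue. z \<in> - ball x r \<longrightarrow> z \<in> (\<Union>j. ?X j)" by auto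
  fix j
  have "(r / (r * 2 ^ j)) powr \<delta> = (2 powr (- \<delta>)) ^ j"
    using r by (simp add: powr_divide powr_minus_divide power_divide flip: powr_realpow)
      (simp add: powr_powr mult.commute)
  moreover have "r \<le> r * 2 ^ j" using r by simp
  ultimately show "mass h (?X j) \<le> E * ennreal ((2 powr (- \<delta>)) ^ j)"
    using bound[of "r * 2 ^ j"] by simp
qed

text \<open>The exponent \<open>q\<close> serves only for finiteness and doubling and is above 1
  even when the Morrey estimate is for p = 1. The number \<kappa> stands for the second Morrey
  exponent divided by the dimension.\<close>

locale morrey_weight =
  fixes W :: "'a::euclidean_space \<Rightarrow> ennreal" and q K b C \<kappa> :: real
  assumes W: "pos_weight W" and A: "Ap q (ennreal K) W" and q: "1 < q" and K: "1 \<le> K"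
    and growth: "ball_growth b C W" and C: "1 \<le> C" and \<kappa>: "0 \<le> \<kappa>" "\<kappa> \<le> 1"
begin

definition \<mu> :: "'a \<Rightarrow> real \<Rightarrow> real" where "\<mu> x \<rho> = enn2real (mass W (ball x \<rho>))"

lemma mass_eq_mu: "0 < \<rho> \<Longrightarrow> mass W (ball x \<rho>) = ennreal (\<mu> x \<rho>)"
  using Ap_mass_finite[OF W A, of \<rho> x] q by (simp add: \<mu>_def)

lemma mu_pos: "0 < \<rho> \<Longrightarrow> 0 < \<mu> x \<rho>"
  using mass_ball_pos[OF W, of \<rho> x] by (auto simp: mass_eq_mu)

lemma mu_mono: "0 < \<rho> \<Longrightarrow> 0 < R \<Longrightarrow> ball x \<rho> \<subseteq> ball y R \<Longrightarrow> \<mu> x \<rho> \<le> \<mu> y R"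
  using mass_mono[of "ball x \<rho>" "ball y R" W] mu_pos[of R y] by (simp add: mass_eq_mu)

lemma mu_compare: "0 < r \<Longrightarrow> 1 \<le> t \<Longrightarrow> ball d r \<subseteq> ball c (t * r) \<Longrightarrow> \<mu> c (t * r) \<le> K * t powr (real DIM('a) * q) * \<mu> d r"
  using Ap_ball_compare[OF W A q, of r t d c] K mu_pos[of r d]
  by (simp add: mass_eq_mu ennreal_mult[symmetric])

lemma mu_growth: "0 < \<rho> \<Longrightarrow> \<rho> \<le> R \<Longrightarrow> \<mu> x \<rho> \<le> C * (\<rho> / R) powr (real DIM('a) * b) * \<mu> x R"
  using growth[unfolded ball_growth_def, rule_format, of \<rho> R x] C mu_pos[of R x]
  by (simp add: mass_eq_mu ennreal_mult[symmetric])

definition m :: "'a \<Rightarrow> real \<Rightarrow> real \<Rightarrow> real" where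
  "m x \<gamma> \<rho> = \<rho> powr \<gamma> * \<mu> x \<rho> powr \<kappa>"

definition U :: "'a \<Rightarrow> real \<Rightarrow> real \<Rightarrow> 'a \<Rightarrow> ennreal" where
  "U x \<gamma> r z = ennreal (1 / m x \<gamma> (max (dist x z) r)) * W z"

lemma m_pos: "0 < \<rho> \<Longrightarrow> 0 < m x \<gamma> \<rho>"
  using mu_pos[of \<rho> x] by (simp add: m_def)

text \<open>The constant by which \<open>m\<close> can grow when the radius grows at most fourfold.
  The absolute value is there because \<gamma> may be negative.\<close>

definition c3 :: "real \<Rightarrow> real" where
  "c3 \<gamma> = 4 powr \<bar>\<gamma>\<bar> * (K * 4 powr (real DIM('a) * q)) powr \<kappa>"

lemma powr_le_of_comparable:
  fixes \<rho> R \<gamma> :: real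
  assumes "0 < \<rho>" "\<rho> \<le> R" "R \<le> 4 * \<rho>"
  shows "R powr \<gamma> \<le> 4 powr \<bar>\<gamma>\<bar> * \<rho> powr \<gamma>"
proof -
  have "(R / \<rho>) powr \<gamma> \<le> (R / \<rho>) powr \<bar>\<gamma>\<bar>" using assms by (intro powr_mono) auto
  also have "\<dots> \<le> 4 powr \<bar>\<gamma>\<bar>" using assms by (intro powr_mono2) (auto simp: divide_le_eq)
  finally show ?thesis using assms by (simp add: powr_divide divide_le_eq)
qed

lemma mu_le_of_comparable:
  assumes "0 < \<rho>" "\<rho> \<le> R" "R \<le> 4 * \<rho>"
  shows "\<mu> x R \<le> K * 4 powr (real DIM('a) * q) * \<mu> x \<rho>"
proof -
  have "\<mu> x R \<le> \<mu> x (4 * \<rho>)" using assms by (intro mu_mono) auto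
  also have "\<dots> \<le> K * 4 powr (real DIM('a) * q) * \<mu> x \<rho>" using assms by (intro mu_compare) auto
  finally show ?thesis .
qed

lemma m_le_of_comparable:
  assumes "0 < \<rho>" "\<rho> \<le> R" "R \<le> 4 * \<rho>"
  shows "m x \<gamma> R \<le> c3 \<gamma> * m x \<gamma> \<rho>"
proof -
  have "\<mu> x R powr \<kappa> \<le> (K * 4 powr (real DIM('a) * q) * \<mu> x \<rho>) powr \<kappa>"
    using mu_le_of_comparable[OF assms] mu_pos[of R x] assms \<kappa> by (intro powr_mono2) auto
  also have "\<dots> = (K * 4 powr (real DIM('a) * q)) powr \<kappa> * \<mu> x \<rho> powr \<kappa>"
    using mu_pos[of \<rho> x] assms K by (simp add: powr_mult)
  finally have "R powr \<gamma> * \<mu> x R powr \<kappa> \<le> (4 powr \<bar>\<gamma>\<bar> * \<rho> powr \<gamma>) * ((K * 4 powr (real DIM('a) * q)) powr \<kappa> * \<mu> x \<rho> powr \<kappa>)"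
    by (intro mult_mono powr_le_of_comparable assms) auto
  then show ?thesis by (simp add: m_def c3_def mult_ac)
qed

lemma c3_pos: "0 < c3 \<gamma>" using K by (simp add: c3_def)

lemma borel_measurable_mu: "(\<lambda>z. \<mu> x (max (dist x z) r)) \<in> borel_measurable lebesgue"
proof -
  interpret sigma_finite_measure "lebesgue :: 'a measure" by (rule sigma_finite_lebesgue)
  note [measurable] = measurable_lebesgue_ident pos_weight_measurable[OF W]
  have "(\<lambda>z. \<integral>\<^sup>+y. (if dist x y < max (dist x z) r then W y else 0) \<partial>lebesgue) \<in> borel_measurable lebesgue"
    unfolding dist_norm by measurable
  moreover have "mass W (ball x s) = (\<integral>\<^sup>+y. (if dist x y < s then W y else 0) \<partial>lebesgue)" for s
    unfolding mass_def by (intro nn_integral_cong) (auto simp: indicator_def)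
  ultimately show ?thesis unfolding \<mu>_def by simp
qed

lemma pos_weight_U:
  assumes "0 < r" shows "pos_weight (U x \<gamma> r)"
proof -
  note [measurable] = measurable_lebesgue_ident borel_measurable_mu
  have "(\<lambda>z. ennreal (1 / m x \<gamma> (max (dist x z) r))) \<in> borel_measurable lebesgue"
    unfolding m_def by measurable
  moreover have "0 < m x \<gamma> (max (dist x z) r)" for z using assms by (intro m_pos) auto
  ultimately have "pos_weight (\<lambda>z. ennreal (1 / m x \<gamma> (max (dist x z) r)))"
    by (auto simp: pos_weight_def)
  from pos_weight_mult[OF this W] show ?thesis by (simp add: U_def[abs_def])
qed

lemma W_eq_U: "0 < r \<Longrightarrow> W z = ennreal (m x \<gamma> (max (dist x z) r)) * U x \<gamma> r z"
proof -
  assume "0 < r"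
  then have "0 < m x \<gamma> (max (dist x z) r)" by (intro m_pos) auto
  then have "ennreal (m x \<gamma> (max (dist x z) r)) * ennreal (1 / m x \<gamma> (max (dist x z) r)) = 1"
    by (subst ennreal_mult[symmetric]) auto
  then show ?thesis by (simp add: U_def mult.assoc[symmetric])
qed

definition cU :: "real \<Rightarrow> real \<Rightarrow> real \<Rightarrow> real \<Rightarrow> real" where
  "cU c1 c2 \<delta> \<gamma> = c1 * (c3 \<gamma> + (c2 + c3 \<gamma> * c2 / (1 - 2 powr (- \<delta>))) * (K * 3 powr (real DIM('a) * q)) + 1)"

text \<open>The annulus at radius \<rho> has mass at most \<open>c3 \<gamma>\<close> times
  \<mu>(\<rho>) / m(\<rho>), and the hypothesis makes this a geometric sequence dominated by its
  value at \<open>R\<close>. The inner ball, where the radius is frozen at \<open>r\<close>, is one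
  more term of the same size.\<close>

lemma U_mass_ball_le:
  assumes r: "0 < r" "r \<le> R" and \<delta>: "0 < \<delta>" and c2: "0 \<le> c2"
    and summable: "\<And>\<rho>. r \<le> \<rho> \<Longrightarrow> \<rho> \<le> R \<Longrightarrow> \<mu> x \<rho> / m x \<gamma> \<rho> \<le> c2 * (\<rho> / R) powr \<delta> * (\<mu> x R / m x \<gamma> R)"
  shows "mass (U x \<gamma> r) (ball x R) \<le> ennreal ((c2 + c3 \<gamma> * c2 / (1 - 2 powr (- \<delta>))) * (\<mu> x R / m x \<gamma> R))"
proof -
  note [measurable] = pos_weight_measurable[OF W] pos_weight_measurable[OF pos_weight_U[OF r(1)]]
  have R: "0 < R" using r by simp
  let ?Q = "\<mu> x R / m x \<gamma> R"
  have Q: "0 < ?Q" using mu_pos[OF R] m_pos[OF R] by simp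
  have d1: "0 < 1 - 2 powr (- \<delta>)"
  proof -
    have "2 powr (- \<delta>) < (2::real) powr 0" using \<delta> by (intro powr_less_mono) auto
    then show ?thesis by simp
  qed
  have inner: "mass (U x \<gamma> r) (ball x r) \<le> ennreal (c2 * ?Q)"
  proof -
    have "mass (U x \<gamma> r) (ball x r) = mass (\<lambda>z. ennreal (1 / m x \<gamma> r) * W z) (ball x r)"
      by (rule mass_cong) (auto simp: U_def max_def)
    also have "\<dots> = ennreal (\<mu> x r / m x \<gamma> r)"
      using r mu_pos[of r x] m_pos[of r x \<gamma>] by (simp add: mass_cmult mass_eq_mu ennreal_mult[symmetric])
    also have "\<dots> \<le> ennreal (c2 * ?Q)"
    proof (rule ennreal_leI)
      have "(r / R) powr \<delta> \<le> 1" using r \<delta> by (intro powr_le1) auto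
      then have "c2 * (r / R) powr \<delta> * ?Q \<le> c2 * 1 * ?Q" using c2 Q by (intro mult_right_mono mult_left_mono) auto
      then show "\<mu> x r / m x \<gamma> r \<le> c2 * ?Q" using summable[of r] r by simp
    qed
    finally show ?thesis .
  qed
  \<comment> \<open>Cutting off the inner ball makes annuli inside it contribute nothing, and in an
    annulus that meets its boundary only points with frozen radius \<open>dist x z\<close>
    remain.\<close>
  let ?h = "\<lambda>z. U x \<gamma> r z * indicator (- ball x r) z"
  have "mass ?h (ball x R) \<le> ennreal (c3 \<gamma> * c2 * ?Q) * ennreal (1 / (1 - 2 powr (- \<delta>)))"
  proof (rule mass_ball_annuli[OF _ \<delta> R])
    show "?h \<in> borel_measurable lebesgue"
      by (intro borel_measurable_times_ennreal borel_measurable_indicator) auto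
    fix \<rho> assume \<rho>: "0 < \<rho>" "\<rho> \<le> R"
    show "mass ?h (ball x \<rho> - ball x (\<rho> / 2)) \<le> ennreal (c3 \<gamma> * c2 * ?Q) * ennreal ((\<rho> / R) powr \<delta>)"
    proof (cases "\<rho> \<le> r")
      case True
      then have "mass ?h (ball x \<rho> - ball x (\<rho> / 2)) = mass (\<lambda>_. 0) (ball x \<rho> - ball x (\<rho> / 2))"
        by (intro mass_cong) auto
      then show ?thesis by (simp add: mass_def)
    next
      case False
      have "mass ?h (ball x \<rho> - ball x (\<rho> / 2)) \<le> mass (\<lambda>z. ennreal (c3 \<gamma> / m x \<gamma> \<rho>) * W z) (ball x \<rho> - ball x (\<rho> / 2))"
      proof (rule mass_mono_weight)
        fix z assume z: "z \<in> ball x \<rho> - ball x (\<rho> / 2)"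
        show "?h z \<le> ennreal (c3 \<gamma> / m x \<gamma> \<rho>) * W z"
        proof (cases "z \<in> ball x r")
          case False
          then have d: "max (dist x z) r = dist x z" "0 < dist x z" using r by auto
          have "m x \<gamma> \<rho> \<le> c3 \<gamma> * m x \<gamma> (dist x z)" using z d by (intro m_le_of_comparable) auto
          then have "1 / m x \<gamma> (dist x z) \<le> c3 \<gamma> / m x \<gamma> \<rho>"
            using m_pos[OF d(2), of x \<gamma>] m_pos[OF \<rho>(1), of x \<gamma>] by (simp add: field_simps)
          then show ?thesis using False by (simp add: U_def d(1) mult_right_mono ennreal_leI)
        qed simp
      qed
      also have "\<dots> \<le> mass (\<lambda>z. ennreal (c3 \<gamma> / m x \<gamma> \<rho>) * W z) (ball x \<rho>)" by (rule mass_mono) auto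
      also have "\<dots> = ennreal (c3 \<gamma> * (\<mu> x \<rho> / m x \<gamma> \<rho>))"
        using \<rho> mu_pos[of \<rho> x] m_pos[of \<rho> x \<gamma>] c3_pos[of \<gamma>] by (simp add: mass_cmult mass_eq_mu ennreal_mult[symmetric])
      also have "\<dots> \<le> ennreal (c3 \<gamma> * (c2 * (\<rho> / R) powr \<delta> * ?Q))"
        using summable[of \<rho>] False \<rho> c3_pos[of \<gamma>] by (intro ennreal_leI mult_left_mono) auto
      also have "c3 \<gamma> * (c2 * (\<rho> / R) powr \<delta> * ?Q) = (c3 \<gamma> * c2 * ?Q) * (\<rho> / R) powr \<delta>" by simp
      also have "ennreal \<dots> = ennreal (c3 \<gamma> * c2 * ?Q) * ennreal ((\<rho> / R) powr \<delta>)"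
        by (intro ennreal_mult mult_nonneg_nonneg c2 less_imp_le[OF c3_pos] less_imp_le[OF Q]) auto
      finally show ?thesis .
    qed
  qed
  also have "\<dots> = ennreal (c3 \<gamma> * c2 / (1 - 2 powr (- \<delta>)) * ?Q)"
  proof -
    have "0 \<le> c3 \<gamma> * c2 * ?Q" by (intro mult_nonneg_nonneg c2 less_imp_le[OF c3_pos] less_imp_le[OF Q])
    then show ?thesis by (subst ennreal_mult[symmetric]) (use d1 in \<open>auto simp: mult_ac\<close>)
  qed
  finally have outer: "mass ?h (ball x R) \<le> ennreal (c3 \<gamma> * c2 / (1 - 2 powr (- \<delta>)) * ?Q)" .
  have "mass (U x \<gamma> r) (ball x R) \<le> mass (U x \<gamma> r) (ball x r \<union> (ball x R - ball x r))"
    by (rule mass_mono) auto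
  also have "\<dots> \<le> mass (U x \<gamma> r) (ball x r) + mass (U x \<gamma> r) (ball x R - ball x r)"
    by (intro mass_Un_le sets.Diff) auto
  also have "mass (U x \<gamma> r) (ball x R - ball x r) = mass ?h (ball x R)"
    by (simp add: mass_indicator Diff_eq)
  also have "mass (U x \<gamma> r) (ball x r) + mass ?h (ball x R) \<le> ennreal (c2 * ?Q) + ennreal (c3 \<gamma> * c2 / (1 - 2 powr (- \<delta>)) * ?Q)"
    by (intro add_mono inner outer)
  also have "\<dots> = ennreal ((c2 + c3 \<gamma> * c2 / (1 - 2 powr (- \<delta>))) * ?Q)"
    unfolding distrib_right
  proof (rule ennreal_plus[symmetric])
    show "0 \<le> c2 * ?Q" by (intro mult_nonneg_nonneg c2 less_imp_le[OF Q])
    show "0 \<le> c3 \<gamma> * c2 / (1 - 2 powr (- \<delta>)) * ?Q"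
      by (intro mult_nonneg_nonneg divide_nonneg_nonneg c2 less_imp_le[OF c3_pos] less_imp_le[OF Q] less_imp_le[OF d1])
  qed
  finally show ?thesis .
qed

text \<open>Far from \<open>x\<close>, relative to its radius, a ball sees an almost constant
  \<open>m\<close> and inherits the condition from \<open>W\<close>. A ball near \<open>x\<close>
  sees a nonconstant \<open>m\<close>; there the quasi-monotonicity bounds \<open>m\<close>
  pointwise from above, hence \<open>U\<close> from below, and \<open>U_mass_ball_le\<close> bounds
  the average of \<open>U\<close>.\<close>

lemma Ap_U:
  assumes r: "0 < r" and \<delta>: "0 < \<delta>" and c: "1 \<le> c1" "1 \<le> c2" and p: "1 \<le> p" and L: "Ap p (ennreal L) W"
    and quasi_incr: "\<And>\<rho> R. r \<le> \<rho> \<Longrightarrow> \<rho> \<le> R \<Longrightarrow> m x \<gamma> \<rho> \<le> c1 * m x \<gamma> R"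
    and summable: "\<And>\<rho> R. r \<le> \<rho> \<Longrightarrow> \<rho> \<le> R \<Longrightarrow> \<mu> x \<rho> / m x \<gamma> \<rho> \<le> c2 * (\<rho> / R) powr \<delta> * (\<mu> x R / m x \<gamma> R)"
  shows "Ap p (ennreal (cU c1 c2 \<delta> \<gamma>) * ennreal L) (U x \<gamma> r)"
  unfolding Ap_def
proof (intro allI impI)
  fix y :: 'a and t :: real assume t: "0 < t"
  note [measurable] = pos_weight_measurable[OF W] pos_weight_measurable[OF pos_weight_U[OF r]]
  have LB: "Ap_ball p (ennreal L) W y t" using L t by (simp add: Ap_def)
  have UW: "pos_weight (U x \<gamma> r)" by (rule pos_weight_U[OF r])
  let ?B = "c2 + c3 \<gamma> * c2 / (1 - 2 powr (- \<delta>))"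
  have d1: "0 < 1 - 2 powr (- \<delta>)"
  proof -
    have "2 powr (- \<delta>) < (2::real) powr 0" using \<delta> by (intro powr_less_mono) auto
    then show ?thesis by simp
  qed
  have B: "0 \<le> ?B" using c c3_pos[of \<gamma>] d1 by simp
  \<comment> \<open>In each case \<open>a\<close> bounds \<open>m\<close> from above on the ball and
    \<beta> compares the averages of \<open>U\<close> and \<open>W\<close>. Both depend on the ball,
    but their product stays below \<open>cU\<close>.\<close>
  have main: "Ap_ball p (ennreal (cU c1 c2 \<delta> \<gamma>) * ennreal L) (U x \<gamma> r) y t"
    if up: "\<And>z. z \<in> ball y t \<Longrightarrow> m x \<gamma> (max (dist x z) r) \<le> a" and a: "0 < a"
      and avg: "avg (U x \<gamma> r) (ball y t) \<le> ennreal \<beta> * avg W (ball y t)" and \<beta>: "0 \<le> \<beta>" and le: "a * \<beta> \<le> cU c1 c2 \<delta> \<gamma>" for a \<beta>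
  proof -
    have "Ap_ball p (ennreal a * ennreal \<beta> * ennreal L) (U x \<gamma> r) y t"
    proof (rule Ap_ball_perturb[OF W LB p t avg _ UW])
      have "W z \<le> ennreal a * U x \<gamma> r z" if "z \<in> ball y t" for z
        unfolding W_eq_U[OF r, of z x \<gamma>] by (intro mult_right_mono ennreal_leI up that) auto
      then show "AE z in lebesgue. z \<in> ball y t \<longrightarrow> W z \<le> ennreal a * U x \<gamma> r z" by auto
    qed (use a in auto)
    moreover have "ennreal a * ennreal \<beta> * ennreal L \<le> ennreal (cU c1 c2 \<delta> \<gamma>) * ennreal L"
      using le a \<beta> by (intro mult_right_mono) (auto simp: ennreal_mult[symmetric] intro: ennreal_leI)
    ultimately show ?thesis
      unfolding Ap_ball_def by (auto split: if_splits elim!: eventually_mono intro: order_trans order_trans[OF _ mult_right_mono])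
  qed
  define d where "d = dist x y"
  show "Ap_ball p (ennreal (cU c1 c2 \<delta> \<gamma>) * ennreal L) (U x \<gamma> r) y t"
  proof (cases "2 * t \<le> d")
    case True
    define \<rho>0 where "\<rho>0 = max (d / 2) r"
    have \<rho>0: "0 < \<rho>0" "r \<le> \<rho>0" using r by (auto simp: \<rho>0_def)
    have range: "\<rho>0 \<le> max (dist x z) r" "max (dist x z) r \<le> 4 * \<rho>0" if "z \<in> ball y t" for z
    proof -
      have "d \<le> dist x z + dist y z" unfolding d_def by (rule dist_triangle2)
      then have "d / 2 \<le> dist x z" using that True by simp
      moreover have "dist x z \<le> d + dist y z" unfolding d_def by (rule dist_triangle)
      then have "dist x z \<le> 3 * (d / 2)" using that True by simp
      ultimately show "\<rho>0 \<le> max (dist x z) r" "max (dist x z) r \<le> 4 * \<rho>0" using r by (auto simp: \<rho>0_def)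
    qed
    have m0: "0 < m x \<gamma> \<rho>0" by (rule m_pos[OF \<rho>0(1)])
    show ?thesis
    proof (rule main)
      show "m x \<gamma> (max (dist x z) r) \<le> c3 \<gamma> * m x \<gamma> \<rho>0" if "z \<in> ball y t" for z
        by (rule m_le_of_comparable[OF \<rho>0(1) range[OF that]])
      have "avg (U x \<gamma> r) (ball y t) \<le> avg (\<lambda>z. ennreal (c1 / m x \<gamma> \<rho>0) * W z) (ball y t)"
      proof (rule avg_mono)
        fix z assume z: "z \<in> ball y t"
        have "m x \<gamma> \<rho>0 \<le> c1 * m x \<gamma> (max (dist x z) r)" by (rule quasi_incr[OF \<rho>0(2) range(1)[OF z]])
        moreover have "0 < m x \<gamma> (max (dist x z) r)" using r by (intro m_pos) auto
        ultimately have "1 / m x \<gamma> (max (dist x z) r) \<le> c1 / m x \<gamma> \<rho>0" using m0 by (simp add: field_simps)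
        then show "U x \<gamma> r z \<le> ennreal (c1 / m x \<gamma> \<rho>0) * W z"
          unfolding U_def by (intro mult_right_mono ennreal_leI) auto
      qed
      also have "\<dots> = ennreal (c1 / m x \<gamma> \<rho>0) * avg W (ball y t)" by (intro avg_cmult) auto
      finally show "avg (U x \<gamma> r) (ball y t) \<le> ennreal (c1 / m x \<gamma> \<rho>0) * avg W (ball y t)" .
      have "c3 \<gamma> * m x \<gamma> \<rho>0 * (c1 / m x \<gamma> \<rho>0) = c1 * c3 \<gamma>" using m0 by simp
      also have "\<dots> \<le> cU c1 c2 \<delta> \<gamma>"
        unfolding cU_def using c B K by (intro mult_left_mono) auto
      finally show "c3 \<gamma> * m x \<gamma> \<rho>0 * (c1 / m x \<gamma> \<rho>0) \<le> cU c1 c2 \<delta> \<gamma>" .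
    qed (use m0 c3_pos[of \<gamma>] c in auto)
  next
    case False
    have near: "dist x z < 3 * t" if "z \<in> ball y t" for z
      using dist_triangle[of x z y] that False by (simp add: d_def)
    then have sub: "ball y t \<subseteq> ball x (3 * t)" by auto
    show ?thesis
    proof (cases "3 * t \<le> r")
      case True
      have mr: "0 < m x \<gamma> r" by (rule m_pos[OF r])
      have \<rho>z: "max (dist x z) r = r" if "z \<in> ball y t" for z using near[OF that] True by simp
      show ?thesis
      proof (rule main)
        show "m x \<gamma> (max (dist x z) r) \<le> m x \<gamma> r" if "z \<in> ball y t" for z using \<rho>z[OF that] by simp
        have "avg (U x \<gamma> r) (ball y t) \<le> avg (\<lambda>z. ennreal (1 / m x \<gamma> r) * W z) (ball y t)"
          by (rule avg_mono) (simp only: U_def \<rho>z order_refl)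
        also have "\<dots> = ennreal (1 / m x \<gamma> r) * avg W (ball y t)" by (intro avg_cmult) auto
        finally show "avg (U x \<gamma> r) (ball y t) \<le> ennreal (1 / m x \<gamma> r) * avg W (ball y t)" .
        have "1 * 1 \<le> cU c1 c2 \<delta> \<gamma>"
          unfolding cU_def using c B K c3_pos[of \<gamma>] by (intro mult_mono) auto
        then show "m x \<gamma> r * (1 / m x \<gamma> r) \<le> cU c1 c2 \<delta> \<gamma>" using mr by simp
      qed (use mr in auto)
    next
      case False
      let ?R = "3 * t"
      have R: "0 < ?R" "r \<le> ?R" using t False by auto
      have mR: "0 < m x \<gamma> ?R" by (rule m_pos[OF R(1)])
      let ?\<beta> = "?B * (K * 3 powr (real DIM('a) * q)) / m x \<gamma> ?R"
      show ?thesis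
      proof (rule main)
        show "m x \<gamma> (max (dist x z) r) \<le> c1 * m x \<gamma> ?R" if "z \<in> ball y t" for z
          using near[OF that] R by (intro quasi_incr) auto
        have "mass (U x \<gamma> r) (ball y t) \<le> mass (U x \<gamma> r) (ball x ?R)" by (rule mass_mono[OF sub])
        also have "\<dots> \<le> ennreal (?B * (\<mu> x ?R / m x \<gamma> ?R))"
          using R r \<delta> c summable by (intro U_mass_ball_le) auto
        also have "\<dots> \<le> ennreal (?\<beta> * \<mu> y t)"
        proof (rule ennreal_leI)
          have "\<mu> x ?R \<le> K * 3 powr (real DIM('a) * q) * \<mu> y t" using t sub by (intro mu_compare) auto
          then have "?B * (\<mu> x ?R / m x \<gamma> ?R) \<le> ?B * ((K * 3 powr (real DIM('a) * q) * \<mu> y t) / m x \<gamma> ?R)"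
            using B mR by (intro mult_left_mono divide_right_mono) auto
          then show "?B * (\<mu> x ?R / m x \<gamma> ?R) \<le> ?\<beta> * \<mu> y t" by simp
        qed
        also have "\<dots> = ennreal ?\<beta> * mass W (ball y t)"
        proof -
          have "0 \<le> ?\<beta>" using B K mR by (intro divide_nonneg_pos mult_nonneg_nonneg) auto
          then show ?thesis unfolding mass_eq_mu[OF t] using mu_pos[OF t, of y] by (intro ennreal_mult) auto
        qed
        also have "\<dots> = ennreal ?\<beta> * avg W (ball y t) * emeasure lebesgue (ball y t)"
          by (simp only: avg_times_volume[OF t, symmetric] mult.assoc)
        finally show "avg (U x \<gamma> r) (ball y t) \<le> ennreal ?\<beta> * avg W (ball y t)"
          using t by (simp add: avg_le_iff)
        have "c1 * m x \<gamma> ?R * ?\<beta> = c1 * (?B * (K * 3 powr (real DIM('a) * q)))" using mR by simp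
        also have "\<dots> \<le> cU c1 c2 \<delta> \<gamma>"
          unfolding cU_def using c c3_pos[of \<gamma>] by (intro mult_left_mono) auto
        finally show "c1 * m x \<gamma> ?R * ?\<beta> \<le> cU c1 c2 \<delta> \<gamma>" .
      qed (use mR c B K in auto)
    qed
  qed
qed

end

section \<open>Estimates in weighted Morrey spaces\<close>

definition power_weight :: "real \<Rightarrow> ('a::euclidean_space \<Rightarrow> ennreal) \<Rightarrow> 'a \<Rightarrow> ennreal" where
  "power_weight al W z = ennreal (norm z powr al) * W z"

text \<open>The left side is the bound of \<open>mass_le_of_Morrey_bound\<close> for a set with
  norms at least d / t, inside a ball of radius u \<rho> with norms at most v d. Separating the
  numerical constants exhibits the net power d^(- al (1 - \<kappa>)).\<close>

lemma powr_scale: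
  fixes d \<rho> :: real
  assumes "0 < d" "0 < \<rho>" "0 < t" "0 < u" "0 < v" "0 \<le> M"
  shows "(d / t) powr (- al) * (u * \<rho>) powr lam * ((v * d) powr al * M) powr \<kappa>
    = (t powr al * u powr lam * v powr (al * \<kappa>)) * (d powr (- al * (1 - \<kappa>)) * \<rho> powr lam * M powr \<kappa>)"
proof -
  have 1: "(d / t) powr (- al) = t powr al * d powr (- al)"
    using assms by (simp add: powr_divide powr_minus field_simps)
  have 2: "((v * d) powr al * M) powr \<kappa> = v powr (al * \<kappa>) * d powr (al * \<kappa>) * M powr \<kappa>"
    using assms by (simp add: powr_mult powr_powr)
  have 3: "(u * \<rho>) powr lam = u powr lam * \<rho> powr lam"
    using assms by (simp add: powr_mult)
  have 4: "d powr (- al * (1 - \<kappa>)) = d powr (- al) * d powr (al * \<kappa>)"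
    by (simp add: powr_add[symmetric] algebra_simps)
  show ?thesis unfolding 1 2 3 4 by (simp only: mult_ac)
qed

lemma powr_comparable:
  fixes x y lam :: real
  assumes "0 < x" "0 < y" "x \<le> 4 * y" "y \<le> 4 * x"
  shows "x powr lam \<le> 4 powr \<bar>lam\<bar> * y powr lam"
proof -
  have "(x / y) powr lam \<le> 4 powr \<bar>lam\<bar>"
  proof (cases "0 \<le> lam")
    case True
    then show ?thesis using assms by (auto simp: divide_le_eq intro!: powr_mono2)
  next
    case False
    have "(x / y) powr lam = (y / x) powr (- lam)"
      using assms by (simp add: powr_divide powr_minus field_simps)
    also have "\<dots> \<le> 4 powr (- lam)" using assms False by (intro powr_mono2) (auto simp: divide_le_eq)
    finally show ?thesis using False by simp
  qed
  then show ?thesis using assms by (simp add: powr_divide divide_le_eq)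
qed

lemma geometric_denominator_pos: "0 < \<delta> \<Longrightarrow> 0 < 1 - 2 powr (- \<delta> :: real)"
  using powr_less_mono[of "- \<delta>" 0 "2 :: real"] by simp

context morrey_weight
begin

lemma U_outside_le:
  assumes r: "0 < r" "r \<le> \<rho>" and z: "z \<notin> ball x \<rho>" and c1: "0 \<le> c1"
    and quasi_incr: "\<And>\<rho> R. r \<le> \<rho> \<Longrightarrow> \<rho> \<le> R \<Longrightarrow> m x \<gamma> \<rho> \<le> c1 * m x \<gamma> R"
  shows "U x \<gamma> r z \<le> ennreal (c1 / m x \<gamma> \<rho>) * W z"
proof -
  have d: "\<rho> \<le> max (dist x z) r" using z by auto
  have "m x \<gamma> \<rho> \<le> c1 * m x \<gamma> (max (dist x z) r)" by (rule quasi_incr[OF r(2) d])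
  moreover have "0 < m x \<gamma> \<rho>" "0 < m x \<gamma> (max (dist x z) r)" using r by (auto intro!: m_pos)
  ultimately have "1 / m x \<gamma> (max (dist x z) r) \<le> c1 / m x \<gamma> \<rho>" by (simp add: field_simps)
  then show ?thesis unfolding U_def by (intro mult_right_mono ennreal_leI) auto
qed

text \<open>On the annulus at \<rho> the factor m(\<rho>) cancels against the weight
  \<open>U\<close>, up to the constant \<open>c1\<close>. What is left is \<rho>^(-\<epsilon>), and
  the sum over the annuli is governed by the innermost one.\<close>

lemma wint_U_le:
  assumes r: "0 < r" and \<epsilon>: "0 < \<epsilon>" and c1: "1 \<le> c1" and a: "0 \<le> a"
    and [measurable]: "f \<in> borel_measurable lebesgue"
    and quasi_incr: "\<And>\<rho> R. r \<le> \<rho> \<Longrightarrow> \<rho> \<le> R \<Longrightarrow> m x \<gamma> \<rho> \<le> c1 * m x \<gamma> R"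
    and inner: "mass (\<lambda>z. epowr (f z) p * W z) (ball x r) \<le> X * ennreal (a * r powr (- \<epsilon>) * m x \<gamma> r)"
    and outer: "\<And>\<rho>. r \<le> \<rho> \<Longrightarrow> mass (\<lambda>z. epowr (f z) p * W z) (ball x (2 * \<rho>) - ball x \<rho>) \<le> X * ennreal (a * \<rho> powr (- \<epsilon>) * m x \<gamma> \<rho>)"
  shows "wint p (U x \<gamma> r) f \<le> X * ennreal (a * (1 + c1 / (1 - 2 powr (- \<epsilon>))) * r powr (- \<epsilon>))"
proof -
  note [measurable] = pos_weight_measurable[OF W] pos_weight_measurable[OF pos_weight_U[OF r]]
  let ?F = "\<lambda>z. epowr (f z) p * W z" and ?G = "\<lambda>z. epowr (f z) p * U x \<gamma> r z"
  have d1: "0 < 1 - 2 powr (- \<epsilon>)" by (rule geometric_denominator_pos[OF \<epsilon>])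
  have mr: "0 < m x \<gamma> r" by (rule m_pos[OF r])
  have 1: "mass ?G (ball x r) \<le> X * ennreal (a * r powr (- \<epsilon>))"
  proof -
    have "mass ?G (ball x r) = mass (\<lambda>z. ennreal (1 / m x \<gamma> r) * ?F z) (ball x r)"
      by (rule mass_cong) (auto simp: U_def max_def mult_ac)
    also have "\<dots> = ennreal (1 / m x \<gamma> r) * mass ?F (ball x r)" by (intro mass_cmult) auto
    also have "\<dots> \<le> ennreal (1 / m x \<gamma> r) * (X * ennreal (a * r powr (- \<epsilon>) * m x \<gamma> r))"
      by (intro mult_left_mono inner) auto
    also have "\<dots> = X * (ennreal (1 / m x \<gamma> r) * ennreal (a * r powr (- \<epsilon>) * m x \<gamma> r))" by (simp only: mult_ac)
    also have "ennreal (1 / m x \<gamma> r) * ennreal (a * r powr (- \<epsilon>) * m x \<gamma> r) = ennreal (a * r powr (- \<epsilon>))"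
      using mr a by (subst ennreal_mult[symmetric]) auto
    finally show ?thesis .
  qed
  have 2: "mass ?G (- ball x r) \<le> X * ennreal (a * c1 * r powr (- \<epsilon>)) * ennreal (1 / (1 - 2 powr (- \<epsilon>)))"
  proof (rule mass_outside_ball_annuli[OF _ \<epsilon> r])
    fix \<rho> assume \<rho>: "r \<le> \<rho>"
    then have \<rho>0: "0 < \<rho>" using r by simp
    have m\<rho>: "0 < m x \<gamma> \<rho>" by (rule m_pos[OF \<rho>0])
    let ?S = "ball x (2 * \<rho>) - ball x \<rho>"
    have S: "?S \<in> sets lebesgue" by (intro sets.Diff) auto
    have "mass ?G ?S \<le> mass (\<lambda>z. ennreal (c1 / m x \<gamma> \<rho>) * ?F z) ?S"
    proof (rule mass_mono_weight)
      fix z assume "z \<in> ?S"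
      then have "U x \<gamma> r z \<le> ennreal (c1 / m x \<gamma> \<rho>) * W z"
        using c1 by (intro U_outside_le r \<rho> quasi_incr) auto
      then have "epowr (f z) p * U x \<gamma> r z \<le> epowr (f z) p * (ennreal (c1 / m x \<gamma> \<rho>) * W z)" by (rule mult_left_mono) simp
      then show "?G z \<le> ennreal (c1 / m x \<gamma> \<rho>) * ?F z" by (simp add: mult_ac)
    qed
    also have "\<dots> = ennreal (c1 / m x \<gamma> \<rho>) * mass ?F ?S" by (intro mass_cmult S) auto
    also have "\<dots> \<le> ennreal (c1 / m x \<gamma> \<rho>) * (X * ennreal (a * \<rho> powr (- \<epsilon>) * m x \<gamma> \<rho>))"
      by (intro mult_left_mono outer \<rho>) auto
    also have "\<dots> = X * (ennreal (c1 / m x \<gamma> \<rho>) * ennreal (a * \<rho> powr (- \<epsilon>) * m x \<gamma> \<rho>))" by (simp only: mult_ac)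
    also have "ennreal (c1 / m x \<gamma> \<rho>) * ennreal (a * \<rho> powr (- \<epsilon>) * m x \<gamma> \<rho>) = ennreal (a * c1 * r powr (- \<epsilon>) * (r / \<rho>) powr \<epsilon>)"
    proof -
      have "r powr (- \<epsilon>) * (r / \<rho>) powr \<epsilon> = \<rho> powr (- \<epsilon>)"
        using r \<rho>0 by (simp add: powr_divide powr_minus field_simps)
      then show ?thesis using m\<rho> a c1 by (subst ennreal_mult[symmetric]) (auto simp: mult.assoc)
    qed
    also have "\<dots> = ennreal (a * c1 * r powr (- \<epsilon>)) * ennreal ((r / \<rho>) powr \<epsilon>)"
      using a c1 by (intro ennreal_mult) auto
    finally show "mass ?G ?S \<le> X * ennreal (a * c1 * r powr (- \<epsilon>)) * ennreal ((r / \<rho>) powr \<epsilon>)" by (simp only: mult.assoc)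
  qed measurable
  have "wint p (U x \<gamma> r) f = mass ?G (ball x r \<union> (- ball x r))" by (simp add: wint_def mass_UNIV)
  also have "\<dots> \<le> mass ?G (ball x r) + mass ?G (- ball x r)"
    by (intro mass_Un_le) (auto intro!: open_imp_lebesgue sets.compl_sets[of _ lebesgue, simplified] simp: Compl_in_sets_lebesgue)
  also have "\<dots> \<le> X * ennreal (a * r powr (- \<epsilon>)) + X * ennreal (a * c1 * r powr (- \<epsilon>)) * ennreal (1 / (1 - 2 powr (- \<epsilon>)))"
    by (intro add_mono 1 2)
  also have "\<dots> = X * (ennreal (a * r powr (- \<epsilon>)) + ennreal (a * c1 * r powr (- \<epsilon>)) * ennreal (1 / (1 - 2 powr (- \<epsilon>))))"
    by (simp only: distrib_left mult.assoc)
  also have "ennreal (a * c1 * r powr (- \<epsilon>)) * ennreal (1 / (1 - 2 powr (- \<epsilon>))) = ennreal (a * c1 * r powr (- \<epsilon>) * (1 / (1 - 2 powr (- \<epsilon>))))"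
    using a c1 d1 by (intro ennreal_mult[symmetric]) auto
  also have "ennreal (a * r powr (- \<epsilon>)) + \<dots> = ennreal (a * r powr (- \<epsilon>) + a * c1 * r powr (- \<epsilon>) * (1 / (1 - 2 powr (- \<epsilon>))))"
    using a c1 d1 by (intro ennreal_plus[symmetric]) auto
  also have "a * r powr (- \<epsilon>) + a * c1 * r powr (- \<epsilon>) * (1 / (1 - 2 powr (- \<epsilon>))) = a * (1 + c1 / (1 - 2 powr (- \<epsilon>))) * r powr (- \<epsilon>)"
    by (simp add: algebra_simps)
  finally show ?thesis .
qed

text \<open>The factor \<mu>^\<kappa> grows at least with exponent s \<kappa>, which makes up for a
  negative \<gamma> as long as \<gamma> + s \<kappa> \<ge> 0.\<close>

lemma m_quasi_increasing:
  assumes g: "\<And>\<rho> R. 0 < \<rho> \<Longrightarrow> \<rho> \<le> R \<Longrightarrow> \<mu> x \<rho> \<le> c * (\<rho> / R) powr s * \<mu> x R"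
    and c: "1 \<le> c" and s: "0 \<le> \<gamma> + s * \<kappa>" and \<rho>: "0 < \<rho>" "\<rho> \<le> R"
  shows "m x \<gamma> \<rho> \<le> c powr \<kappa> * m x \<gamma> R"
proof -
  have R: "0 < R" using \<rho> by simp
  have "\<mu> x \<rho> powr \<kappa> \<le> (c * (\<rho> / R) powr s * \<mu> x R) powr \<kappa>"
    using g[OF \<rho>] mu_pos[OF \<rho>(1), of x] \<kappa> by (intro powr_mono2) auto
  also have "\<dots> = c powr \<kappa> * (\<rho> / R) powr (s * \<kappa>) * \<mu> x R powr \<kappa>"
    using c \<rho> R mu_pos[OF R, of x] by (simp add: powr_mult powr_powr)
  finally have "\<rho> powr \<gamma> * \<mu> x \<rho> powr \<kappa> \<le> \<rho> powr \<gamma> * (c powr \<kappa> * (\<rho> / R) powr (s * \<kappa>) * \<mu> x R powr \<kappa>)"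
    by (rule mult_left_mono) simp
  also have "\<dots> = c powr \<kappa> * (R powr \<gamma> * (\<rho> / R) powr (\<gamma> + s * \<kappa>)) * \<mu> x R powr \<kappa>"
  proof -
    have "\<rho> powr \<gamma> = R powr \<gamma> * (\<rho> / R) powr \<gamma>" using \<rho> R by (simp add: powr_divide)
    then show ?thesis by (simp add: powr_add mult_ac)
  qed
  also have "\<dots> \<le> c powr \<kappa> * (R powr \<gamma> * 1) * \<mu> x R powr \<kappa>"
    using \<rho> R s c by (intro mult_right_mono mult_left_mono powr_le1) auto
  finally show ?thesis by (simp add: m_def mult_ac)
qed

text \<open>The quotient \<mu> / m equals \<rho>^(-\<gamma>) \<mu>^(1 - \<kappa>), and the second
  factor grows at least with exponent n b (1 - \<kappa>). The hypothesis leaves a surplus of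
  \<epsilon>.\<close>

lemma m_summable:
  assumes \<gamma>: "\<gamma> + \<epsilon> \<le> real DIM('a) * b * (1 - \<kappa>)" and \<rho>: "0 < \<rho>" "\<rho> \<le> R"
  shows "\<mu> x \<rho> / m x \<gamma> \<rho> \<le> C powr (1 - \<kappa>) * (\<rho> / R) powr \<epsilon> * (\<mu> x R / m x \<gamma> R)"
proof -
  have R: "0 < R" using \<rho> by simp
  have eq: "\<mu> x t / m x \<gamma> t = t powr (- \<gamma>) * \<mu> x t powr (1 - \<kappa>)" if "0 < t" for t
    using mu_pos[OF that, of x] that by (simp add: m_def powr_diff powr_minus field_simps)
  have "\<mu> x \<rho> powr (1 - \<kappa>) \<le> (C * (\<rho> / R) powr (real DIM('a) * b) * \<mu> x R) powr (1 - \<kappa>)"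
    using mu_growth[OF \<rho>, of x] mu_pos[OF \<rho>(1), of x] \<kappa> by (intro powr_mono2) auto
  also have "\<dots> = C powr (1 - \<kappa>) * (\<rho> / R) powr (real DIM('a) * b * (1 - \<kappa>)) * \<mu> x R powr (1 - \<kappa>)"
    using C \<rho> R mu_pos[OF R, of x] by (simp add: powr_mult powr_powr)
  finally have "\<rho> powr (- \<gamma>) * \<mu> x \<rho> powr (1 - \<kappa>) \<le> \<rho> powr (- \<gamma>) * (C powr (1 - \<kappa>) * (\<rho> / R) powr (real DIM('a) * b * (1 - \<kappa>)) * \<mu> x R powr (1 - \<kappa>))"
    by (rule mult_left_mono) simp
  also have "\<rho> powr (- \<gamma>) * (C powr (1 - \<kappa>) * (\<rho> / R) powr (real DIM('a) * b * (1 - \<kappa>)) * \<mu> x R powr (1 - \<kappa>))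
     = C powr (1 - \<kappa>) * (\<rho> / R) powr (real DIM('a) * b * (1 - \<kappa>) - \<gamma>) * (R powr (- \<gamma>) * \<mu> x R powr (1 - \<kappa>))"
  proof -
    have 1: "\<rho> powr (- \<gamma>) = R powr (- \<gamma>) * (\<rho> / R) powr (- \<gamma>)" using \<rho> R by (simp add: powr_divide)
    have 2: "(\<rho> / R) powr (real DIM('a) * b * (1 - \<kappa>) - \<gamma>) = (\<rho> / R) powr (- \<gamma>) * (\<rho> / R) powr (real DIM('a) * b * (1 - \<kappa>))"
      unfolding powr_add[symmetric] by simp
    show ?thesis unfolding 1 2 by (simp only: mult_ac)
  qed
  also have "\<dots> \<le> C powr (1 - \<kappa>) * (\<rho> / R) powr \<epsilon> * (R powr (- \<gamma>) * \<mu> x R powr (1 - \<kappa>))"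
    using \<rho> R \<gamma> by (intro mult_right_mono mult_left_mono powr_mono') auto
  finally show ?thesis unfolding eq[OF \<rho>(1)] eq[OF R] .
qed

end

text \<open>The two conditions in \<open>lam\<close> are those of \<open>ex_growth_exponent\<close>
  with the second Morrey exponent written as n \<kappa>, and \<open>tau\<close> stands for n
  \<theta>. The assumption \<open>e_pos\<close> is the bound on \<alpha> multiplied by 1 - \<kappa>;
  for \<kappa> = 1 it no longer restricts \<alpha>.\<close>

locale morrey_data = morrey_weight W q K b C \<kappa>
  for W :: "'a::euclidean_space \<Rightarrow> ennreal" and q K b C \<kappa> :: real +
  fixes p L lam al tau c0 :: real
  assumes p: "1 \<le> p" and L: "Ap p (ennreal L) W" and al: "0 \<le> al"
    and lam: "0 < lam + real DIM('a) * b * \<kappa>" "lam < real DIM('a) * b * (1 - \<kappa>)"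
    and growth0: "\<And>\<rho> R. 0 < \<rho> \<Longrightarrow> \<rho> \<le> R \<Longrightarrow> \<mu> 0 \<rho> \<le> c0 * (\<rho> / R) powr tau * \<mu> 0 R" and c0: "1 \<le> c0"
    and e_pos: "0 < lam - al * (1 - \<kappa>) + tau * \<kappa>"
begin

definition e :: real where "e = lam - al * (1 - \<kappa>)"
text \<open>Half of the gap: with \<gamma> = lam + \<epsilon> the hypothesis of
  \<open>m_summable\<close> holds with equality, one \<epsilon> being spent in \<gamma> and the
  other kept as decay.\<close>

definition \<epsilon> :: real where "\<epsilon> = (real DIM('a) * b * (1 - \<kappa>) - lam) / 2"

lemma eps_pos: "0 < \<epsilon>" using lam by (simp add: \<epsilon>_def)

abbreviation v :: "'a \<Rightarrow> ennreal" where "v \<equiv> power_weight al W"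

lemma borel_measurable_v [measurable]: "v \<in> borel_measurable lebesgue"
proof -
  note [measurable] = measurable_lebesgue_ident pos_weight_measurable[OF W]
  show ?thesis unfolding power_weight_def by measurable
qed

text \<open>The p-th power of the Morrey norm is at most \<open>X\<close>, with the denominator
  multiplied out.\<close>

definition Morrey_bound :: "('a \<Rightarrow> ennreal) \<Rightarrow> ennreal \<Rightarrow> bool" where
  "Morrey_bound f X \<longleftrightarrow> (\<forall>x \<rho>. 0 < \<rho> \<longrightarrow>
     mass (\<lambda>z. epowr (f z) p * v z) (ball x \<rho>) \<le> X * (ennreal (\<rho> powr lam) * epowr (mass v (ball x \<rho>)) \<kappa>))"

lemma v_mass_lower:
  assumes "0 < s" "0 < \<rho>" "\<And>z. z \<in> ball x \<rho> \<Longrightarrow> s \<le> norm z"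
  shows "ennreal (s powr al * \<mu> x \<rho>) \<le> mass v (ball x \<rho>)"
proof -
  have "ennreal (s powr al * \<mu> x \<rho>) = mass (\<lambda>z. ennreal (s powr al) * W z) (ball x \<rho>)"
    using assms pos_weight_measurable[OF W] mu_pos[of \<rho> x] by (simp add: mass_cmult mass_eq_mu ennreal_mult)
  also have "\<dots> \<le> mass v (ball x \<rho>)"
    unfolding power_weight_def using assms al
    by (intro mass_mono_weight mult_right_mono ennreal_leI powr_mono2) auto
  finally show ?thesis .
qed

lemma v_mass_upper:
  assumes "0 < S" "0 < \<rho>" "\<And>z. z \<in> ball x \<rho> \<Longrightarrow> norm z \<le> S"
  shows "mass v (ball x \<rho>) \<le> ennreal (S powr al * \<mu> x \<rho>)"
proof -
  have "mass v (ball x \<rho>) \<le> mass (\<lambda>z. ennreal (S powr al) * W z) (ball x \<rho>)"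
    unfolding power_weight_def using assms al
    by (intro mass_mono_weight mult_right_mono ennreal_leI powr_mono2) auto
  also have "\<dots> = ennreal (S powr al * \<mu> x \<rho>)"
    using assms pos_weight_measurable[OF W] mu_pos[of \<rho> x] by (simp add: mass_cmult mass_eq_mu ennreal_mult)
  finally show ?thesis .
qed

lemma mass_le_of_Morrey_bound:
  assumes f: "Morrey_bound f X" and [measurable]: "f \<in> borel_measurable lebesgue"
    and sub: "E \<subseteq> ball x R" and E: "E \<in> sets lebesgue" and pos: "0 < s" "0 < S" "0 < R"
    and s: "\<And>z. z \<in> E \<Longrightarrow> s \<le> norm z" and S: "\<And>z. z \<in> ball x R \<Longrightarrow> norm z \<le> S"
  shows "mass (\<lambda>z. epowr (f z) p * W z) E \<le> X * ennreal (s powr (- al) * R powr lam * (S powr al * \<mu> x R) powr \<kappa>)"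
proof -
  note [measurable] = pos_weight_measurable[OF W]
  have "mass (\<lambda>z. epowr (f z) p * W z) E \<le> mass (\<lambda>z. ennreal (s powr (- al)) * (epowr (f z) p * v z)) E"
  proof (rule mass_mono_weight)
    fix z assume "z \<in> E"
    then have nz: "s \<le> norm z" by (rule s)
    have "1 = s powr (- al) * s powr al" using pos by (simp add: powr_minus)
    also have "\<dots> \<le> s powr (- al) * norm z powr al"
      using nz pos al by (intro mult_left_mono powr_mono2) auto
    finally have "1 \<le> ennreal (s powr (- al)) * ennreal (norm z powr al)"
      using pos by (simp add: ennreal_mult[symmetric])
    then have "1 * (epowr (f z) p * W z) \<le> ennreal (s powr (- al)) * ennreal (norm z powr al) * (epowr (f z) p * W z)"
      by (rule mult_right_mono) simp
    then show "epowr (f z) p * W z \<le> ennreal (s powr (- al)) * (epowr (f z) p * v z)"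
      by (simp add: power_weight_def mult_ac)
  qed
  also have "\<dots> = ennreal (s powr (- al)) * mass (\<lambda>z. epowr (f z) p * v z) E"
    by (intro mass_cmult E) measurable
  also have "\<dots> \<le> ennreal (s powr (- al)) * mass (\<lambda>z. epowr (f z) p * v z) (ball x R)"
    by (intro mult_left_mono mass_mono sub) auto
  also have "\<dots> \<le> ennreal (s powr (- al)) * (X * (ennreal (R powr lam) * epowr (mass v (ball x R)) \<kappa>))"
    using f pos by (intro mult_left_mono) (auto simp: Morrey_bound_def)
  also have "\<dots> \<le> ennreal (s powr (- al)) * (X * (ennreal (R powr lam) * epowr (ennreal (S powr al * \<mu> x R)) \<kappa>))"
    using \<kappa> pos S by (intro mult_left_mono epowr_mono v_mass_upper) auto
  also have "epowr (ennreal (S powr al * \<mu> x R)) \<kappa> = ennreal ((S powr al * \<mu> x R) powr \<kappa>)"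
    using pos mu_pos[OF pos(3), of x] by (intro epowr_ennreal) auto
  also have "ennreal (s powr (- al)) * (X * (ennreal (R powr lam) * ennreal ((S powr al * \<mu> x R) powr \<kappa>)))
     = X * (ennreal (s powr (- al)) * (ennreal (R powr lam) * ennreal ((S powr al * \<mu> x R) powr \<kappa>)))"
    by (simp only: mult_ac)
  also have "ennreal (s powr (- al)) * (ennreal (R powr lam) * ennreal ((S powr al * \<mu> x R) powr \<kappa>)) = ennreal (s powr (- al) * R powr lam * (S powr al * \<mu> x R) powr \<kappa>)"
    by (simp add: ennreal_mult mult.assoc)
  finally show ?thesis .
qed

definition Cs :: real where "Cs = 2 powr al * c0 powr \<kappa> / (1 - 2 powr (- (e + tau * \<kappa>)))"

lemma e_delta: "0 < e + tau * \<kappa>" using e_pos by (simp add: e_def)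

lemma Cs_pos: "0 < Cs" using c0 geometric_denominator_pos[OF e_delta] by (simp add: Cs_def)

lemma powr_e: "0 < \<rho> \<Longrightarrow> \<rho> powr (- al * (1 - \<kappa>)) * \<rho> powr lam = \<rho> powr e"
  by (simp add: powr_add[symmetric] e_def)

text \<open>On the annulus at radius \<rho> around 0 the norm is comparable with \<rho>, and the
  Morrey bound gives \<rho>^e \<mu>(\<rho>)^\<kappa>. By the growth condition at 0 this decays like
  the power e + tau \<kappa> of \<rho>, and the bound on \<alpha> makes this power positive, so the
  annuli shrinking to 0 can be summed.\<close>

lemma mass_ball_0_le:
  assumes f: "Morrey_bound f X" and [measurable]: "f \<in> borel_measurable lebesgue" and R: "0 < R"
  shows "mass (\<lambda>z. epowr (f z) p * W z) (ball 0 R) \<le> X * ennreal (Cs * (R powr e * \<mu> 0 R powr \<kappa>))"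
proof -
  note [measurable] = pos_weight_measurable[OF W]
  let ?E = "2 powr al * c0 powr \<kappa> * (R powr e * \<mu> 0 R powr \<kappa>)"
  have "mass (\<lambda>z. epowr (f z) p * W z) (ball 0 R) \<le> (X * ennreal ?E) * ennreal (1 / (1 - 2 powr (- (e + tau * \<kappa>))))"
  proof (rule mass_ball_annuli[OF _ e_delta R])
    fix \<rho> assume \<rho>: "0 < \<rho>" "\<rho> \<le> R"
    have "mass (\<lambda>z. epowr (f z) p * W z) (ball 0 \<rho> - ball 0 (\<rho> / 2))
       \<le> X * ennreal ((\<rho> / 2) powr (- al) * \<rho> powr lam * (\<rho> powr al * \<mu> 0 \<rho>) powr \<kappa>)"
      using \<rho> by (intro mass_le_of_Morrey_bound[OF f]) (auto intro!: sets.Diff)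
    also have "(\<rho> / 2) powr (- al) * \<rho> powr lam * (\<rho> powr al * \<mu> 0 \<rho>) powr \<kappa> = 2 powr al * (\<rho> powr e * \<mu> 0 \<rho> powr \<kappa>)"
      using powr_scale[of \<rho> \<rho> 2 1 1 "\<mu> 0 \<rho>" al lam \<kappa>] \<rho> mu_pos[of \<rho> 0] by (simp add: powr_e[symmetric] mult_ac)
    also have "X * ennreal (2 powr al * (\<rho> powr e * \<mu> 0 \<rho> powr \<kappa>)) \<le> X * ennreal (?E * (\<rho> / R) powr (e + tau * \<kappa>))"
    proof (intro mult_left_mono ennreal_leI)
      have "\<mu> 0 \<rho> powr \<kappa> \<le> (c0 * (\<rho> / R) powr tau * \<mu> 0 R) powr \<kappa>"
        using growth0[OF \<rho>] mu_pos[OF \<rho>(1), of 0] \<kappa> by (intro powr_mono2) auto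
      also have "\<dots> = c0 powr \<kappa> * (\<rho> / R) powr (tau * \<kappa>) * \<mu> 0 R powr \<kappa>"
        using c0 \<rho> R mu_pos[OF R, of 0] by (simp add: powr_mult powr_powr)
      finally have "2 powr al * (\<rho> powr e * \<mu> 0 \<rho> powr \<kappa>) \<le> 2 powr al * (\<rho> powr e * (c0 powr \<kappa> * (\<rho> / R) powr (tau * \<kappa>) * \<mu> 0 R powr \<kappa>))"
        by (intro mult_left_mono) auto
      also have "2 powr al * (\<rho> powr e * (c0 powr \<kappa> * (\<rho> / R) powr (tau * \<kappa>) * \<mu> 0 R powr \<kappa>)) = ?E * (\<rho> / R) powr (e + tau * \<kappa>)"
      proof -
        have "\<rho> powr e = R powr e * (\<rho> / R) powr e" using \<rho> R by (simp add: powr_divide)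
        then show ?thesis unfolding powr_add by (simp only: mult_ac)
      qed
      finally show "2 powr al * (\<rho> powr e * \<mu> 0 \<rho> powr \<kappa>) \<le> ?E * (\<rho> / R) powr (e + tau * \<kappa>)" .
    qed auto
    also have "\<dots> = X * ennreal ?E * ennreal ((\<rho> / R) powr (e + tau * \<kappa>))"
      unfolding mult.assoc by (subst ennreal_mult[symmetric]) (auto simp: mult.assoc)
    finally show "mass (\<lambda>z. epowr (f z) p * W z) (ball 0 \<rho> - ball 0 (\<rho> / 2)) \<le> X * ennreal ?E * ennreal ((\<rho> / R) powr (e + tau * \<kappa>))" .
  qed measurable
  also have "\<dots> = X * ennreal (Cs * (R powr e * \<mu> 0 R powr \<kappa>))"
    using geometric_denominator_pos[OF e_delta] unfolding mult.assoc
    by (subst ennreal_mult[symmetric]) (auto simp: Cs_def mult_ac)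
  finally show ?thesis .
qed

lemma mass_power_weight_le_wint_U:
  assumes r: "0 < r" and S: "0 < S" "\<And>z. z \<in> ball x r \<Longrightarrow> norm z \<le> S" and [measurable]: "g \<in> borel_measurable lebesgue"
  shows "mass (\<lambda>z. epowr (g z) p * v z) (ball x r) \<le> ennreal (S powr al * m x \<gamma> r) * wint p (U x \<gamma> r) g"
proof -
  note [measurable] = pos_weight_measurable[OF pos_weight_U[OF r]]
  have "mass (\<lambda>z. epowr (g z) p * v z) (ball x r) \<le> mass (\<lambda>z. ennreal (S powr al * m x \<gamma> r) * (epowr (g z) p * U x \<gamma> r z)) (ball x r)"
  proof (rule mass_mono_weight)
    fix z assume z: "z \<in> ball x r"
    then have "max (dist x z) r = r" by auto
    then have Wz: "W z = ennreal (m x \<gamma> r) * U x \<gamma> r z" using W_eq_U[OF r, of z x \<gamma>] by simp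
    have "v z \<le> ennreal (S powr al) * (ennreal (m x \<gamma> r) * U x \<gamma> r z)"
      unfolding power_weight_def Wz using S z al by (intro mult_right_mono ennreal_leI powr_mono2) auto
    also have "\<dots> = ennreal (S powr al * m x \<gamma> r) * U x \<gamma> r z"
      using m_pos[OF r, of x \<gamma>] by (simp add: ennreal_mult mult.assoc)
    finally have "epowr (g z) p * v z \<le> epowr (g z) p * (ennreal (S powr al * m x \<gamma> r) * U x \<gamma> r z)" by (rule mult_left_mono) simp
    then show "epowr (g z) p * v z \<le> ennreal (S powr al * m x \<gamma> r) * (epowr (g z) p * U x \<gamma> r z)" by (simp only: mult_ac)
  qed
  also have "\<dots> = ennreal (S powr al * m x \<gamma> r) * mass (\<lambda>z. epowr (g z) p * U x \<gamma> r z) (ball x r)"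
    by (intro mass_cmult) auto
  also have "\<dots> \<le> ennreal (S powr al * m x \<gamma> r) * mass (\<lambda>z. epowr (g z) p * U x \<gamma> r z) UNIV"
    by (intro mult_left_mono mass_mono) auto
  finally show ?thesis by (simp add: wint_def mass_UNIV)
qed

end

section \<open>Transfer of Morrey bounds from \<open>f\<close> to \<open>g\<close>\<close>

context morrey_data
begin

text \<open>The larger of the constants of the two families of adapted weights. It depends neither
  on the ball nor on the pair of functions, so extrapolation is invoked only once.\<close>

definition \<Lambda> :: ennreal where
  "\<Lambda> = max (ennreal (cU (C powr \<kappa>) (C powr (1 - \<kappa>)) \<epsilon> (lam + \<epsilon>)) * ennreal L)
           (ennreal (cU (c0 powr \<kappa>) (C powr (1 - \<kappa>)) \<epsilon> (e + \<epsilon>)) * ennreal L)"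

lemma \<Lambda>_finite: "\<Lambda> < top"
  by (simp add: \<Lambda>_def max_def ennreal_mult_less_top)

definition controls :: "real \<Rightarrow> ('a \<Rightarrow> ennreal) \<Rightarrow> ('a \<Rightarrow> ennreal) \<Rightarrow> bool" where
  "controls Ce f g \<longleftrightarrow> (\<forall>Y. pos_weight Y \<longrightarrow> Ap p \<Lambda> Y \<longrightarrow> wint p Y g \<le> ennreal Ce * wint p Y f)"

definition A0 :: real where "A0 = 2 powr al * 2 powr (al * \<kappa>)"
text \<open>The first summand is for annuli that stay away from 0, the second for those that may
  reach it, where \<open>mass_ball_0_le\<close> is used.\<close>

definition A1 :: real where
  "A1 = 2 powr al * 2 powr lam * 3 powr (al * \<kappa>) * (K * 4 powr (real DIM('a) * q)) powr \<kappa>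
     + Cs * 5 powr e * 4 powr \<bar>lam\<bar> * (K * 20 powr (real DIM('a) * q)) powr \<kappa>"

lemma A0_nonneg: "0 \<le> A0" by (simp add: A0_def)
lemma A1_nonneg: "0 \<le> A1" using Cs_pos by (simp add: A1_def)

lemma mu_double_powr:
  assumes "0 < \<rho>"
  shows "\<mu> x (2 * \<rho>) powr \<kappa> \<le> (K * 4 powr (real DIM('a) * q)) powr \<kappa> * \<mu> x \<rho> powr \<kappa>"
proof -
  have "\<mu> x (2 * \<rho>) powr \<kappa> \<le> (K * 4 powr (real DIM('a) * q) * \<mu> x \<rho>) powr \<kappa>"
    using mu_le_of_comparable[of \<rho> "2 * \<rho>" x] mu_pos[of "2 * \<rho>" x] assms \<kappa> by (intro powr_mono2) auto
  then show ?thesis using K mu_pos[OF assms, of x] by (simp add: powr_mult)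
qed

lemma mass_ball_away_le:
  assumes f: "Morrey_bound f X" "f \<in> borel_measurable lebesgue" and r: "0 < r" "2 * r \<le> norm x"
  shows "mass (\<lambda>z. epowr (f z) p * W z) (ball x r)
     \<le> X * ennreal (A0 * (norm x powr (- al * (1 - \<kappa>)) * r powr lam * \<mu> x r powr \<kappa>))"
proof -
  let ?d = "norm x"
  have nz: "?d / 2 \<le> norm z \<and> norm z \<le> 2 * ?d" if "z \<in> ball x r" for z
    using that r norm_triangle_ineq2[of x z] norm_triangle_ineq2[of z x] by (auto simp: dist_norm norm_minus_commute)
  have d: "0 < ?d" using r by linarith
  have "mass (\<lambda>z. epowr (f z) p * W z) (ball x r) \<le> X * ennreal ((?d / 2) powr (- al) * r powr lam * ((2 * ?d) powr al * \<mu> x r) powr \<kappa>)"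
    using r d nz by (intro mass_le_of_Morrey_bound[OF f]) auto
  also have "(?d / 2) powr (- al) * r powr lam * ((2 * ?d) powr al * \<mu> x r) powr \<kappa> = A0 * (?d powr (- al * (1 - \<kappa>)) * r powr lam * \<mu> x r powr \<kappa>)"
    using powr_scale[of ?d r 2 1 2 "\<mu> x r" al lam \<kappa>] d r mu_pos[of r x] by (simp add: A0_def)
  finally show ?thesis .
qed

text \<open>If \<rho> is small against \<open>norm x\<close>, norms on the annulus are comparable
  with \<open>norm x\<close>. If \<rho> is large they are comparable with \<rho>, and \<rho>^(- al
  (1 - \<kappa>)) is at most the same power of \<open>norm x\<close>. In between the annulus may
  contain 0, and it is enclosed in a ball around 0.\<close>

lemma mass_annulus_away_le:
  assumes f: "Morrey_bound f X" "f \<in> borel_measurable lebesgue" and \<rho>: "0 < \<rho>" and x: "x \<noteq> 0"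
  shows "mass (\<lambda>z. epowr (f z) p * W z) (ball x (2 * \<rho>) - ball x \<rho>)
     \<le> X * ennreal (A1 * (norm x powr (- al * (1 - \<kappa>)) * \<rho> powr lam * \<mu> x \<rho> powr \<kappa>))"
    (is "mass ?F ?E \<le> X * ennreal (A1 * ?G)")
proof -
  let ?d = "norm x"
  have d: "0 < ?d" using x by simp
  let ?k4 = "(K * 4 powr (real DIM('a) * q)) powr \<kappa>"
  let ?B1 = "2 powr al * 2 powr lam * 3 powr (al * \<kappa>) * ?k4"
  let ?B2 = "Cs * 5 powr e * 4 powr \<bar>lam\<bar> * (K * 20 powr (real DIM('a) * q)) powr \<kappa>"
  have G: "0 \<le> ?G" by simp
  have A1: "?B1 \<le> A1" "?B2 \<le> A1" using Cs_pos by (auto simp: A1_def)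
  have up: "\<exists>B. mass ?F ?E \<le> X * ennreal B \<and> B \<le> A1 * ?G \<Longrightarrow> ?thesis"
    by (auto elim!: order_trans intro!: mult_left_mono ennreal_leI)
  have Es: "?E \<in> sets lebesgue" by (intro sets.Diff) auto
  have mu2: "0 \<le> \<mu> x (2 * \<rho>)" using mu_pos[of "2 * \<rho>" x] \<rho> by simp
  have near0: "norm z \<le> ?d + dist x z" "?d \<le> norm z + dist x z" "dist x z \<le> norm z + ?d" for z
    using norm_triangle_ineq2[of x z] norm_triangle_ineq2[of z x] norm_triangle_ineq4[of x z] by (auto simp: dist_norm norm_minus_commute)
  consider "4 * \<rho> \<le> ?d" | "2 * ?d \<le> \<rho>" | "\<rho> < 2 * ?d" "?d < 4 * \<rho>" by linarith
  then show ?thesis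
  proof cases
    case 1
    show ?thesis
    proof (rule up, intro exI conjI)
      show "mass ?F ?E \<le> X * ennreal ((?d / 2) powr (- al) * (2 * \<rho>) powr lam * ((2 * ?d) powr al * \<mu> x (2 * \<rho>)) powr \<kappa>)"
      proof (rule mass_le_of_Morrey_bound[OF f _ Es])
        show "?d / 2 \<le> norm z" if "z \<in> ?E" for z using near0(2)[of z] that 1 by auto
        show "norm z \<le> 2 * ?d" if "z \<in> ball x (2 * \<rho>)" for z
        proof -
          have "dist x z < 2 * \<rho>" using that by simp
          then show ?thesis using near0(1)[of z] 1 norm_ge_zero[of x] by linarith
        qed
      qed (use \<rho> d in auto)
      have "(?d / 2) powr (- al) * (2 * \<rho>) powr lam * ((2 * ?d) powr al * \<mu> x (2 * \<rho>)) powr \<kappa>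
          = (2 powr al * 2 powr lam * 2 powr (al * \<kappa>)) * (?d powr (- al * (1 - \<kappa>)) * \<rho> powr lam * \<mu> x (2 * \<rho>) powr \<kappa>)"
        by (rule powr_scale) (use d \<rho> mu2 in auto)
      also have "\<dots> \<le> (2 powr al * 2 powr lam * 3 powr (al * \<kappa>)) * (?d powr (- al * (1 - \<kappa>)) * \<rho> powr lam * (?k4 * \<mu> x \<rho> powr \<kappa>))"
        using al \<kappa> by (intro mult_mono mult_left_mono mu_double_powr \<rho> powr_mono2 order_refl) auto
      also have "\<dots> = ?B1 * ?G" by (simp only: mult_ac)
      also have "\<dots> \<le> A1 * ?G" by (intro mult_right_mono A1 G)
      finally show "(?d / 2) powr (- al) * (2 * \<rho>) powr lam * ((2 * ?d) powr al * \<mu> x (2 * \<rho>)) powr \<kappa> \<le> A1 * ?G" .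
    qed
  next
    case 2
    show ?thesis
    proof (rule up, intro exI conjI)
      show "mass ?F ?E \<le> X * ennreal ((\<rho> / 2) powr (- al) * (2 * \<rho>) powr lam * ((3 * \<rho>) powr al * \<mu> x (2 * \<rho>)) powr \<kappa>)"
      proof (rule mass_le_of_Morrey_bound[OF f _ Es])
        show "\<rho> / 2 \<le> norm z" if "z \<in> ?E" for z using near0(3)[of z] that 2 by auto
        show "norm z \<le> 3 * \<rho>" if "z \<in> ball x (2 * \<rho>)" for z using near0(1)[of z] that 2 \<rho> by auto
      qed (use \<rho> in auto)
      have "(\<rho> / 2) powr (- al) * (2 * \<rho>) powr lam * ((3 * \<rho>) powr al * \<mu> x (2 * \<rho>)) powr \<kappa>
          = (2 powr al * 2 powr lam * 3 powr (al * \<kappa>)) * (\<rho> powr (- al * (1 - \<kappa>)) * \<rho> powr lam * \<mu> x (2 * \<rho>) powr \<kappa>)"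
        by (rule powr_scale) (use \<rho> mu2 in auto)
      also have "\<dots> \<le> (2 powr al * 2 powr lam * 3 powr (al * \<kappa>)) * (?d powr (- al * (1 - \<kappa>)) * \<rho> powr lam * (?k4 * \<mu> x \<rho> powr \<kappa>))"
      proof (intro mult_mono mult_left_mono mu_double_powr \<rho> order_refl)
        show "\<rho> powr (- al * (1 - \<kappa>)) \<le> ?d powr (- al * (1 - \<kappa>))"
        proof (rule powr_mono2')
          show "?d \<le> \<rho>" using 2 norm_ge_zero[of x] by linarith
          show "- al * (1 - \<kappa>) \<le> 0" using al \<kappa> by simp
        qed (rule d)
      qed auto
      also have "\<dots> = ?B1 * ?G" by (simp only: mult_ac)
      also have "\<dots> \<le> A1 * ?G" by (intro mult_right_mono A1 G)
      finally show "(\<rho> / 2) powr (- al) * (2 * \<rho>) powr lam * ((3 * \<rho>) powr al * \<mu> x (2 * \<rho>)) powr \<kappa> \<le> A1 * ?G" .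
    qed
  next
    case 3
    show ?thesis
    proof (rule up, intro exI conjI)
      \<comment> \<open>Here 2 \<rho> < 4 \<open>?d\<close>, which gives the factor 5; and
        \<open>?d\<close> < 4 \<rho> gives the radius 20 \<rho> used below to return to
        \<open>\<mu> x \<rho>\<close>.\<close>
      have "?E \<subseteq> ball 0 (5 * ?d)"
      proof
        fix z assume "z \<in> ?E"
        then show "z \<in> ball 0 (5 * ?d)" using near0(1)[of z] 3 by auto
      qed
      then have "mass ?F ?E \<le> mass ?F (ball 0 (5 * ?d))" by (rule mass_mono)
      also have "\<dots> \<le> X * ennreal (Cs * ((5 * ?d) powr e * \<mu> 0 (5 * ?d) powr \<kappa>))"
        using d by (intro mass_ball_0_le[OF f]) auto
      finally show "mass ?F ?E \<le> X * ennreal (Cs * ((5 * ?d) powr e * \<mu> 0 (5 * ?d) powr \<kappa>))" .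
      have "(5 * ?d) powr e = 5 powr e * (?d powr (- al * (1 - \<kappa>)) * ?d powr lam)"
        unfolding powr_e[OF d] using d by (simp add: powr_mult)
      also have "\<dots> \<le> 5 powr e * (?d powr (- al * (1 - \<kappa>)) * (4 powr \<bar>lam\<bar> * \<rho> powr lam))"
        using 3 d \<rho> by (intro mult_left_mono powr_comparable) auto
      finally have 1: "(5 * ?d) powr e \<le> 5 powr e * (?d powr (- al * (1 - \<kappa>)) * (4 powr \<bar>lam\<bar> * \<rho> powr lam))" .
      have "\<mu> 0 (5 * ?d) \<le> \<mu> 0 (20 * \<rho>)" using d \<rho> 3 by (intro mu_mono) auto
      also have "\<dots> \<le> K * 20 powr (real DIM('a) * q) * \<mu> x \<rho>"
      proof (rule mu_compare[OF \<rho>])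
        show "ball x \<rho> \<subseteq> ball 0 (20 * \<rho>)" using 3 \<rho> by (auto simp: ball_subset_ball_iff)
      qed simp
      finally have "\<mu> 0 (5 * ?d) powr \<kappa> \<le> (K * 20 powr (real DIM('a) * q) * \<mu> x \<rho>) powr \<kappa>"
        using mu_pos[of "5 * ?d" 0] d \<kappa> by (intro powr_mono2) auto
      also have "\<dots> = (K * 20 powr (real DIM('a) * q)) powr \<kappa> * \<mu> x \<rho> powr \<kappa>"
        using K mu_pos[OF \<rho>, of x] by (simp add: powr_mult)
      finally have 2: "\<mu> 0 (5 * ?d) powr \<kappa> \<le> (K * 20 powr (real DIM('a) * q)) powr \<kappa> * \<mu> x \<rho> powr \<kappa>" .
      have "Cs * ((5 * ?d) powr e * \<mu> 0 (5 * ?d) powr \<kappa>)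
         \<le> Cs * ((5 powr e * (?d powr (- al * (1 - \<kappa>)) * (4 powr \<bar>lam\<bar> * \<rho> powr lam))) * ((K * 20 powr (real DIM('a) * q)) powr \<kappa> * \<mu> x \<rho> powr \<kappa>))"
        using Cs_pos by (intro mult_left_mono mult_mono 1 2) auto
      also have "\<dots> = ?B2 * ?G" by (simp only: mult_ac)
      also have "\<dots> \<le> A1 * ?G" by (intro mult_right_mono A1 G)
      finally show "Cs * ((5 * ?d) powr e * \<mu> 0 (5 * ?d) powr \<kappa>) \<le> A1 * ?G" .
    qed
  qed
qed

definition Z1 :: real where "Z1 = 1 + C powr \<kappa> / (1 - 2 powr (- \<epsilon>))"
definition Z2 :: real where "Z2 = 1 + c0 powr \<kappa> / (1 - 2 powr (- \<epsilon>))"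

lemma Z_nonneg: "0 \<le> Z1" "0 \<le> Z2"
  using geometric_denominator_pos[OF eps_pos] by (auto simp: Z1_def Z2_def)

lemma m_eps: "0 < \<rho> \<Longrightarrow> \<rho> powr (- \<epsilon>) * m x (s + \<epsilon>) \<rho> = \<rho> powr s * \<mu> x \<rho> powr \<kappa>"
  by (simp add: m_def powr_add powr_minus)

lemma ennreal_chain_le:
  assumes "I \<le> ennreal S * J" "J \<le> ennreal Ce * H" "H \<le> X * ennreal T"
    and "S * T \<le> P * M" "ennreal M \<le> D" "0 \<le> S" "0 \<le> T" "0 \<le> P" "0 \<le> M" "0 \<le> Ce"
  shows "I \<le> ennreal (P * Ce) * X * D"
proof -
  have "I \<le> ennreal S * (ennreal Ce * (X * ennreal T))"
    by (intro order_trans[OF assms(1)] mult_left_mono order_trans[OF assms(2)] assms(3)) auto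
  also have "\<dots> = ennreal Ce * X * (ennreal S * ennreal T)" by (simp only: mult_ac)
  also have "ennreal S * ennreal T = ennreal (S * T)" using assms by (intro ennreal_mult[symmetric])
  also have "ennreal Ce * X * ennreal (S * T) \<le> ennreal Ce * X * ennreal (P * M)"
    by (intro mult_left_mono ennreal_leI assms) auto
  also have "ennreal (P * M) = ennreal P * ennreal M" using assms by (intro ennreal_mult)
  also have "ennreal Ce * X * (ennreal P * ennreal M) = (ennreal P * ennreal Ce) * X * ennreal M" by (simp only: mult_ac)
  also have "ennreal P * ennreal Ce = ennreal (P * Ce)" using assms by (intro ennreal_mult[symmetric])
  also have "ennreal (P * Ce) * X * ennreal M \<le> ennreal (P * Ce) * X * D" by (intro mult_left_mono assms) auto
  finally show ?thesis .
qed

lemma Morrey_denominator_ge: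
  assumes "0 \<le> t" "ennreal t \<le> mass v (ball x r)" "0 < r"
  shows "ennreal (r powr lam * t powr \<kappa>) \<le> ennreal (r powr lam) * epowr (mass v (ball x r)) \<kappa>"
proof (cases "t = 0")
  case False
  then have "ennreal (r powr lam * t powr \<kappa>) = ennreal (r powr lam) * epowr (ennreal t) \<kappa>"
    using assms by (simp add: epowr_ennreal ennreal_mult)
  also have "\<dots> \<le> ennreal (r powr lam) * epowr (mass v (ball x r)) \<kappa>"
    using assms \<kappa> by (intro mult_left_mono epowr_mono) auto
  finally show ?thesis .
qed simp

definition P1 :: real where "P1 = (A0 + A1) * Z1 * 2 powr al * 2 powr (al * \<kappa>)"

text \<open>On B(x, r) the factor \<open>norm z powr al\<close> is comparable with d^al, d =
  \<open>norm x\<close>. Multiplied by the cost d^(- al (1 - \<kappa>)) of the bound for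
  \<open>f\<close>, it leaves d^(al \<kappa>), which is what the power \<kappa> of the mass of
  \<open>v\<close> in the denominator contains.\<close>

lemma Morrey_bound_away:
  assumes f: "Morrey_bound f X" "f \<in> borel_measurable lebesgue" and g: "g \<in> borel_measurable lebesgue"
    and ctrl: "controls Ce f g" and Ce: "0 \<le> Ce" and r: "0 < r" "2 * r \<le> norm x"
  shows "mass (\<lambda>z. epowr (g z) p * v z) (ball x r) \<le> ennreal (P1 * Ce) * X * (ennreal (r powr lam) * epowr (mass v (ball x r)) \<kappa>)"
proof -
  let ?d = "norm x" and ?\<gamma> = "lam + \<epsilon>"
  have d: "0 < ?d" using r by linarith
  have x: "x \<noteq> 0" using d by simp
  let ?D = "?d powr (- al * (1 - \<kappa>))"
  let ?a = "(A0 + A1) * ?D"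
  have C1: "1 \<le> C powr \<kappa>" "1 \<le> C powr (1 - \<kappa>)" using C \<kappa> by (auto simp: ge_one_powr_ge_zero)
  have quasi: "m x ?\<gamma> \<rho> \<le> C powr \<kappa> * m x ?\<gamma> R" if "r \<le> \<rho>" "\<rho> \<le> R" for \<rho> R
  proof (rule m_quasi_increasing[OF mu_growth C])
    show "0 \<le> ?\<gamma> + real DIM('a) * b * \<kappa>" using lam(1) eps_pos by simp
  qed (use that r in auto)
  have summ: "\<mu> x \<rho> / m x ?\<gamma> \<rho> \<le> C powr (1 - \<kappa>) * (\<rho> / R) powr \<epsilon> * (\<mu> x R / m x ?\<gamma> R)" if "r \<le> \<rho>" "\<rho> \<le> R" for \<rho> R
    using that r by (intro m_summable) (auto simp: \<epsilon>_def)
  have "Ap p (ennreal (cU (C powr \<kappa>) (C powr (1 - \<kappa>)) \<epsilon> ?\<gamma>) * ennreal L) (U x ?\<gamma> r)"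
    by (rule Ap_U[OF r(1) eps_pos C1 p L quasi summ])
  then have "Ap p \<Lambda> (U x ?\<gamma> r)" by (rule Ap_mono) (simp add: \<Lambda>_def)
  then have ext: "wint p (U x ?\<gamma> r) g \<le> ennreal Ce * wint p (U x ?\<gamma> r) f"
    using ctrl pos_weight_U[OF r(1)] by (simp add: controls_def)
  have a: "A0 * (?D * \<rho> powr lam * \<mu> x \<rho> powr \<kappa>) \<le> ?a * \<rho> powr (- \<epsilon>) * m x ?\<gamma> \<rho>"
       "A1 * (?D * \<rho> powr lam * \<mu> x \<rho> powr \<kappa>) \<le> ?a * \<rho> powr (- \<epsilon>) * m x ?\<gamma> \<rho>" if "0 < \<rho>" for \<rho>
  proof -
    have "?a * \<rho> powr (- \<epsilon>) * m x ?\<gamma> \<rho> = (A0 + A1) * (?D * \<rho> powr lam * \<mu> x \<rho> powr \<kappa>)"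
      unfolding mult.assoc m_eps[OF that] by (simp only: mult_ac)
    moreover have "A0 * (?D * \<rho> powr lam * \<mu> x \<rho> powr \<kappa>) \<le> (A0 + A1) * (?D * \<rho> powr lam * \<mu> x \<rho> powr \<kappa>)"
       "A1 * (?D * \<rho> powr lam * \<mu> x \<rho> powr \<kappa>) \<le> (A0 + A1) * (?D * \<rho> powr lam * \<mu> x \<rho> powr \<kappa>)"
      using A0_nonneg A1_nonneg by (intro mult_right_mono; simp)+
    ultimately show "A0 * (?D * \<rho> powr lam * \<mu> x \<rho> powr \<kappa>) \<le> ?a * \<rho> powr (- \<epsilon>) * m x ?\<gamma> \<rho>"
       "A1 * (?D * \<rho> powr lam * \<mu> x \<rho> powr \<kappa>) \<le> ?a * \<rho> powr (- \<epsilon>) * m x ?\<gamma> \<rho>"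
      by (simp_all only:)
  qed
  have fI: "wint p (U x ?\<gamma> r) f \<le> X * ennreal (?a * Z1 * r powr (- \<epsilon>))"
    unfolding Z1_def
  proof (rule wint_U_le[OF r(1) eps_pos C1(1) _ f(2) quasi])
    show "0 \<le> ?a" using A0_nonneg A1_nonneg by simp
    show "mass (\<lambda>z. epowr (f z) p * W z) (ball x r) \<le> X * ennreal (?a * r powr (- \<epsilon>) * m x ?\<gamma> r)"
      by (rule order_trans[OF mass_ball_away_le[OF f r]]) (intro mult_left_mono ennreal_leI a r, simp)
    show "mass (\<lambda>z. epowr (f z) p * W z) (ball x (2 * \<rho>) - ball x \<rho>) \<le> X * ennreal (?a * \<rho> powr (- \<epsilon>) * m x ?\<gamma> \<rho>)" if "r \<le> \<rho>" for \<rho>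
    proof -
      have "0 < \<rho>" using that r by simp
      then show ?thesis
        by (intro order_trans[OF mass_annulus_away_le[OF f _ x]] mult_left_mono ennreal_leI a) auto
    qed
  qed
  have nz: "?d / 2 \<le> norm z \<and> norm z \<le> 2 * ?d" if "z \<in> ball x r" for z
    using that r norm_triangle_ineq2[of x z] norm_triangle_ineq2[of z x] by (auto simp: dist_norm norm_minus_commute)
  let ?t = "(?d / 2) powr al * \<mu> x r"
  show ?thesis
  proof (rule ennreal_chain_le[OF _ ext fI _ Morrey_denominator_ge[of ?t]])
    show "mass (\<lambda>z. epowr (g z) p * v z) (ball x r) \<le> ennreal ((2 * ?d) powr al * m x ?\<gamma> r) * wint p (U x ?\<gamma> r) g"
      by (rule mass_power_weight_le_wint_U[OF r(1) _ _ g]) (use d nz in auto)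
    have "(2 * ?d) powr al * m x ?\<gamma> r * (?a * Z1 * r powr (- \<epsilon>)) = (2 * ?d) powr al * ?a * Z1 * (r powr (- \<epsilon>) * m x ?\<gamma> r)"
      by (simp only: mult_ac)
    also have "\<dots> = (A0 + A1) * Z1 * ((2 * ?d) powr al * ?D) * (r powr lam * \<mu> x r powr \<kappa>)"
      unfolding m_eps[OF r(1)] by (simp only: mult_ac)
    also have "(2 * ?d) powr al * ?D = 2 powr al * 2 powr (al * \<kappa>) * (?d / 2) powr (al * \<kappa>)"
    proof -
      have "?d powr al * ?D = ?d powr (al * \<kappa>)" by (simp add: powr_add[symmetric] algebra_simps)
      then show ?thesis using d by (simp add: powr_mult powr_divide)
    qed
    also have "(A0 + A1) * Z1 * (2 powr al * 2 powr (al * \<kappa>) * (?d / 2) powr (al * \<kappa>)) * (r powr lam * \<mu> x r powr \<kappa>)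
       = P1 * (r powr lam * ((?d / 2) powr (al * \<kappa>) * \<mu> x r powr \<kappa>))" unfolding P1_def by (simp only: mult_ac)
    also have "(?d / 2) powr (al * \<kappa>) * \<mu> x r powr \<kappa> = ?t powr \<kappa>"
      using mu_pos[OF r(1), of x] by (simp add: powr_mult powr_powr)
    finally show "(2 * ?d) powr al * m x ?\<gamma> r * (?a * Z1 * r powr (- \<epsilon>)) \<le> P1 * (r powr lam * ?t powr \<kappa>)" by simp
    show "ennreal ?t \<le> mass v (ball x r)" by (rule v_mass_lower) (use d r nz in auto)
  qed (use r Ce A0_nonneg A1_nonneg Z_nonneg m_pos[OF r(1), of x ?\<gamma>] mu_pos[OF r(1), of x] in \<open>auto simp: P1_def\<close>)
qed

definition A2 :: real where "A2 = Cs * (1 + 2 powr e * (K * 4 powr (real DIM('a) * q)) powr \<kappa>)"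
definition P2 :: real where
  "P2 = A2 * Z2 * 3 powr lam * 12 powr (al * \<kappa>) * (K * 12 powr (real DIM('a) * q)) powr \<kappa>"

lemma A2_nonneg: "0 \<le> A2" using Cs_pos by (simp add: A2_def)

text \<open>The ball is enlarged to B(0, 3 r), where the weight adapted to 0 at scale 3 r is used.
  The denominator still belongs to B(x, r) and must be bounded from below, although \<open>v\<close>
  degenerates at 0.\<close>

lemma Morrey_bound_near:
  assumes f: "Morrey_bound f X" "f \<in> borel_measurable lebesgue" and g: "g \<in> borel_measurable lebesgue"
    and ctrl: "controls Ce f g" and Ce: "0 \<le> Ce" and r: "0 < r" "norm x < 2 * r"
  shows "mass (\<lambda>z. epowr (g z) p * v z) (ball x r) \<le> ennreal (P2 * Ce) * X * (ennreal (r powr lam) * epowr (mass v (ball x r)) \<kappa>)"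
proof -
  let ?\<gamma> = "e + \<epsilon>" and ?R = "3 * r"
  have R: "0 < ?R" using r by simp
  have c01: "1 \<le> c0 powr \<kappa>" "1 \<le> C powr (1 - \<kappa>)" using C c0 \<kappa> by (auto simp: ge_one_powr_ge_zero)
  have quasi: "m 0 ?\<gamma> \<rho> \<le> c0 powr \<kappa> * m 0 ?\<gamma> S" if "?R \<le> \<rho>" "\<rho> \<le> S" for \<rho> S
  proof (rule m_quasi_increasing[OF growth0 c0])
    show "0 \<le> ?\<gamma> + tau * \<kappa>" using e_delta eps_pos by simp
  qed (use that r in auto)
  have e_le: "e \<le> lam" using al \<kappa> by (simp add: e_def)
  have summ: "\<mu> 0 \<rho> / m 0 ?\<gamma> \<rho> \<le> C powr (1 - \<kappa>) * (\<rho> / S) powr \<epsilon> * (\<mu> 0 S / m 0 ?\<gamma> S)" if "?R \<le> \<rho>" "\<rho> \<le> S" for \<rho> S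
    using that r e_le by (intro m_summable) (auto simp: \<epsilon>_def)
  have "Ap p (ennreal (cU (c0 powr \<kappa>) (C powr (1 - \<kappa>)) \<epsilon> ?\<gamma>) * ennreal L) (U 0 ?\<gamma> ?R)"
    by (rule Ap_U[OF R eps_pos c01 p L quasi summ])
  then have "Ap p \<Lambda> (U 0 ?\<gamma> ?R)" by (rule Ap_mono) (simp add: \<Lambda>_def)
  then have ext: "wint p (U 0 ?\<gamma> ?R) g \<le> ennreal Ce * wint p (U 0 ?\<gamma> ?R) f"
    using ctrl pos_weight_U[OF R] by (simp add: controls_def)
  let ?k4 = "(K * 4 powr (real DIM('a) * q)) powr \<kappa>"
  have A2eq: "A2 * \<rho> powr (- \<epsilon>) * m 0 ?\<gamma> \<rho> = Cs * (\<rho> powr e * \<mu> 0 \<rho> powr \<kappa>) + Cs * (2 powr e * ?k4) * (\<rho> powr e * \<mu> 0 \<rho> powr \<kappa>)" if "0 < \<rho>" for \<rho>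
    unfolding mult.assoc m_eps[OF that] A2_def by (simp add: algebra_simps)
  have fI: "wint p (U 0 ?\<gamma> ?R) f \<le> X * ennreal (A2 * Z2 * ?R powr (- \<epsilon>))"
    unfolding Z2_def
  proof (rule wint_U_le[OF R eps_pos c01(1) A2_nonneg f(2) quasi])
    show "mass (\<lambda>z. epowr (f z) p * W z) (ball 0 ?R) \<le> X * ennreal (A2 * ?R powr (- \<epsilon>) * m 0 ?\<gamma> ?R)"
    proof (rule order_trans[OF mass_ball_0_le[OF f R]], intro mult_left_mono ennreal_leI)
      show "Cs * (?R powr e * \<mu> 0 ?R powr \<kappa>) \<le> A2 * ?R powr (- \<epsilon>) * m 0 ?\<gamma> ?R"
        unfolding A2eq[OF R] using Cs_pos by simp
    qed simp
    fix \<rho> assume "?R \<le> \<rho>"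
    then have \<rho>: "0 < \<rho>" using R by simp
    have "mass (\<lambda>z. epowr (f z) p * W z) (ball 0 (2 * \<rho>) - ball 0 \<rho>) \<le> mass (\<lambda>z. epowr (f z) p * W z) (ball 0 (2 * \<rho>))"
      by (rule mass_mono) auto
    also have "\<dots> \<le> X * ennreal (Cs * ((2 * \<rho>) powr e * \<mu> 0 (2 * \<rho>) powr \<kappa>))"
      using \<rho> by (intro mass_ball_0_le[OF f]) auto
    also have "\<dots> \<le> X * ennreal (A2 * \<rho> powr (- \<epsilon>) * m 0 ?\<gamma> \<rho>)"
    proof (intro mult_left_mono ennreal_leI)
      have "Cs * ((2 * \<rho>) powr e * \<mu> 0 (2 * \<rho>) powr \<kappa>) \<le> Cs * ((2 * \<rho>) powr e * (?k4 * \<mu> 0 \<rho> powr \<kappa>))"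
        using Cs_pos by (intro mult_left_mono mu_double_powr \<rho>) auto
      also have "Cs * ((2 * \<rho>) powr e * (?k4 * \<mu> 0 \<rho> powr \<kappa>)) = Cs * (2 powr e * ?k4) * (\<rho> powr e * \<mu> 0 \<rho> powr \<kappa>)"
      proof -
        have "(2 * \<rho>) powr e = 2 powr e * \<rho> powr e" using \<rho> by (simp add: powr_mult)
        then show ?thesis by (simp only: mult_ac)
      qed
      also have "\<dots> \<le> A2 * \<rho> powr (- \<epsilon>) * m 0 ?\<gamma> \<rho>"
        unfolding A2eq[OF \<rho>] using Cs_pos by simp
      finally show "Cs * ((2 * \<rho>) powr e * \<mu> 0 (2 * \<rho>) powr \<kappa>) \<le> A2 * \<rho> powr (- \<epsilon>) * m 0 ?\<gamma> \<rho>" .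
    qed simp
    finally show "mass (\<lambda>z. epowr (f z) p * W z) (ball 0 (2 * \<rho>) - ball 0 \<rho>) \<le> X * ennreal (A2 * \<rho> powr (- \<epsilon>) * m 0 ?\<gamma> \<rho>)" .
  qed
  \<comment> \<open>A direction pointing away from 0, arbitrary when x = 0. Moving x by r / 2 along
    it gives the centre of a ball of radius r / 4 inside B(x, r) on which norms are at least r / 4;
    the factor 12 below is the ratio of 3 r to r / 4.\<close>
  obtain u :: 'a where u: "norm u = 1" "norm (x + (r / 2) *\<^sub>R u) = norm x + r / 2"
  proof (cases "x = 0")
    case True
    obtain u :: 'a where "u \<in> Basis" using nonempty_Basis by blast
    then show ?thesis using True r by (intro that[of u]) auto
  next
    case False
    have "x + (r / 2) *\<^sub>R sgn x = (1 + r / 2 / norm x) *\<^sub>R x" by (simp only: sgn_div_norm scaleR_add_left scaleR_one scaleR_scaleR divide_inverse)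
    then have "norm (x + (r / 2) *\<^sub>R sgn x) = \<bar>1 + r / 2 / norm x\<bar> * norm x" by simp
    also have "\<dots> = norm x + r / 2" using False r by (simp add: field_simps)
    finally show ?thesis using False by (intro that[of "sgn x"]) (auto simp: norm_sgn)
  qed
  define y where "y = x + (r / 2) *\<^sub>R u"
  have y: "dist x y = r / 2" "norm y = norm x + r / 2" using u r by (auto simp: y_def dist_norm)
  have sub: "ball y (r / 4) \<subseteq> ball x r" using y r by (auto simp: ball_subset_ball_iff dist_commute)
  have ny: "r / 4 \<le> norm z" if "z \<in> ball y (r / 4)" for z
  proof -
    have "norm y \<le> norm z + dist y z" using norm_triangle_ineq2[of y z] by (simp add: dist_norm)
    moreover have "dist y z < r / 4" using that by simp
    ultimately show ?thesis using y(2) norm_ge_zero[of x] by linarith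
  qed
  let ?t = "(r / 4) powr al * \<mu> y (r / 4)"
  have r4: "0 < r / 4" using r by simp
  show ?thesis
  proof (rule ennreal_chain_le[OF _ ext fI _ Morrey_denominator_ge[of ?t]])
    have "ball x r \<subseteq> ball 0 ?R" using r by (auto simp: ball_subset_ball_iff)
    then have "mass (\<lambda>z. epowr (g z) p * v z) (ball x r) \<le> mass (\<lambda>z. epowr (g z) p * v z) (ball 0 ?R)" by (rule mass_mono)
    also have "\<dots> \<le> ennreal (?R powr al * m 0 ?\<gamma> ?R) * wint p (U 0 ?\<gamma> ?R) g"
      by (rule mass_power_weight_le_wint_U[OF R R _ g]) auto
    finally show "mass (\<lambda>z. epowr (g z) p * v z) (ball x r) \<le> ennreal (?R powr al * m 0 ?\<gamma> ?R) * wint p (U 0 ?\<gamma> ?R) g" .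
    have "\<mu> 0 ?R = \<mu> 0 (12 * (r / 4))" by simp
    also have "\<dots> \<le> K * 12 powr (real DIM('a) * q) * \<mu> y (r / 4)"
      by (rule mu_compare[OF r4]) (use y r in \<open>auto simp: ball_subset_ball_iff\<close>)
    finally have "\<mu> 0 ?R powr \<kappa> \<le> (K * 12 powr (real DIM('a) * q) * \<mu> y (r / 4)) powr \<kappa>"
      using mu_pos[OF R, of 0] \<kappa> by (intro powr_mono2) auto
    also have "\<dots> = (K * 12 powr (real DIM('a) * q)) powr \<kappa> * \<mu> y (r / 4) powr \<kappa>"
      using K mu_pos[OF r4, of y] by (simp add: powr_mult)
    finally have mu12: "\<mu> 0 ?R powr \<kappa> \<le> (K * 12 powr (real DIM('a) * q)) powr \<kappa> * \<mu> y (r / 4) powr \<kappa>" .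
    have "?R powr al * m 0 ?\<gamma> ?R * (A2 * Z2 * ?R powr (- \<epsilon>)) = ?R powr al * A2 * Z2 * (?R powr (- \<epsilon>) * m 0 ?\<gamma> ?R)"
      by (simp only: mult_ac)
    also have "\<dots> = A2 * Z2 * (?R powr al * ?R powr e) * \<mu> 0 ?R powr \<kappa>"
      unfolding m_eps[OF R] by (simp only: mult_ac)
    also have "?R powr al * ?R powr e = 3 powr lam * r powr lam * (12 powr (al * \<kappa>) * (r / 4) powr (al * \<kappa>))"
    proof -
      have "?R powr al * ?R powr e = ?R powr lam * ?R powr (al * \<kappa>)"
        unfolding powr_add[symmetric] e_def by (simp add: algebra_simps)
      also have "?R powr (al * \<kappa>) = (12 * (r / 4)) powr (al * \<kappa>)" by simp
      also have "\<dots> = 12 powr (al * \<kappa>) * (r / 4) powr (al * \<kappa>)" using r4 by (subst powr_mult) auto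
      also have "?R powr lam = 3 powr lam * r powr lam" using r by (simp add: powr_mult)
      finally show ?thesis .
    qed
    also have "A2 * Z2 * (3 powr lam * r powr lam * (12 powr (al * \<kappa>) * (r / 4) powr (al * \<kappa>))) * \<mu> 0 ?R powr \<kappa>
      \<le> A2 * Z2 * (3 powr lam * r powr lam * (12 powr (al * \<kappa>) * (r / 4) powr (al * \<kappa>))) * ((K * 12 powr (real DIM('a) * q)) powr \<kappa> * \<mu> y (r / 4) powr \<kappa>)"
      using A2_nonneg Z_nonneg by (intro mult_left_mono mu12) auto
    also have "\<dots> = P2 * (r powr lam * ((r / 4) powr (al * \<kappa>) * \<mu> y (r / 4) powr \<kappa>))"
      unfolding P2_def by (simp only: mult_ac)
    also have "(r / 4) powr (al * \<kappa>) * \<mu> y (r / 4) powr \<kappa> = ?t powr \<kappa>"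
      using mu_pos[OF r4, of y] by (simp add: powr_mult powr_powr)
    finally show "?R powr al * m 0 ?\<gamma> ?R * (A2 * Z2 * ?R powr (- \<epsilon>)) \<le> P2 * (r powr lam * ?t powr \<kappa>)" .
    have "ennreal ?t \<le> mass v (ball y (r / 4))" by (rule v_mass_lower[OF r4 r4 ny])
    also have "\<dots> \<le> mass v (ball x r)" by (rule mass_mono[OF sub])
    finally show "ennreal ?t \<le> mass v (ball x r)" .
  qed (use r Ce A2_nonneg Z_nonneg m_pos[OF R, of 0 ?\<gamma>] mu_pos[OF r4, of y] in \<open>auto simp: P2_def\<close>)
qed

theorem Morrey_bound_transfer:
  assumes f: "Morrey_bound f X" "f \<in> borel_measurable lebesgue" and g: "g \<in> borel_measurable lebesgue"
    and ctrl: "controls Ce f g" and Ce: "0 \<le> Ce"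
  shows "Morrey_bound g (ennreal (max P1 P2 * Ce) * X)"
  unfolding Morrey_bound_def
proof (intro allI impI)
  fix x :: 'a and r :: real assume r: "0 < r"
  have le: "ennreal (P * Ce) * X * Y \<le> ennreal (max P1 P2 * Ce) * X * Y" if "P \<le> max P1 P2" for P Y
    using that Ce by (intro mult_right_mono ennreal_leI) auto
  show "mass (\<lambda>z. epowr (g z) p * v z) (ball x r) \<le> ennreal (max P1 P2 * Ce) * X * (ennreal (r powr lam) * epowr (mass v (ball x r)) \<kappa>)"
  proof (cases "2 * r \<le> norm x")
    case True
    show ?thesis by (rule order_trans[OF Morrey_bound_away[OF f g ctrl Ce r True] le]) simp
  next
    case False
    then have "norm x < 2 * r" by simp
    show ?thesis by (rule order_trans[OF Morrey_bound_near[OF f g ctrl Ce r \<open>norm x < 2 * r\<close>] le]) simp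
  qed
qed

end

section \<open>Conclusion for weighted Morrey norms\<close>

lemma Ap_class_2_of_1:
  assumes "w \<in> Ap_class 1" shows "w \<in> Ap_class 2"
proof -
  have iw: "is_weight w" using assms by (simp add: Ap_class_def)
  note w = Ap_class_pos_version[OF assms]
  have "Ap 2 (Ap_const 1 w) (pos_version w)" by (rule Ap_1_imp_Ap) (use w in auto)
  then have "Ap_const 2 w \<le> Ap_const 1 w"
    using iw w(1) by (simp add: Ap_const_eq Ap_iff_cst)
  also have "\<dots> < top" using w by simp
  finally show ?thesis using iw by (simp add: Ap_class_def)
qed

lemma AE_power_weight:
  fixes w :: "real ^ 'n \<Rightarrow> real"
  assumes "is_weight w"
  shows "AE x in lebesgue. ennreal (norm x powr \<alpha> * w x) = power_weight \<alpha> (pos_version w) x"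
proof -
  have "AE x in lebesgue. 0 < w x" using assms by (simp add: is_weight_def)
  then show ?thesis
    by eventually_elim (simp add: power_weight_def pos_version_def ennreal_mult)
qed

text \<open>That the constant depends on \<open>u\<close> only through its \<open>A_p\<close>
  constant is expressed by an arbitrary function \<Phi> of that constant. The two assertions, for p
  > 1 and for p = p0 = 1, are joined by the disjunction on \<open>p\<close>.\<close>

theorem theorem4p1:
  fixes F :: "((real ^ 'n \<Rightarrow> ennreal) \<times> (real ^ 'n \<Rightarrow> ennreal)) set"
    and w :: "real ^ 'n \<Rightarrow> real"
    and p0 p lam1 lam2 \<theta> \<alpha> c :: real
  assumes p0: "1 \<le> p0"
    and meas: "\<And>f g. (f, g) \<in> F \<Longrightarrow>
                 f \<in> borel_measurable lebesgue \<and> g \<in> borel_measurable lebesgue"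
    and star: "\<exists>\<Phi> :: ennreal \<Rightarrow> real. \<forall>u \<in> Ap_class p0. \<forall>(f, g) \<in> F.
                 Lp_norm p0 u g \<le> ennreal (\<Phi> (Ap_const p0 u)) * Lp_norm p0 u f"
    and p: "1 < p \<or> (p0 = 1 \<and> p = 1)"
    and w: "w \<in> Ap_class p"
    and lam2: "0 \<le> lam2" "lam2 \<le> real CARD('n)"
    and lam1: "0 < lam1 * conj_exp (sigma_exp w) + lam2"
            "lam1 * conj_exp (sigma_exp w) + lam2 < real CARD('n)"
    and theta: "0 \<le> \<theta>" "0 < lam1 + lam2 * \<theta>"
    and growth: "\<And>r R. 0 < r \<Longrightarrow> r < R \<Longrightarrow>
                   wmeasure w (ball 0 r) / wmeasure w (ball 0 R)
                     \<le> ennreal (c * (r / R) powr (real CARD('n) * \<theta>))"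
    and alpha: "0 \<le> \<alpha>"
               "lam2 < real CARD('n) \<Longrightarrow>
                  \<alpha> < real CARD('n) / (real CARD('n) - lam2) * (lam1 + lam2 * \<theta>)"
  shows "\<exists>C::real. \<forall>(f, g) \<in> F.
           morrey_norm p (lam1, lam2) (\<lambda>x. norm x powr \<alpha> * w x) g
             \<le> ennreal C * morrey_norm p (lam1, lam2) (\<lambda>x. norm x powr \<alpha> * w x) f"
proof -
  define N where "N = real CARD('n)"
  have N: "0 < N" "real DIM(real ^ 'n) = N" by (simp_all add: N_def)
  define \<kappa> where "\<kappa> = lam2 / N"
  have \<kappa>: "0 \<le> \<kappa>" "\<kappa> \<le> 1" "lam2 = N * \<kappa>" using lam2 N by (auto simp: \<kappa>_def N_def)
  have p1: "1 \<le> p" using p by auto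
  have iw: "is_weight w" using w by (simp add: Ap_class_def)
  let ?W = "pos_version w"
  note W = Ap_class_pos_version[OF w p1]
  \<comment> \<open>For p = 1 the weight is regarded as an \<open>A_2\<close> weight, since doubling
    and the growth of balls are derived for exponents above 1.\<close>
  define q where "q = (if p = 1 then 2 else p)"
  have q: "1 < q" "w \<in> Ap_class q" using p w Ap_class_2_of_1[of w] by (auto simp: q_def)
  note Wq = Ap_class_pos_version[OF q(2) less_imp_le[OF q(1)]]
  define K where "K = max 1 (enn2real (Ap_const q w))"
  have K: "1 \<le> K" "Ap_const q w \<le> ennreal K"
    using Wq(3) by (cases "Ap_const q w", auto simp: K_def intro: ennreal_leI)+
  obtain b Cb where b: "1 \<le> Cb" "ball_growth b Cb ?W" "0 < lam1 + lam2 * b" "lam1 + lam2 * b < N * b"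
    using ex_growth_exponent[OF q(2,1) lam2[folded N_def] lam1[folded N_def]] by blast
  interpret mw: morrey_weight ?W q K b Cb \<kappa>
    by unfold_locales (use W(1) Ap_mono[OF Wq(2) K(2)] q K b \<kappa> in auto)
  define L where "L = enn2real (Ap_const p w)"
  define tau where "tau = N * \<theta>"
  define c0 where "c0 = max 1 c"
  have c0: "1 \<le> c0" by (simp add: c0_def)
  have mass_w: "wmeasure w (ball x r) = mass ?W (ball x r)" for x r
    unfolding wmeasure_eq_mass by (rule mass_cong_AE) (use AE_pos_version[OF iw] in \<open>auto elim!: eventually_mono\<close>)
  \<comment> \<open>The hypothesis covers r < R only; the case r = R is the reason for c0 \<ge>
    1.\<close>
  have growth0: "mw.\<mu> 0 r \<le> c0 * (r / R) powr tau * mw.\<mu> 0 R" if r: "0 < r" "r \<le> R" for r R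
  proof (cases "r = R")
    case True
    then show ?thesis using r c0 mw.mu_pos[of R 0] by (simp add: mult_le_cancel_right1)
  next
    case False
    then have rR: "r < R" "0 < R" using r by auto
    have pos: "0 < mw.\<mu> 0 r" "0 < mw.\<mu> 0 R" using mw.mu_pos r rR by auto
    have "ennreal (mw.\<mu> 0 r / mw.\<mu> 0 R) \<le> ennreal (c * (r / R) powr tau)"
      using growth[OF r(1) rR(1)] pos r(1) rR(2)
      by (simp add: mass_w mw.mass_eq_mu divide_ennreal tau_def N_def)
    also have "\<dots> \<le> ennreal (c0 * (r / R) powr tau)"
      by (intro ennreal_leI mult_right_mono) (auto simp: c0_def)
    finally have "mw.\<mu> 0 r / mw.\<mu> 0 R \<le> c0 * (r / R) powr tau"
      using c0 by (subst (asm) ennreal_le_iff) auto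
    then show ?thesis using pos by (simp add: divide_le_eq)
  qed
  have e_pos: "0 < lam1 - \<alpha> * (1 - \<kappa>) + tau * \<kappa>"
  proof -
    have tk: "tau * \<kappa> = lam2 * \<theta>" by (simp add: tau_def \<kappa>(3))
    show ?thesis
    proof (cases "lam2 < N")
      case True
      have "\<alpha> < N / (N - lam2) * (lam1 + lam2 * \<theta>)" using alpha(2) True by (simp add: N_def)
      then have "\<alpha> * (N - lam2) < N * (lam1 + lam2 * \<theta>)" using True by (simp add: pos_less_divide_eq)
      moreover have "N - lam2 = N * (1 - \<kappa>)" by (simp add: \<kappa>(3) algebra_simps)
      ultimately have "N * (\<alpha> * (1 - \<kappa>)) < N * (lam1 + lam2 * \<theta>)" by (simp add: mult_ac)
      then have "\<alpha> * (1 - \<kappa>) < lam1 + lam2 * \<theta>" using N(1) by simp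
      then show ?thesis using tk by simp
    next
      case False
      then have "\<kappa> = 1" using lam2 N by (simp add: \<kappa>_def N_def)
      then show ?thesis using theta tk by simp
    qed
  qed
  interpret md: morrey_data ?W q K b Cb \<kappa> p L lam1 \<alpha> tau c0
  proof unfold_locales
    show "1 \<le> p" by (rule p1)
    show "Ap p (ennreal L) ?W" using W by (simp add: L_def)
    show "0 < lam1 + real DIM(real ^ 'n) * b * \<kappa>" using b(3) unfolding N(2) \<kappa>(3) by (simp add: mult_ac)
    show "lam1 < real DIM(real ^ 'n) * b * (1 - \<kappa>)" using b(4) unfolding N(2) \<kappa>(3) by (simp add: algebra_simps)
  qed (use alpha growth0 c0 e_pos in auto)
  obtain \<Phi> :: "ennreal \<Rightarrow> real" where \<Phi>: "\<forall>u \<in> Ap_class p0. \<forall>(f, g) \<in> F.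
                 Lp_norm p0 u g \<le> ennreal (\<Phi> (Ap_const p0 u)) * Lp_norm p0 u f"
    using star by blast
  have base: "\<exists>C. \<forall>Y. pos_weight Y \<longrightarrow> Ap p0 M Y \<longrightarrow> (\<forall>(f, g)\<in>F. wint p0 Y g \<le> ennreal C * wint p0 Y f)" if "M < top" for M
    by (rule uniform_hypothesis[OF p0 \<Phi> meas that])
  \<comment> \<open>For p = 1 also p0 = 1, and the uniform hypothesis is already the estimate
    wanted; otherwise it is extrapolated.\<close>
  have "\<exists>C. \<forall>Y. pos_weight Y \<longrightarrow> Ap p md.\<Lambda> Y \<longrightarrow> (\<forall>(f, g)\<in>F. wint p Y g \<le> ennreal C * wint p Y f)"
  proof (cases "p = 1")
    case True
    then show ?thesis using base[OF md.\<Lambda>_finite] p by simp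
  next
    case False
    then show ?thesis using p by (intro extrapolation[OF p0 _ meas base md.\<Lambda>_finite]) auto
  qed
  then obtain Ce0 where Ce0: "\<And>Y f g. pos_weight Y \<Longrightarrow> Ap p md.\<Lambda> Y \<Longrightarrow> (f, g) \<in> F \<Longrightarrow> wint p Y g \<le> ennreal Ce0 * wint p Y f"
    by fast
  define Ce where "Ce = max 0 Ce0"
  have ctrl: "md.controls Ce f g" if "(f, g) \<in> F" for f g
    unfolding md.controls_def
  proof (intro allI impI)
    fix Y :: "real ^ 'n \<Rightarrow> ennreal" assume "pos_weight Y" "Ap p md.\<Lambda> Y"
    from Ce0[OF this \<open>(f, g) \<in> F\<close>] show "wint p Y g \<le> ennreal Ce * wint p Y f"
      by (rule order_trans) (intro mult_right_mono ennreal_leI, auto simp: Ce_def)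
  qed
  define P where "P = max 1 (max md.P1 md.P2 * Ce)"
  let ?u = "\<lambda>x. norm x powr \<alpha> * w x"
  let ?v = "power_weight \<alpha> ?W"
  have uv: "AE x in lebesgue. ennreal (?u x) = ?v x" by (rule AE_power_weight[OF iw])
  let ?den = "\<lambda>x r. ennreal (r powr lam1) * epowr (mass ?v (ball x r)) \<kappa>"
  have norm_eq: "morrey_norm p (lam1, lam2) ?u h =
     (SUP x. SUP r\<in>{0<..}. epowr (mass (\<lambda>z. epowr (h z) p * ?v z) (ball x r) / ?den x r) (1 / p))" for h
  proof -
    have "wmeasure ?u (ball x r) = mass ?v (ball x r)" for x r
      unfolding wmeasure_eq_mass by (rule mass_cong_AE) (use uv in \<open>auto elim!: eventually_mono\<close>)
    moreover have "(\<integral>\<^sup>+y\<in>ball x r. epowr (h y) p * ennreal (?u y) \<partial>lebesgue) = mass (\<lambda>z. epowr (h z) p * ?v z) (ball x r)" for x r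
      unfolding mass_def by (rule nn_integral_cong_AE) (use uv in \<open>auto elim!: eventually_mono\<close>)
    ultimately show ?thesis unfolding morrey_norm_def \<kappa>_def N_def by simp
  qed
  \<comment> \<open>Nonzero and finite denominators allow passing between the quotients of the norm
    and the products of \<open>Morrey_bound\<close>. The weight \<open>?v\<close> vanishes at most
    at 0, a null set, so balls have positive mass.\<close>
  have den: "?den x r \<noteq> 0 \<and> ?den x r < top" if r: "0 < r" for x r
  proof -
    have "?v z = 0 \<longleftrightarrow> z = 0" for z using pos_weight_ne[OF W(1), of z] by (simp add: power_weight_def)
    have "mass ?v (ball x r) \<noteq> 0"
    proof
      assume "mass ?v (ball x r) = 0"
      then have "AE z in lebesgue. ?v z * indicator (ball x r) z = 0"
        unfolding mass_def by (subst (asm) nn_integral_0_iff_AE) (auto intro!: borel_measurable_times_ennreal md.borel_measurable_v)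
      moreover have "AE z in lebesgue. z \<noteq> 0" by (intro AE_completion AE_lborel_singleton)
      ultimately have "AE z in lebesgue. z \<notin> ball x r"
        by eventually_elim (use \<open>\<And>z. ?v z = 0 \<longleftrightarrow> z = 0\<close> in \<open>auto simp: indicator_def split: if_splits\<close>)
      then show False using r by (rule AE_not_in_ballD)
    qed
    moreover have "mass ?v (ball x r) \<le> ennreal ((norm x + r) powr \<alpha> * mw.\<mu> x r)"
    proof (rule md.v_mass_upper)
      fix z assume "z \<in> ball x r"
      then show "norm z \<le> norm x + r"
        using norm_triangle_ineq2[of z x] by (simp add: dist_norm norm_minus_commute)
    qed (use r norm_ge_zero[of x] in linarith)+
    then have "mass ?v (ball x r) < top" by (rule order_le_less_trans) simp
    ultimately have "0 < mass ?v (ball x r)" "mass ?v (ball x r) < top" by (simp_all add: zero_less_iff_neq_zero)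
    then have "0 < epowr (mass ?v (ball x r)) \<kappa>" "epowr (mass ?v (ball x r)) \<kappa> < top"
      by (rule epowr_pos, rule epowr_less_top)
    then show ?thesis using r by (auto simp: ennreal_mult_less_top)
  qed
  show ?thesis
  proof (intro exI[of _ "P powr (1 / p)"] ballI, clarify)
    fix f g assume fg: "(f, g) \<in> F"
    let ?A = "morrey_norm p (lam1, lam2) ?u f"
    have f: "f \<in> borel_measurable lebesgue" and g: "g \<in> borel_measurable lebesgue" using meas[OF fg] by auto
    have "md.Morrey_bound f (epowr ?A p)"
      unfolding md.Morrey_bound_def
    proof (intro allI impI)
      fix x r assume r: "0 < (r :: real)"
      let ?I = "mass (\<lambda>z. epowr (f z) p * ?v z) (ball x r)"
      have "epowr (?I / ?den x r) (1 / p) \<le> ?A"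
        unfolding norm_eq by (rule SUP_upper2[of x], simp, rule SUP_upper) (use r in simp)
      then have "epowr (epowr (?I / ?den x r) (1 / p)) p \<le> epowr ?A p"
        using p1 by (intro epowr_mono) auto
      then have "?I / ?den x r \<le> epowr ?A p" using p1 by (simp add: epowr_cancel')
      then show "?I \<le> epowr ?A p * ?den x r" using den[OF r, of x] by (subst (asm) ennreal_divide_le_iff) auto
    qed
    then have "md.Morrey_bound g (ennreal (max md.P1 md.P2 * Ce) * epowr ?A p)"
      by (rule md.Morrey_bound_transfer[OF _ f g ctrl[OF fg]]) (simp add: Ce_def)
    then have g_le: "mass (\<lambda>z. epowr (g z) p * ?v z) (ball x r) \<le> ennreal (max md.P1 md.P2 * Ce) * epowr ?A p * ?den x r" if "0 < r" for x r
      using that unfolding md.Morrey_bound_def by blast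
    show "morrey_norm p (lam1, lam2) ?u g \<le> ennreal (P powr (1 / p)) * ?A"
      unfolding norm_eq[of g]
    proof (intro SUP_least)
      fix x and r :: real assume "r \<in> {0<..}"
      then have r: "0 < r" by simp
      let ?I = "mass (\<lambda>z. epowr (g z) p * ?v z) (ball x r)"
      have "?I / ?den x r \<le> ennreal (max md.P1 md.P2 * Ce) * epowr ?A p"
        using g_le[OF r, of x] den[OF r, of x] by (subst ennreal_divide_le_iff) auto
      also have "\<dots> \<le> ennreal P * epowr ?A p" by (intro mult_right_mono ennreal_leI) (auto simp: P_def)
      finally have "epowr (?I / ?den x r) (1 / p) \<le> epowr (ennreal P * epowr ?A p) (1 / p)"
        using p1 by (intro epowr_mono) auto
      also have "\<dots> = epowr (ennreal P) (1 / p) * ?A" using p1 by (simp add: epowr_mult epowr_cancel)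
      also have "epowr (ennreal P) (1 / p) = ennreal (P powr (1 / p))" by (rule epowr_ennreal) (simp add: P_def)
      finally show "epowr (?I / ?den x r) (1 / p) \<le> ennreal (P powr (1 / p)) * ?A" .
    qed
  qed
qed

end
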